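(* Let $m\ge 1$ be an integer, and let $X_1,\dots,X_m$, $Y_1,\dots,Y_m$ and $Y$ be ball quasi-Banach function spaces on $\mathbb R^n$. Suppose that each $X_k$ ($1\le k\le m$) has an absolutely continuous quasi-norm and satisfies Assumptions (A) and (B) stated in the context, and that $Y$ satisfies Assumption (B). Let $0<p,q,p_k,q_k<\infty$ ($1\le k\le m$) and $\alpha\in(0,mn)$ be such that $$\frac1q=\sum_{k=1}^m\frac1{q_k},\qquad \frac1p=\sum_{k=1}^m\frac1{p_k},\qquad \frac1{p_k}-\frac1{q_k}=\frac{\alpha}{mn}\quad (k=1,\dots,m).$$ Suppose that the following Hölder inequality holds: there is a constant $C>0$ such that for all $f_k\in Y_k$ ($k=1,\dots,m$), $$\Big\|\prod_{k=1}^m f_k\Big\|_{Y}\le C\prod_{k=1}^m\|f_k\|_{Y_k}.$$ Suppose that, for each $k$, $X_k^{1/p_k}$ and $Y_k^{1/q_k}$ are ball Banach function spaces satisfying $$\big(Y_k^{1/q_k}\big)'=\Big(\big(X_k^{1/p_k}\big)'\Big)^{p_k/q_k}.$$ Assume further that the Hardy--Littlewood maximal operator $\mathcal M$ is bounded on $\big(Y_k^{1/q_k}\big)'$ for each $k$. Then the multilinear fractional integral operator $\mathcal T_\alpha$ can be extended to a bounded operator from $H_{X_1}\times\cdots\times H_{X_m}$ into $Y$.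
   Context: **Operator.** For $0<\alpha<mn$, $$\mathcal T_\alpha(f_1,\dots,f_m)(x)=\int_{(\mathbb R^n)^m}\frac{1}{|(y_1,\dots,y_m)|^{mn-\alpha}}\prod_{k=1}^m f_k(x-y_k)\,dy_1\cdots dy_m .$$ "$\mathcal T_\alpha$ can be extended to a bounded operator from $H_{X_1}\times\cdots\times H_{X_m}$ into $Y$" means: there are $C>0$, $d\in\mathbb Z_+$ and an $m$-linear operator $T:H_{X_1}\times\cdots\times H_{X_m}\to Y$ with $\|T(f_1,\dots,f_m)\|_Y\le C\prod_k\|f_k\|_{H_{X_k}}$ that agrees with $\mathcal T_\alpha$ whenever all $f_k$ are finite linear combinations of $(X_k,\infty,d)$-atoms. An $(X,\infty,d)$-atom is a measurable function $a$ supported in a cube $Q$ with $\|a\|_{L^\infty}\le \|\chi_Q\|_X^{-1}$ and $\int a(x)x^{\beta}dx=0$ for all multi-indices $|\beta|\le d$. **Ball quasi-Banach function spaces.** Let $\mathscr M(\mathbb R^n)$ be the set of measurable functions on $\mathbb R^n$. A quasi-normed linear space $X\subset\mathscr M(\mathbb R^n)$, with a quasi-norm $\|\cdot\|_X$ that makes sense for all measurable functions, is a ball quasi-Banach function space if: (i) $\|f\|_X=0$ implies $f=0$ a.e.; (ii) $|g|\le|f|$ a.e. implies $\|g\|_X\le\|f\|_X$; (iii) $0\le f_j\uparrow f$ a.e. implies $\|f_j\|_X\uparrow\|f\|_X$; (iv) $\chi_B\in X$ for every ball $B$. It is a ball Banach function space if moreover (v) $\|f+g\|_X\le\|f\|_X+\|g\|_X$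 for all $f,g\in X$; (vi) for every ball $B$ there is $C_{(B)}>0$ with $\int_B|f|\le C_{(B)}\|f\|_X$ for all $f\in X$. The associate space $X'$ of a ball Banach function space $X$ consists of all measurable $f$ with $\|f\|_{X'}:=\sup\{\|fg\|_{L^1}: g\in X,\ \|g\|_X=1\}<\infty$. For $r\in(0,\infty)$, $X^r:=\{f:|f|^r\in X\}$ with $\|f\|_{X^r}:=\||f|^r\|_X^{1/r}$. Equality of spaces is understood with equivalent quasi-norms. $X$ has an absolutely continuous quasi-norm if $\|f\chi_{E_j}\|_X\downarrow 0$ for every $f\in X$ and every decreasing sequence of measurable sets $E_j$ with $\bigcap_jE_j=\emptyset$. **Maximal operators.** $\mathcal M f(x)=\sup_{Q\ni x}|Q|^{-1}\int_Q|f|$ (supremum over cubes containing $x$), and $\mathcal M^{(\theta)}f=\{\mathcal M(|f|^\theta)\}^{1/\theta}$ for $\theta\in(0,\infty)$. **Assumption (A)** for $X$: for some $\theta,s\in(0,1]$ with $\theta<s$ there is $C>0$ such that for all $\{f_j\}_{j\ge1}\subset L^1_{loc}(\mathbb R^n)$, $$\Big\|\Big\{\sum_{j}[\mathcal M^{(\theta)}(f_j)]^s\Big\}^{1/s}\Big\|_X\le C\Big\|\Big\{\sum_j|f_j|^s\Big\}^{1/s}\Big\|_X.$$ **Assumption (B)** for $X$: for some $q>1$ and some $0<s<q$ (with $X^{1/s}$ a ball Banach function space, so that its associate space is defined) there is $C>0$ such that for all $f\in (X^{1/s})'$, $$\big\|\mathcal M^{((q/s)')}(f)\big\|_{(X^{1/s})'}\le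 C\|f\|_{(X^{1/s})'},$$ where $(q/s)'$ is the conjugate exponent of $q/s$. (The $q$ and $s$ here are local to this assumption.) **Hardy space.** For a sufficiently large fixed integer $N$, let $\mathcal F_N=\{\varphi\in\mathcal S(\mathbb R^n):\sum_{|\beta|\le N}\sup_x(1+|x|)^N|\partial^\beta\varphi(x)|\le1\}$ and, for $f\in\mathcal S'(\mathbb R^n)$, $\mathcal M_Nf(x)=\sup\{|\psi_t*f(x)|:t>0,\psi\in\mathcal F_N\}$, $\psi_t(x)=t^{-n}\psi(x/t)$. Then $H_X$ is the set of $f\in\mathcal S'$ with $\|f\|_{H_X}:=\|\mathcal M_Nf\|_X<\infty$. *)

theory Defs
  imports "HOL-Analysis.Analysis"
begin

section \<open>Ball quasi-Banach function spaces\<close>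

text \<open>
  A function space \<open>X\<close> on \<open>\<real>\<^sup>n\<close> is given by its extended quasi-norm, which is evaluated on
  (Lebesgue) measurable functions; the space itself is the set of measurable functions on which
  it is finite. Values of the functional on non-measurable functions are never used.
\<close>

type_synonym 'n fun_norm = "((real^'n) \<Rightarrow> complex) \<Rightarrow> ennreal"

definition fspace :: "'n::finite fun_norm \<Rightarrow> ((real^'n) \<Rightarrow> complex) set" where
  "fspace X = {f \<in> borel_measurable lebesgue. X f < \<infinity>}"

definition quasi_norm :: "'n::finite fun_norm \<Rightarrow> bool" where
  "quasi_norm X \<longleftrightarrow>
     (\<forall>c. \<forall>f \<in> borel_measurable lebesgue. X (\<lambda>x. c * f x) = ennreal (norm c) * X f) \<and>
     (\<exists>K\<ge>1. \<forall>f \<in> borel_measurable lebesgue. \<forall>g \<in> borel_measurable lebesgue.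
        X (\<lambda>x. f x + g x) \<le> ennreal K * (X f + X g))"

definition ball_quasi_banach :: "'n::finite fun_norm \<Rightarrow> bool" where
  "ball_quasi_banach X \<longleftrightarrow>
     quasi_norm X \<and>
     (\<forall>f \<in> borel_measurable lebesgue. X f = 0 \<longrightarrow> (AE x in lebesgue. f x = 0)) \<and>
     (\<forall>f \<in> borel_measurable lebesgue. \<forall>g \<in> borel_measurable lebesgue.
        (AE x in lebesgue. norm (g x) \<le> norm (f x)) \<longrightarrow> X g \<le> X f) \<and>
     (\<forall>(F :: nat \<Rightarrow> (real^'n) \<Rightarrow> real) f.
        (\<forall>j. F j \<in> borel_measurable lebesgue) \<and> f \<in> borel_measurable lebesgue \<and>
        (AE x in lebesgue. 0 \<le> F 0 x \<and> incseq (\<lambda>j. F j x) \<and> (\<lambda>j. F j x) \<longlonglongrightarrow> f x) \<longrightarrow>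
        incseq (\<lambda>j. X (\<lambda>x. complex_of_real (F j x))) \<and>
        (\<lambda>j. X (\<lambda>x. complex_of_real (F j x))) \<longlonglongrightarrow> X (\<lambda>x. complex_of_real (f x))) \<and>
     (\<forall>c r. 0 < r \<longrightarrow> indicator (ball c r) \<in> fspace X)"

definition ball_banach :: "'n::finite fun_norm \<Rightarrow> bool" where
  "ball_banach X \<longleftrightarrow>
     ball_quasi_banach X \<and>
     (\<forall>f \<in> fspace X. \<forall>g \<in> fspace X. X (\<lambda>x. f x + g x) \<le> X f + X g) \<and>
     (\<forall>c r. 0 < r \<longrightarrow>
        (\<exists>C>0. \<forall>f \<in> fspace X.
           (\<integral>\<^sup>+x\<in>ball c r. ennreal (norm (f x)) \<partial>lebesgue) \<le> ennreal C * X f))"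

definition assoc :: "'n::finite fun_norm \<Rightarrow> 'n fun_norm" where
  "assoc X f =
     (SUP g \<in> {g \<in> fspace X. X g = 1}. \<integral>\<^sup>+x. ennreal (norm (f x * g x)) \<partial>lebesgue)"

text \<open>Powers of \<open>[0,\<infinity>]\<close>-valued quantities; only positive exponents occur.\<close>

definition epow :: "ennreal \<Rightarrow> real \<Rightarrow> ennreal" where
  "epow u r = (if u = \<infinity> then \<infinity> else ennreal (enn2real u powr r))"

definition abs_pow :: "((real^'n::finite) \<Rightarrow> complex) \<Rightarrow> real \<Rightarrow> (real^'n) \<Rightarrow> complex" where
  "abs_pow f r = (\<lambda>x. complex_of_real (norm (f x) powr r))"

definition pow_space :: "'n::finite fun_norm \<Rightarrow> real \<Rightarrow> 'n fun_norm" where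
  "pow_space X r f = epow (X (abs_pow f r)) (1 / r)"

definition same_space :: "'n::finite fun_norm \<Rightarrow> 'n fun_norm \<Rightarrow> bool" where
  "same_space X Z \<longleftrightarrow>
     fspace X = fspace Z \<and>
     (\<exists>C>0. \<forall>f \<in> fspace X. X f \<le> ennreal C * Z f \<and> Z f \<le> ennreal C * X f)"

definition abs_cont_norm :: "'n::finite fun_norm \<Rightarrow> bool" where
  "abs_cont_norm X \<longleftrightarrow>
     (\<forall>f \<in> fspace X. \<forall>E :: nat \<Rightarrow> (real^'n) set.
        (\<forall>j. E j \<in> sets lebesgue) \<and> decseq E \<and> (\<Inter>j. E j) = {} \<longrightarrow>
        decseq (\<lambda>j. X (\<lambda>x. f x * indicator (E j) x)) \<and>
        (\<lambda>j. X (\<lambda>x. f x * indicator (E j) x)) \<longlonglongrightarrow> 0)"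

text \<open>
  Maximal functions take values in \<open>[0,\<infinity>]\<close>. The quasi-norm of such a function is the quasi-norm
  of a finite representative if it is finite almost everywhere, and \<open>\<infinity>\<close> otherwise.
\<close>

definition ext_norm :: "'n::finite fun_norm \<Rightarrow> ((real^'n) \<Rightarrow> ennreal) \<Rightarrow> ennreal" where
  "ext_norm X u =
     (if AE x in lebesgue. u x < \<infinity> then X (\<lambda>x. complex_of_real (enn2real (u x))) else \<infinity>)"


section \<open>Maximal operators and the two assumptions\<close>

definition cube :: "(real^'n::finite) set \<Rightarrow> bool" where
  "cube Q \<longleftrightarrow> (\<exists>a l. 0 < l \<and> Q = cbox a (a + (\<chi> i. l)))"

definition hl_max :: "((real^'n::finite) \<Rightarrow> complex) \<Rightarrow> (real^'n) \<Rightarrow> ennreal" where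
  "hl_max f x =
     (SUP Q \<in> {Q. cube Q \<and> x \<in> Q}.
        (\<integral>\<^sup>+y\<in>Q. ennreal (norm (f y)) \<partial>lebesgue) / emeasure lebesgue Q)"

definition hl_max_pow :: "real \<Rightarrow> ((real^'n::finite) \<Rightarrow> complex) \<Rightarrow> (real^'n) \<Rightarrow> ennreal" where
  "hl_max_pow \<theta> f x = epow (hl_max (abs_pow f \<theta>) x) (1 / \<theta>)"

definition hl_max_bounded_on :: "'n::finite fun_norm \<Rightarrow> bool" where
  "hl_max_bounded_on X \<longleftrightarrow>
     (\<exists>C>0. \<forall>f \<in> fspace X. ext_norm X (hl_max f) \<le> ennreal C * X f)"

definition L1_loc :: "((real^'n::finite) \<Rightarrow> complex) set" where
  "L1_loc = {f \<in> borel_measurable lebesgue. \<forall>K. compact K \<longrightarrow> set_integrable lebesgue K f}"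

definition assumption_A :: "'n::finite fun_norm \<Rightarrow> bool" where
  "assumption_A X \<longleftrightarrow>
     (\<exists>\<theta> s. 0 < \<theta> \<and> \<theta> < s \<and> s \<le> 1 \<and>
        (\<exists>C>0. \<forall>f :: nat \<Rightarrow> (real^'n) \<Rightarrow> complex. (\<forall>j. f j \<in> L1_loc) \<longrightarrow>
           ext_norm X (\<lambda>x. epow (\<Sum>j. epow (hl_max_pow \<theta> (f j) x) s) (1 / s))
           \<le> ennreal C * ext_norm X (\<lambda>x. epow (\<Sum>j. epow (ennreal (norm (f j x))) s) (1 / s))))"

definition conj_exp :: "real \<Rightarrow> real" where
  "conj_exp r = r / (r - 1)"

definition assumption_B :: "'n::finite fun_norm \<Rightarrow> bool" where
  "assumption_B X \<longleftrightarrow>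
     (\<exists>q s. 1 < q \<and> 0 < s \<and> s < q \<and> ball_banach (pow_space X (1 / s)) \<and>
        (\<exists>C>0. \<forall>f \<in> fspace (assoc (pow_space X (1 / s))).
           ext_norm (assoc (pow_space X (1 / s))) (hl_max_pow (conj_exp (q / s)) f)
           \<le> ennreal C * assoc (pow_space X (1 / s)) f))"


section \<open>Schwartz functions and tempered distributions\<close>

definition partial_deriv :: "'n::finite \<Rightarrow> ((real^'n) \<Rightarrow> complex) \<Rightarrow> (real^'n) \<Rightarrow> complex" where
  "partial_deriv i f x = frechet_derivative f (at x) (axis i 1)"

definition smooth_fun :: "((real^'n::finite) \<Rightarrow> complex) \<Rightarrow> bool" where
  "smooth_fun f \<longleftrightarrow> (\<forall>is x. foldr partial_deriv is f differentiable (at x))"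

definition mi_order :: "('n::finite \<Rightarrow> nat) \<Rightarrow> nat" where
  "mi_order \<beta> = (\<Sum>i\<in>UNIV. \<beta> i)"

text \<open>
  \<open>\<partial>\<^sup>\<beta>\<close> applies \<open>\<beta> i\<close> derivatives in each direction \<open>i\<close>. The order, which is irrelevant for smooth
  functions, is fixed by an arbitrary choice because the index type carries no ordering.
\<close>

definition mi_deriv :: "('n::finite \<Rightarrow> nat) \<Rightarrow> ((real^'n) \<Rightarrow> complex) \<Rightarrow> (real^'n) \<Rightarrow> complex" where
  "mi_deriv \<beta> f = foldr partial_deriv (SOME is. \<forall>i. count_list is i = \<beta> i) f"

definition schwartz_norm :: "nat \<Rightarrow> ((real^'n::finite) \<Rightarrow> complex) \<Rightarrow> ennreal" where
  "schwartz_norm N \<phi> =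
     (\<Sum>\<beta> | mi_order \<beta> \<le> N. SUP x. ennreal ((1 + norm x) ^ N * norm (mi_deriv \<beta> \<phi> x)))"

definition schwartz :: "((real^'n::finite) \<Rightarrow> complex) set" where
  "schwartz = {\<phi>. smooth_fun \<phi> \<and> (\<forall>N. schwartz_norm N \<phi> < \<infinity>)}"

text \<open>
  Tempered distributions are the complex-linear functionals on the Schwartz space that are
  continuous for its (metrizable) topology, given by the increasing seminorms \<open>schwartz_norm N\<close>.
  They are normalised to vanish off the Schwartz space, so that equality, sums and multiples of
  distributions are those of HOL functions.
\<close>

type_synonym 'n dist = "((real^'n) \<Rightarrow> complex) \<Rightarrow> complex"

definition tempered :: "'n::finite dist set" where
  "tempered = {f.
     (\<forall>\<phi>. \<phi> \<notin> schwartz \<longrightarrow> f \<phi> = 0) \<and>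
     (\<forall>\<phi> \<in> schwartz. \<forall>\<psi> \<in> schwartz. \<forall>a b.
        f (\<lambda>x. a * \<phi> x + b * \<psi> x) = a * f \<phi> + b * f \<psi>) \<and>
     (\<forall>\<Phi> :: nat \<Rightarrow> (real^'n) \<Rightarrow> complex. \<forall>\<phi> \<in> schwartz.
        (\<forall>j. \<Phi> j \<in> schwartz) \<and>
        (\<forall>N. (\<lambda>j. schwartz_norm N (\<lambda>x. \<Phi> j x - \<phi> x)) \<longlonglongrightarrow> 0) \<longrightarrow>
        (\<lambda>j. f (\<Phi> j)) \<longlonglongrightarrow> f \<phi>)}"

definition dist_of :: "((real^'n::finite) \<Rightarrow> complex) \<Rightarrow> 'n dist" where
  "dist_of g \<phi> = (if \<phi> \<in> schwartz then LINT x|lebesgue. g x * \<phi> x else 0)"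


section \<open>Hardy spaces\<close>

definition schwartz_ball :: "nat \<Rightarrow> ((real^'n::finite) \<Rightarrow> complex) set" where
  "schwartz_ball N = {\<phi> \<in> schwartz. schwartz_norm N \<phi> \<le> 1}"

definition dilate :: "real \<Rightarrow> ((real^'n::finite) \<Rightarrow> complex) \<Rightarrow> (real^'n) \<Rightarrow> complex" where
  "dilate t \<psi> x = complex_of_real (1 / t ^ CARD('n)) * \<psi> (x /\<^sub>R t)"

definition conv_dist :: "((real^'n::finite) \<Rightarrow> complex) \<Rightarrow> 'n dist \<Rightarrow> (real^'n) \<Rightarrow> complex" where
  "conv_dist \<psi> f x = f (\<lambda>y. \<psi> (x - y))"

definition grand_max :: "nat \<Rightarrow> 'n::finite dist \<Rightarrow> (real^'n) \<Rightarrow> ennreal" where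
  "grand_max N f x =
     (SUP (t, \<psi>) \<in> {0<..} \<times> schwartz_ball N. ennreal (norm (conv_dist (dilate t \<psi>) f x)))"

definition hardy_norm :: "nat \<Rightarrow> 'n::finite fun_norm \<Rightarrow> 'n dist \<Rightarrow> ennreal" where
  "hardy_norm N X f = ext_norm X (grand_max N f)"

definition hardy :: "nat \<Rightarrow> 'n::finite fun_norm \<Rightarrow> 'n dist set" where
  "hardy N X = {f \<in> tempered. hardy_norm N X f < \<infinity>}"

definition atom :: "'n::finite fun_norm \<Rightarrow> nat \<Rightarrow> ((real^'n) \<Rightarrow> complex) \<Rightarrow> bool" where
  "atom X d a \<longleftrightarrow>
     a \<in> borel_measurable lebesgue \<and>
     (\<exists>Q. cube Q \<and> (\<forall>x. x \<notin> Q \<longrightarrow> a x = 0) \<and>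
        (AE x in lebesgue. ennreal (norm (a x)) \<le> inverse (X (indicator Q)))) \<and>
     (\<forall>\<beta>. mi_order \<beta> \<le> d \<longrightarrow>
        (LINT x|lebesgue. a x * complex_of_real (\<Prod>i\<in>UNIV. (x $ i) ^ \<beta> i)) = 0)"

definition atom_span :: "'n::finite fun_norm \<Rightarrow> nat \<Rightarrow> ((real^'n) \<Rightarrow> complex) set" where
  "atom_span X d =
     {g. \<exists>(L::nat) c a. (\<forall>i<L. atom X d (a i)) \<and> g = (\<lambda>x. \<Sum>i<L. c i * a i x)}"


section \<open>The multilinear fractional integral operator\<close>

text \<open>
  The index type \<open>'m\<close> stands for \<open>{1,\<dots>,m}\<close>, and \<open>(real^'n)^'m\<close> with its Lebesgue measure and
  Euclidean norm for \<open>(\<real>\<^sup>n)\<^sup>m\<close>.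
\<close>

definition frac_int ::
  "real \<Rightarrow> ('m::finite \<Rightarrow> (real^'n::finite) \<Rightarrow> complex) \<Rightarrow> (real^'n) \<Rightarrow> complex" where
  "frac_int \<alpha> f x =
     (LINT y|(lebesgue :: ((real^'n)^'m) measure).
        complex_of_real (1 / norm y powr (real CARD('m) * real CARD('n) - \<alpha>)) *
        (\<Prod>k\<in>UNIV. f k (x - y $ k)))"

text \<open>
  Boundedness of an extension \<open>T\<close> of \<open>\<T>\<^sub>\<alpha>\<close>. Elements of \<open>Y\<close> are identified when equal almost
  everywhere. The third clause includes that finite linear combinations of atoms, seen as
  distributions, lie in the domain of \<open>T\<close>.
\<close>

definition extends_bounded ::
  "nat \<Rightarrow> real \<Rightarrow> ('m::finite \<Rightarrow> 'n::finite fun_norm) \<Rightarrow> 'n fun_norm \<Rightarrow> bool" where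
  "extends_bounded N \<alpha> X Y \<longleftrightarrow>
     (\<exists>C>0. \<exists>d::nat. \<exists>T :: ('m \<Rightarrow> 'n dist) \<Rightarrow> (real^'n) \<Rightarrow> complex.
        (\<forall>f. (\<forall>k. f k \<in> hardy N (X k)) \<longrightarrow>
           T f \<in> fspace Y \<and> Y (T f) \<le> ennreal C * (\<Prod>k\<in>UNIV. hardy_norm N (X k) (f k))) \<and>
        (\<forall>f k g h a b. (\<forall>j. f j \<in> hardy N (X j)) \<and> g \<in> hardy N (X k) \<and> h \<in> hardy N (X k) \<longrightarrow>
           (AE x in lebesgue.
              T (f(k := (\<lambda>\<phi>. a * g \<phi> + b * h \<phi>))) x = a * T (f(k := g)) x + b * T (f(k := h)) x)) \<and>
        (\<forall>g. (\<forall>k. g k \<in> atom_span (X k) d) \<longrightarrow>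
           (\<forall>k. dist_of (g k) \<in> hardy N (X k)) \<and>
           (AE x in lebesgue. T (\<lambda>k. dist_of (g k)) x = frac_int \<alpha> g x)))"

end

theory Submission
  imports Defs "HOL-Library.Multiset"
begin

text \<open>
  The identity \<open>c \<bar>y\<bar>\<^bsup>- a\<^esup> = \<integral>\<^sub>0\<^sup>\<infinity> t\<^bsup>- 1 - a\<^esup> e\<^bsup>- (\<bar>y\<bar> / t)\<^sup>2\<^esup> dt\<close> with \<open>a = mn - \<alpha>\<close> turns the
  fractional integral into \<open>c\<^bsup>- 1\<^esup> \<integral>\<^sub>0\<^sup>\<infinity> t\<^bsup>\<alpha> - 1\<^esup> \<Prod>\<^sub>k (\<gamma>\<^sub>t * f\<^sub>k)(x) dt\<close>, where \<open>\<gamma>\<close> is a Gaussian. This formula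
  defines the extension on all tuples of distributions at once, so that no atomic decomposition is
  needed. Since \<open>(\<gamma>\<^sub>t * f\<^sub>k)(x)\<close> is controlled by the infimum of the grand maximal function over the
  dyadic cube at \<open>x\<close> of side comparable to \<open>t\<close>, the extension is bounded pointwise by the product of the dyadic
  sums \<open>\<Sum>\<^sub>j 2\<^bsup>j \<alpha> / m\<^esup> inf\<^bsub>Q\<^sub>j(x)\<^esub> \<M> f\<^sub>k\<close>. For such sums a Hedberg-type argument gives a two-weight inequality
  from \<open>L\<^sup>p(w\<^bsup>p / q\<^esup>)\<close> to \<open>L\<^sup>q(w)\<close> with \<open>w \<in> A\<^sub>1\<close>; the Rubio de Francia algorithm in \<open>(Y\<^sub>k\<^bsup>1 / q\<^sub>k\<^esup>)'\<close>
  and the Lorentz--Luxemburg theorem transfer it to \<open>X\<^sub>k \<rightarrow> Y\<^sub>k\<close>, and the Hoelder inequality finishes the proof.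
\<close>


text \<open>The exponents p_k may be below 1, where means of the grand maximal function itself are
  out of control. Its infimum over a cell, however, is at most its L^s mean for every s > 0. The
  choice s = p/2 leads to an average whose square is governed by L^2(w), where the dyadic maximal
  operator relative to w is bounded with a constant independent of w. An A_1 weight enters through
  two consequences: it is bounded below by a multiple of its averages, and its mass drops by a fixed
  factor from a dyadic cell to the next smaller one. The second makes the sum over the scales
  geometric.

  The relation 1/p_k - 1/q_k = \<alpha>/(mn) gives all m factors the same exponent \<alpha>/m, so
  t^\<alpha> splits evenly, and a sum over scales of products is at most the product of m sums that
  are treated separately.

  It remains to see that finite sums of atoms belong to H_X. Assumption (A), applied to the
  indicator of one cube, puts (1 + |x|)^(-K) in X for all large K, and d is taken so large that
  vanishing moments up to order d give this decay.\<close>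

section \<open>Schwartz functions\<close>

text \<open>Schwarz's theorem: the second difference over a small parallelogram equals h^2 times
  either mixed derivative at some point of it, and both are continuous at \<open>x\<close>. It is
  needed because \<open>mi_deriv\<close> differentiates in an arbitrarily chosen order. Real values
  are required by the mean value theorem.\<close>

lemma mixed_directional_derivatives_eq:
  fixes g gu gv guv gvu :: "'a::real_normed_vector \<Rightarrow> real"
  assumes gu: "\<And>x s. ((\<lambda>s. g (x + s *\<^sub>R u)) has_real_derivative gu (x + s *\<^sub>R u)) (at s)"
    and gv: "\<And>x s. ((\<lambda>s. g (x + s *\<^sub>R v)) has_real_derivative gv (x + s *\<^sub>R v)) (at s)"
    and guv: "\<And>x s. ((\<lambda>s. gu (x + s *\<^sub>R v)) has_real_derivative guv (x + s *\<^sub>R v)) (at s)"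
    and gvu: "\<And>x s. ((\<lambda>s. gv (x + s *\<^sub>R u)) has_real_derivative gvu (x + s *\<^sub>R u)) (at s)"
    and cuv: "isCont guv x" and cvu: "isCont gvu x"
  shows "guv x = gvu x"
proof -
  \<comment> \<open>The mean value theorem in direction \<open>u\<close> for a difference taken in
    direction \<open>v\<close>, then in direction \<open>v\<close> for \<open>fu\<close>. The
    directions are generalised so that their roles can be exchanged.\<close>
  have key: "\<exists>\<xi> \<eta>. 0 < \<xi> \<and> \<xi> < h \<and> 0 < \<eta> \<and> \<eta> < h \<and>
      g (x + h *\<^sub>R u + h *\<^sub>R v) - g (x + h *\<^sub>R u) - g (x + h *\<^sub>R v) + g x =
      h * h * fuv (x + \<xi> *\<^sub>R u + \<eta> *\<^sub>R v)"
    if "h > 0" and fu: "\<And>x s. ((\<lambda>s. g (x + s *\<^sub>R u)) has_real_derivative fu (x + s *\<^sub>R u)) (at s)"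
      and fuv: "\<And>x s. ((\<lambda>s. fu (x + s *\<^sub>R v)) has_real_derivative fuv (x + s *\<^sub>R v)) (at s)"
    for h fu fuv u v
  proof -
    define p where "p s = g (x + h *\<^sub>R v + s *\<^sub>R u) - g (x + s *\<^sub>R u)" for s
    have p': "(p has_real_derivative fu (x + h *\<^sub>R v + s *\<^sub>R u) - fu (x + s *\<^sub>R u)) (at s)" for s
      unfolding p_def by (rule DERIV_diff[OF fu fu])
    have "\<exists>\<xi>. 0 < \<xi> \<and> \<xi> < h \<and> p h - p 0 = (h - 0) * (fu (x + h *\<^sub>R v + \<xi> *\<^sub>R u) - fu (x + \<xi> *\<^sub>R u))"
      by (rule MVT2[OF \<open>h > 0\<close> p'])
    then obtain \<xi> where \<xi>: "0 < \<xi>" "\<xi> < h"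
        "p h - p 0 = (h - 0) * (fu (x + h *\<^sub>R v + \<xi> *\<^sub>R u) - fu (x + \<xi> *\<^sub>R u))" by blast
    have "\<exists>\<eta>. 0 < \<eta> \<and> \<eta> < h \<and> fu ((x + \<xi> *\<^sub>R u) + h *\<^sub>R v) - fu ((x + \<xi> *\<^sub>R u) + 0 *\<^sub>R v) = (h - 0) * fuv ((x + \<xi> *\<^sub>R u) + \<eta> *\<^sub>R v)"
      by (rule MVT2[OF \<open>h > 0\<close> fuv])
    then obtain \<eta> where \<eta>: "0 < \<eta>" "\<eta> < h"
        "fu ((x + \<xi> *\<^sub>R u) + h *\<^sub>R v) - fu ((x + \<xi> *\<^sub>R u) + 0 *\<^sub>R v) = (h - 0) * fuv ((x + \<xi> *\<^sub>R u) + \<eta> *\<^sub>R v)" by blast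
    have "x + h *\<^sub>R v + \<xi> *\<^sub>R u = x + \<xi> *\<^sub>R u + h *\<^sub>R v" "x + h *\<^sub>R v + h *\<^sub>R u = x + h *\<^sub>R u + h *\<^sub>R v"
      by simp_all
    with \<xi>(3) \<eta>(3) have "p h - p 0 = h * h * fuv (x + \<xi> *\<^sub>R u + \<eta> *\<^sub>R v)" by simp
    moreover have "p h - p 0 = g (x + h *\<^sub>R u + h *\<^sub>R v) - g (x + h *\<^sub>R u) - g (x + h *\<^sub>R v) + g x"
      by (simp add: p_def add_ac)
    ultimately show ?thesis
      using \<xi>(1,2) \<eta>(1,2) by metis
  qed
  have close: "\<exists>d>0. \<forall>\<xi> \<eta>. 0 < \<xi> \<and> \<xi> < d \<and> 0 < \<eta> \<and> \<eta> < d \<longrightarrow> \<bar>f (x + \<xi> *\<^sub>R a + \<eta> *\<^sub>R b) - f x\<bar> < e"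
    if cont: "isCont f x" "e > 0" for f :: "'a \<Rightarrow> real" and a b and e :: real
  proof -
    obtain d where d: "d > 0" "\<And>y. dist y x < d \<Longrightarrow> dist (f y) (f x) < e"
      using cont unfolding continuous_at_eps_delta by blast
    define d' where "d' = d / (norm a + norm b + 1)"
    have d': "d' > 0" "d' * (norm a + norm b) < d"
    proof -
      have p: "0 < norm a + norm b + 1" using norm_ge_zero[of a] norm_ge_zero[of b] by linarith
      then show "d' > 0" using d(1) by (simp add: d'_def)
      have "d' * (norm a + norm b) < d' * (norm a + norm b + 1)" using \<open>d' > 0\<close> by simp
      also have "\<dots> = d" using p by (simp add: d'_def)
      finally show "d' * (norm a + norm b) < d" .
    qed
    show ?thesis
    proof (intro exI[of _ d'] conjI allI impI d')
      fix \<xi> \<eta> assume *: "0 < \<xi> \<and> \<xi> < d' \<and> 0 < \<eta> \<and> \<eta> < d'"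
      have "norm (\<xi> *\<^sub>R a + \<eta> *\<^sub>R b) \<le> \<xi> * norm a + \<eta> * norm b"
        using * norm_triangle_ineq[of "\<xi> *\<^sub>R a" "\<eta> *\<^sub>R b"] by simp
      also have "\<dots> \<le> d' * norm a + d' * norm b"
        using * by (intro add_mono mult_right_mono) auto
      finally have "dist (x + \<xi> *\<^sub>R a + \<eta> *\<^sub>R b) x < d"
        using d'(2) by (simp add: dist_norm algebra_simps)
      from d(2)[OF this] show "\<bar>f (x + \<xi> *\<^sub>R a + \<eta> *\<^sub>R b) - f x\<bar> < e" by (simp add: dist_real_def)
    qed
  qed
  show ?thesis
  proof (rule ccontr)
    assume "guv x \<noteq> gvu x"
    then have e: "\<bar>guv x - gvu x\<bar> / 2 > 0" (is "?e > 0") by simp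
    obtain d1 where d1: "d1 > 0" "\<And>\<xi> \<eta>. 0 < \<xi> \<and> \<xi> < d1 \<and> 0 < \<eta> \<and> \<eta> < d1 \<Longrightarrow>
        \<bar>guv (x + \<xi> *\<^sub>R u + \<eta> *\<^sub>R v) - guv x\<bar> < ?e" using close[OF cuv e] by blast
    obtain d2 where d2: "d2 > 0" "\<And>\<xi> \<eta>. 0 < \<xi> \<and> \<xi> < d2 \<and> 0 < \<eta> \<and> \<eta> < d2 \<Longrightarrow>
        \<bar>gvu (x + \<xi> *\<^sub>R v + \<eta> *\<^sub>R u) - gvu x\<bar> < ?e" using close[OF cvu e] by blast
    define h where "h = min d1 d2"
    have h: "h > 0" "h \<le> d1" "h \<le> d2" using d1 d2 by (auto simp: h_def)
    obtain \<xi> \<eta> where 1: "0 < \<xi>" "\<xi> < h" "0 < \<eta>" "\<eta> < h"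
      "g (x + h *\<^sub>R u + h *\<^sub>R v) - g (x + h *\<^sub>R u) - g (x + h *\<^sub>R v) + g x =
      h * h * guv (x + \<xi> *\<^sub>R u + \<eta> *\<^sub>R v)" using key[OF h(1) gu guv] by blast
    obtain \<xi>' \<eta>' where 2: "0 < \<xi>'" "\<xi>' < h" "0 < \<eta>'" "\<eta>' < h"
      "g (x + h *\<^sub>R v + h *\<^sub>R u) - g (x + h *\<^sub>R v) - g (x + h *\<^sub>R u) + g x =
      h * h * gvu (x + \<xi>' *\<^sub>R v + \<eta>' *\<^sub>R u)" using key[OF h(1) gv gvu] by blast
    have sw: "x + h *\<^sub>R v + h *\<^sub>R u = x + h *\<^sub>R u + h *\<^sub>R v" by simp
    have "h * h * guv (x + \<xi> *\<^sub>R u + \<eta> *\<^sub>R v) = h * h * gvu (x + \<xi>' *\<^sub>R v + \<eta>' *\<^sub>R u)"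
      using 1(5) 2(5)[unfolded sw] by linarith
    then have "guv (x + \<xi> *\<^sub>R u + \<eta> *\<^sub>R v) = gvu (x + \<xi>' *\<^sub>R v + \<eta>' *\<^sub>R u)" using h(1) by simp
    moreover have "\<bar>guv (x + \<xi> *\<^sub>R u + \<eta> *\<^sub>R v) - guv x\<bar> < ?e" using 1 h by (intro d1(2)) auto
    moreover have "\<bar>gvu (x + \<xi>' *\<^sub>R v + \<eta>' *\<^sub>R u) - gvu x\<bar> < ?e" using 2 h by (intro d2(2)) auto
    ultimately show False by (auto simp: abs_if field_simps split: if_splits)
  qed
qed

section \<open>Iterated partial derivatives and the Schwartz seminorms\<close>

abbreviation pderivs :: "'n::finite list \<Rightarrow> ((real^'n) \<Rightarrow> complex) \<Rightarrow> (real^'n) \<Rightarrow> complex" where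
  "pderivs is f \<equiv> foldr partial_deriv is f"

lemma has_derivative_partial_deriv:
  fixes f :: "real^'n::finite \<Rightarrow> complex"
  assumes "f differentiable at x"
  shows "(f has_derivative (\<lambda>v. \<Sum>i\<in>UNIV. (v $ i) *\<^sub>R partial_deriv i f x)) (at x)"
proof -
  have d: "(f has_derivative frechet_derivative f (at x)) (at x)"
    using assms frechet_derivative_works by blast
  then interpret bounded_linear "frechet_derivative f (at x)" by (rule has_derivative_bounded_linear)
  have "frechet_derivative f (at x) = (\<lambda>v. \<Sum>i\<in>UNIV. (v $ i) *\<^sub>R partial_deriv i f x)"
  proof
    fix v
    show "frechet_derivative f (at x) v = (\<Sum>i\<in>UNIV. (v $ i) *\<^sub>R partial_deriv i f x)"
      by (subst basis_expansion[symmetric, of v])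
        (simp only: sum scalar_mult_eq_scaleR scaleR partial_deriv_def)
  qed
  with d show ?thesis by simp
qed

lemma partial_derivI:
  assumes "(f has_derivative f') (at x)"
  shows "partial_deriv i f x = f' (axis i 1)"
  unfolding partial_deriv_def using frechet_derivative_at[OF assms] by simp

lemma smooth_pderivs_differentiable:
  "smooth_fun f \<Longrightarrow> pderivs is f differentiable (at x)"
  unfolding smooth_fun_def by blast

lemma smooth_differentiable: "smooth_fun f \<Longrightarrow> f differentiable (at x)"
  using smooth_pderivs_differentiable[of f "[]"] by simp

lemma smooth_pderivs: "smooth_fun f \<Longrightarrow> smooth_fun (pderivs js f)"
  unfolding smooth_fun_def foldr_append[symmetric, unfolded comp_def] by blast

lemma smooth_partial_deriv: "smooth_fun f \<Longrightarrow> smooth_fun (partial_deriv i f)"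
  using smooth_pderivs[of f "[i]"] by simp

lemma smooth_isCont: "smooth_fun f \<Longrightarrow> isCont f x"
  by (simp add: differentiable_imp_continuous_within smooth_differentiable)

lemma smooth_continuous_on: "smooth_fun f \<Longrightarrow> continuous_on S f"
  by (simp add: continuous_at_imp_continuous_on smooth_isCont)

lemma smooth_measurable: "smooth_fun f \<Longrightarrow> f \<in> borel_measurable borel"
  by (simp add: borel_measurable_continuous_onI smooth_continuous_on)

lemma has_vector_derivative_line:
  fixes f :: "real^'n::finite \<Rightarrow> complex"
  assumes "f differentiable at (x + s *\<^sub>R v)"
  shows "((\<lambda>s. f (x + s *\<^sub>R v)) has_vector_derivative
    (\<Sum>i\<in>UNIV. (v $ i) *\<^sub>R partial_deriv i f (x + s *\<^sub>R v))) (at s)"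
proof -
  have "((\<lambda>s. x + s *\<^sub>R v) has_derivative (\<lambda>h. h *\<^sub>R v)) (at s)"
    by (auto intro!: derivative_eq_intros)
  from diff_chain_at[OF this has_derivative_partial_deriv[OF assms]]
  show ?thesis
    by (simp add: has_vector_derivative_def o_def scaleR_sum_right)
qed

lemma has_vector_derivative_axis:
  fixes f :: "real^'n::finite \<Rightarrow> complex"
  assumes "smooth_fun f"
  shows "((\<lambda>s. f (x + s *\<^sub>R axis i 1)) has_vector_derivative
    partial_deriv i f (x + s *\<^sub>R axis i 1)) (at s)"
proof -
  have "(\<Sum>j\<in>UNIV. (axis i (1::real) $ j) *\<^sub>R partial_deriv j f y) = partial_deriv i f y" for y
    by (subst sum.remove[of _ i]) (auto simp: axis_def intro!: sum.neutral)
  then show ?thesis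
    using has_vector_derivative_line[OF smooth_differentiable[OF assms], where x = x and s = s and v = "axis i 1"] by simp
qed

text \<open>Real and imaginary parts are handled separately by the real symmetry theorem.\<close>

lemma partial_deriv_commute:
  assumes "smooth_fun f"
  shows "partial_deriv i (partial_deriv j f) = partial_deriv j (partial_deriv i f)"
proof
  fix x
  have L: "((\<lambda>s. L (f' (y + s *\<^sub>R axis k 1))) has_real_derivative L (partial_deriv k f' (y + s *\<^sub>R axis k 1))) (at s)"
    if "bounded_linear L" "smooth_fun f'" for L f' y k s
    using bounded_linear.has_vector_derivative[OF that(1) has_vector_derivative_axis[OF that(2), of y k s]]
    by (simp add: has_real_derivative_iff_has_vector_derivative)
  have "L (partial_deriv i (partial_deriv j f) x) = L (partial_deriv j (partial_deriv i f) x)"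
    if "bounded_linear L" for L :: "complex \<Rightarrow> real"
  proof (rule mixed_directional_derivatives_eq[of "\<lambda>x. L (f x)" "axis j 1" "\<lambda>x. L (partial_deriv j f x)"
          "axis i 1" "\<lambda>x. L (partial_deriv i f x)" "\<lambda>x. L (partial_deriv i (partial_deriv j f) x)"
          "\<lambda>x. L (partial_deriv j (partial_deriv i f) x)"])
    note sm = assms smooth_partial_deriv[OF assms, of i] smooth_partial_deriv[OF assms, of j]
    show "((\<lambda>s. L (f (x + s *\<^sub>R axis j 1))) has_real_derivative L (partial_deriv j f (x + s *\<^sub>R axis j 1))) (at s)" for x s
      using L[OF that sm(1), of x j s] .
    show "((\<lambda>s. L (f (x + s *\<^sub>R axis i 1))) has_real_derivative L (partial_deriv i f (x + s *\<^sub>R axis i 1))) (at s)" for x s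
      using L[OF that sm(1), of x i s] .
    show "((\<lambda>s. L (partial_deriv j f (x + s *\<^sub>R axis i 1))) has_real_derivative
        L (partial_deriv i (partial_deriv j f) (x + s *\<^sub>R axis i 1))) (at s)" for x s
      using L[OF that sm(3), of x i s] .
    show "((\<lambda>s. L (partial_deriv i f (x + s *\<^sub>R axis j 1))) has_real_derivative
        L (partial_deriv j (partial_deriv i f) (x + s *\<^sub>R axis j 1))) (at s)" for x s
      using L[OF that sm(2), of x j s] .
    show "isCont (\<lambda>x. L (partial_deriv i (partial_deriv j f) x)) x" "isCont (\<lambda>x. L (partial_deriv j (partial_deriv i f) x)) x"
      using sm by (intro bounded_linear.isCont[OF that] smooth_isCont smooth_partial_deriv; simp)+
  qed
  from this[OF bounded_linear_Re] this[OF bounded_linear_Im]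
  show "partial_deriv i (partial_deriv j f) x = partial_deriv j (partial_deriv i f) x"
    by (simp add: complex_eq_iff)
qed

lemma pderivs_mset_cong:
  assumes "smooth_fun f" "mset is = mset js"
  shows "pderivs is f = pderivs js f"
proof -
  have "fold partial_deriv (rev is) f = fold partial_deriv (rev js) f"
    using assms
    by (intro fold_permuted_eq[where P = smooth_fun] smooth_partial_deriv)
      (auto intro: partial_deriv_commute)
  then show ?thesis by (simp add: foldr_conv_fold)
qed

lemma mi_order_count_list: "mi_order (count_list is) = length is"
  unfolding mi_order_def by (rule sum_count_set) auto

text \<open>The \<open>SOME\<close> in \<open>mi_deriv\<close> picks some list with the prescribed
  counts, and for smooth functions the order of the list is irrelevant. From here on estimates run
  over index lists, which suit the recursion of \<open>pderivs\<close>.\<close>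

lemma mi_deriv_count_list:
  assumes "smooth_fun f"
  shows "mi_deriv (count_list is) f = pderivs is f"
  unfolding mi_deriv_def
proof (rule pderivs_mset_cong[OF assms])
  have "\<forall>i. count_list (SOME js. \<forall>i. count_list js i = count_list is i) i = count_list is i"
    by (rule someI[of _ "is"]) simp
  then show "mset (SOME js. \<forall>i. count_list js i = count_list is i) = mset is"
    by (intro multiset_eqI) (simp add: count_mset)
qed

text \<open>One list serves all functions, smooth or not. \<open>Abs_multiset\<close> turns \<beta>
  into a multiset, so a list with these counts exists.\<close>

lemma mi_deriv_cases:
  obtains js where "length js = mi_order \<beta>" "\<And>f. mi_deriv \<beta> f = pderivs js f"
proof -
  have "finite {x. 0 < \<beta> x}" by simp
  obtain ks where ks: "mset ks = Abs_multiset \<beta>" using ex_mset by blast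
  then have "\<forall>i. count_list ks i = \<beta> i"
    by (simp add: count_mset[symmetric])
  then have c: "\<forall>i. count_list (SOME js. \<forall>i. count_list js i = \<beta> i) i = \<beta> i"
    by (rule someI)
  define js where "js = (SOME js. \<forall>i. count_list js i = \<beta> i)"
  have "count_list js = \<beta>" using c by (auto simp: js_def)
  then show ?thesis
    using that[of js] mi_order_count_list[of js] by (auto simp: mi_deriv_def js_def)
qed

lemma finite_mi_order: "finite {\<beta> :: 'n::finite \<Rightarrow> nat. mi_order \<beta> \<le> N}"
proof (rule finite_subset)
  show "{\<beta> :: 'n \<Rightarrow> nat. mi_order \<beta> \<le> N} \<subseteq> (UNIV \<rightarrow>\<^sub>E {..N})"
  proof
    fix \<beta> :: "'n \<Rightarrow> nat" assume "\<beta> \<in> {\<beta>. mi_order \<beta> \<le> N}"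
    then have "(\<Sum>i\<in>UNIV. \<beta> i) \<le> N" by (simp add: mi_order_def)
    then have "\<beta> i \<le> N" for i using member_le_sum[of i UNIV \<beta>] by simp
    then show "\<beta> \<in> (UNIV \<rightarrow>\<^sub>E {..N})" by auto
  qed
qed (auto intro: finite_PiE)

lemma pderivs_le_schwartz_norm:
  fixes f :: "real^'n::finite \<Rightarrow> complex"
  assumes "smooth_fun f" "length is \<le> N"
  shows "ennreal ((1 + norm x) ^ N * norm (pderivs is f x)) \<le> schwartz_norm N f"
proof -
  have "ennreal ((1 + norm x) ^ N * norm (pderivs is f x)) \<le>
      (SUP x. ennreal ((1 + norm x) ^ N * norm (mi_deriv (count_list is) f x)))"
    using mi_deriv_count_list[OF assms(1)] by (intro SUP_upper2[of x]) auto
  also have "\<dots> \<le> schwartz_norm N f"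
    unfolding schwartz_norm_def
    by (rule member_le_sum[of _ _ "\<lambda>\<beta>. SUP x. ennreal ((1 + norm x) ^ N * norm (mi_deriv \<beta> f x))"])
      (use assms in \<open>auto simp: finite_mi_order mi_order_count_list\<close>)
  finally show ?thesis .
qed

definition mi_card :: "'n::finite itself \<Rightarrow> nat \<Rightarrow> nat" where
  "mi_card TYPE('n) N = card {\<beta> :: 'n \<Rightarrow> nat. mi_order \<beta> \<le> N}"

text \<open>The seminorm is a sum over multi-indices, so a uniform bound costs their number.\<close>

lemma schwartz_norm_le:
  fixes f :: "real^'n::finite \<Rightarrow> complex"
  assumes "\<And>is x. length is \<le> N \<Longrightarrow> (1 + norm x) ^ N * norm (pderivs is f x) \<le> B"
  shows "schwartz_norm N f \<le> ennreal (real (mi_card TYPE('n) N) * B)"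
proof -
  have "0 \<le> B" using assms[of "[]" 0] norm_ge_zero[of "f 0"] by (auto intro: order_trans[OF norm_ge_zero])
  have "schwartz_norm N f \<le> (\<Sum>\<beta> | mi_order (\<beta> :: 'n \<Rightarrow> nat) \<le> N. ennreal B)"
    unfolding schwartz_norm_def
  proof (intro sum_mono SUP_least ennreal_leI)
    fix \<beta> :: "'n \<Rightarrow> nat" and x assume "\<beta> \<in> {\<beta>. mi_order \<beta> \<le> N}"
    then show "(1 + norm x) ^ N * norm (mi_deriv \<beta> f x) \<le> B"
      by (metis assms mem_Collect_eq mi_deriv_cases)
  qed
  also have "\<dots> = ennreal (real (mi_card TYPE('n) N) * B)"
    using \<open>0 \<le> B\<close> by (simp add: mi_card_def ennreal_mult' ennreal_of_nat_eq_real_of_nat)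
  finally show ?thesis .
qed

text \<open>Here the power of decay and the order of differentiation vary independently, whereas a
  seminorm ties both to \<open>N\<close>. Finitely many lists contribute to it, so a maximum of the
  individual bounds suffices.\<close>

lemma schwartzI:
  fixes f :: "real^'n::finite \<Rightarrow> complex"
  assumes "smooth_fun f" "\<And>N is. \<exists>B. \<forall>x. (1 + norm x) ^ N * norm (pderivs is f x) \<le> B"
  shows "f \<in> schwartz"
  unfolding schwartz_def
proof (intro CollectI conjI allI assms)
  fix N
  have fin: "finite {is :: 'n list. length is \<le> N}"
    using finite_lists_length_le[of "UNIV :: 'n set" N] by simp
  obtain B where B: "\<And>is x. (1 + norm x) ^ N * norm (pderivs is f x) \<le> B is"
    using assms(2)[of N] by metis
  have "schwartz_norm N f \<le> ennreal (real (mi_card TYPE('n) N) * (Max (B ` {is. length is \<le> N})))"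
    using fin by (intro schwartz_norm_le order_trans[OF B] Max_ge) auto
  then show "schwartz_norm N f < \<infinity>" by (auto intro: le_less_trans)
qed

lemma schwartz_smooth: "f \<in> schwartz \<Longrightarrow> smooth_fun f"
  by (simp add: schwartz_def)

lemma schwartz_bound:
  assumes "f \<in> schwartz" "length is \<le> N"
  shows "(1 + norm x) ^ N * norm (pderivs is f x) \<le> enn2real (schwartz_norm N f)"
proof -
  have "schwartz_norm N f < \<infinity>" using assms by (simp add: schwartz_def)
  then have "ennreal (enn2real (schwartz_norm N f)) = schwartz_norm N f" by simp
  then show ?thesis
    using pderivs_le_schwartz_norm[OF schwartz_smooth[OF assms(1)] assms(2), of x]
    by (metis enn2real_nonneg ennreal_le_iff)
qed

section \<open>Linear combinations and affine substitutions of Schwartz functions\<close>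

lemma partial_deriv_linear:
  assumes "f differentiable at x" "g differentiable at x"
  shows "partial_deriv i (\<lambda>x. a * f x + b * g x) x = a * partial_deriv i f x + b * partial_deriv i g x"
proof -
  note d = assms[THEN frechet_derivative_works[THEN iffD1]]
  show ?thesis
    by (subst partial_derivI[OF has_derivative_add[OF has_derivative_mult_right[OF d(1)]
         has_derivative_mult_right[OF d(2)]]]) (simp add: partial_deriv_def)
qed

lemma pderivs_linear:
  assumes "smooth_fun f" "smooth_fun g"
  shows "pderivs is (\<lambda>x. a * f x + b * g x) = (\<lambda>x. a * pderivs is f x + b * pderivs is g x)"
proof (induction "is")
  case (Cons i "is")
  show ?case
    unfolding foldr.simps o_def Cons
    by (rule ext, rule partial_deriv_linear) (intro smooth_pderivs_differentiable assms)+
qed simp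

lemma smooth_linear:
  assumes "smooth_fun f" "smooth_fun g"
  shows "smooth_fun (\<lambda>x. a * f x + b * g x)"
  unfolding smooth_fun_def pderivs_linear[OF assms]
  by (intro allI differentiable_add differentiable_mult differentiable_const smooth_pderivs_differentiable assms)

lemma pderivs_cmult: "smooth_fun f \<Longrightarrow> pderivs is (\<lambda>x. a * f x) = (\<lambda>x. a * pderivs is f x)"
  using pderivs_linear[of f f "is" a 0] by simp

lemma pderivs_diff:
  "smooth_fun f \<Longrightarrow> smooth_fun g \<Longrightarrow> pderivs is (\<lambda>x. f x - g x) = (\<lambda>x. pderivs is f x - pderivs is g x)"
  using pderivs_linear[of f g "is" 1 "-1"] by simp

lemma schwartz_linear:
  assumes "f \<in> schwartz" "g \<in> schwartz"
  shows "(\<lambda>x. a * f x + b * g x) \<in> schwartz"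
proof (rule schwartzI)
  note sm = assms[THEN schwartz_smooth]
  show "smooth_fun (\<lambda>x. a * f x + b * g x)" by (rule smooth_linear[OF sm])
  fix N and "is" :: "'a list"
  \<comment> \<open>\<open>schwartz_bound\<close> asks for a seminorm index that is at least the
    order of the derivative.\<close>
  define M where "M = max N (length is)"
  show "\<exists>B. \<forall>x. (1 + norm x) ^ N * norm (pderivs is (\<lambda>x. a * f x + b * g x) x) \<le> B"
  proof (intro exI allI)
    fix x :: "real^'a"
    have *: "(1 + norm x) ^ N * norm (pderivs is h x) \<le> enn2real (schwartz_norm M h)" if "h \<in> schwartz" for h
    proof -
      have "(1 + norm x) ^ N * norm (pderivs is h x) \<le> (1 + norm x) ^ M * norm (pderivs is h x)"
        by (intro mult_right_mono power_increasing) (auto simp: M_def)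
      also have "\<dots> \<le> enn2real (schwartz_norm M h)"
        by (rule schwartz_bound[OF that]) (simp add: M_def)
      finally show ?thesis .
    qed
    have "(1 + norm x) ^ N * norm (pderivs is (\<lambda>x. a * f x + b * g x) x) \<le>
        (1 + norm x) ^ N * (norm a * norm (pderivs is f x) + norm b * norm (pderivs is g x))"
      unfolding pderivs_linear[OF sm] norm_mult[symmetric]
      by (intro mult_left_mono norm_triangle_ineq) auto
    also have "\<dots> = norm a * ((1 + norm x) ^ N * norm (pderivs is f x)) +
        norm b * ((1 + norm x) ^ N * norm (pderivs is g x))" by (simp add: algebra_simps)
    also have "\<dots> \<le> norm a * enn2real (schwartz_norm M f) + norm b * enn2real (schwartz_norm M g)"
      by (intro add_mono mult_left_mono * assms) auto
    finally show "(1 + norm x) ^ N * norm (pderivs is (\<lambda>x. a * f x + b * g x) x) \<le>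
      norm a * enn2real (schwartz_norm M f) + norm b * enn2real (schwartz_norm M g)" .
  qed
qed

lemma schwartz_cmult: "f \<in> schwartz \<Longrightarrow> (\<lambda>x. a * f x) \<in> schwartz"
  using schwartz_linear[of f f a 0] by simp

lemma schwartz_norm_cmult:
  assumes "smooth_fun f"
  shows "schwartz_norm N (\<lambda>x. a * f x) = ennreal (norm a) * schwartz_norm N f"
  unfolding schwartz_norm_def sum_distrib_left
proof (intro sum.cong refl)
  fix \<beta> :: "'a \<Rightarrow> nat"
  obtain js where js: "\<And>f. mi_deriv \<beta> f = pderivs js f" using mi_deriv_cases by metis
  show "(SUP x. ennreal ((1 + norm x) ^ N * norm (mi_deriv \<beta> (\<lambda>x. a * f x) x))) =
      ennreal (norm a) * (SUP x. ennreal ((1 + norm x) ^ N * norm (mi_deriv \<beta> f x)))"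
    unfolding js pderivs_cmult[OF assms] SUP_mult_left_ennreal
    by (intro SUP_cong refl) (simp add: norm_mult ennreal_mult'[symmetric] mult_ac)
qed

lemma pderivs_affine:
  fixes f :: "real^'n::finite \<Rightarrow> complex"
  assumes "smooth_fun f"
  shows "pderivs is (\<lambda>y. f (s *\<^sub>R y + b)) = (\<lambda>y. (s ^ length is) *\<^sub>R pderivs is f (s *\<^sub>R y + b))"
proof (induction "is")
  case (Cons i "is")
  have "partial_deriv i (\<lambda>y. (s ^ length is) *\<^sub>R pderivs is f (s *\<^sub>R y + b)) y =
      (s ^ length (i # is)) *\<^sub>R pderivs (i # is) f (s *\<^sub>R y + b)" for y
  proof -
    have 1: "((\<lambda>y. s *\<^sub>R y + b) has_derivative (\<lambda>h. s *\<^sub>R h)) (at y)"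
      by (auto intro!: derivative_eq_intros)
    have 2: "(pderivs is f has_derivative frechet_derivative (pderivs is f) (at (s *\<^sub>R y + b))) (at (s *\<^sub>R y + b))"
      using assms smooth_pderivs_differentiable frechet_derivative_works by blast
    interpret bounded_linear "frechet_derivative (pderivs is f) (at (s *\<^sub>R y + b))"
      using 2 by (rule has_derivative_bounded_linear)
    show ?thesis
      by (subst partial_derivI[OF has_derivative_scaleR_right[OF diff_chain_at[OF 1 2, unfolded o_def]]])
        (simp add: scaleR partial_deriv_def)
  qed
  then show ?case using Cons by auto
qed simp

lemma smooth_affine:
  fixes f :: "real^'n::finite \<Rightarrow> complex"
  assumes "smooth_fun f"
  shows "smooth_fun (\<lambda>y. f (s *\<^sub>R y + b))"
  unfolding smooth_fun_def pderivs_affine[OF assms]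
proof (intro allI differentiable_scaleR)
  fix "is" x
  have "(pderivs is f \<circ> (\<lambda>y. s *\<^sub>R y + b)) differentiable at x"
    by (intro differentiable_chain_at smooth_pderivs_differentiable assms) auto
  then show "(\<lambda>x. pderivs is f (s *\<^sub>R x + b)) differentiable at x" by (simp add: o_def)
qed auto

text \<open>A Peetre-type inequality: the substitution changes the weight 1 + |y| by at most a
  constant factor. It carries decay estimates through affine substitutions.\<close>

lemma one_plus_norm_affine:
  fixes y b :: "'a::real_normed_vector"
  assumes "s \<noteq> 0"
  shows "1 + norm y \<le> (1 + 1 / \<bar>s\<bar>) * (1 + norm b) * (1 + norm (s *\<^sub>R y + b))"
proof -
  have "\<bar>s\<bar> * norm y = norm ((s *\<^sub>R y + b) - b)" by simp
  also have "\<dots> \<le> norm (s *\<^sub>R y + b) + norm b" by (rule norm_triangle_ineq4)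
  finally have "norm y \<le> (1 / \<bar>s\<bar>) * (norm (s *\<^sub>R y + b) + norm b)"
    using assms by (simp add: field_simps)
  also have "\<dots> \<le> (1 / \<bar>s\<bar>) * ((1 + norm b) * (1 + norm (s *\<^sub>R y + b)))"
    by (intro mult_left_mono) (auto simp: algebra_simps)
  finally have 1: "norm y \<le> (1 / \<bar>s\<bar>) * ((1 + norm b) * (1 + norm (s *\<^sub>R y + b)))" .
  have "1 * 1 \<le> (1 + norm b) * (1 + norm (s *\<^sub>R y + b))" by (intro mult_mono) auto
  with 1 have "1 + norm y \<le> (1 + 1 / \<bar>s\<bar>) * ((1 + norm b) * (1 + norm (s *\<^sub>R y + b)))"
    unfolding distrib_right[of 1 "1 / \<bar>s\<bar>"] by linarith
  then show ?thesis by (simp only: mult.assoc)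
qed

lemma schwartz_affine:
  fixes f :: "real^'n::finite \<Rightarrow> complex"
  assumes "f \<in> schwartz" "s \<noteq> 0"
  shows "(\<lambda>y. f (s *\<^sub>R y + b)) \<in> schwartz"
proof (rule schwartzI)
  note sm = assms(1)[THEN schwartz_smooth]
  show "smooth_fun (\<lambda>y. f (s *\<^sub>R y + b))" by (rule smooth_affine[OF sm])
  fix N and "is" :: "'n list"
  define M where "M = max N (length is)"
  define K where "K = (1 + 1 / \<bar>s\<bar>) * (1 + norm b)"
  have "K \<ge> 0" by (auto simp: K_def)
  show "\<exists>B. \<forall>x. (1 + norm x) ^ N * norm (pderivs is (\<lambda>y. f (s *\<^sub>R y + b)) x) \<le> B"
  proof (intro exI allI)
    fix y :: "real^'n"
    define z where "z = s *\<^sub>R y + b"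
    have "(1 + norm y) ^ N * norm (pderivs is (\<lambda>y. f (s *\<^sub>R y + b)) y) =
       \<bar>s\<bar> ^ length is * ((1 + norm y) ^ N * norm (pderivs is f z))"
      unfolding pderivs_affine[OF sm] by (simp add: power_abs z_def)
    also have "\<dots> \<le> \<bar>s\<bar> ^ length is * ((K * (1 + norm z)) ^ N * norm (pderivs is f z))"
      using one_plus_norm_affine[OF assms(2), of y b]
      by (intro mult_left_mono mult_right_mono power_mono) (auto simp: K_def z_def)
    also have "\<dots> = \<bar>s\<bar> ^ length is * K ^ N * ((1 + norm z) ^ N * norm (pderivs is f z))"
      by (simp add: power_mult_distrib)
    also have "\<dots> \<le> \<bar>s\<bar> ^ length is * K ^ N * ((1 + norm z) ^ M * norm (pderivs is f z))"
      using \<open>K \<ge> 0\<close> by (intro mult_left_mono mult_right_mono power_increasing) (auto simp: M_def)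
    also have "\<dots> \<le> \<bar>s\<bar> ^ length is * K ^ N * enn2real (schwartz_norm M f)"
      using \<open>K \<ge> 0\<close> by (intro mult_left_mono schwartz_bound assms) (auto simp: M_def)
    finally show "(1 + norm y) ^ N * norm (pderivs is (\<lambda>y. f (s *\<^sub>R y + b)) y) \<le>
      \<bar>s\<bar> ^ length is * K ^ N * enn2real (schwartz_norm M f)" .
  qed
qed

lemma norm_diff_le_pderivs:
  fixes f :: "real^'n::finite \<Rightarrow> complex"
  assumes "smooth_fun f"
    and B: "\<And>\<tau> i. 0 \<le> \<tau> \<Longrightarrow> \<tau> \<le> 1 \<Longrightarrow> norm (partial_deriv i f (u + \<tau> *\<^sub>R (v - u))) \<le> B"
  shows "norm (f v - f u) \<le> norm (v - u) * (real CARD('n) * B)"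
proof -
  define g where "g \<tau> = f (u + \<tau> *\<^sub>R (v - u))" for \<tau>
  have d: "(g has_derivative (\<lambda>h. h *\<^sub>R (\<Sum>i\<in>UNIV. ((v - u) $ i) *\<^sub>R partial_deriv i f (u + \<tau> *\<^sub>R (v - u))))) (at \<tau>)" for \<tau>
    using has_vector_derivative_line[OF smooth_differentiable[OF assms(1)], where x = u and s = \<tau> and v = "v - u"]
    unfolding g_def[abs_def] has_vector_derivative_def .
  have "norm (g 1 - g 0) \<le> (norm (v - u) * (real CARD('n) * B)) * norm (1 - 0 :: real)"
  proof (rule differentiable_bound[of "{0..1}" g])
    fix \<tau> :: real assume \<tau>: "\<tau> \<in> {0..1}"
    show "(g has_derivative (\<lambda>h. h *\<^sub>R (\<Sum>i\<in>UNIV. ((v - u) $ i) *\<^sub>R partial_deriv i f (u + \<tau> *\<^sub>R (v - u))))) (at \<tau> within {0..1})"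
      by (rule has_derivative_at_withinI[OF d])
    have "norm (\<Sum>i\<in>UNIV. ((v - u) $ i) *\<^sub>R partial_deriv i f (u + \<tau> *\<^sub>R (v - u))) \<le> (\<Sum>i\<in>(UNIV::'n set). norm (v - u) * B)"
    proof (rule sum_norm_le)
      fix i :: 'n
      show "norm (((v - u) $ i) *\<^sub>R partial_deriv i f (u + \<tau> *\<^sub>R (v - u))) \<le> norm (v - u) * B"
        unfolding norm_scaleR using B[of \<tau> i] \<tau> component_le_norm_cart[of "v - u" i] by (intro mult_mono) auto
    qed
    then have S: "norm (\<Sum>i\<in>UNIV. ((v - u) $ i) *\<^sub>R partial_deriv i f (u + \<tau> *\<^sub>R (v - u))) \<le> norm (v - u) * (real CARD('n) * B)"
      by (simp add: mult_ac)
    show "onorm (\<lambda>h. h *\<^sub>R (\<Sum>i\<in>UNIV. ((v - u) $ i) *\<^sub>R partial_deriv i f (u + \<tau> *\<^sub>R (v - u)))) \<le> norm (v - u) * (real CARD('n) * B)"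
    proof (rule onorm_bound)
      show "0 \<le> norm (v - u) * (real CARD('n) * B)" by (rule order_trans[OF norm_ge_zero S])
    next
      fix h :: real
      show "norm (h *\<^sub>R (\<Sum>i\<in>UNIV. ((v - u) $ i) *\<^sub>R partial_deriv i f (u + \<tau> *\<^sub>R (v - u)))) \<le> norm (v - u) * (real CARD('n) * B) * norm h"
        unfolding norm_scaleR using mult_right_mono[OF S, of "norm h"] by (simp add: mult_ac)
    qed
  qed auto
  then show ?thesis by (simp add: g_def)
qed

text \<open>Tempered distributions are continuous along Schwartz sequences, so this convergence is
  what makes the convolution with \<psi>_t continuous in (t, x), hence measurable. A difference of
  derivatives splits into a change of the factor s^k and a change of the argument. The mean value
  theorem bounds the latter by a derivative of one order more; the seminorm of index N + 1 also
  supplies the extra power of 1 + |y| that pays for the distance of the two arguments.\<close>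

lemma schwartz_affine_tendsto:
  fixes f :: "real^'n::finite \<Rightarrow> complex" and s :: "nat \<Rightarrow> real"
  assumes f: "f \<in> schwartz" and s: "s \<longlonglongrightarrow> s0" "s0 \<noteq> 0" and b: "b \<longlonglongrightarrow> b0"
  shows "(\<lambda>j. schwartz_norm N (\<lambda>y. f (s j *\<^sub>R y + b j) - f (s0 *\<^sub>R y + b0))) \<longlonglongrightarrow> 0"
proof -
  note sm = schwartz_smooth[OF f]
  \<comment> \<open>The constant of \<open>one_plus_norm_affine\<close>, uniform over the segment
    from (s0, b0) to (s j, b j): for large j the slopes on it are at least |s0|/2 in modulus, and
    the translations have norm at most 1 + |b0|.\<close>
  define K where "K = (1 + 2 / \<bar>s0\<bar>) * (2 + norm b0)"
  have K0: "K \<ge> 0" by (auto simp: K_def)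
  define C where "C M = enn2real (schwartz_norm M f)" for M
  have C0: "C M \<ge> 0" for M by (simp add: C_def)
  define \<delta> where "\<delta> j = \<bar>s j - s0\<bar> + norm (b j - b0)" for j
  define B where "B j = (\<Sum>k\<le>N. \<bar>s j ^ k - s0 ^ k\<bar>) * (K ^ N * C N) +
     (\<Sum>k\<le>N. \<bar>s0\<bar> ^ k) * (\<delta> j * (real CARD('n) * (K ^ (Suc N) * C (Suc N))))" for j
  have "B \<longlonglongrightarrow> (\<Sum>k\<le>N. \<bar>s0 ^ k - s0 ^ k\<bar>) * (K ^ N * C N) +
     (\<Sum>k\<le>N. \<bar>s0\<bar> ^ k) * ((\<bar>s0 - s0\<bar> + norm (b0 - b0)) * (real CARD('n) * (K ^ (Suc N) * C (Suc N))))"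
    unfolding B_def \<delta>_def by (intro tendsto_intros s b)
  then have "B \<longlonglongrightarrow> 0" by simp
  then have lim: "(\<lambda>j. ennreal (real (mi_card TYPE('n) N) * B j)) \<longlonglongrightarrow> 0"
    using tendsto_ennrealI[OF tendsto_mult_right_zero[of B sequentially "real (mi_card TYPE('n) N)"]] by simp
  have "\<forall>\<^sub>F j in sequentially. dist (s j) s0 < \<bar>s0\<bar> / 2" "\<forall>\<^sub>F j in sequentially. dist (b j) b0 < 1"
    using tendstoD[OF s(1), of "\<bar>s0\<bar> / 2"] tendstoD[OF b, of 1] s(2) by auto
  then have "\<forall>\<^sub>F j in sequentially.
      schwartz_norm N (\<lambda>y. f (s j *\<^sub>R y + b j) - f (s0 *\<^sub>R y + b0)) \<le> ennreal (real (mi_card TYPE('n) N) * B j)"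
  proof eventually_elim
    fix j assume sj: "dist (s j) s0 < \<bar>s0\<bar> / 2" and bj: "dist (b j) b0 < 1"
    have ineq: "1 + norm y \<le> K * (1 + norm ((s0 + \<tau> * (s j - s0)) *\<^sub>R y + (b0 + \<tau> *\<^sub>R (b j - b0))))"
      if "0 \<le> \<tau>" "\<tau> \<le> 1" for \<tau> y
    proof -
      let ?s = "s0 + \<tau> * (s j - s0)" and ?b = "b0 + \<tau> *\<^sub>R (b j - b0)"
      have "\<bar>\<tau> * (s j - s0)\<bar> \<le> 1 * (\<bar>s0\<bar> / 2)"
        unfolding abs_mult using that sj by (intro mult_mono) (auto simp: dist_real_def)
      then have s': "\<bar>?s\<bar> \<ge> \<bar>s0\<bar> / 2" by linarith
      have "norm (\<tau> *\<^sub>R (b j - b0)) \<le> 1 * 1"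
        unfolding norm_scaleR using that bj by (intro mult_mono) (auto simp: dist_norm)
      then have b': "norm ?b \<le> 1 + norm b0" using norm_triangle_ineq[of b0 "\<tau> *\<^sub>R (b j - b0)"] by simp
      have s'': "1 / \<bar>?s\<bar> \<le> 2 / \<bar>s0\<bar>" using frac_le[of 1 1 "\<bar>s0\<bar> / 2" "\<bar>?s\<bar>"] s' s(2) by simp
      have "1 + norm y \<le> ((1 + 1 / \<bar>?s\<bar>) * (1 + norm ?b)) * (1 + norm (?s *\<^sub>R y + ?b))"
        using one_plus_norm_affine[of ?s y ?b] s' s(2) by force
      also have "\<dots> \<le> K * (1 + norm (?s *\<^sub>R y + ?b))"
        unfolding K_def using s'' b' by (intro mult_right_mono mult_mono) auto
      finally show ?thesis .
    qed
    \<comment> \<open>The N + 1 powers in the denominator cancel the N powers on the left and the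
      one power in the distance of the arguments.\<close>
    have aux: "q ^ N * a \<le> d * (m * M)" if "a \<le> (d * q) * (m * (M / q ^ Suc N))" "q > 0" for q a d m M :: real
    proof -
      have "q ^ N * a \<le> q ^ N * ((d * q) * (m * (M / q ^ Suc N)))"
        using that by (intro mult_left_mono) auto
      also have "\<dots> = d * (m * M)" using that by simp
      finally show ?thesis .
    qed
    show "schwartz_norm N (\<lambda>y. f (s j *\<^sub>R y + b j) - f (s0 *\<^sub>R y + b0)) \<le> ennreal (real (mi_card TYPE('n) N) * B j)"
    proof (rule schwartz_norm_le)
      fix "is" :: "'n list" and y :: "real^'n" assume len: "length is \<le> N"
      let ?k = "length is"
      define z where "z = s0 *\<^sub>R y + b0"
      define z' where "z' = s j *\<^sub>R y + b j"
      have pz: "z + \<tau> *\<^sub>R (z' - z) = (s0 + \<tau> * (s j - s0)) *\<^sub>R y + (b0 + \<tau> *\<^sub>R (b j - b0))" for \<tau>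
        by (simp add: z_def z'_def algebra_simps)
      have ineq': "1 + norm y \<le> K * (1 + norm (z + \<tau> *\<^sub>R (z' - z)))" if "0 \<le> \<tau>" "\<tau> \<le> 1" for \<tau>
        using ineq[OF that] unfolding pz .
      have bd: "(1 + norm y) ^ M * norm (pderivs js f (z + \<tau> *\<^sub>R (z' - z))) \<le> K ^ M * C M"
        if "0 \<le> \<tau>" "\<tau> \<le> 1" "length js \<le> M" for M js \<tau>
      proof -
        have "(1 + norm y) ^ M * norm (pderivs js f (z + \<tau> *\<^sub>R (z' - z))) \<le>
            (K * (1 + norm (z + \<tau> *\<^sub>R (z' - z)))) ^ M * norm (pderivs js f (z + \<tau> *\<^sub>R (z' - z)))"
          using ineq'[OF that(1,2)] by (intro mult_right_mono power_mono) auto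
        also have "\<dots> = K ^ M * ((1 + norm (z + \<tau> *\<^sub>R (z' - z))) ^ M * norm (pderivs js f (z + \<tau> *\<^sub>R (z' - z))))"
          by (simp add: power_mult_distrib)
        also have "\<dots> \<le> K ^ M * C M"
          unfolding C_def using K0 by (intro mult_left_mono schwartz_bound f that) auto
        finally show ?thesis .
      qed
      have t1: "(1 + norm y) ^ N * norm (pderivs is f z') \<le> K ^ N * C N"
        using bd[of 1 "is" N] len by simp
      have "norm (pderivs is f z' - pderivs is f z) \<le>
          norm (z' - z) * (real CARD('n) * (K ^ Suc N * C (Suc N) / (1 + norm y) ^ Suc N))"
      proof (rule norm_diff_le_pderivs[OF smooth_pderivs[OF sm]])
        fix \<tau> :: real and i :: 'n assume "0 \<le> \<tau>" "\<tau> \<le> 1"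
        from bd[OF this, of "i # is" "Suc N"] len
        show "norm (partial_deriv i (pderivs is f) (z + \<tau> *\<^sub>R (z' - z))) \<le> K ^ Suc N * C (Suc N) / (1 + norm y) ^ Suc N"
          by (subst pos_le_divide_eq) (auto simp: mult_ac add_pos_nonneg)
      qed
      also have "\<dots> \<le> (\<delta> j * (1 + norm y)) * (real CARD('n) * (K ^ Suc N * C (Suc N) / (1 + norm y) ^ Suc N))"
      proof (intro mult_right_mono)
        have "norm (z' - z) = norm ((s j - s0) *\<^sub>R y + (b j - b0))"
          by (simp add: z_def z'_def algebra_simps)
        also have "\<dots> \<le> \<bar>s j - s0\<bar> * norm y + norm (b j - b0) * 1"
          by (rule order_trans[OF norm_triangle_ineq]) simp
        also have "\<dots> \<le> \<bar>s j - s0\<bar> * (1 + norm y) + norm (b j - b0) * (1 + norm y)"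
          by (intro add_mono mult_left_mono) auto
        finally show "norm (z' - z) \<le> \<delta> j * (1 + norm y)" by (simp add: \<delta>_def algebra_simps)
        show "0 \<le> real CARD('n) * (K ^ Suc N * C (Suc N) / (1 + norm y) ^ Suc N)"
          using K0 C0 by (intro mult_nonneg_nonneg divide_nonneg_nonneg) auto
      qed
      finally have t2: "(1 + norm y) ^ N * norm (pderivs is f z' - pderivs is f z) \<le>
          \<delta> j * (real CARD('n) * (K ^ Suc N * C (Suc N)))"
        by (rule aux) (simp add: add_pos_nonneg)
      have "(1 + norm y) ^ N * norm (pderivs is (\<lambda>y. f (s j *\<^sub>R y + b j) - f (s0 *\<^sub>R y + b0)) y) =
        (1 + norm y) ^ N * norm ((s j ^ ?k - s0 ^ ?k) *\<^sub>R pderivs is f z' + s0 ^ ?k *\<^sub>R (pderivs is f z' - pderivs is f z))"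
        unfolding pderivs_diff[OF smooth_affine[OF sm] smooth_affine[OF sm]] pderivs_affine[OF sm] z_def z'_def
        by (simp add: algebra_simps)
      also have "\<dots> \<le> (1 + norm y) ^ N * (\<bar>s j ^ ?k - s0 ^ ?k\<bar> * norm (pderivs is f z') + \<bar>s0\<bar> ^ ?k * norm (pderivs is f z' - pderivs is f z))"
        by (intro mult_left_mono order_trans[OF norm_triangle_ineq]) (auto simp: power_abs)
      also have "\<dots> = \<bar>s j ^ ?k - s0 ^ ?k\<bar> * ((1 + norm y) ^ N * norm (pderivs is f z')) +
         \<bar>s0\<bar> ^ ?k * ((1 + norm y) ^ N * norm (pderivs is f z' - pderivs is f z))" by (simp add: algebra_simps)
      also have "\<dots> \<le> \<bar>s j ^ ?k - s0 ^ ?k\<bar> * (K ^ N * C N) + \<bar>s0\<bar> ^ ?k * (\<delta> j * (real CARD('n) * (K ^ Suc N * C (Suc N))))"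
        by (intro add_mono mult_left_mono t1 t2) auto
      also have "\<dots> \<le> B j"
        unfolding B_def
      proof (intro add_mono mult_right_mono)
        show "\<bar>s j ^ ?k - s0 ^ ?k\<bar> \<le> (\<Sum>k\<le>N. \<bar>s j ^ k - s0 ^ k\<bar>)"
          by (rule member_le_sum[of _ _ "\<lambda>k. \<bar>s j ^ k - s0 ^ k\<bar>"]) (use len in auto)
        show "\<bar>s0\<bar> ^ ?k \<le> (\<Sum>k\<le>N. \<bar>s0\<bar> ^ k)"
          by (rule member_le_sum[of _ _ "\<lambda>k. \<bar>s0\<bar> ^ k"]) (use len in auto)
      qed (use K0 C0 in \<open>auto simp: \<delta>_def\<close>)
      finally show "(1 + norm y) ^ N * norm (pderivs is (\<lambda>y. f (s j *\<^sub>R y + b j) - f (s0 *\<^sub>R y + b0)) y) \<le> B j" .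
    qed
  qed
  then show ?thesis
    by (rule tendsto_sandwich[OF _ _ tendsto_const lim, rotated]) simp
qed

text \<open>Joint continuity in slope and translation. Slope 0 is excluded because it would turn
  \<psi> into a constant function.\<close>

lemma tempered_continuous_affine:
  fixes f :: "'n::finite dist"
  assumes "f \<in> tempered" "\<psi> \<in> schwartz"
  shows "continuous_on {(s, b). s \<noteq> 0} (\<lambda>(s, b). f (\<lambda>y. \<psi> (s *\<^sub>R y + b)))"
  unfolding continuous_on_sequentially
proof (intro allI ballI impI, safe)
  fix u :: "nat \<Rightarrow> real \<times> (real^'n)" and s b
  assume u: "\<forall>n. u n \<in> {(s, b). s \<noteq> 0}" "u \<longlonglongrightarrow> (s, b)" and "s \<noteq> 0"
  have lim: "(\<lambda>n. fst (u n)) \<longlonglongrightarrow> s" "(\<lambda>n. snd (u n)) \<longlonglongrightarrow> b"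
    using tendsto_fst[OF u(2)] tendsto_snd[OF u(2)] by auto
  have "(\<lambda>n. f (\<lambda>y. \<psi> (fst (u n) *\<^sub>R y + snd (u n)))) \<longlonglongrightarrow> f (\<lambda>y. \<psi> (s *\<^sub>R y + b))"
  proof -
    have *: "(\<forall>j. \<Phi> j \<in> schwartz) \<and> (\<forall>N. (\<lambda>j. schwartz_norm N (\<lambda>x. \<Phi> j x - \<phi> x)) \<longlonglongrightarrow> 0) \<longrightarrow>
        (\<lambda>j. f (\<Phi> j)) \<longlonglongrightarrow> f \<phi>" if "\<phi> \<in> schwartz" for \<Phi> \<phi>
      using assms(1) that unfolding tempered_def by blast
    have "fst (u j) \<noteq> 0" for j using u(1) by (metis (mono_tags, lifting) case_prod_unfold mem_Collect_eq)
    then show ?thesis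
      using schwartz_affine_tendsto[OF assms(2) lim(1) \<open>s \<noteq> 0\<close> lim(2)]
      by (intro *[rule_format]) (auto intro!: schwartz_affine assms \<open>s \<noteq> 0\<close>)
  qed
  then show "((\<lambda>(s, b). f (\<lambda>y. \<psi> (s *\<^sub>R y + b))) \<circ> u) \<longlonglongrightarrow> f (\<lambda>y. \<psi> (s *\<^sub>R y + b))"
    by (simp add: o_def case_prod_unfold)
qed

section \<open>The Gaussian is a Schwartz function\<close>

lemma real_polynomial_partial:
  fixes p :: "real^'n::finite \<Rightarrow> real"
  assumes "real_polynomial_function p"
  shows "\<exists>p'. real_polynomial_function p' \<and> (\<forall>x. \<exists>D. (p has_derivative D) (at x) \<and> D (axis i 1) = p' x)"
  using assms
proof (induction rule: real_polynomial_function.induct)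
  case (linear f)
  then show ?case
    by (intro exI[of _ "\<lambda>_. f (axis i 1)"] conjI real_polynomial_function.intros(2))
      (auto intro!: exI[of _ f] bounded_linear_imp_has_derivative)
next
  case (const c)
  show ?case
    by (intro exI[of _ "\<lambda>_. 0"] conjI real_polynomial_function.intros(2))
      (auto intro!: exI[of _ "\<lambda>_. 0"])
next
  case (add f g)
  then obtain f' g' where *: "real_polynomial_function f'" "real_polynomial_function g'"
    "\<And>x. \<exists>D. (f has_derivative D) (at x) \<and> D (axis i 1) = f' x"
    "\<And>x. \<exists>D. (g has_derivative D) (at x) \<and> D (axis i 1) = g' x" by blast
  show ?case
  proof (rule exI[of _ "\<lambda>x. f' x + g' x"], rule conjI, rule real_polynomial_function.intros(3)[OF *(1,2)], rule allI)
    fix x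
    obtain D1 D2 where "(f has_derivative D1) (at x)" "D1 (axis i 1) = f' x"
      "(g has_derivative D2) (at x)" "D2 (axis i 1) = g' x" using *(3,4) by metis
    then show "\<exists>D. ((\<lambda>x. f x + g x) has_derivative D) (at x) \<and> D (axis i 1) = f' x + g' x"
      by (intro exI[of _ "\<lambda>h. D1 h + D2 h"]) (auto intro: has_derivative_add)
  qed
next
  case (mult f g)
  then obtain f' g' where *: "real_polynomial_function f'" "real_polynomial_function g'"
    "\<And>x. \<exists>D. (f has_derivative D) (at x) \<and> D (axis i 1) = f' x"
    "\<And>x. \<exists>D. (g has_derivative D) (at x) \<and> D (axis i 1) = g' x" by blast
  show ?case
  proof (rule exI[of _ "\<lambda>x. f x * g' x + f' x * g x"], rule conjI)
    show "real_polynomial_function (\<lambda>x. f x * g' x + f' x * g x)"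
      by (intro real_polynomial_function.intros(3,4) *(1,2) mult)
    show "\<forall>x. \<exists>D. ((\<lambda>x. f x * g x) has_derivative D) (at x) \<and> D (axis i 1) = f x * g' x + f' x * g x"
    proof
    fix x
    obtain D1 D2 where "(f has_derivative D1) (at x)" "D1 (axis i 1) = f' x"
      "(g has_derivative D2) (at x)" "D2 (axis i 1) = g' x" using *(3,4) by metis
    then show "\<exists>D. ((\<lambda>x. f x * g x) has_derivative D) (at x) \<and> D (axis i 1) = f x * g' x + f' x * g x"
      by (intro exI[of _ "\<lambda>h. f x * D2 h + D1 h * g x"]) (auto intro: has_derivative_mult)
    qed
  qed
qed

lemma real_polynomial_growth:
  fixes p :: "'a::real_normed_vector \<Rightarrow> real"
  assumes "real_polynomial_function p"
  shows "\<exists>C k. C \<ge> 0 \<and> (\<forall>x. \<bar>p x\<bar> \<le> C * (1 + norm x) ^ k)"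
  using assms
proof (induction rule: real_polynomial_function.induct)
  case (linear f)
  then obtain K where K: "\<And>x. norm (f x) \<le> norm x * K" "K \<ge> 0" using bounded_linear.nonneg_bounded by blast
  show ?case
  proof (intro exI[of _ K] exI[of _ 1] conjI allI)
    fix x show "\<bar>f x\<bar> \<le> K * (1 + norm x) ^ 1" using K(1)[of x] K(2) by (simp add: algebra_simps)
  qed fact
next
  case (const c)
  show ?case by (intro exI[of _ "\<bar>c\<bar>"] exI[of _ 0]) auto
next
  case (add f g)
  then obtain C k D l where *: "C \<ge> 0" "D \<ge> 0" "\<And>x. \<bar>f x\<bar> \<le> C * (1 + norm x) ^ k" "\<And>x. \<bar>g x\<bar> \<le> D * (1 + norm x) ^ l"
    by metis
  show ?case
  proof (intro exI[of _ "C + D"] exI[of _ "k + l"] conjI allI)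
    fix x
    have "\<bar>f x + g x\<bar> \<le> C * (1 + norm x) ^ k + D * (1 + norm x) ^ l" using *(3,4)[of x] by linarith
    also have "\<dots> \<le> C * (1 + norm x) ^ (k + l) + D * (1 + norm x) ^ (k + l)"
      using * by (intro add_mono mult_left_mono power_increasing) auto
    finally show "\<bar>f x + g x\<bar> \<le> (C + D) * (1 + norm x) ^ (k + l)" by (simp add: algebra_simps)
  qed (use * in auto)
next
  case (mult f g)
  then obtain C k D l where *: "C \<ge> 0" "D \<ge> 0" "\<And>x. \<bar>f x\<bar> \<le> C * (1 + norm x) ^ k" "\<And>x. \<bar>g x\<bar> \<le> D * (1 + norm x) ^ l"
    by metis
  show ?case
  proof (intro exI[of _ "C * D"] exI[of _ "k + l"] conjI allI)
    fix x
    have "\<bar>f x * g x\<bar> \<le> (C * (1 + norm x) ^ k) * (D * (1 + norm x) ^ l)"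
      unfolding abs_mult using * by (intro mult_mono) auto
    then show "\<bar>f x * g x\<bar> \<le> (C * D) * (1 + norm x) ^ (k + l)" by (simp add: power_add mult_ac)
  qed (use * in auto)
qed

definition gauss :: "real^'n::finite \<Rightarrow> complex" where
  "gauss x = complex_of_real (exp (- (norm x)\<^sup>2))"

text \<open>Each differentiation replaces the polynomial p by its i-th partial derivative minus 2
  x_i p. Both claims rest on the same derivative formula, hence the joint proof.\<close>

lemma pderivs_gauss:
  "\<exists>p. real_polynomial_function p \<and>
    pderivs is (gauss :: real^'n::finite \<Rightarrow> complex) = (\<lambda>x. complex_of_real (p x * exp (- (norm x)\<^sup>2)))"
  (is "\<exists>p. ?P is p")
  and poly_gauss_differentiable:
  "real_polynomial_function p \<Longrightarrow> (\<lambda>x :: real^'n. complex_of_real (p x * exp (- (norm x)\<^sup>2))) differentiable (at x)"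
proof -
  have D: "((\<lambda>x. complex_of_real (p x * exp (- (norm x)\<^sup>2))) has_derivative
      (\<lambda>h. complex_of_real (D h * exp (- (norm x)\<^sup>2) + p x * (exp (- (norm x)\<^sup>2) * - (x \<bullet> h + h \<bullet> x))))) (at x)"
    if "(p has_derivative D) (at x)" for p D and x :: "real^'n"
    unfolding power2_norm_eq_inner using that
    by (intro derivative_eq_intros bounded_linear.has_derivative[OF bounded_linear_of_real] refl | assumption)+ 
       (auto simp: algebra_simps fun_eq_iff)
  show "real_polynomial_function p \<Longrightarrow> (\<lambda>x :: real^'n. complex_of_real (p x * exp (- (norm x)\<^sup>2))) differentiable (at x)"
    for p x using D real_polynomial_partial[of p] unfolding differentiable_def by meson
  show "\<exists>p. ?P is p"
  proof (induction "is")
    case Nil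
    show ?case by (intro exI[of _ "\<lambda>_. 1"]) (auto simp: gauss_def fun_eq_iff intro: real_polynomial_function.intros(2))
  next
    case (Cons i "is")
    then obtain p where p: "real_polynomial_function p"
      "pderivs is gauss = (\<lambda>x :: real^'n. complex_of_real (p x * exp (- (norm x)\<^sup>2)))" by blast
    obtain p' where p': "real_polynomial_function p'" "\<And>x. \<exists>D. (p has_derivative D) (at x) \<and> D (axis i 1) = p' x"
      using real_polynomial_partial[OF p(1)] by blast
    define r where "r x = p' x + (- 2) * (p x * (x $ i))" for x
    have "real_polynomial_function r"
      unfolding r_def
      by (intro real_polynomial_function.intros(2-4) real_polynomial_function.intros(1)[OF bounded_linear_vec_nth] p(1) p'(1))
    moreover have "pderivs (i # is) gauss x = complex_of_real (r x * exp (- (norm x)\<^sup>2))" for x :: "real^'n"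
    proof -
      obtain D' where D': "(p has_derivative D') (at x)" "D' (axis i 1) = p' x" using p'(2) by blast
      show ?thesis unfolding foldr.simps o_def p(2) partial_derivI[OF D[OF D'(1)]]
        by (simp add: D'(2) r_def inner_axis inner_axis' algebra_simps)
    qed
    ultimately show ?case by blast
  qed
qed

lemma gauss_schwartz: "(gauss :: real^'n::finite \<Rightarrow> complex) \<in> schwartz"
proof (rule schwartzI)
  show "smooth_fun (gauss :: real^'n \<Rightarrow> complex)"
    unfolding smooth_fun_def
  proof (intro allI)
    fix "is" and x :: "real^'n"
    obtain p where p: "real_polynomial_function p"
      "pderivs is gauss = (\<lambda>x :: real^'n. complex_of_real (p x * exp (- (norm x)\<^sup>2)))" using pderivs_gauss by blast
    show "pderivs is gauss differentiable (at x)" unfolding p(2) by (rule poly_gauss_differentiable[OF p(1)])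
  qed
  fix N and "is" :: "'n list"
  obtain p where p: "real_polynomial_function p"
      "pderivs is gauss = (\<lambda>x :: real^'n. complex_of_real (p x * exp (- (norm x)\<^sup>2)))" using pderivs_gauss by blast
  obtain C k where C: "C \<ge> 0" "\<And>x. \<bar>p x\<bar> \<le> C * (1 + norm x) ^ k" using real_polynomial_growth[OF p(1)] by blast
  define M where "M = real (N + k)"
  show "\<exists>B. \<forall>x. (1 + norm x) ^ N * norm (pderivs is gauss x) \<le> B"
  proof (intro exI allI)
    fix x :: "real^'n"
    have "(1 + norm x) ^ N * norm (pderivs is gauss x) = (1 + norm x) ^ N * (\<bar>p x\<bar> * exp (- (norm x)\<^sup>2))"
      unfolding p(2) by (simp only: norm_of_real abs_mult abs_exp_cancel)
    also have "\<dots> \<le> (1 + norm x) ^ N * ((C * (1 + norm x) ^ k) * exp (- (norm x)\<^sup>2))"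
      using C by (intro mult_left_mono mult_right_mono) auto
    also have "\<dots> = C * ((1 + norm x) ^ (N + k) * exp (- (norm x)\<^sup>2))" by (simp add: power_add)
    \<comment> \<open>With r = |x|: (1 + r)^M is at most exp(M r), and completing the square gives M
      r - r^2 \<le> M^2/4.\<close>
    also have "(1 + norm x) ^ (N + k) \<le> exp (norm x) ^ (N + k)"
      by (intro power_mono) (auto simp: exp_ge_add_one_self)
    also have "exp (norm x) ^ (N + k) = exp (M * norm x)" by (simp only: M_def exp_of_nat_mult)
    also have "exp (M * norm x) * exp (- (norm x)\<^sup>2) = exp (M * norm x - (norm x)\<^sup>2)" by (simp add: exp_diff exp_minus field_simps)
    also have "\<dots> \<le> exp (M\<^sup>2 / 4)"
      using zero_le_power2[of "norm x - M / 2"] by (simp add: power2_diff power_divide mult.commute)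
    finally show "(1 + norm x) ^ N * norm (pderivs is gauss x) \<le> C * exp (M\<^sup>2 / 4)"
      using C(1) by (simp add: mult_left_mono)
  qed
qed

section \<open>Convolution of tempered distributions with dilated test functions\<close>

lemma tempered_linear:
  "f \<in> tempered \<Longrightarrow> \<phi> \<in> schwartz \<Longrightarrow> \<psi> \<in> schwartz \<Longrightarrow>
    f (\<lambda>x. a * \<phi> x + b * \<psi> x) = a * f \<phi> + b * f \<psi>"
  unfolding tempered_def by blast

lemma tempered_cmult: "f \<in> tempered \<Longrightarrow> \<phi> \<in> schwartz \<Longrightarrow> f (\<lambda>x. a * \<phi> x) = a * f \<phi>"
  using tempered_linear[of f \<phi> \<phi> a 0] by simp

text \<open>As a function of y the test function is an affine substitution with slope -1/t, which
  makes \<open>tempered_continuous_affine\<close> applicable.\<close>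

lemma conv_dist_dilate:
  fixes f :: "'n::finite dist"
  assumes "f \<in> tempered" "\<psi> \<in> schwartz" "t > 0"
  shows "conv_dist (dilate t \<psi>) f x =
    complex_of_real (1 / t ^ CARD('n)) * f (\<lambda>y. \<psi> ((- 1 / t) *\<^sub>R y + x /\<^sub>R t))"
proof -
  have "(\<lambda>y. dilate t \<psi> (x - y)) = (\<lambda>y. complex_of_real (1 / t ^ CARD('n)) * \<psi> ((- 1 / t) *\<^sub>R y + x /\<^sub>R t))"
    by (simp add: dilate_def scaleR_diff_right divide_inverse)
  then show ?thesis
    unfolding conv_dist_def using assms by (simp only:) (intro tempered_cmult schwartz_affine; simp)
qed

lemma conv_dist_continuous:
  fixes f :: "'n::finite dist"
  assumes "f \<in> tempered" "\<psi> \<in> schwartz"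
  shows "continuous_on ({0<..} \<times> UNIV) (\<lambda>(t, x). conv_dist (dilate t \<psi>) f x)"
proof -
  have "continuous_on ({0<..} \<times> UNIV) (\<lambda>p. complex_of_real (1 / fst p ^ CARD('n)) *
      (\<lambda>(s, b). f (\<lambda>y. \<psi> (s *\<^sub>R y + b))) (- 1 / fst p, snd p /\<^sub>R fst p))"
    by (intro continuous_intros continuous_on_compose2[OF tempered_continuous_affine[OF assms]]) auto
  then show ?thesis
    by (rule continuous_on_eq) (auto simp: conv_dist_dilate assms)
qed

lemma conv_dist_continuous_space:
  fixes f :: "'n::finite dist"
  assumes "f \<in> tempered" "\<psi> \<in> schwartz" "t > 0"
  shows "continuous_on UNIV (\<lambda>x. conv_dist (dilate t \<psi>) f x)"
proof -
  have "continuous_on UNIV (\<lambda>x. (t, x))" "range (\<lambda>x. (t, x)) \<subseteq> {0<..} \<times> UNIV"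
    using assms(3) by (auto intro!: continuous_intros)
  from continuous_on_compose2[OF conv_dist_continuous[OF assms(1,2)] this] show ?thesis by simp
qed

text \<open>A supremum of continuous functions is lower semicontinuous, whatever the size of the
  family. This covers the uncountably many test functions and scales in
  \<open>grand_max\<close>.\<close>

lemma lsc_SUP_measurable:
  fixes g :: "'i \<Rightarrow> 'a::topological_space \<Rightarrow> ennreal"
  assumes "\<And>i. i \<in> I \<Longrightarrow> continuous_on UNIV (g i)"
  shows "(\<lambda>x. SUP i\<in>I. g i x) \<in> borel_measurable borel"
proof (rule borel_measurableI_greater)
  fix a
  have "{x \<in> space borel. a < (SUP i\<in>I. g i x)} = (\<Union>i\<in>I. {x. a < g i x})"
    by (auto simp: less_SUP_iff)
  moreover have "open {x. a < g i x}" if "i \<in> I" for i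
    using open_Collect_less[OF continuous_on_const assms[OF that]] .
  ultimately show "{x \<in> space borel. a < (SUP i\<in>I. g i x)} \<in> sets borel"
    by (simp only:) (intro borel_open open_UN ballI)
qed

lemma schwartz_ball_schwartz: "\<psi> \<in> schwartz_ball N \<Longrightarrow> \<psi> \<in> schwartz"
  by (simp add: schwartz_ball_def)

lemma grand_max_measurable:
  assumes "f \<in> tempered"
  shows "grand_max N f \<in> borel_measurable borel"
  unfolding grand_max_def[abs_def] case_prod_unfold
  by (intro lsc_SUP_measurable continuous_on_ennreal continuous_on_norm conv_dist_continuous_space assms)
    (auto simp: schwartz_ball_schwartz)

text \<open>A shift of length at most t is absorbed by the test function: (x - y)/t = (z - y)/t + h
  with |h| \<le> 1, and translating \<phi> by such an h increases the seminorm by a bounded factor.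
  A fixed multiple of the translate thus lies in \<open>schwartz_ball N\<close>. Since z is free, an
  infimum over a whole cell can be taken later.\<close>

lemma grand_max_translate_bound:
  fixes \<phi> :: "real^'n::finite \<Rightarrow> complex"
  assumes \<phi>: "\<phi> \<in> schwartz"
  obtains C where "C > 0" "\<And>f t x z. f \<in> tempered \<Longrightarrow> t > 0 \<Longrightarrow> norm (z - x) \<le> t \<Longrightarrow>
    ennreal (norm (conv_dist (dilate t \<phi>) f x)) \<le> ennreal C * grand_max N f z"
proof
  define C where "C = real (mi_card TYPE('n) N) * (2 ^ N * enn2real (schwartz_norm N \<phi>)) + 1"
  show C: "C > 0" by (simp add: C_def add_nonneg_pos)
  fix f :: "'n dist" and t and x z :: "real^'n"
  assume f: "f \<in> tempered" and t: "t > 0" and zx: "norm (z - x) \<le> t"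
  define h where "h = (x - z) /\<^sub>R t"
  have h: "norm h \<le> 1" using zx t unfolding h_def norm_scaleR by (simp add: norm_minus_commute divide_simps)
  define \<eta> where "\<eta> u = \<phi> (1 *\<^sub>R u + h)" for u
  have \<eta>: "\<eta> \<in> schwartz" unfolding \<eta>_def using schwartz_affine[OF \<phi>, of 1 h] by simp
  have "schwartz_norm N \<eta> \<le> ennreal (real (mi_card TYPE('n) N) * (2 ^ N * enn2real (schwartz_norm N \<phi>)))"
  proof (rule schwartz_norm_le)
    fix "is" :: "'n list" and u :: "real^'n" assume len: "length is \<le> N"
    have "norm u \<le> norm (u + h) + norm h" by (metis add_diff_cancel_right' norm_triangle_ineq4)
    have u: "1 + norm u \<le> 2 * (1 + norm (u + h))"
    proof -
      have "1 + a \<le> 2 * (1 + b)" if "a \<le> b + c" "c \<le> 1" "0 \<le> b" for a b c :: real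
        using that by (simp add: algebra_simps)
      from this[OF _ h norm_ge_zero] \<open>norm u \<le> norm (u + h) + norm h\<close> show ?thesis by blast
    qed
    have "(1 + norm u) ^ N * norm (pderivs is \<eta> u) = (1 + norm u) ^ N * norm (pderivs is \<phi> (u + h))"
      unfolding \<eta>_def pderivs_affine[OF schwartz_smooth[OF \<phi>]] by simp
    also have "\<dots> \<le> (2 * (1 + norm (u + h))) ^ N * norm (pderivs is \<phi> (u + h))"
      using u by (intro mult_right_mono power_mono) auto
    also have "\<dots> = 2 ^ N * ((1 + norm (u + h)) ^ N * norm (pderivs is \<phi> (u + h)))"
      by (simp only: power_mult_distrib mult.assoc)
    also have "\<dots> \<le> 2 ^ N * enn2real (schwartz_norm N \<phi>)"
      by (intro mult_left_mono schwartz_bound \<phi> len) auto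
    finally show "(1 + norm u) ^ N * norm (pderivs is \<eta> u) \<le> 2 ^ N * enn2real (schwartz_norm N \<phi>)" .
  qed
  also have "\<dots> \<le> ennreal C" by (intro ennreal_leI) (simp add: C_def)
  finally have nC: "schwartz_norm N \<eta> \<le> ennreal C" .
  define \<zeta> where "\<zeta> = (\<lambda>u. complex_of_real (1 / C) * \<eta> u)"
  have \<zeta>: "\<zeta> \<in> schwartz_ball N"
    unfolding schwartz_ball_def
  proof (intro CollectI conjI)
    show "\<zeta> \<in> schwartz" unfolding \<zeta>_def by (rule schwartz_cmult[OF \<eta>])
    have "schwartz_norm N \<zeta> = ennreal (1 / C) * schwartz_norm N \<eta>"
    proof -
      have "norm (complex_of_real (1 / C)) = 1 / C" using C unfolding norm_of_real by simp
      then show ?thesis unfolding \<zeta>_def by (simp only: schwartz_norm_cmult[OF schwartz_smooth[OF \<eta>]])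
    qed
    also have "\<dots> \<le> ennreal (1 / C) * ennreal C" by (intro mult_left_mono nC) auto
    also have "\<dots> = 1" using C by (simp add: ennreal_mult[symmetric])
    finally show "schwartz_norm N \<zeta> \<le> 1" .
  qed
  have eq: "\<phi> (x /\<^sub>R t - y /\<^sub>R t) = \<eta> (z /\<^sub>R t - y /\<^sub>R t)" for y
    by (simp add: \<eta>_def h_def algebra_simps)
  have "conv_dist (dilate t \<phi>) f x = conv_dist (dilate t \<eta>) f z"
    unfolding conv_dist_def dilate_def scaleR_diff_right eq ..
  also have "dilate t \<eta> = (\<lambda>u. complex_of_real C * dilate t \<zeta> u)"
    using C by (auto simp: dilate_def \<zeta>_def fun_eq_iff)
  also have "conv_dist (\<lambda>u. complex_of_real C * dilate t \<zeta> u) f z = complex_of_real C * conv_dist (dilate t \<zeta>) f z"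
  proof -
    have "(\<lambda>y. \<zeta> ((- 1 / t) *\<^sub>R y + z /\<^sub>R t)) \<in> schwartz"
      using t by (intro schwartz_affine schwartz_ball_schwartz[OF \<zeta>]) auto
    from schwartz_cmult[OF this, of "complex_of_real (1 / t ^ CARD('n))"]
    have "(\<lambda>y. dilate t \<zeta> (z - y)) \<in> schwartz"
      by (simp add: dilate_def scaleR_diff_right divide_inverse)
    then show ?thesis unfolding conv_dist_def by (rule tempered_cmult[OF f])
  qed
  finally have "ennreal (norm (conv_dist (dilate t \<phi>) f x)) = ennreal C * ennreal (norm (conv_dist (dilate t \<zeta>) f z))"
    using C by (simp add: norm_mult ennreal_mult)
  also have "ennreal (norm (conv_dist (dilate t \<zeta>) f z)) \<le> grand_max N f z"
    unfolding grand_max_def using t \<zeta> by (intro SUP_upper2[of "(t, \<zeta>)"]) auto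
  finally show "ennreal (norm (conv_dist (dilate t \<phi>) f x)) \<le> ennreal C * grand_max N f z"
    by (simp add: mult_left_mono)
qed

section \<open>Taylor expansion and decay of grand maximal functions\<close>

lemma pderivs_norm_le_one:
  assumes "\<psi> \<in> schwartz_ball N" "length is \<le> N"
  shows "(1 + norm x) ^ N * norm (pderivs is \<psi> x) \<le> 1"
proof -
  have "\<psi> \<in> schwartz" "schwartz_norm N \<psi> \<le> 1" using assms by (auto simp: schwartz_ball_def)
  then have "ennreal ((1 + norm x) ^ N * norm (pderivs is \<psi> x)) \<le> 1"
    using pderivs_le_schwartz_norm[OF schwartz_smooth[OF \<open>\<psi> \<in> schwartz\<close>] assms(2), of x] order_trans by blast
  then show ?thesis by (simp only: ennreal_le_1)
qed

text \<open>Translates the monomials of the Taylor formula, written along index lists, into the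
  multi-index monomials of the moment conditions.\<close>

lemma prod_list_count_UNIV:
  fixes f :: "'n::finite \<Rightarrow> 'a::comm_monoid_mult"
  shows "prod_list (map f is) = (\<Prod>i\<in>UNIV. f i ^ count_list is i)"
proof (induction "is")
  case (Cons j "is")
  have "(\<Prod>i\<in>UNIV. f i ^ count_list (j # is) i) = (\<Prod>i\<in>UNIV. (if i = j then f i else 1) * f i ^ count_list is i)"
    by (intro prod.cong refl) auto
  also have "\<dots> = f j * (\<Prod>i\<in>UNIV. f i ^ count_list is i)" by (simp add: prod.distrib)
  finally show ?case using Cons by simp
qed simp

text \<open>The head of a list is the outermost derivative, so differentiating a sum over lists of
  length k yields the right-hand side.\<close>

lemma sum_lists_length_Suc:
  fixes F :: "'n::finite list \<Rightarrow> 'a::comm_monoid_add"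
  shows "(\<Sum>is | length is = Suc k. F is) = (\<Sum>is | length is = k. \<Sum>i\<in>UNIV. F (i # is))"
proof -
  have fin: "finite {is :: 'n list. length is = k}" for k
    using finite_lists_length_eq[of "UNIV :: 'n set" k] by simp
  have "(\<Sum>is | length is = k. \<Sum>i\<in>UNIV. F (i # is)) = (\<Sum>(is, i)\<in>{is. length is = k} \<times> UNIV. F (i # is))"
    by (rule sum.cartesian_product)
  also have "\<dots> = (\<Sum>is | length is = Suc k. F is)"
    by (rule sum.reindex_bij_witness[of _ "\<lambda>is. (tl is, hd is)" "\<lambda>(is, i). i # is"])
      (auto simp: length_Suc_conv)
  finally show ?thesis ..
qed

lemma card_lists_length_eq_UNIV: "card {is :: 'n::finite list. length is = k} = CARD('n) ^ k"
  using card_lists_length_eq[of "UNIV :: 'n set" k] by simp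

text \<open>Taylor's formula along the segment from \<open>0\<close> to \<open>y\<close>; the derivative of order \<open>k\<close> in the direction \<open>y\<close>
  is expanded as a sum over index lists of length \<open>k\<close>.\<close>

lemma taylor_remainder_bound:
  fixes f :: "real^'n::finite \<Rightarrow> complex"
  assumes sm: "smooth_fun f"
    and B: "\<And>is \<tau>. length is = Suc d \<Longrightarrow> 0 \<le> \<tau> \<Longrightarrow> \<tau> \<le> 1 \<Longrightarrow> norm (pderivs is f (\<tau> *\<^sub>R y)) \<le> B"
    and R: "norm y \<le> R"
  shows "norm (f y - (\<Sum>k\<le>d. (1 / fact k) *\<^sub>R (\<Sum>is | length is = k. prod_list (map (($) y) is) *\<^sub>R pderivs is f 0)))
    \<le> real (CARD('n) ^ Suc d) * (R ^ Suc d * B)"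
proof -
  define D where "D k \<tau> = (\<Sum>is | length is = k. prod_list (map (($) y) is) *\<^sub>R pderivs is f (\<tau> *\<^sub>R y))" for k \<tau>
  have R0: "R \<ge> 0" using R norm_ge_zero order_trans by blast
  have prodR: "\<bar>prod_list (map (($) y) is)\<bar> \<le> R ^ length is" for "is" :: "'n list"
  proof (induction "is")
    case (Cons i "is")
    have "\<bar>y $ i\<bar> \<le> R" using component_le_norm_cart[of y i] R by linarith
    then show ?case using Cons R0 by (auto simp: abs_mult intro!: mult_mono)
  qed simp
  have der: "(D k has_vector_derivative D (Suc k) \<tau>) (at \<tau> within {0..1})" for k \<tau>
  proof -
    have "((\<lambda>\<tau>. prod_list (map (($) y) is) *\<^sub>R pderivs is f (\<tau> *\<^sub>R y)) has_vector_derivative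
       (\<Sum>i\<in>UNIV. prod_list (map (($) y) (i # is)) *\<^sub>R pderivs (i # is) f (\<tau> *\<^sub>R y))) (at \<tau>)" for "is"
    proof -
      have "((\<lambda>\<tau>. pderivs is f (0 + \<tau> *\<^sub>R y)) has_vector_derivative
         (\<Sum>i\<in>UNIV. (y $ i) *\<^sub>R partial_deriv i (pderivs is f) (0 + \<tau> *\<^sub>R y))) (at \<tau>)"
        by (rule has_vector_derivative_line[OF smooth_pderivs_differentiable[OF sm]])
      from bounded_linear.has_vector_derivative[OF bounded_linear_scaleR_right this, of "prod_list (map (($) y) is)"]
      show ?thesis by (simp add: scaleR_sum_right mult_ac)
    qed
    then have "(D k has_vector_derivative
       (\<Sum>is | length is = k. \<Sum>i\<in>UNIV. prod_list (map (($) y) (i # is)) *\<^sub>R pderivs (i # is) f (\<tau> *\<^sub>R y))) (at \<tau>)"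
      unfolding D_def by (intro has_vector_derivative_sum)
    then show ?thesis
      unfolding D_def sum_lists_length_Suc by (rule has_vector_derivative_at_within)
  qed
  have f1: "f y = D 0 1" by (simp add: D_def)
  have "((\<lambda>\<tau>. ((1 - \<tau>) ^ (Suc d - 1) / fact (Suc d - 1)) *\<^sub>R D (Suc d) \<tau>) has_integral
      D 0 1 - (\<Sum>i<Suc d. ((1 - 0) ^ i / fact i) *\<^sub>R D i 0)) {0..1}"
    by (rule Taylor_has_integral[where Df = D and p = "Suc d"]) (use der in auto)
  note int = this[folded cbox_interval]
  have "0 \<le> B" using B[of "replicate (Suc d) undefined" 0] by (auto intro: order_trans[OF norm_ge_zero])
  then have nn: "0 \<le> real (CARD('n) ^ Suc d) * (R ^ Suc d * B)" using R0 by simp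
  have bd: "norm (((1 - \<tau>) ^ (Suc d - 1) / fact (Suc d - 1)) *\<^sub>R D (Suc d) \<tau>) \<le> real (CARD('n) ^ Suc d) * (R ^ Suc d * B)"
    if "\<tau> \<in> cbox 0 1" for \<tau>
  proof -
    from that have \<tau>: "0 \<le> \<tau>" "\<tau> \<le> 1" by auto
    have "norm (D (Suc d) \<tau>) \<le> (\<Sum>is | length (is :: 'n list) = Suc d. R ^ Suc d * B)"
      unfolding D_def
    proof (rule sum_norm_le)
      fix "is" :: "'n list" assume "is \<in> {is. length is = Suc d}"
      then have l: "length is = Suc d" by simp
      show "norm (prod_list (map (($) y) is) *\<^sub>R pderivs is f (\<tau> *\<^sub>R y)) \<le> R ^ Suc d * B"
        unfolding norm_scaleR using prodR[of "is"] B[OF l \<tau>] R0 unfolding l by (intro mult_mono) auto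
    qed
    also have "\<dots> = real (CARD('n) ^ Suc d) * (R ^ Suc d * B)"
      unfolding sum_constant card_lists_length_eq_UNIV ..
    finally have Db: "norm (D (Suc d) \<tau>) \<le> real (CARD('n) ^ Suc d) * (R ^ Suc d * B)" .
    have "(1 - \<tau>) ^ d \<le> 1" using \<tau> by (intro power_le_one) auto
    then have "(1 - \<tau>) ^ d / fact d \<le> 1" using fact_ge_1[of d] by (simp add: field_simps order_trans)
    moreover have "0 \<le> (1 - \<tau>) ^ d / fact d" using \<tau> by simp
    ultimately have "norm (((1 - \<tau>) ^ d / fact d) *\<^sub>R D (Suc d) \<tau>) \<le> 1 * norm (D (Suc d) \<tau>)"
      unfolding norm_scaleR real_norm_def by (intro mult_right_mono) (simp_all only: abs_of_nonneg norm_ge_zero)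
    then show "norm (((1 - \<tau>) ^ (Suc d - 1) / fact (Suc d - 1)) *\<^sub>R D (Suc d) \<tau>) \<le> real (CARD('n) ^ Suc d) * (R ^ Suc d * B)"
      using Db by simp
  qed
  have "norm (D 0 1 - (\<Sum>i<Suc d. ((1 - 0) ^ i / fact i) *\<^sub>R D i 0)) \<le> real (CARD('n) ^ Suc d) * (R ^ Suc d * B)"
    using has_integral_bound[OF nn int bd] by simp
  then show ?thesis
    unfolding f1 by (simp add: D_def lessThan_Suc_atMost)
qed

section \<open>Integrability of polynomial decay and the scaling of dilations\<close>

lemma ennreal_le_suminf: "f j \<le> (\<Sum>j. f j)" for f :: "nat \<Rightarrow> ennreal"
  using sum_le_suminf[of f "{j}"] by auto

text \<open>The shell 2^j \<le> 1 + |u| < 2^(j+1) lies in a cube of side 4 * 2^j, and the integrand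
  there is at most 2^(-jN). With N \<ge> n + 1 it contributes at most a constant times
  2^(-j).\<close>

lemma nn_integral_decay_finite:
  assumes "N \<ge> CARD('n) + 1"
  shows "(\<integral>\<^sup>+u. ennreal (1 / (1 + norm (u :: real^'n::finite)) ^ N) \<partial>lborel) < \<infinity>"
proof -
  have pw: "ennreal (1 / (1 + norm u) ^ N) \<le> (\<Sum>j. ennreal ((1/2) ^ (j * N)) * indicator (cbox (- (\<chi> i. 2 ^ Suc j)) (\<chi> i. 2 ^ Suc j)) u)" for u :: "real^'n"
  proof -
    define j where "j = nat \<lfloor>log 2 (1 + norm u)\<rfloor>"
    have p: "1 + norm u > 0" by (simp add: add_pos_nonneg)
    then have l0: "0 \<le> log 2 (1 + norm u)" by (subst zero_le_log_cancel_iff) auto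
    have "2 powr real j \<le> 2 powr (log 2 (1 + norm u))"
      by (intro powr_mono) (use l0 in \<open>auto simp: j_def\<close>)
    then have j1: "2 ^ j \<le> 1 + norm u" using p by (simp add: powr_realpow)
    have "2 powr (log 2 (1 + norm u)) < 2 powr real (Suc j)"
    proof (rule powr_less_mono)
      show "log 2 (1 + norm u) < real (Suc j)" using l0 unfolding j_def by linarith
    qed simp
    then have j2: "1 + norm u < 2 ^ Suc j" using p by (simp add: powr_realpow powr_add)
    have "u \<in> cbox (- (\<chi> i. 2 ^ Suc j)) (\<chi> i. 2 ^ Suc j)"
    proof -
      have "\<bar>u $ i\<bar> \<le> 2 ^ Suc j" for i using component_le_norm_cart[of u i] j2 by linarith
      then show ?thesis by (auto simp: mem_box_cart abs_le_iff minus_le_iff)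
    qed
    moreover have "1 / (1 + norm u) ^ N \<le> (1/2) ^ (j * N)"
    proof -
      have "(2 ^ j) ^ N \<le> (1 + norm u) ^ N" using j1 by (intro power_mono) auto
      then have "1 / (1 + norm u) ^ N \<le> 1 / (2 ^ j) ^ N" by (intro divide_left_mono) (auto simp: p)
      then show ?thesis by (simp add: power_mult power_one_over)
    qed
    ultimately have "ennreal (1 / (1 + norm u) ^ N) \<le> ennreal ((1/2) ^ (j * N)) * indicator (cbox (- (\<chi> i. 2 ^ Suc j)) (\<chi> i. 2 ^ Suc j)) u"
      by (auto intro: ennreal_leI)
    also have "\<dots> \<le> (\<Sum>j. ennreal ((1/2) ^ (j * N)) * indicator (cbox (- (\<chi> i. 2 ^ Suc j)) (\<chi> i. 2 ^ Suc j)) u)"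
      by (rule ennreal_le_suminf)
    finally show ?thesis .
  qed
  have vol: "emeasure lborel (cbox (- (\<chi> i. 2 ^ Suc j)) (\<chi> i. 2 ^ Suc j) :: (real^'n) set) = ennreal ((4 * 2 ^ j) ^ CARD('n))" for j
  proof -
    have "emeasure lborel (cbox (- (\<chi> i. 2 ^ Suc j)) (\<chi> i. 2 ^ Suc j) :: (real^'n) set) =
      ennreal (\<Prod>b\<in>(Basis :: (real^'n) set). ((\<chi> i. 2 ^ Suc j) - (- (\<chi> i. 2 ^ Suc j))) \<bullet> b)"
      by (rule emeasure_lborel_cbox) (auto simp: Basis_vec_def inner_axis)
    also have "(\<Prod>b\<in>(Basis :: (real^'n) set). ((\<chi> i. 2 ^ Suc j) - (- (\<chi> i. 2 ^ Suc j))) \<bullet> b) = (\<Prod>b\<in>(Basis :: (real^'n) set). 4 * 2 ^ j)"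
      by (intro prod.cong refl) (auto simp: Basis_vec_def inner_axis)
    finally show ?thesis by simp
  qed
  have "(\<integral>\<^sup>+u. ennreal (1 / (1 + norm (u :: real^'n)) ^ N) \<partial>lborel) \<le>
     (\<integral>\<^sup>+u. (\<Sum>j. ennreal ((1/2) ^ (j * N)) * indicator (cbox (- (\<chi> i. 2 ^ Suc j)) (\<chi> i. 2 ^ Suc j)) (u :: real^'n)) \<partial>lborel)"
    by (intro nn_integral_mono pw)
  also have "\<dots> = (\<Sum>j. \<integral>\<^sup>+u. ennreal ((1/2) ^ (j * N)) * indicator (cbox (- (\<chi> i. 2 ^ Suc j)) (\<chi> i. 2 ^ Suc j)) (u :: real^'n) \<partial>lborel)"
    by (intro nn_integral_suminf) simp
  also have "\<dots> = (\<Sum>j. ennreal ((1/2) ^ (j * N)) * ennreal ((4 * 2 ^ j) ^ CARD('n)))"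
    by (subst nn_integral_cmult_indicator, simp, simp only: vol)
  also have "\<dots> \<le> (\<Sum>j. ennreal (4 ^ CARD('n) * (1/2) ^ j))"
  proof (intro suminf_le)
    fix j
    obtain e where e: "N = CARD('n) + 1 + e" using assms le_Suc_ex by blast
    have "(1/2) ^ (j * N) * (4 * 2 ^ j) ^ CARD('n) = 4 ^ CARD('n) * (((1/2) ^ j * 2 ^ j) ^ CARD('n) * (1/2) ^ j * (1/2) ^ (j * e) :: real)"
      unfolding e by (simp only: power_add power_mult power_mult_distrib mult.assoc power_one_right distrib_left mult_1_right) (simp add: mult_ac)
    also have "\<dots> = 4 ^ CARD('n) * ((1/2) ^ j * (1/2) ^ (j * e))" by (simp add: power_mult_distrib[symmetric])
    also have "\<dots> \<le> 4 ^ CARD('n) * ((1/2) ^ j * 1)" by (intro mult_left_mono power_le_one) auto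
    finally show "ennreal ((1/2) ^ (j * N)) * ennreal ((4 * 2 ^ j) ^ CARD('n)) \<le> ennreal (4 ^ CARD('n) * (1/2) ^ j)"
      by (simp add: ennreal_mult[symmetric] del: power_mult_distrib)
  qed auto
  also have "\<dots> = ennreal (\<Sum>j. 4 ^ CARD('n) * (1/2) ^ j)"
    by (intro suminf_ennreal2 summable_mult summable_geometric) auto
  also have "\<dots> < \<infinity>" by simp
  finally show ?thesis .
qed

lemma nn_integral_dilate:
  fixes \<psi> :: "real^'n::finite \<Rightarrow> complex"
  assumes "\<psi> \<in> borel_measurable borel" "t > 0"
  shows "(\<integral>\<^sup>+y. ennreal (norm (dilate t \<psi> (x - y))) \<partial>lborel) = (\<integral>\<^sup>+u. ennreal (norm (\<psi> u)) \<partial>lborel)"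
proof -
  have dil: "(\<lambda>y. ennreal (norm (dilate t \<psi> (x - y)))) \<in> borel_measurable borel"
    unfolding dilate_def using assms(1) by measurable
  have "(\<integral>\<^sup>+y. ennreal (norm (dilate t \<psi> (x - y))) \<partial>lborel) =
     (\<integral>\<^sup>+y. ennreal (norm (dilate t \<psi> (x - y))) \<partial>(density (distr lborel borel (\<lambda>u. x + (- t) *\<^sub>R u)) (\<lambda>_. \<bar>- t\<bar> ^ DIM(real^'n))))"
    using lborel_affine[of "- t" x] assms(2) by simp
  also have "\<dots> = (\<integral>\<^sup>+u. ennreal (t ^ CARD('n)) * ennreal (norm (dilate t \<psi> (x - (x + (- t) *\<^sub>R u)))) \<partial>lborel)"
    using assms(2) dil by (subst nn_integral_density) (auto simp: nn_integral_distr)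
  also have "\<dots> = (\<integral>\<^sup>+u. ennreal (norm (\<psi> u)) \<partial>lborel)"
    using assms(2) by (intro nn_integral_cong) (simp add: dilate_def norm_mult ennreal_mult[symmetric] norm_divide norm_power)
  finally show ?thesis .
qed

text \<open>Finite combinations of atoms have these properties. As for atoms, the bound holds almost
  everywhere and the support condition everywhere. \<open>R\<close> is at least 1 so that |x| \<ge>
  2 R keeps x away from the origin.\<close>

locale bounded_cpt =
  fixes g :: "real^'n::finite \<Rightarrow> complex" and A R :: real
  assumes g_meas [measurable]: "g \<in> borel_measurable lebesgue"
    and A0: "0 \<le> A" and gA: "AE x in lebesgue. norm (g x) \<le> A"
    and R1: "1 \<le> R" and gR: "\<And>x. norm x > R \<Longrightarrow> g x = 0"
begin

definition V where "V = measure lebesgue (cball 0 R :: (real^'n) set)"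

lemma V0: "0 \<le> V" by (simp add: V_def)

lemma AE_mult_le:
  assumes "\<And>x. norm x \<le> R \<Longrightarrow> norm (h x) \<le> B"
  shows "AE x in lebesgue. norm (g x * h x) \<le> (A * B) * indicator (cball 0 R) x"
  using gA
proof eventually_elim
  fix x assume "norm (g x) \<le> A"
  then show "norm (g x * h x) \<le> (A * B) * indicator (cball 0 R) x"
    using assms[of x] gR[of x] A0 by (cases "norm x \<le> R") (auto simp: norm_mult intro!: mult_mono)
qed

lemma integrable_mult:
  assumes "h \<in> borel_measurable lebesgue" "\<And>x. norm x \<le> R \<Longrightarrow> norm (h x) \<le> B"
  shows "integrable lebesgue (\<lambda>x. g x * h x)"
proof (rule Bochner_Integration.integrable_bound)
  show "integrable lebesgue (\<lambda>x. (A * B) * indicator (cball 0 R :: (real^'n) set) x :: real)"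
    by (intro integrable_mult_right integrable_real_indicator) (simp_all add: emeasure_lborel_cball_finite[unfolded infinity_ennreal_def])
  show "(\<lambda>x. g x * h x) \<in> borel_measurable lebesgue" using assms(1) by measurable
  show "AE x in lebesgue. norm (g x * h x) \<le> norm (A * B * indicator (cball 0 R) x)"
  proof -
    have "AE x in lebesgue. norm (g x * h x) \<le> (A * B) * indicator (cball 0 R) x"
      by (rule AE_mult_le) (rule assms(2))
    then show ?thesis by eventually_elim auto
  qed
qed

lemma integral_mult_le:
  assumes "h \<in> borel_measurable lebesgue" "\<And>x. norm x \<le> R \<Longrightarrow> norm (h x) \<le> B"
  shows "norm (LINT x|lebesgue. g x * h x) \<le> A * B * V"
proof -
  have "norm (LINT x|lebesgue. g x * h x) \<le> (LINT x|lebesgue. norm (g x * h x))"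
    by (rule integral_norm_bound)
  also have "\<dots> \<le> (LINT x|lebesgue. (A * B) * indicator (cball 0 R :: (real^'n) set) x)"
  proof (rule Bochner_Integration.integral_mono_AE)
    show "integrable lebesgue (\<lambda>x. norm (g x * h x))" by (intro integrable_norm integrable_mult[OF assms])
    show "integrable lebesgue (\<lambda>x. (A * B) * indicator (cball 0 R :: (real^'n) set) x :: real)"
      by (intro integrable_mult_right integrable_real_indicator) (simp_all add: emeasure_lborel_cball_finite[unfolded infinity_ennreal_def])
    show "AE x in lebesgue. norm (g x * h x) \<le> (A * B) * indicator (cball 0 R) x"
      by (rule AE_mult_le) (rule assms(2))
  qed
  finally have "norm (LINT x|lebesgue. g x * h x) \<le> (LINT x|lebesgue. (A * B) * indicator (cball 0 R :: (real^'n) set) x)" .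
  then show ?thesis by (simp add: V_def)
qed

lemma schwartz_bdd: "\<phi> \<in> schwartz \<Longrightarrow> \<exists>B. \<forall>x. norm (\<phi> x) \<le> B"
  using schwartz_bound[of \<phi> "[]" 0] by auto

lemma schwartz_lebesgue_measurable: "\<phi> \<in> schwartz \<Longrightarrow> \<phi> \<in> borel_measurable lebesgue"
  using smooth_measurable[OF schwartz_smooth] by (intro measurable_completion) simp

lemma integrable_schwartz: "\<phi> \<in> schwartz \<Longrightarrow> integrable lebesgue (\<lambda>x. g x * \<phi> x)"
  using integrable_mult schwartz_bdd schwartz_lebesgue_measurable by metis

text \<open>The pairing of g with \<phi> is at most A V sup |\<phi>|, so the seminorm of index 0
  controls it.\<close>

lemma dist_of_tempered: "dist_of g \<in> tempered"
  unfolding tempered_def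
proof (intro CollectI conjI ballI allI impI)
  fix \<phi> :: "real^'n \<Rightarrow> complex" assume "\<phi> \<notin> schwartz" then show "dist_of g \<phi> = 0" by (simp add: dist_of_def)
next
  fix \<phi> \<psi> :: "real^'n \<Rightarrow> complex" and a b assume *: "\<phi> \<in> schwartz" "\<psi> \<in> schwartz"
  have "(LINT x|lebesgue. g x * (a * \<phi> x + b * \<psi> x)) = (LINT x|lebesgue. a * (g x * \<phi> x) + b * (g x * \<psi> x))"
    by (simp add: algebra_simps)
  also have "\<dots> = a * (LINT x|lebesgue. g x * \<phi> x) + b * (LINT x|lebesgue. g x * \<psi> x)"
    by (simp add: integrable_schwartz *)
  finally show "dist_of g (\<lambda>x. a * \<phi> x + b * \<psi> x) = a * dist_of g \<phi> + b * dist_of g \<psi>"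
    using * by (simp add: dist_of_def schwartz_linear)
next
  fix \<Phi> :: "nat \<Rightarrow> (real^'n) \<Rightarrow> complex" and \<phi> assume \<phi>: "\<phi> \<in> schwartz"
    and *: "(\<forall>j. \<Phi> j \<in> schwartz) \<and> (\<forall>N. (\<lambda>j. schwartz_norm N (\<lambda>x. \<Phi> j x - \<phi> x)) \<longlonglongrightarrow> 0)"
  define e where "e j = enn2real (schwartz_norm 0 (\<lambda>x. \<Phi> j x - \<phi> x))" for j
  have "e \<longlonglongrightarrow> 0" unfolding e_def using tendsto_enn2real[of _ 0 sequentially] * by simp
  have sd: "(\<lambda>x. \<Phi> j x - \<phi> x) \<in> schwartz" for j
    using schwartz_linear[of "\<Phi> j" \<phi> 1 "-1"] * \<phi> by simp
  have "norm (dist_of g (\<Phi> j) - dist_of g \<phi>) \<le> A * e j * V" for j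
  proof -
    have "dist_of g (\<Phi> j) - dist_of g \<phi> = (LINT x|lebesgue. g x * (\<Phi> j x - \<phi> x))"
      using * \<phi> by (simp add: dist_of_def integrable_schwartz right_diff_distrib)
    also have "norm \<dots> \<le> A * e j * V"
      using schwartz_bound[OF sd[of j], of "[]" 0]
      by (intro integral_mult_le schwartz_lebesgue_measurable sd) (simp add: e_def)
    finally show ?thesis .
  qed
  then have "(\<lambda>j. dist_of g (\<Phi> j) - dist_of g \<phi>) \<longlonglongrightarrow> 0"
    by (rule Lim_null_comparison[OF always_eventually[OF allI]])
      (use tendsto_mult_left_zero[OF tendsto_mult_right_zero[OF \<open>e \<longlonglongrightarrow> 0\<close>, of A], of V] in simp)
  then show "(\<lambda>j. dist_of g (\<Phi> j)) \<longlonglongrightarrow> dist_of g \<phi>" by (simp add: LIM_zero_iff)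
qed

lemma conv_dist_of:
  assumes "\<psi> \<in> schwartz" "t > 0"
  shows "conv_dist (dilate t \<psi>) (dist_of g) x = (LINT y|lebesgue. g y * dilate t \<psi> (x - y))"
    and "(\<lambda>y. dilate t \<psi> (x - y)) \<in> schwartz"
proof -
  have "(\<lambda>y. complex_of_real (1 / t ^ CARD('n)) * \<psi> ((- 1 / t) *\<^sub>R y + x /\<^sub>R t)) \<in> schwartz"
    using assms by (intro schwartz_cmult schwartz_affine) auto
  then show *: "(\<lambda>y. dilate t \<psi> (x - y)) \<in> schwartz"
    by (simp add: dilate_def scaleR_diff_right divide_inverse)
  then show "conv_dist (dilate t \<psi>) (dist_of g) x = (LINT y|lebesgue. g y * dilate t \<psi> (x - y))"
    by (simp add: conv_dist_def dist_of_def)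
qed

text \<open>The L^1 norm of \<psi>_t does not depend on t, and the seminorm bound gives |\<psi>(u)|
  \<le> (1 + |u|)^(-N). The resulting estimate serves near the support of g.\<close>

lemma conv_near:
  assumes N: "N \<ge> CARD('n) + 1" and \<psi>: "\<psi> \<in> schwartz_ball N" and t: "t > 0"
  shows "norm (conv_dist (dilate t \<psi>) (dist_of g) x) \<le>
    A * enn2real (\<integral>\<^sup>+u. ennreal (1 / (1 + norm (u :: real^'n)) ^ N) \<partial>lborel)"
proof -
  define I where "I = (\<integral>\<^sup>+u. ennreal (1 / (1 + norm (u :: real^'n)) ^ N) \<partial>lborel)"
  have I: "I = ennreal (enn2real I)" using nn_integral_decay_finite[OF N] by (simp add: I_def)
  have \<psi>': "\<psi> \<in> schwartz" using \<psi> by (simp add: schwartz_ball_def)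
  have mb: "\<psi> \<in> borel_measurable borel" using smooth_measurable[OF schwartz_smooth[OF \<psi>']] .
  have "ennreal (norm (conv_dist (dilate t \<psi>) (dist_of g) x)) \<le> (\<integral>\<^sup>+y. ennreal (norm (g y * dilate t \<psi> (x - y))) \<partial>lebesgue)"
    unfolding conv_dist_of(1)[OF \<psi>' t]
    by (rule integral_norm_bound_ennreal[OF integrable_schwartz[OF conv_dist_of(2)[OF \<psi>' t]]])
  also have "\<dots> \<le> (\<integral>\<^sup>+y. ennreal A * ennreal (norm (dilate t \<psi> (x - y))) \<partial>lebesgue)"
    by (rule nn_integral_mono_AE) (use gA in \<open>eventually_elim, auto simp: norm_mult ennreal_mult intro!: mult_right_mono ennreal_leI\<close>)
  also have "\<dots> = (\<integral>\<^sup>+y. ennreal A * ennreal (norm (dilate t \<psi> (x - y))) \<partial>lborel)"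
    using smooth_measurable[OF schwartz_smooth[OF conv_dist_of(2)[OF \<psi>' t]]] by (intro nn_integral_completion) measurable
  also have "\<dots> = ennreal A * (\<integral>\<^sup>+y. ennreal (norm (dilate t \<psi> (x - y))) \<partial>lborel)"
    using smooth_measurable[OF schwartz_smooth[OF conv_dist_of(2)[OF \<psi>' t]]] by (intro nn_integral_cmult) measurable
  also have "\<dots> = ennreal A * (\<integral>\<^sup>+u. ennreal (norm (\<psi> u)) \<partial>lborel)" by (simp add: nn_integral_dilate mb t)
  also have "\<dots> \<le> ennreal A * I"
    unfolding I_def
  proof (intro mult_left_mono nn_integral_mono ennreal_leI)
    fix u show "norm (\<psi> u) \<le> 1 / (1 + norm u) ^ N"
      using pderivs_norm_le_one[OF \<psi>, of "[]" u] by (simp add: pos_le_divide_eq add_pos_nonneg mult.commute)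
  qed auto
  also have "\<dots> = ennreal (A * enn2real I)" by (subst I) (simp add: ennreal_mult A0)
  finally show ?thesis using A0 unfolding I_def[symmetric] by (simp add: ennreal_le_iff)
qed

text \<open>The vanishing moments allow the Taylor polynomial of degree d at 0 of the function y ->
  \<psi>_t(x - y) to be subtracted. Its derivatives of order d + 1 carry the factor t^(-(n+d+1)),
  and the decay of \<psi> supplies (|x - z|/t)^(-(n+d+1)). So t cancels and a multiple of
  |x|^(-(n+d+1)) remains.\<close>

lemma conv_far:
  assumes mom: "\<And>\<beta>. mi_order \<beta> \<le> d \<Longrightarrow> (LINT x|lebesgue. g x * complex_of_real (\<Prod>i\<in>UNIV. (x $ i) ^ \<beta> i)) = 0"
    and N: "N \<ge> CARD('n) + Suc d" and \<psi>: "\<psi> \<in> schwartz_ball N" and t: "t > 0" and x: "norm x \<ge> 2 * R"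
  shows "norm (conv_dist (dilate t \<psi>) (dist_of g) x) \<le>
    A * (real (CARD('n) ^ Suc d) * (R ^ Suc d * (2 / norm x) ^ (CARD('n) + Suc d))) * V"
proof -
  define K where "K = CARD('n) + Suc d"
  have \<psi>': "\<psi> \<in> schwartz" using \<psi> by (simp add: schwartz_ball_def)
  define f where "f y = dilate t \<psi> (x - y)" for y
  have fS: "f \<in> schwartz" unfolding f_def by (rule conv_dist_of(2)[OF \<psi>' t])
  have f_eq: "f = (\<lambda>y. complex_of_real (1 / t ^ CARD('n)) * \<psi> ((- 1 / t) *\<^sub>R y + x /\<^sub>R t))"
    by (rule ext) (simp add: f_def dilate_def scaleR_diff_right divide_inverse)
  have x0: "norm x > 0" using x R1 by linarith
  have B: "norm (pderivs is f z) \<le> (2 / norm x) ^ K" if l: "length is = Suc d" and z: "norm z \<le> R" for "is" z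
  proof -
    define w where "w = (- 1 / t) *\<^sub>R z + x /\<^sub>R t"
    have w: "norm w = norm (x - z) / t"
    proof -
      have "w = (x - z) /\<^sub>R t" by (simp add: w_def algebra_simps divide_inverse)
      then show ?thesis using t by (simp add: divide_inverse)
    qed
    have "norm x - norm z \<le> norm (x - z)" by (rule norm_triangle_ineq2)
    then have xz: "norm x / 2 \<le> norm (x - z)" using z x by linarith
    have "norm (pderivs is f z) = (1 / t ^ CARD('n)) * ((1 / t) ^ Suc d * norm (pderivs is \<psi> w))"
      unfolding f_eq w_def using t
      by (subst pderivs_cmult[OF smooth_affine[OF schwartz_smooth[OF \<psi>']]], subst pderivs_affine[OF schwartz_smooth[OF \<psi>']])
        (simp add: norm_mult norm_divide norm_power l power_abs)
    also have "\<dots> = (1 / t) ^ K * norm (pderivs is \<psi> w)" by (simp add: K_def power_add power_one_over)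
    also have "\<dots> \<le> (1 / t) ^ K * (1 / (norm w) ^ K)"
    proof (intro mult_left_mono)
      have wpos: "norm w > 0" unfolding w using xz x0 t by (intro divide_pos_pos) linarith+
      have "(norm w) ^ K * norm (pderivs is \<psi> w) \<le> (1 + norm w) ^ N * norm (pderivs is \<psi> w)"
        using N by (intro mult_right_mono order_trans[OF power_mono[of "norm w" "1 + norm w" K] power_increasing]) (auto simp: K_def)
      also have "\<dots> \<le> 1" using N l by (intro pderivs_norm_le_one[OF \<psi>]) simp
      finally show "norm (pderivs is \<psi> w) \<le> 1 / norm w ^ K" using wpos by (simp add: pos_le_divide_eq mult.commute)
    qed (use t in simp)
    also have "\<dots> = (1 / norm (x - z)) ^ K"
      using t xz x0 by (simp add: w power_divide)
    also have "\<dots> \<le> (2 / norm x) ^ K"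
    proof (intro power_mono)
      have "0 < norm (x - z) * (norm x / 2)" using xz x0 by (intro mult_pos_pos) linarith+
      then have "1 / norm (x - z) \<le> 1 / (norm x / 2)" using xz by (intro divide_left_mono) auto
      then show "1 / norm (x - z) \<le> 2 / norm x" by simp
    qed simp
    finally show ?thesis .
  qed
  define P where "P y = (\<Sum>k\<le>d. (1 / fact k) *\<^sub>R (\<Sum>is | length is = k. prod_list (map (($) y) is) *\<^sub>R pderivs is f 0))" for y
  have mon: "(LINT y|lebesgue. g y * complex_of_real (prod_list (map (($) y) is))) = 0" if "length is \<le> d" for "is"
    using mom[of "count_list is"] that by (simp add: prod_list_count_UNIV mi_order_count_list)
  have intmon: "integrable lebesgue (\<lambda>y. g y * complex_of_real (prod_list (map (($) y) is)))" for "is"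
  proof (rule integrable_mult)
    show "(\<lambda>y. complex_of_real (prod_list (map (($) y) is))) \<in> borel_measurable lebesgue"
    proof (induction "is")
      case (Cons i "is")
      have "(\<lambda>y :: real^'n. complex_of_real (y $ i)) \<in> borel_measurable lebesgue"
        by (intro measurable_completion) simp
      with Cons show ?case by simp
    qed simp
    fix y :: "real^'n" assume y: "norm y \<le> R"
    show "norm (complex_of_real (prod_list (map (($) y) is))) \<le> R ^ length is"
    proof (induction "is")
      case (Cons i "is")
      have "\<bar>y $ i\<bar> \<le> R" using component_le_norm_cart[of y i] y by linarith
      then show ?case using Cons R1 by (auto simp: abs_mult norm_mult intro!: mult_mono)
    qed simp
  qed
  have gP: "g y * P y = (\<Sum>k\<le>d. \<Sum>is | length is = k. (1 / fact k) *\<^sub>R (pderivs is f 0 * (g y * complex_of_real (prod_list (map (($) y) is)))))" for y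
    unfolding P_def sum_distrib_left scaleR_sum_right
    by (intro sum.cong refl) (simp add: scaleR_conv_of_real mult_ac)
  have intP: "integrable lebesgue (\<lambda>y. g y * P y)"
    unfolding gP by (intro Bochner_Integration.integrable_sum integrable_scaleR_right integrable_mult_right intmon)
  have zeroP: "(LINT y|lebesgue. g y * P y) = 0"
    unfolding gP
    by (subst Bochner_Integration.integral_sum, intro Bochner_Integration.integrable_sum integrable_scaleR_right integrable_mult_right intmon,
        rule sum.neutral, rule ballI, subst Bochner_Integration.integral_sum, intro integrable_scaleR_right integrable_mult_right intmon,
        rule sum.neutral) (simp add: mon)
  have "conv_dist (dilate t \<psi>) (dist_of g) x = (LINT y|lebesgue. g y * f y)"
    unfolding f_def by (rule conv_dist_of(1)[OF \<psi>' t])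
  also have "\<dots> = (LINT y|lebesgue. g y * f y) - (LINT y|lebesgue. g y * P y)" by (simp add: zeroP)
  also have "\<dots> = (LINT y|lebesgue. g y * (f y - P y))"
    using integrable_schwartz[OF fS] intP by (simp add: right_diff_distrib)
  also have "norm \<dots> \<le> A * (real (CARD('n) ^ Suc d) * (R ^ Suc d * (2 / norm x) ^ K)) * V"
  proof (rule integral_mult_le)
    have "P \<in> borel_measurable lebesgue"
    proof -
      have "(\<lambda>y :: real^'n. prod_list (map (($) y) is)) \<in> borel_measurable borel" for "is"
        by (induction "is") auto
      then have "P \<in> borel_measurable borel" unfolding P_def by simp
      then show ?thesis by (simp add: measurable_completion)
    qed
    then show "(\<lambda>y. f y - P y) \<in> borel_measurable lebesgue"
      using schwartz_lebesgue_measurable[OF fS] by simp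
    fix y :: "real^'n" assume y: "norm y \<le> R"
    show "norm (f y - P y) \<le> real (CARD('n) ^ Suc d) * (R ^ Suc d * (2 / norm x) ^ K)"
      unfolding P_def
    proof (rule taylor_remainder_bound[OF schwartz_smooth[OF fS] _ y])
      fix "is" :: "'n list" and \<tau> :: real assume *: "length is = Suc d" "0 \<le> \<tau>" "\<tau> \<le> 1"
      have "\<tau> * norm y \<le> 1 * R" using * y by (intro mult_mono) auto
      then show "norm (pderivs is f (\<tau> *\<^sub>R y)) \<le> (2 / norm x) ^ K" using * by (intro B) auto
    qed
  qed
  finally show ?thesis unfolding K_def .
qed

text \<open>The near and the far estimate meet at |x| = 2 R. Each further order of vanishing moments
  gains one power of decay.\<close>

lemma grand_max_decay:
  assumes mom: "\<And>\<beta>. mi_order \<beta> \<le> d \<Longrightarrow> (LINT x|lebesgue. g x * complex_of_real (\<Prod>i\<in>UNIV. (x $ i) ^ \<beta> i)) = 0"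
    and N: "N \<ge> CARD('n) + Suc d"
  shows "\<exists>C\<ge>0. \<forall>x. grand_max N (dist_of g) x \<le> ennreal (C / (1 + norm x) ^ (CARD('n) + Suc d))"
proof -
  define K where "K = CARD('n) + Suc d"
  define C1 where "C1 = A * enn2real (\<integral>\<^sup>+u. ennreal (1 / (1 + norm (u :: real^'n)) ^ N) \<partial>lborel)"
  define C2 where "C2 = A * real (CARD('n) ^ Suc d) * R ^ Suc d * V"
  have C0: "C1 \<ge> 0" "C2 \<ge> 0" using A0 R1 V0 by (auto simp: C1_def C2_def)
  define C where "C = C1 * (1 + 2 * R) ^ K + C2 * 4 ^ K"
  have "C \<ge> 0" using C0 R1 by (simp add: C_def)
  moreover have "grand_max N (dist_of g) x \<le> ennreal (C / (1 + norm x) ^ K)" for x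
    unfolding grand_max_def
  proof (rule SUP_least)
    fix t\<psi> :: "real \<times> (real^'n \<Rightarrow> complex)" assume "t\<psi> \<in> {0<..} \<times> schwartz_ball N"
    then obtain t \<psi> where t\<psi>: "t\<psi> = (t, \<psi>)" and t: "t \<in> {0<..}" and \<psi>: "\<psi> \<in> schwartz_ball N" by auto
    have p: "0 < (1 + norm x) ^ K" by (simp add: add_pos_nonneg)
    have "ennreal (norm (conv_dist (dilate t \<psi>) (dist_of g) x)) \<le> ennreal (C / (1 + norm x) ^ K)"
    proof (rule ennreal_leI, cases "norm x < 2 * R")
      case True
      have "norm (conv_dist (dilate t \<psi>) (dist_of g) x) * (1 + norm x) ^ K \<le> C1 * (1 + 2 * R) ^ K"
        using conv_near[OF _ \<psi>, of t x] N t True C0 unfolding C1_def[symmetric]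
        by (intro mult_mono power_mono) auto
      also have "\<dots> \<le> C" using C0 by (simp add: C_def)
      finally show "norm (conv_dist (dilate t \<psi>) (dist_of g) x) \<le> C / (1 + norm x) ^ K"
        using p by (simp add: pos_le_divide_eq)
    next
      case False
      then have x: "2 * R \<le> norm x" by simp
      have x1: "norm x \<ge> 2" using x R1 by linarith
      have "2 / norm x \<le> 1" using x1 by (subst divide_le_eq_1_pos) auto
      then have "(2 / norm x) * (1 + norm x) \<le> 4" using x1 by (simp add: distrib_left)
      then have "((2 / norm x) * (1 + norm x)) ^ K \<le> 4 ^ K" by (intro power_mono) auto
      then have "(2 / norm x) ^ K * (1 + norm x) ^ K \<le> 4 ^ K" by (simp only: power_mult_distrib)
      have "norm (conv_dist (dilate t \<psi>) (dist_of g) x) \<le> C2 * (2 / norm x) ^ K"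
        using conv_far[OF mom N \<psi> _ x, of t] t by (simp add: C2_def K_def mult_ac)
      then have "norm (conv_dist (dilate t \<psi>) (dist_of g) x) * (1 + norm x) ^ K \<le> C2 * (2 / norm x) ^ K * (1 + norm x) ^ K"
        using p by (intro mult_right_mono) auto
      also have "\<dots> \<le> C2 * 4 ^ K"
        using \<open>(2 / norm x) ^ K * (1 + norm x) ^ K \<le> 4 ^ K\<close> C0 by (simp only: mult.assoc) (intro mult_left_mono)
      also have "\<dots> \<le> C" using C0 R1 by (simp add: C_def)
      finally show "norm (conv_dist (dilate t \<psi>) (dist_of g) x) \<le> C / (1 + norm x) ^ K"
        using p by (simp add: pos_le_divide_eq)
    qed
    then show "(case t\<psi> of (t, \<psi>) \<Rightarrow> ennreal (norm (conv_dist (dilate t \<psi>) (dist_of g) x))) \<le> ennreal (C / (1 + norm x) ^ K)"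
      by (simp add: t\<psi>)
  qed
  ultimately show ?thesis unfolding K_def by blast
qed

end

section \<open>Ball quasi-Banach function spaces\<close>

lemma epow_ennreal: "0 \<le> x \<Longrightarrow> epow (ennreal x) r = ennreal (x powr r)"
  by (simp add: epow_def)

lemma epow_top [simp]: "epow \<infinity> r = \<infinity>" "epow top r = top"
  by (simp_all add: epow_def)

lemma epow_0 [simp]: "epow 0 r = 0"
  by (simp add: epow_def)

lemma epow_1 [simp]: "epow u 1 = u"
  by (cases u) (simp_all add: epow_ennreal)

lemma epow_mono: "0 \<le> r \<Longrightarrow> u \<le> v \<Longrightarrow> epow u r \<le> epow v r"
  by (cases u; cases v) (simp_all add: epow_ennreal powr_mono2 top_unique)

lemma epow_epow: "epow (epow u r) s = epow u (r * s)"
  by (cases u) (simp_all add: epow_ennreal powr_powr)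

lemma epow_mult: "0 < r \<Longrightarrow> epow (u * v) r = epow u r * epow v r"
proof (cases u; cases v)
  fix x y assume "0 < r" "0 \<le> x" "u = ennreal x" "0 \<le> y" "v = ennreal y"
  then show ?thesis by (simp add: epow_ennreal ennreal_mult[symmetric] powr_mult)
next
  fix x assume "0 < r" "0 \<le> x" "u = ennreal x" "v = top"
  then show ?thesis by (cases "x = 0") (simp_all add: epow_ennreal ennreal_mult_top)
next
  fix y assume "0 < r" "0 \<le> y" "u = top" "v = ennreal y"
  then show ?thesis by (cases "y = 0") (simp_all add: epow_ennreal ennreal_top_mult)
qed simp

lemma epow_less_top_iff [simp]: "epow u r < \<infinity> \<longleftrightarrow> u < \<infinity>" "epow u r < top \<longleftrightarrow> u < top"
  by (cases u; simp add: epow_ennreal)+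

lemma epow_le_cancel: "0 < r \<Longrightarrow> epow u r \<le> epow v r \<Longrightarrow> u \<le> v"
  using epow_mono[of "1 / r" "epow u r" "epow v r"] by (simp add: epow_epow)

lemma epow_measurable [measurable]: "u \<in> borel_measurable M \<Longrightarrow> (\<lambda>x. epow (u x) r) \<in> borel_measurable M"
proof -
  assume [measurable]: "u \<in> borel_measurable M"
  have [measurable]: "{x \<in> space M. u x = \<infinity>} \<in> sets M" by measurable
  have "(\<lambda>x. ennreal (enn2real (u x) powr r)) \<in> borel_measurable M"
    by (rule measurable_compose[of "\<lambda>x. enn2real (u x)" M borel "\<lambda>t. ennreal (t powr r)"]) measurable
  then show ?thesis unfolding epow_def by (intro measurable_If) auto
qed

lemma emeasure_cube:
  fixes a :: "real^'n::finite"
  assumes "0 \<le> l"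
  shows "emeasure lborel (cbox a (a + (\<chi> i. l))) = ennreal (l ^ CARD('n))"
proof -
  have "emeasure lborel (cbox a (a + (\<chi> i. l))) = ennreal (\<Prod>b\<in>(Basis :: (real^'n) set). (a + (\<chi> i. l) - a) \<bullet> b)"
    by (rule emeasure_lborel_cbox) (use assms in \<open>auto simp: Basis_vec_def inner_axis\<close>)
  also have "(\<Prod>b\<in>(Basis :: (real^'n) set). (a + (\<chi> i. l) - a) \<bullet> b) = (\<Prod>b\<in>(Basis :: (real^'n) set). l)"
    by (intro prod.cong refl) (auto simp: Basis_vec_def inner_axis)
  finally show ?thesis by simp
qed

definition cube_max :: "((real^'n::finite) \<Rightarrow> ennreal) \<Rightarrow> (real^'n) \<Rightarrow> ennreal" where
  "cube_max u x = (SUP Q \<in> {Q. cube Q \<and> x \<in> Q}. (\<integral>\<^sup>+y\<in>Q. u y \<partial>lebesgue) / emeasure lebesgue Q)"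

lemma hl_max_eq_cube_max: "hl_max f = cube_max (\<lambda>y. ennreal (norm (f y)))"
  by (rule ext) (simp add: hl_max_def cube_max_def)

lemma cube_max_ge: "cube Q \<Longrightarrow> x \<in> Q \<Longrightarrow> (\<integral>\<^sup>+y\<in>Q. u y \<partial>lebesgue) / emeasure lebesgue Q \<le> cube_max u x"
  unfolding cube_max_def by (rule SUP_upper) simp

text \<open>Cubes are closed, so a point of a cube may lie on its boundary. Enlarging the cube by e
  on each side makes the point interior, and for small e the average stays above a.\<close>

lemma cube_enlarge_average:
  fixes I a :: ennreal
  assumes "l > 0" "a < I / ennreal (l ^ n)"
  shows "\<exists>e>0. a < I / ennreal ((l + 2 * e) ^ n)"
proof (cases I)
  case top
  then show ?thesis using assms by (intro exI[of _ 1]) (auto simp: ennreal_top_divide)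
next
  case (real c)
  have ln: "l ^ n > 0" using assms(1) by simp
  have "a < ennreal (c / l ^ n)" using assms(2) real ln by (simp add: divide_ennreal)
  then obtain b where b: "a = ennreal b" "0 \<le> b" "b < c / l ^ n"
    by (cases a) (auto simp: ennreal_less_iff)
  have "((\<lambda>e. c / (l + 2 * e) ^ n) \<longlongrightarrow> c / (l + 2 * 0) ^ n) (at_right 0)"
    using assms(1) by (intro tendsto_intros) auto
  then have "\<forall>\<^sub>F e in at_right 0. b < c / (l + 2 * e) ^ n"
    using b(3) by (intro order_tendstoD) auto
  moreover have "\<forall>\<^sub>F e in at_right (0::real). e > 0" by (simp add: eventually_at_right_less)
  ultimately have "\<exists>e. b < c / (l + 2 * e) ^ n \<and> e > 0"
    using eventually_happens[OF eventually_conj] trivial_limit_at_right_real by blast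
  then obtain e where e: "e > 0" "b < c / (l + 2 * e) ^ n" by blast
  then have "a < I / ennreal ((l + 2 * e) ^ n)"
    using assms(1) real b by (simp add: divide_ennreal ennreal_less_iff)
  with e show ?thesis by blast
qed

text \<open>Superlevel sets are open: the interior of a slightly enlarged cube is a neighbourhood of
  the point on which the same average is available.\<close>

lemma cube_max_measurable:
  fixes u :: "real^'n::finite \<Rightarrow> ennreal"
  shows "cube_max u \<in> borel_measurable borel"
proof (rule borel_measurableI_greater)
  fix a
  have "open {x. a < cube_max u x}"
  proof (subst open_subopen, clarify)
    fix x assume "a < cube_max u x"
    then obtain Q where Q: "cube Q" "x \<in> Q" "a < (\<integral>\<^sup>+y\<in>Q. u y \<partial>lebesgue) / emeasure lebesgue Q"
      unfolding cube_max_def less_SUP_iff by auto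
    then obtain p l where pl: "0 < l" "Q = cbox p (p + (\<chi> i. l))" by (auto simp: cube_def)
    then have "a < (\<integral>\<^sup>+y\<in>Q. u y \<partial>lebesgue) / ennreal (l ^ CARD('n))"
      using Q(3) emeasure_cube[of l p] by simp
    then obtain e where e: "e > 0" "a < (\<integral>\<^sup>+y\<in>Q. u y \<partial>lebesgue) / ennreal ((l + 2 * e) ^ CARD('n))"
      using cube_enlarge_average[OF pl(1)] by blast
    define p' where "p' = p - (\<chi> i. e)"
    define Q' where "Q' = cbox p' (p' + (\<chi> i. l + 2 * e))"
    have c: "cube Q'" unfolding cube_def Q'_def using pl(1) e(1) by (intro exI[of _ p'] exI[of _ "l + 2 * e"]) auto
    have QQ': "Q \<subseteq> Q'" unfolding pl(2) Q'_def p'_def using e(1) by (auto simp: mem_box_cart algebra_simps; smt (verit))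
    have av: "a < (\<integral>\<^sup>+y\<in>Q'. u y \<partial>lebesgue) / emeasure lebesgue Q'"
    proof -
      have "(\<integral>\<^sup>+y\<in>Q. u y \<partial>lebesgue) \<le> (\<integral>\<^sup>+y\<in>Q'. u y \<partial>lebesgue)"
        using QQ' by (intro nn_integral_mono) (auto split: split_indicator)
      then have "(\<integral>\<^sup>+y\<in>Q. u y \<partial>lebesgue) / ennreal ((l + 2 * e) ^ CARD('n)) \<le> (\<integral>\<^sup>+y\<in>Q'. u y \<partial>lebesgue) / emeasure lebesgue Q'"
        using emeasure_cube[of "l + 2 * e" p'] e(1) pl(1) by (simp add: Q'_def divide_right_mono_ennreal)
      with e(2) show ?thesis by (rule less_le_trans)
    qed
    define U where "U = box p' (p' + (\<chi> i. l + 2 * e))"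
    have "x \<in> U" using Q(2) e(1) unfolding pl(2) U_def p'_def by (auto simp: mem_box_cart algebra_simps; smt (verit))
    moreover have "U \<subseteq> {x. a < cube_max u x}"
    proof
      fix y assume "y \<in> U"
      then have "y \<in> Q'" unfolding U_def Q'_def using box_subset_cbox by blast
      from cube_max_ge[OF c this, of u] av show "y \<in> {x. a < cube_max u x}" by simp
    qed
    ultimately show "\<exists>T. open T \<and> x \<in> T \<and> T \<subseteq> {x. a < cube_max u x}"
      by (intro exI[of _ U]) (auto simp: U_def open_box)
  qed
  then show "{x \<in> space borel. a < cube_max u x} \<in> sets borel" by simp
qed

lemma hl_max_measurable: "hl_max f \<in> borel_measurable borel"
  unfolding hl_max_eq_cube_max by (rule cube_max_measurable)

lemma borel_imp_lebesgue: "f \<in> borel_measurable borel \<Longrightarrow> f \<in> borel_measurable lebesgue"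
  by (intro measurable_completion) simp

section \<open>Power decay from Assumption (A), and atoms in the Hardy space\<close>

lemma quasi_banachD:
  assumes "ball_quasi_banach X"
  shows bqb_cmult: "f \<in> borel_measurable lebesgue \<Longrightarrow> X (\<lambda>x. c * f x) = ennreal (norm c) * X f"
    and bqb_zero: "f \<in> borel_measurable lebesgue \<Longrightarrow> X f = 0 \<Longrightarrow> AE x in lebesgue. f x = 0"
    and bqb_mono: "f \<in> borel_measurable lebesgue \<Longrightarrow> g \<in> borel_measurable lebesgue \<Longrightarrow>
      AE x in lebesgue. norm (g x) \<le> norm (f x) \<Longrightarrow> X g \<le> X f"
    and bqb_ball: "0 < r \<Longrightarrow> indicator (ball c' r) \<in> fspace X"
  using assms unfolding ball_quasi_banach_def quasi_norm_def by blast+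

lemma bqb_Fatou:
  assumes "ball_quasi_banach X" "\<And>j. F j \<in> borel_measurable lebesgue" "f \<in> borel_measurable lebesgue"
    "AE x in lebesgue. 0 \<le> F 0 x \<and> incseq (\<lambda>j. F j x) \<and> (\<lambda>j. F j x) \<longlonglongrightarrow> f x"
  shows "incseq (\<lambda>j. X (\<lambda>x. complex_of_real (F j x)))"
    "(\<lambda>j. X (\<lambda>x. complex_of_real (F j x))) \<longlonglongrightarrow> X (\<lambda>x. complex_of_real (f x))"
  using assms unfolding ball_quasi_banach_def by blast+

lemma bqb_cube:
  assumes "ball_quasi_banach X" "cube Q"
  shows "X (indicator Q) < \<infinity>" "X (indicator Q) \<noteq> 0"
proof -
  obtain a l where Q: "0 < l" "Q = cbox a (a + (\<chi> i. l))" using assms(2) by (auto simp: cube_def)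
  have m: "indicator Q \<in> borel_measurable lebesgue" unfolding Q(2) by (intro borel_measurable_indicator) simp
  obtain r where r: "r > 0" "Q \<subseteq> ball 0 r"
    using bounded_subset_ballD[OF bounded_cbox] unfolding Q(2) by blast
  have "X (indicator Q) \<le> X (indicator (ball 0 r))"
    using r bqb_ball[OF assms(1) r(1)] by (intro bqb_mono[OF assms(1)] m AE_I2) (auto simp: fspace_def split: split_indicator)
  also have "\<dots> < \<infinity>" using bqb_ball[OF assms(1) r(1)] by (simp add: fspace_def)
  finally show "X (indicator Q) < \<infinity>" .
  show "X (indicator Q) \<noteq> 0"
  proof
    assume "X (indicator Q) = 0"
    from bqb_zero[OF assms(1) m this] have "AE x in lebesgue. x \<notin> Q"
      by eventually_elim (auto split: split_indicator_asm)
    then have "emeasure lebesgue Q = 0"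
      by (subst (asm) AE_iff_measurable[of Q]) (auto simp: Q(2))
    then show False using emeasure_cube[of l a] Q zero_less_power[OF Q(1), of "CARD('a)"] by (simp add: ennreal_eq_0_iff)
  qed
qed

text \<open>Assumption (A) is applied to the sequence whose only nonzero member is the indicator of
  the unit cube. Its maximal function of order \<theta> is at least a multiple of (1 +
  |x|)^(-n/\<theta>), so this power has finite quasi-norm, and faster decay only helps.\<close>

lemma assumption_A_decay:
  fixes X :: "'n::finite fun_norm"
  assumes X: "ball_quasi_banach X" and A: "assumption_A X"
  obtains K0 where "\<And>K. real K \<ge> K0 \<Longrightarrow> X (\<lambda>x. complex_of_real (1 / (1 + norm x) ^ K)) < \<infinity>"
proof -
  from A obtain \<theta> s C where \<theta>: "0 < \<theta>" "\<theta> < s" "s \<le> 1" and C: "C > 0"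
    "\<And>f :: nat \<Rightarrow> (real^'n) \<Rightarrow> complex. (\<forall>j. f j \<in> L1_loc) \<Longrightarrow>
           ext_norm X (\<lambda>x. epow (\<Sum>j. epow (hl_max_pow \<theta> (f j) x) s) (1 / s))
           \<le> ennreal C * ext_norm X (\<lambda>x. epow (\<Sum>j. epow (ennreal (norm (f j x))) s) (1 / s))"
    unfolding assumption_A_def by blast
  define Q :: "(real^'n) set" where "Q = cbox 0 (0 + (\<chi> i. 1))"
  have Q: "cube Q" unfolding cube_def Q_def by (intro exI[of _ 0] exI[of _ 1]) auto
  have Qm [measurable]: "Q \<in> sets lebesgue" by (simp add: Q_def)
  define f :: "nat \<Rightarrow> (real^'n) \<Rightarrow> complex" where "f j = (if j = 0 then indicator Q else (\<lambda>_. 0))" for j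
  have fm: "f j \<in> borel_measurable lebesgue" for j unfolding f_def by simp
  have L1: "\<forall>j. f j \<in> L1_loc"
  proof
    fix j
    have "set_integrable lebesgue K (f j)" if "compact K" for K
      unfolding set_integrable_def
    proof (rule Bochner_Integration.integrable_bound)
      have "emeasure lborel K < \<infinity>" using that by (intro emeasure_bounded_finite compact_imp_bounded)
      then show "integrable lebesgue (indicator K :: real^'n \<Rightarrow> real)"
        using borel_compact[OF that] by (intro integrable_real_indicator) simp_all
      show "(\<lambda>x. indicat_real K x *\<^sub>R f j x) \<in> borel_measurable lebesgue"
        using fm that by (intro borel_measurable_scaleR borel_measurable_indicator) (auto intro!: borel_compact)
      show "AE x in lebesgue. norm (indicat_real K x *\<^sub>R f j x) \<le> norm (indicat_real K x)"
        by (intro AE_I2) (auto simp: f_def split: split_indicator)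
    qed
    then show "f j \<in> L1_loc" using fm by (simp add: L1_loc_def)
  qed
  define u where "u x = epow (\<Sum>j. epow (hl_max_pow \<theta> (f j) x) s) (1 / s)" for x
  have "ext_norm X u \<le> ennreal C * ext_norm X (\<lambda>x. epow (\<Sum>j. epow (ennreal (norm (f j x))) s) (1 / s))"
    unfolding u_def by (rule C(2)[OF L1])
  also have "(\<lambda>x. epow (\<Sum>j. epow (ennreal (norm (f j x))) s) (1 / s)) = (\<lambda>x. ennreal (indicator Q x))"
  proof
    fix x
    have "(\<Sum>j. epow (ennreal (norm (f j x))) s) = (\<Sum>j\<in>{0}. epow (ennreal (norm (f j x))) s)"
      by (rule suminf_finite) (auto simp: f_def)
    then show "epow (\<Sum>j. epow (ennreal (norm (f j x))) s) (1 / s) = ennreal (indicator Q x)"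
      using \<theta> by (simp add: epow_epow f_def split: split_indicator)
  qed
  also have "ext_norm X (\<lambda>x. ennreal (indicator Q x)) = X (indicator Q)"
  proof -
    have "(\<lambda>x. complex_of_real (enn2real (ennreal (indicator Q x)))) = indicator Q"
      by (rule ext) (simp split: split_indicator)
    then show ?thesis unfolding ext_norm_def by (simp only:) simp
  qed
  also have "ennreal C * X (indicator Q) < \<infinity>"
    using bqb_cube(1)[OF X Q] by (simp add: ennreal_mult_less_top)
  finally have fin: "ext_norm X u < \<infinity>" .
  then have uae: "AE x in lebesgue. u x < \<infinity>" and uX: "X (\<lambda>x. complex_of_real (enn2real (u x))) < \<infinity>"
    unfolding ext_norm_def by (auto split: if_splits)
  have um: "u \<in> borel_measurable lebesgue"
    unfolding u_def[abs_def] hl_max_pow_def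
    using borel_imp_lebesgue[OF hl_max_measurable] by measurable
  define c where "c x = (1 / (2 * (1 + norm (x :: real^'n))) ^ CARD('n)) powr (1 / \<theta>)" for x
  have uge: "ennreal (c x) \<le> u x" for x
  proof -
    \<comment> \<open>The cube [-L, L]^n contains both x and the unit cube, and its volume is
      (2L)^n.\<close>
    define L where "L = 1 + norm x"
    have L: "L \<ge> 1" by (simp add: L_def)
    define Q' where "Q' = cbox (- (\<chi> i. L)) (- (\<chi> i. L) + (\<chi> i. 2 * L) :: real^'n)"
    have cQ': "cube Q'" unfolding cube_def Q'_def using L by (intro exI[of _ "- (\<chi> i. L)"] exI[of _ "2 * L"]) auto
    have "\<bar>x $ i\<bar> \<le> L" for i using component_le_norm_cart[of x i] by (simp add: L_def)
    then have xQ': "x \<in> Q'" unfolding Q'_def by (auto simp: mem_box_cart abs_le_iff minus_le_iff)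
    have QQ': "Q \<subseteq> Q'" unfolding Q_def Q'_def using L by (auto simp: mem_box_cart; smt (verit))
    have "(\<integral>\<^sup>+y\<in>Q'. ennreal (norm (indicator Q y :: complex)) \<partial>lebesgue) = (\<integral>\<^sup>+y. indicator Q y \<partial>lebesgue)"
      using QQ' by (intro nn_integral_cong) (auto split: split_indicator)
    also have "\<dots> = 1" using emeasure_cube[of 1 "0 :: real^'n"] by (simp add: Q_def)
    finally have "1 / emeasure lebesgue Q' \<le> hl_max (indicator Q) x"
      using cube_max_ge[OF cQ' xQ', of "\<lambda>y. ennreal (norm (indicator Q y :: complex))"] by (simp add: hl_max_eq_cube_max)
    moreover have "emeasure lebesgue Q' = ennreal ((2 * L) ^ CARD('n))"
      using emeasure_cube[of "2 * L" "- (\<chi> i. L) :: real^'n"] L by (simp add: Q'_def)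
    ultimately have h: "ennreal (1 / (2 * L) ^ CARD('n)) \<le> hl_max (indicator Q) x"
      using L by (simp add: divide_ennreal[symmetric])
    have ap: "abs_pow (indicator Q) \<theta> = indicator Q"
      using \<theta> by (auto simp: abs_pow_def split: split_indicator)
    have "ennreal (c x) = epow (ennreal (1 / (2 * L) ^ CARD('n))) (1 / \<theta>)"
      using L by (subst epow_ennreal) (auto simp: c_def L_def)
    also have "\<dots> \<le> hl_max_pow \<theta> (f 0) x"
      unfolding hl_max_pow_def f_def using h \<theta> by (simp add: ap epow_mono)
    also have "\<dots> = epow (epow (hl_max_pow \<theta> (f 0) x) s) (1 / s)" using \<theta> by (simp add: epow_epow)
    also have "\<dots> \<le> u x"
      unfolding u_def using \<theta> sum_le_suminf[of "\<lambda>j. epow (hl_max_pow \<theta> (f j) x) s" "{0}"] by (intro epow_mono) auto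
    finally show ?thesis .
  qed
  define M where "M = real CARD('n) / \<theta>"
  have cM: "c x = (2 powr (- M)) * (1 + norm x) powr (- M)" for x
  proof -
    have p: "1 + norm x > 0" by (simp add: add_pos_nonneg)
    have "c x = ((2 * (1 + norm x)) powr (- real CARD('n))) powr (1 / \<theta>)"
      using p by (simp add: c_def powr_minus powr_realpow divide_inverse)
    also have "\<dots> = (2 * (1 + norm x)) powr (- M)" by (simp add: powr_powr M_def)
    also have "\<dots> = (2 powr (- M)) * (1 + norm x) powr (- M)"
      using p by (simp only: powr_mult zero_le_numeral less_imp_le)
    finally show ?thesis .
  qed
  show thesis
  proof (rule that[of M])
    fix K :: nat assume K: "M \<le> real K"
    have "X (\<lambda>x. complex_of_real (1 / (1 + norm x) ^ K)) \<le> X (\<lambda>x. complex_of_real (2 powr M) * complex_of_real (enn2real (u x)))"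
    proof (rule bqb_mono[OF X])
      show "(\<lambda>x. complex_of_real (2 powr M) * complex_of_real (enn2real (u x))) \<in> borel_measurable lebesgue" using um by measurable
      have "(\<lambda>x :: real^'n. complex_of_real (1 / (1 + norm x) ^ K)) \<in> borel_measurable borel" by measurable
      then show "(\<lambda>x :: real^'n. complex_of_real (1 / (1 + norm x) ^ K)) \<in> borel_measurable lebesgue" by (rule borel_imp_lebesgue)
      show "AE x in lebesgue. norm (complex_of_real (1 / (1 + norm x) ^ K)) \<le> norm (complex_of_real (2 powr M) * complex_of_real (enn2real (u x)))"
        using uae
      proof eventually_elim
        fix x :: "real^'n" assume ux: "u x < \<infinity>"
        have p: "1 \<le> 1 + norm x" by simp
        have "1 / (1 + norm x) ^ K = (1 + norm x) powr (- real K)"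
          using p by (simp add: powr_minus powr_realpow divide_inverse add_pos_nonneg)
        also have "\<dots> \<le> (1 + norm x) powr (- M)" using p K by (intro powr_mono) auto
        also have "\<dots> = 2 powr M * c x" unfolding cM by (simp add: powr_minus field_simps)
        also have "\<dots> \<le> 2 powr M * enn2real (u x)"
        proof (intro mult_left_mono)
          have "enn2real (ennreal (c x)) \<le> enn2real (u x)" using uge ux by (intro enn2real_mono) auto
          then show "c x \<le> enn2real (u x)" by (simp add: c_def)
        qed simp
        finally show "norm (complex_of_real (1 / (1 + norm x) ^ K)) \<le> norm (complex_of_real (2 powr M) * complex_of_real (enn2real (u x)))"
          unfolding norm_mult norm_of_real by (simp add: abs_of_nonneg)
      qed
    qed
    also have "\<dots> = ennreal (2 powr M) * X (\<lambda>x. complex_of_real (enn2real (u x)))"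
      using um by (subst bqb_cmult[OF X]) (auto simp: norm_of_real)
    also have "\<dots> < \<infinity>" using uX by (simp add: ennreal_mult_less_top)
    finally show "X (\<lambda>x. complex_of_real (1 / (1 + norm x) ^ K)) < \<infinity>" .
  qed
qed

text \<open>The indicator of a cube has nonzero quasi-norm, so the size condition of an atom is a
  finite bound.\<close>

lemma atom_bounded_cpt:
  assumes X: "ball_quasi_banach X" and a: "atom X d a"
  shows "\<exists>A R. bounded_cpt a A R"
proof -
  from a obtain Q where am: "a \<in> borel_measurable lebesgue" and Q: "cube Q" "\<And>x. x \<notin> Q \<Longrightarrow> a x = 0"
    and bd: "AE x in lebesgue. ennreal (norm (a x)) \<le> inverse (X (indicator Q))"
    unfolding atom_def by blast
  obtain p l where pl: "0 < l" "Q = cbox p (p + (\<chi> i. l))" using Q(1) by (auto simp: cube_def)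
  obtain r where r: "r > 0" "Q \<subseteq> ball 0 r"
    using bounded_subset_ballD[OF bounded_cbox] unfolding pl(2) by blast
  define A where "A = enn2real (inverse (X (indicator Q)))"
  have "inverse (X (indicator Q)) < top" using bqb_cube(2)[OF X Q(1)]
    by (simp add: less_top[symmetric])
  then have A: "inverse (X (indicator Q)) = ennreal A" by (simp add: A_def)
  have "bounded_cpt a A (max 1 r)"
  proof
    show "a \<in> borel_measurable lebesgue" by fact
    show "0 \<le> A" by (simp add: A_def)
    show "AE x in lebesgue. norm (a x) \<le> A"
      using bd unfolding A by eventually_elim (simp add: A_def)
    show "1 \<le> max 1 r" by simp
    show "a x = 0" if "norm x > max 1 r" for x
    proof -
      have "x \<notin> ball 0 r" using that by simp
      then show ?thesis using Q(2) r(2) by blast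
    qed
  qed
  then show ?thesis by blast
qed

lemma atom_span_bounded_cpt:
  assumes X: "ball_quasi_banach X" and g: "g \<in> atom_span X d"
  obtains A R where "bounded_cpt g A R"
    "\<And>\<beta>. mi_order \<beta> \<le> d \<Longrightarrow> (LINT x|lebesgue. g x * complex_of_real (\<Prod>i\<in>UNIV. (x $ i) ^ \<beta> i)) = 0"
proof -
  from g obtain L :: nat and c a where a: "\<And>i. i < L \<Longrightarrow> atom X d (a i)" and g: "g = (\<lambda>x. \<Sum>i<L. c i * a i x)"
    unfolding atom_span_def by blast
  obtain A R where AR: "\<And>i. i < L \<Longrightarrow> bounded_cpt (a i) (A i) (R i)"
    using atom_bounded_cpt[OF X a] by metis
  define A' where "A' = (\<Sum>i<L. norm (c i) * A i)"
  define R' where "R' = 1 + (\<Sum>i<L. R i)"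
  have R0: "0 \<le> R i" if "i < L" for i using bounded_cpt.R1[OF AR[OF that]] by simp
  have "bounded_cpt g A' R'"
  proof
    show "g \<in> borel_measurable lebesgue"
      unfolding g using bounded_cpt.g_meas[OF AR] by (intro borel_measurable_sum borel_measurable_times) auto
    show "0 \<le> A'" unfolding A'_def using bounded_cpt.A0[OF AR] by (intro sum_nonneg mult_nonneg_nonneg) auto
    have "AE x in lebesgue. \<forall>i\<in>{..<L}. norm (a i x) \<le> A i"
      using bounded_cpt.gA[OF AR] by (intro AE_finite_allI) auto
    then show "AE x in lebesgue. norm (g x) \<le> A'"
    proof eventually_elim
      fix x assume "\<forall>i\<in>{..<L}. norm (a i x) \<le> A i"
      then show "norm (g x) \<le> A'"
        unfolding g A'_def by (intro sum_norm_le) (auto simp: norm_mult intro: mult_left_mono)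
    qed
    have "0 \<le> sum R {..<L}" by (rule sum_nonneg) (use R0 in auto)
    then show "1 \<le> R'" unfolding R'_def by simp
    show "g x = 0" if "norm x > R'" for x
    proof -
      have "R i \<le> R'" if "i < L" for i
        using member_le_sum[of i "{..<L}" R] R0 that by (simp add: R'_def)
      then show ?thesis
        unfolding g using bounded_cpt.gR[OF AR] \<open>norm x > R'\<close> by (intro sum.neutral) force
    qed
  qed
  moreover have "(LINT x|lebesgue. g x * complex_of_real (\<Prod>i\<in>UNIV. (x $ i) ^ \<beta> i)) = 0" if \<beta>: "mi_order \<beta> \<le> d" for \<beta>
  proof -
    define h where "h x = complex_of_real (\<Prod>i\<in>UNIV. (x $ i) ^ \<beta> i)" for x
    have hc: "continuous_on S h" for S unfolding h_def by (intro continuous_intros)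
    have hm: "h \<in> borel_measurable lebesgue"
      by (rule borel_imp_lebesgue) (intro borel_measurable_continuous_onI hc)
    have int: "integrable lebesgue (\<lambda>x. a i x * h x)" if "i < L" for i
    proof -
      have "bounded (h ` cball 0 (R i))" by (intro compact_imp_bounded compact_continuous_image hc compact_cball)
      then obtain B where "\<forall>y\<in>h ` cball 0 (R i). norm y \<le> B" unfolding bounded_iff by blast
      then have "norm (h x) \<le> B" if "norm x \<le> R i" for x using that by auto
      then show ?thesis by (intro bounded_cpt.integrable_mult[OF AR[OF that] hm])
    qed
    have "(LINT x|lebesgue. g x * h x) = (LINT x|lebesgue. (\<Sum>i<L. c i * (a i x * h x)))"
      unfolding g sum_distrib_right mult.assoc ..
    also have "\<dots> = (\<Sum>i<L. (LINT x|lebesgue. c i * (a i x * h x)))"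
      by (rule Bochner_Integration.integral_sum) (use int in auto)
    also have "\<dots> = 0"
      using a \<beta> unfolding atom_def h_def by (intro sum.neutral) auto
    finally show ?thesis unfolding h_def .
  qed
  ultimately show thesis by (rule that)
qed

text \<open>Here d has two effects: it gives the grand maximal function decay of order n + d + 1,
  and it fixes the power function that has to lie in X.\<close>

lemma atom_span_hardy:
  fixes X :: "'n::finite fun_norm"
  assumes X: "ball_quasi_banach X" and g: "g \<in> atom_span X d"
    and decay: "X (\<lambda>x. complex_of_real (1 / (1 + norm x) ^ (CARD('n) + Suc d))) < \<infinity>"
    and N: "N \<ge> CARD('n) + Suc d"
  shows "dist_of g \<in> hardy N X"
proof -
  obtain A R where AR: "bounded_cpt g A R"
    "\<And>\<beta>. mi_order \<beta> \<le> d \<Longrightarrow> (LINT x|lebesgue. g x * complex_of_real (\<Prod>i\<in>UNIV. (x $ i) ^ \<beta> i)) = 0"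
    by (rule atom_span_bounded_cpt[OF X g]) blast
  have t: "dist_of g \<in> tempered" by (rule bounded_cpt.dist_of_tempered[OF AR(1)])
  obtain C where C: "C \<ge> 0" "\<And>x. grand_max N (dist_of g) x \<le> ennreal (C / (1 + norm x) ^ (CARD('n) + Suc d))"
    using bounded_cpt.grand_max_decay[OF AR N] by blast
  define w where "w x = complex_of_real (1 / (1 + norm x) ^ (CARD('n) + Suc d))" for x :: "real^'n"
  have wm: "w \<in> borel_measurable lebesgue"
    unfolding w_def by (rule borel_imp_lebesgue) measurable
  have fin: "grand_max N (dist_of g) x < \<infinity>" for x using C(2)[of x] by (auto intro: le_less_trans)
  have "X (\<lambda>x. complex_of_real (enn2real (grand_max N (dist_of g) x))) \<le> X (\<lambda>x. complex_of_real C * w x)"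
  proof (rule bqb_mono[OF X])
    show "(\<lambda>x. complex_of_real C * w x) \<in> borel_measurable lebesgue" using wm by measurable
    have "grand_max N (dist_of g) \<in> borel_measurable lebesgue"
      by (rule borel_imp_lebesgue[OF grand_max_measurable[OF t]])
    then show "(\<lambda>x. complex_of_real (enn2real (grand_max N (dist_of g) x))) \<in> borel_measurable lebesgue" by measurable
    show "AE x in lebesgue. norm (complex_of_real (enn2real (grand_max N (dist_of g) x))) \<le> norm (complex_of_real C * w x)"
    proof (rule AE_I2)
      fix x :: "real^'n"
      have nn: "0 \<le> C / (1 + norm x) ^ (CARD('n) + Suc d)" using C(1) by (intro divide_nonneg_nonneg zero_le_power) auto
      have "enn2real (grand_max N (dist_of g) x) \<le> C / (1 + norm x) ^ (CARD('n) + Suc d)"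
        using enn2real_mono[OF C(2)[of x]] nn by simp
      moreover have "complex_of_real C * w x = complex_of_real (C / (1 + norm x) ^ (CARD('n) + Suc d))" by (simp add: w_def)
      ultimately show "norm (complex_of_real (enn2real (grand_max N (dist_of g) x))) \<le> norm (complex_of_real C * w x)"
        by (simp only: norm_of_real abs_of_nonneg[OF nn] abs_of_nonneg[OF enn2real_nonneg])
    qed
  qed
  also have "\<dots> = ennreal (norm (complex_of_real C)) * X w" by (rule bqb_cmult[OF X wm])
  also have "\<dots> < \<infinity>" using decay unfolding w_def[symmetric] by (simp add: ennreal_mult_less_top)
  finally have "hardy_norm N X (dist_of g) < \<infinity>"
    using fin by (simp add: hardy_norm_def ext_norm_def)
  then show ?thesis using t by (simp add: hardy_def)
qed

section \<open>The Lorentz--Luxemburg theorem\<close>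

lemma integrable_mult_squares:
  fixes f g :: "'a \<Rightarrow> real"
  assumes "f \<in> borel_measurable M" "g \<in> borel_measurable M"
    "integrable M (\<lambda>x. (f x)\<^sup>2)" "integrable M (\<lambda>x. (g x)\<^sup>2)"
  shows "integrable M (\<lambda>x. f x * g x)"
proof (rule Bochner_Integration.integrable_bound)
  show "integrable M (\<lambda>x. (f x)\<^sup>2 + (g x)\<^sup>2)" using assms by simp
  show "(\<lambda>x. f x * g x) \<in> borel_measurable M" using assms by simp
  show "AE x in M. norm (f x * g x) \<le> norm ((f x)\<^sup>2 + (g x)\<^sup>2)"
  proof (rule AE_I2)
    fix x
    have "0 \<le> (\<bar>f x\<bar> - \<bar>g x\<bar>)\<^sup>2" "0 \<le> \<bar>f x\<bar> * \<bar>g x\<bar>" by simp_all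
    then have "\<bar>f x\<bar> * \<bar>g x\<bar> \<le> (f x)\<^sup>2 + (g x)\<^sup>2"
      unfolding power2_diff power2_abs by linarith
    then show "norm (f x * g x) \<le> norm ((f x)\<^sup>2 + (g x)\<^sup>2)"
      by (simp add: abs_mult)
  qed
qed

lemma integrable_square_lincomb:
  fixes f g :: "'a \<Rightarrow> real"
  assumes "f \<in> borel_measurable M" "g \<in> borel_measurable M"
    "integrable M (\<lambda>x. (f x)\<^sup>2)" "integrable M (\<lambda>x. (g x)\<^sup>2)"
  shows "integrable M (\<lambda>x. (a * f x + b * g x)\<^sup>2)"
proof -
  have "(a * f x + b * g x)\<^sup>2 = a\<^sup>2 * (f x)\<^sup>2 + (2 * a * b) * (f x * g x) + b\<^sup>2 * (g x)\<^sup>2" for x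
    by (simp add: power2_eq_square algebra_simps)
  then show ?thesis using assms integrable_mult_squares[OF assms] by simp
qed

lemma integrable_square_diff:
  fixes f g :: "'a \<Rightarrow> real"
  assumes "f \<in> borel_measurable M" "g \<in> borel_measurable M"
    "integrable M (\<lambda>x. (f x)\<^sup>2)" "integrable M (\<lambda>x. (g x)\<^sup>2)"
  shows "integrable M (\<lambda>x. (f x - g x)\<^sup>2)"
  using integrable_square_lincomb[OF assms, of 1 "-1"] by simp

text \<open>The parallelogram law makes a minimising sequence Cauchy in L^2. Since the members of
  \<open>U\<close> vanish off a set of finite measure, it is Cauchy in L^1 as well, so a subsequence
  converges almost everywhere, and Fatou's lemma shows that the limit attains the minimum. The
  conclusion is the variational inequality of the nearest point.\<close>

lemma L2_projection:
  fixes U :: "('a \<Rightarrow> real) set" and G :: "'a \<Rightarrow> real"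
  assumes B: "B \<in> sets M" "emeasure M B < \<infinity>"
    and Um: "\<And>u. u \<in> U \<Longrightarrow> u \<in> borel_measurable M"
    and Ui: "\<And>u. u \<in> U \<Longrightarrow> integrable M (\<lambda>x. (u x)\<^sup>2)"
    and UB: "\<And>u x. u \<in> U \<Longrightarrow> x \<notin> B \<Longrightarrow> u x = 0"
    and conv: "\<And>u v t. u \<in> U \<Longrightarrow> v \<in> U \<Longrightarrow> 0 \<le> t \<Longrightarrow> t \<le> 1 \<Longrightarrow> (\<lambda>x. (1 - t) * u x + t * v x) \<in> U"
    and closed: "\<And>s u. (\<And>i::nat. s i \<in> U) \<Longrightarrow> u \<in> borel_measurable M \<Longrightarrow> integrable M (\<lambda>x. (u x)\<^sup>2) \<Longrightarrow>
        (\<And>x. x \<notin> B \<Longrightarrow> u x = 0) \<Longrightarrow> AE x in M. (\<lambda>i. s i x) \<longlonglongrightarrow> u x \<Longrightarrow> u \<in> U"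
    and ne: "U \<noteq> {}"
    and G: "G \<in> borel_measurable M" "integrable M (\<lambda>x. (G x)\<^sup>2)"
  obtains u0 where "u0 \<in> U" "\<And>u. u \<in> U \<Longrightarrow> (LINT x|M. (G x - u0 x) * (u x - u0 x)) \<le> 0"
proof -
  define J where "J u = (LINT x|M. (G x - u x)\<^sup>2)" for u
  have J0: "0 \<le> J u" for u by (simp add: J_def)
  have Ji: "integrable M (\<lambda>x. (G x - u x)\<^sup>2)" if "u \<in> U" for u
    by (rule integrable_square_diff[OF G(1) Um[OF that] G(2) Ui[OF that]])
  define \<delta> where "\<delta> = Inf (J ` U)"
  have bdd: "bdd_below (J ` U)" using J0 by (intro bdd_belowI[of _ 0]) auto
  have \<delta>_le: "\<delta> \<le> J u" if "u \<in> U" for u unfolding \<delta>_def using bdd that by (intro cInf_lower) auto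
  have "\<exists>u\<in>U. J u < \<delta> + 1 / real (Suc n)" for n
    using cInf_lessD[of "J ` U" "\<delta> + 1 / real (Suc n)"] ne unfolding \<delta>_def by auto
  then obtain s where s: "\<And>n. s n \<in> U" "\<And>n. J (s n) < \<delta> + 1 / real (Suc n)" by metis
  \<comment> \<open>Parallelogram law; the midpoint of u and v belongs to \<open>U\<close>, which
    accounts for the term with \<delta>.\<close>
  have par: "(LINT x|M. (u x - v x)\<^sup>2) \<le> 2 * J u + 2 * J v - 4 * \<delta>" if uv: "u \<in> U" "v \<in> U" for u v
  proof -
    define w where "w = (\<lambda>x. (1 - 1/2) * u x + (1/2) * v x)"
    have w: "w \<in> U" unfolding w_def by (rule conv[OF uv]) auto
    have "(u x - v x)\<^sup>2 = 2 * (G x - u x)\<^sup>2 + 2 * (G x - v x)\<^sup>2 - 4 * (G x - w x)\<^sup>2" for x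
      by (simp add: w_def power2_eq_square field_simps)
    then have "(LINT x|M. (u x - v x)\<^sup>2) = 2 * J u + 2 * J v - 4 * J w"
      unfolding J_def using Ji uv w by simp
    then show ?thesis using \<delta>_le[OF w] by simp
  qed
  define V where "V = measure M B"
  have V0: "0 \<le> V" by (simp add: V_def)
  have iB: "integrable M (indicator B :: 'a \<Rightarrow> real)" using B by (intro integrable_real_indicator) auto
  have L1i: "integrable M (s n)" for n
  proof (rule Bochner_Integration.integrable_bound)
    show "integrable M (\<lambda>x. (s n x)\<^sup>2 + indicator B x)" using Ui[OF s(1)] iB by simp
    show "s n \<in> borel_measurable M" by (rule Um[OF s(1)])
    show "AE x in M. norm (s n x) \<le> norm ((s n x)\<^sup>2 + indicator B x)"
    proof (rule AE_I2)
      fix x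
      have "\<bar>t\<bar> \<le> t\<^sup>2 + 1" for t :: real
        using zero_le_power2[of "\<bar>t\<bar> - 1"] zero_le_power2[of t] unfolding power2_diff by simp
      then show "norm (s n x) \<le> norm ((s n x)\<^sup>2 + indicator B x)"
        using UB[OF s(1), of x n] by (cases "x \<in> B") auto
    qed
  qed
  have "\<exists>N. \<forall>i\<ge>N. \<forall>j\<ge>N. (LINT x|M. norm (s i x - s j x)) < e" if e: "e > 0" for e :: real
  proof -
    \<comment> \<open>On \<open>B\<close> the inequality |t| \<le> \<epsilon> + t^2/\<epsilon> turns
      L^2 smallness into L^1 smallness. The first summand integrates to \<epsilon> V < e, and e' is
      chosen so that the total is exactly e.\<close>
    define \<epsilon> where "\<epsilon> = e / (V + 1)"
    have \<epsilon>: "\<epsilon> > 0" using e V0 by (simp add: \<epsilon>_def)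
    have \<epsilon>V: "\<epsilon> * V < e" using e V0 by (simp add: \<epsilon>_def field_simps)
    define e' where "e' = (e - \<epsilon> * V) * \<epsilon> / 4"
    have e': "e' > 0" using \<epsilon> \<epsilon>V by (simp add: e'_def)
    obtain N where N: "1 / real (Suc N) < e'" using reals_Archimedean[OF e'] by (auto simp: inverse_eq_divide)
    have "(LINT x|M. norm (s i x - s j x)) < e" if ij: "i \<ge> N" "j \<ge> N" for i j
    proof -
      have sq: "integrable M (\<lambda>x. (s i x - s j x)\<^sup>2)"
        by (rule integrable_square_diff[OF Um[OF s(1)] Um[OF s(1)] Ui[OF s(1)] Ui[OF s(1)]])
      have "(LINT x|M. norm (s i x - s j x)) \<le> (LINT x|M. \<epsilon> * indicator B x + (1 / \<epsilon>) * (s i x - s j x)\<^sup>2)"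
      proof (rule Bochner_Integration.integral_mono)
        show "integrable M (\<lambda>x. norm (s i x - s j x))" using L1i by simp
        show "integrable M (\<lambda>x. \<epsilon> * indicator B x + (1 / \<epsilon>) * (s i x - s j x)\<^sup>2)" using sq iB by simp
        fix x
        have "\<bar>t\<bar> \<le> \<epsilon> + (1 / \<epsilon>) * t\<^sup>2" for t :: real
        proof -
          have "0 \<le> (\<bar>t\<bar> - \<epsilon>)\<^sup>2" "0 \<le> \<epsilon> * \<bar>t\<bar>" using \<epsilon> by auto
          then have "\<epsilon> * \<bar>t\<bar> \<le> \<epsilon>\<^sup>2 + t\<^sup>2" unfolding power2_diff by (simp add: mult_ac)
          then show ?thesis using \<epsilon> by (simp add: field_simps power2_eq_square)
        qed
        then show "norm (s i x - s j x) \<le> \<epsilon> * indicator B x + (1 / \<epsilon>) * (s i x - s j x)\<^sup>2"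
          using UB[OF s(1), of x i] UB[OF s(1), of x j] by (cases "x \<in> B") auto
      qed
      also have "\<dots> = \<epsilon> * V + (1 / \<epsilon>) * (LINT x|M. (s i x - s j x)\<^sup>2)"
        using sq iB B(1) by (simp add: V_def)
      finally have le: "(LINT x|M. norm (s i x - s j x)) \<le> \<epsilon> * V + (1 / \<epsilon>) * (LINT x|M. (s i x - s j x)\<^sup>2)" .
      have "(LINT x|M. (s i x - s j x)\<^sup>2) \<le> 4 * (1 / real (Suc N))"
      proof -
        have "1 / real (Suc i) \<le> 1 / real (Suc N)" "1 / real (Suc j) \<le> 1 / real (Suc N)"
          using ij by (auto intro!: divide_left_mono)
        then show ?thesis using par[OF s(1)[of i] s(1)[of j]] s(2)[of i] s(2)[of j] by linarith
      qed
      then have "(LINT x|M. (s i x - s j x)\<^sup>2) < 4 * e'" using N by simp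
      then have "(1 / \<epsilon>) * (LINT x|M. (s i x - s j x)\<^sup>2) < (1 / \<epsilon>) * (4 * e')"
        using \<epsilon> by (intro mult_strict_left_mono) auto
      with le have "(LINT x|M. norm (s i x - s j x)) < \<epsilon> * V + (1 / \<epsilon>) * (4 * e')" by linarith
      also have "\<dots> = e" using \<epsilon> by (simp add: e'_def)
      finally show ?thesis .
    qed
    then show ?thesis by blast
  qed
  from cauchy_L1_AE_cauchy_subseq[OF L1i this]
  obtain r where r: "strict_mono r" "AE x in M. Cauchy (\<lambda>i. s (r i) x)" by auto
  define u0 where "u0 x = lim (\<lambda>i. s (r i) x)" for x
  have u0m: "u0 \<in> borel_measurable M" unfolding u0_def[abs_def] using Um[OF s(1)] by measurable
  have lim: "AE x in M. (\<lambda>i. s (r i) x) \<longlonglongrightarrow> u0 x"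
    using r(2) by eventually_elim (auto simp: u0_def Cauchy_convergent_iff convergent_LIMSEQ_iff)
  have u0B: "u0 x = 0" if "x \<notin> B" for x using UB[OF s(1) that] by (simp add: u0_def)
  have fat: "(\<integral>\<^sup>+x. ennreal ((G x - u0 x)\<^sup>2) \<partial>M) \<le> ennreal \<delta>"
  proof -
    have "(\<integral>\<^sup>+x. ennreal ((G x - u0 x)\<^sup>2) \<partial>M) = (\<integral>\<^sup>+x. liminf (\<lambda>i. ennreal ((G x - s (r i) x)\<^sup>2)) \<partial>M)"
    proof (rule nn_integral_cong_AE)
      show "AE x in M. ennreal ((G x - u0 x)\<^sup>2) = liminf (\<lambda>i. ennreal ((G x - s (r i) x)\<^sup>2))"
        using lim
      proof eventually_elim
        fix x assume "(\<lambda>i. s (r i) x) \<longlonglongrightarrow> u0 x"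
        then have "(\<lambda>i. ennreal ((G x - s (r i) x)\<^sup>2)) \<longlonglongrightarrow> ennreal ((G x - u0 x)\<^sup>2)"
          by (intro tendsto_ennrealI tendsto_intros)
        then show "ennreal ((G x - u0 x)\<^sup>2) = liminf (\<lambda>i. ennreal ((G x - s (r i) x)\<^sup>2))"
          by (intro lim_imp_Liminf[symmetric]) auto
      qed
    qed
    also have "\<dots> \<le> liminf (\<lambda>i. \<integral>\<^sup>+x. ennreal ((G x - s (r i) x)\<^sup>2) \<partial>M)"
      using Um[OF s(1)] G(1) by (intro nn_integral_liminf) measurable
    also have "\<dots> = liminf (\<lambda>i. ennreal (J (s (r i))))"
      unfolding J_def by (intro arg_cong[where f = liminf] ext nn_integral_eq_integral Ji s(1)) auto
    also have "(\<lambda>i. ennreal (J (s (r i)))) \<longlonglongrightarrow> ennreal \<delta>"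
    proof (rule tendsto_ennrealI, rule tendsto_sandwich[OF _ _ tendsto_const])
      show "\<forall>\<^sub>F i in sequentially. \<delta> \<le> J (s (r i))" using \<delta>_le s(1) by simp
      show "\<forall>\<^sub>F i in sequentially. J (s (r i)) \<le> \<delta> + 1 / real (Suc (r i))" using s(2) by (intro always_eventually allI less_imp_le)
      have "(\<lambda>i. \<delta> + 1 / real (Suc i)) \<longlonglongrightarrow> \<delta> + 0"
        by (intro tendsto_add tendsto_const LIMSEQ_inverse_real_of_nat[unfolded inverse_eq_divide])
      from LIMSEQ_subseq_LIMSEQ[OF this r(1)]
      show "(\<lambda>i. \<delta> + 1 / real (Suc (r i))) \<longlonglongrightarrow> \<delta>" by (simp add: o_def)
    qed
    then have "liminf (\<lambda>i. ennreal (J (s (r i)))) = ennreal \<delta>" by (intro lim_imp_Liminf) auto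
    finally show ?thesis .
  qed
  have Gu: "integrable M (\<lambda>x. (G x - u0 x)\<^sup>2)"
    using fat u0m G(1) by (intro integrableI_nonneg) (auto intro: le_less_trans)
  have u0i: "integrable M (\<lambda>x. (u0 x)\<^sup>2)"
    using integrable_square_diff[OF G(1) _ G(2) Gu] u0m G(1) by simp
  have u0U: "u0 \<in> U" by (rule closed[OF _ u0m u0i u0B lim]) (rule s(1))
  have \<delta>0: "0 \<le> \<delta>" unfolding \<delta>_def using ne J0 by (intro cInf_greatest) auto
  have J\<delta>: "J u0 \<le> \<delta>"
  proof -
    have "ennreal (J u0) \<le> ennreal \<delta>"
      using fat nn_integral_eq_integral[OF Gu] by (simp add: J_def)
    then show ?thesis using \<delta>0 by (simp add: ennreal_le_iff)
  qed
  have "(LINT x|M. (G x - u0 x) * (u x - u0 x)) \<le> 0" if u: "u \<in> U" for u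
  proof -
    define P where "P = (LINT x|M. (G x - u0 x) * (u x - u0 x))"
    define Q where "Q = (LINT x|M. (u x - u0 x)\<^sup>2)"
    have iP: "integrable M (\<lambda>x. (G x - u0 x) * (u x - u0 x))"
      using u u0m G(1) Um[OF u] by (intro integrable_mult_squares Gu integrable_square_diff Ui u0i) auto
    have iQ: "integrable M (\<lambda>x. (u x - u0 x)\<^sup>2)"
      by (rule integrable_square_diff[OF Um[OF u] u0m Ui[OF u] u0i])
    \<comment> \<open>The squared distance to G is expanded along the segment from u0 to u.
      Minimality at t = 0 and division by t give this inequality; then t tends to 0.\<close>
    have "2 * P \<le> t * Q" if t: "0 < t" "t \<le> 1" for t
    proof -
      have "(\<lambda>x. (1 - t) * u0 x + t * u x) \<in> U" using t by (intro conv u0U u) auto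
      then have "\<delta> \<le> J (\<lambda>x. (1 - t) * u0 x + t * u x)" by (rule \<delta>_le)
      also have "\<dots> = (LINT x|M. (G x - u0 x)\<^sup>2 - (2 * t) * ((G x - u0 x) * (u x - u0 x)) + t\<^sup>2 * (u x - u0 x)\<^sup>2)"
        unfolding J_def by (intro Bochner_Integration.integral_cong refl) (simp add: power2_eq_square algebra_simps)
      also have "\<dots> = J u0 - (2 * t) * P + t\<^sup>2 * Q"
        unfolding J_def P_def Q_def using Gu iP iQ by simp
      finally have "2 * t * P \<le> t\<^sup>2 * Q" using J\<delta> by simp
      then show ?thesis using t by (simp add: power2_eq_square)
    qed
    then have ev: "\<forall>\<^sub>F t in at_right 0. 2 * P \<le> t * Q"
      unfolding eventually_at_right[OF zero_less_one] by (intro exI[of _ 1]) auto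
    have "((\<lambda>t. t * Q) \<longlongrightarrow> 0 * Q) (at_right 0)" by (intro tendsto_intros)
    then have "2 * P \<le> 0 * Q" using ev by (rule tendsto_lowerbound) simp
    then show ?thesis by (simp add: P_def)
  qed
  with u0U show thesis by (rule that)
qed

section \<open>Duality between a ball Banach function space and its associate space\<close>

lemma bqb_real_mono:
  assumes "ball_quasi_banach X" "f \<in> borel_measurable lebesgue" "g \<in> borel_measurable lebesgue"
    "AE x in lebesgue. \<bar>g x\<bar> \<le> \<bar>f x\<bar>"
  shows "X (\<lambda>x. complex_of_real (g x)) \<le> X (\<lambda>x. complex_of_real (f x))"
  using assms by (intro bqb_mono) auto

lemma bqb_zero_fun: "ball_quasi_banach X \<Longrightarrow> X (\<lambda>x. 0) = 0"
  using bqb_cmult[of X "\<lambda>_. 0" 0] by simp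

text \<open>Fatou's lemma for the quasi-norm: the tail infima of |u i| increase to |v| almost
  everywhere, which brings in the monotone convergence axiom. Consequently balls of the quasi-norm
  are closed under limits almost everywhere.\<close>

lemma bqb_liminf:
  fixes u :: "nat \<Rightarrow> real^'n::finite \<Rightarrow> real"
  assumes X: "ball_quasi_banach X" and um: "\<And>i. u i \<in> borel_measurable lebesgue" and vm: "v \<in> borel_measurable lebesgue"
    and le: "\<And>i. X (\<lambda>x. complex_of_real (u i x)) \<le> K" and lim: "AE x in lebesgue. (\<lambda>i. u i x) \<longlonglongrightarrow> v x"
  shows "X (\<lambda>x. complex_of_real (v x)) \<le> K"
proof -
  define w where "w n x = (INF k\<in>{n..}. \<bar>u k x\<bar>)" for n x
  have bdd: "bdd_below ((\<lambda>k. \<bar>u k x\<bar>) ` {n..})" for n x by (rule bdd_belowI[of _ 0]) auto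
  have w0: "0 \<le> w n x" for n x unfolding w_def by (rule cINF_greatest) auto
  have w_le: "w n x \<le> \<bar>u k x\<bar>" if "n \<le> k" for n k x unfolding w_def using bdd that by (intro cINF_lower) auto
  have wm: "w n \<in> borel_measurable lebesgue" for n
    unfolding w_def[abs_def] using bdd um by (intro borel_measurable_cINF) auto
  have inc: "incseq (\<lambda>n. w n x)" for x
    unfolding w_def by (intro incseq_SucI cINF_superset_mono bdd) auto
  have wl: "(\<lambda>n. w n x) \<longlonglongrightarrow> \<bar>v x\<bar>" if "(\<lambda>i. u i x) \<longlonglongrightarrow> v x" for x
  proof (rule LIMSEQ_I)
    fix e :: real assume e: "e > 0"
    have "(\<lambda>i. \<bar>u i x\<bar>) \<longlonglongrightarrow> \<bar>v x\<bar>" using that by (intro tendsto_intros)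
    from LIMSEQ_D[OF this, of "e / 2"] e obtain N where N: "\<And>k. N \<le> k \<Longrightarrow> \<bar>\<bar>u k x\<bar> - \<bar>v x\<bar>\<bar> < e / 2" by auto
    show "\<exists>N. \<forall>n\<ge>N. norm (w n x - \<bar>v x\<bar>) < e"
    proof (intro exI allI impI)
      fix n assume n: "N \<le> n"
      have "\<bar>v x\<bar> - e / 2 \<le> w n x" unfolding w_def
      proof (rule cINF_greatest)
        fix k assume "k \<in> {n..}"
        then have "\<bar>\<bar>u k x\<bar> - \<bar>v x\<bar>\<bar> < e / 2" using N[of k] n by simp
        then show "\<bar>v x\<bar> - e / 2 \<le> \<bar>u k x\<bar>" by linarith
      qed simp
      moreover have "w n x \<le> \<bar>u n x\<bar>" by (rule w_le) simp
      ultimately show "norm (w n x - \<bar>v x\<bar>) < e" using N[OF n] e unfolding real_norm_def by linarith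
    qed
  qed
  have "(\<lambda>n. X (\<lambda>x. complex_of_real (w n x))) \<longlonglongrightarrow> X (\<lambda>x. complex_of_real \<bar>v x\<bar>)"
    by (rule bqb_Fatou(2)[OF X wm]) (use vm lim in \<open>auto simp: w0 inc intro: wl\<close>)
  moreover have "X (\<lambda>x. complex_of_real (w n x)) \<le> K" for n
    using bqb_real_mono[OF X um wm, of n n] w_le[of n n] w0 le[of n] by (auto intro: order_trans)
  ultimately have "X (\<lambda>x. complex_of_real \<bar>v x\<bar>) \<le> K" by (intro LIMSEQ_le_const2) auto
  moreover have "X (\<lambda>x. complex_of_real (v x)) \<le> X (\<lambda>x. complex_of_real \<bar>v x\<bar>)"
    by (rule bqb_real_mono[OF X]) (use vm in auto)
  ultimately show ?thesis by simp
qed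

lemma ball_banachD:
  assumes "ball_banach Z"
  shows bb_bqb: "ball_quasi_banach Z"
    and bb_add: "f \<in> fspace Z \<Longrightarrow> g \<in> fspace Z \<Longrightarrow> Z (\<lambda>x. f x + g x) \<le> Z f + Z g"
    and bb_ball: "0 < r \<Longrightarrow> \<exists>C>0. \<forall>f \<in> fspace Z. (\<integral>\<^sup>+x\<in>ball c r. ennreal (norm (f x)) \<partial>lebesgue) \<le> ennreal C * Z f"
  using assms unfolding ball_banach_def by blast+

text \<open>A function in the polar of the associate unit ball is separated from the unit ball of \<open>Z\<close> by its
  projection in \<open>L\<^sup>2\<close>; Fatou's property makes that ball closed there, so that Hahn--Banach is not needed.\<close>

lemma lorentz_luxemburg_bounded:
  fixes Z :: "'n::finite fun_norm" and G :: "real^'n \<Rightarrow> real"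
  assumes Z: "ball_banach Z" and K: "K > 0" and Gm: "G \<in> borel_measurable lebesgue"
    and G0: "\<And>x. 0 \<le> G x" and GM: "\<And>x. G x \<le> M" and GB: "\<And>x. x \<notin> ball 0 r \<Longrightarrow> G x = 0"
    and dual: "\<And>h. h \<in> borel_measurable lebesgue \<Longrightarrow> (\<And>x. 0 \<le> h x) \<Longrightarrow>
      assoc Z (\<lambda>x. complex_of_real (h x)) \<le> 1 \<Longrightarrow> (\<integral>\<^sup>+x. ennreal (G x * h x) \<partial>lebesgue) \<le> ennreal K"
  shows "Z (\<lambda>x. complex_of_real (G x)) \<le> ennreal K"
proof -
  note X = bb_bqb[OF Z]
  define B where "B = ball (0 :: real^'n) r"
  have Bm [measurable]: "B \<in> sets lebesgue" and Bf: "emeasure lebesgue B < \<infinity>"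
    unfolding B_def using lmeasurable_ball[of 0 r] by (auto simp: fmeasurable_def)
  have iB: "integrable lebesgue (indicator B :: _ \<Rightarrow> real)" using Bf by (intro integrable_real_indicator) auto
  have bdi: "integrable lebesgue (\<lambda>x. (u x)\<^sup>2)" if "u \<in> borel_measurable lebesgue" "\<And>x. \<bar>u x\<bar> \<le> c" "\<And>x. x \<notin> B \<Longrightarrow> u x = 0"
    for u :: "real^'n \<Rightarrow> real" and c
  proof (rule Bochner_Integration.integrable_bound)
    show "integrable lebesgue (\<lambda>x. c\<^sup>2 * indicator B x :: real)" using iB by simp
    show "(\<lambda>x. (u x)\<^sup>2) \<in> borel_measurable lebesgue" using that by simp
    show "AE x in lebesgue. norm ((u x)\<^sup>2) \<le> norm (c\<^sup>2 * indicator B x :: real)"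
    proof (rule AE_I2)
      fix x
      have "(u x)\<^sup>2 \<le> c\<^sup>2" using that(2)[of x] by (intro abs_le_square_iff[THEN iffD1]) linarith
      then show "norm ((u x)\<^sup>2) \<le> norm (c\<^sup>2 * indicator B x :: real)" using that(3)[of x] by (cases "x \<in> B") auto
    qed
  qed
  have G2: "integrable lebesgue (\<lambda>x. (G x)\<^sup>2)"
    by (rule bdi[of G M]) (use Gm G0 GM GB in \<open>auto simp: B_def\<close>)
  \<comment> \<open>The ball of radius K in \<open>Z\<close>, cut down to real square-integrable
    functions that vanish off \<open>B\<close>. If G is not in it, the difference between G and its
    projection is a separating direction.\<close>
  define U where "U = {u \<in> borel_measurable lebesgue. integrable lebesgue (\<lambda>x. (u x)\<^sup>2) \<and> (\<forall>x. x \<notin> B \<longrightarrow> u x = 0) \<and>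
    Z (\<lambda>x. complex_of_real (u x)) \<le> ennreal K}"
  have zU: "(\<lambda>_. 0) \<in> U" using bqb_zero_fun[OF X] by (simp add: U_def)
  have conv: "(\<lambda>x. (1 - t) * u x + t * v x) \<in> U" if uv: "u \<in> U" "v \<in> U" and t: "0 \<le> t" "t \<le> 1" for u v t
  proof -
    have m: "u \<in> borel_measurable lebesgue" "v \<in> borel_measurable lebesgue" using uv by (auto simp: U_def)
    have f: "(\<lambda>x. complex_of_real (1 - t) * complex_of_real (u x)) \<in> fspace Z"
      "(\<lambda>x. complex_of_real t * complex_of_real (v x)) \<in> fspace Z"
      and b: "Z (\<lambda>x. complex_of_real (1 - t) * complex_of_real (u x)) \<le> ennreal (1 - t) * ennreal K"
      "Z (\<lambda>x. complex_of_real t * complex_of_real (v x)) \<le> ennreal t * ennreal K"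
    proof -
      have 1: "Z (\<lambda>x. complex_of_real c * complex_of_real (w x)) \<le> ennreal c * ennreal K" if "w \<in> U" "0 \<le> c" for c w
      proof -
        have "Z (\<lambda>x. complex_of_real c * complex_of_real (w x)) = ennreal c * Z (\<lambda>x. complex_of_real (w x))"
          using that by (subst bqb_cmult[OF X]) (auto simp: U_def norm_of_real)
        also have "\<dots> \<le> ennreal c * ennreal K" using that by (intro mult_left_mono) (auto simp: U_def)
        finally show ?thesis .
      qed
      show b: "Z (\<lambda>x. complex_of_real (1 - t) * complex_of_real (u x)) \<le> ennreal (1 - t) * ennreal K"
        "Z (\<lambda>x. complex_of_real t * complex_of_real (v x)) \<le> ennreal t * ennreal K"
        by (rule 1[OF uv(1)], use t in simp) (rule 1[OF uv(2) t(1)])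
      show "(\<lambda>x. complex_of_real (1 - t) * complex_of_real (u x)) \<in> fspace Z"
        "(\<lambda>x. complex_of_real t * complex_of_real (v x)) \<in> fspace Z"
        unfolding fspace_def using m le_less_trans[OF b(1)] le_less_trans[OF b(2)] by (auto simp: ennreal_mult_less_top)
    qed
    have "Z (\<lambda>x. complex_of_real ((1 - t) * u x + t * v x)) =
        Z (\<lambda>x. complex_of_real (1 - t) * complex_of_real (u x) + complex_of_real t * complex_of_real (v x))" by simp
    also have "\<dots> \<le> ennreal (1 - t) * ennreal K + ennreal t * ennreal K"
      by (rule order_trans[OF bb_add[OF Z f]]) (intro add_mono b)
    also have "\<dots> = ennreal K" using t K
      by (simp add: ennreal_mult[symmetric] ennreal_plus[symmetric] algebra_simps del: ennreal_plus)
    finally have "Z (\<lambda>x. complex_of_real ((1 - t) * u x + t * v x)) \<le> ennreal K" .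
    moreover have "integrable lebesgue (\<lambda>x. ((1 - t) * u x + t * v x)\<^sup>2)"
      using uv by (intro integrable_square_lincomb) (auto simp: U_def)
    ultimately show ?thesis using uv m by (auto simp: U_def)
  qed
  obtain u0 where u0: "u0 \<in> U" "\<And>u. u \<in> U \<Longrightarrow> (LINT x|lebesgue. (G x - u0 x) * (u x - u0 x)) \<le> 0"
  proof (rule L2_projection[of B lebesgue U G])
    show "s \<in> U" if "\<And>i::nat. \<sigma> i \<in> U" "s \<in> borel_measurable lebesgue" "integrable lebesgue (\<lambda>x. (s x)\<^sup>2)"
        "\<And>x. x \<notin> B \<Longrightarrow> s x = 0" "AE x in lebesgue. (\<lambda>i. \<sigma> i x) \<longlonglongrightarrow> s x" for \<sigma> s
    proof -
      have "Z (\<lambda>x. complex_of_real (s x)) \<le> ennreal K"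
        by (rule bqb_liminf[OF X _ that(2) _ that(5)]) (use that(1) in \<open>auto simp: U_def\<close>)
      then show ?thesis using that by (simp add: U_def)
    qed
    show "U \<noteq> {}" using zU by blast
  qed (use Bf Gm G2 conv in \<open>auto simp: U_def\<close>)
  have u0': "u0 \<in> borel_measurable lebesgue" "integrable lebesgue (\<lambda>x. (u0 x)\<^sup>2)" "\<And>x. x \<notin> B \<Longrightarrow> u0 x = 0"
    "Z (\<lambda>x. complex_of_real (u0 x)) \<le> ennreal K" using u0(1) by (auto simp: U_def)
  define h where "h x = G x - u0 x" for x
  have hm [measurable]: "h \<in> borel_measurable lebesgue" using Gm u0'(1) by (simp add: h_def[abs_def])
  have h2: "integrable lebesgue (\<lambda>x. (h x)\<^sup>2)" unfolding h_def by (rule integrable_square_diff[OF Gm u0'(1) G2 u0'(2)])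
  have hB: "h x = 0" if "x \<notin> B" for x using that u0'(3) GB by (auto simp: h_def B_def)
  \<comment> \<open>By the variational inequality, \<rho> is the largest pairing of h with a member
    of \<open>U\<close>.\<close>
  define \<rho> where "\<rho> = (LINT x|lebesgue. h x * u0 x)"
  have ihu0: "integrable lebesgue (\<lambda>x. h x * u0 x)" by (rule integrable_mult_squares[OF hm u0'(1) h2 u0'(2)])
  have hu: "(LINT x|lebesgue. h x * u x) \<le> \<rho>" and ihu: "integrable lebesgue (\<lambda>x. h x * u x)" if "u \<in> U" for u
  proof -
    show i: "integrable lebesgue (\<lambda>x. h x * u x)"
      using that by (intro integrable_mult_squares h2) (auto simp: U_def)
    have "(LINT x|lebesgue. h x * u x) - \<rho> = (LINT x|lebesgue. (G x - u0 x) * (u x - u0 x))"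
      unfolding \<rho>_def using i ihu0 by (simp add: h_def right_diff_distrib)
    with u0(2)[OF that] show "(LINT x|lebesgue. h x * u x) \<le> \<rho>" by simp
  qed
  have \<rho>0: "0 \<le> \<rho>" using hu[OF zU] by simp
  \<comment> \<open>The functions K sgn(h) min(|g|, n), cut off to \<open>B\<close>, belong to
    \<open>U\<close>; pairing them with h and letting n grow gives the claim.\<close>
  have dualh: "ennreal K * (\<integral>\<^sup>+x. ennreal (\<bar>h x\<bar> * norm (g x)) \<partial>lebesgue) \<le> ennreal \<rho>" if g: "g \<in> fspace Z" "Z g = 1" for g
  proof -
    have gm [measurable]: "g \<in> borel_measurable lebesgue" using g by (simp add: fspace_def)
    define T where "T n x = min (norm (g x)) (real n) * indicator B x" for n x
    have Tm [measurable]: "T n \<in> borel_measurable lebesgue" for n unfolding T_def[abs_def] by measurable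
    have step: "ennreal K * (\<integral>\<^sup>+x. ennreal (\<bar>h x\<bar> * T n x) \<partial>lebesgue) \<le> ennreal \<rho>" for n
    proof -
      define u where "u x = K * (sgn (h x) * T n x)" for x
      have um: "u \<in> borel_measurable lebesgue" unfolding u_def[abs_def] by measurable
      have sg: "\<bar>sgn t * a\<bar> \<le> a" if "0 \<le> a" for t a :: real using that by (simp add: abs_mult abs_sgn_eq)
      have Tn: "0 \<le> T n x" "T n x \<le> real n" "T n x \<le> norm (g x)" for x
        by (auto simp: T_def split: split_indicator)
      have ub: "\<bar>u x\<bar> \<le> K * T n x" for x unfolding u_def using sg[OF Tn(1)] K by (simp add: abs_mult)
      have "Z (\<lambda>x. complex_of_real (u x)) \<le> Z (\<lambda>x. complex_of_real K * g x)"
      proof (rule bqb_mono[OF X])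
        show "AE x in lebesgue. norm (complex_of_real (u x)) \<le> norm (complex_of_real K * g x)"
        proof (rule AE_I2)
          fix x
          have "\<bar>u x\<bar> \<le> K * norm (g x)" using ub[of x] mult_left_mono[OF Tn(3)[of x], of K] K by linarith
          then show "norm (complex_of_real (u x)) \<le> norm (complex_of_real K * g x)" using K by (simp add: norm_mult)
        qed
      qed (use um in measurable)
      also have "\<dots> = ennreal K" using bqb_cmult[OF X gm, of "complex_of_real K"] g K by simp
      finally have "Z (\<lambda>x. complex_of_real (u x)) \<le> ennreal K" .
      moreover have "integrable lebesgue (\<lambda>x. (u x)\<^sup>2)"
      proof (rule bdi[OF um])
        show "\<bar>u x\<bar> \<le> K * real n" for x using ub[of x] mult_left_mono[OF Tn(2)[of x], of K] K by linarith
        show "x \<notin> B \<Longrightarrow> u x = 0" for x by (simp add: u_def T_def)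
      qed
      ultimately have uU: "u \<in> U" using um by (auto simp: U_def u_def T_def)
      have hu_eq: "h x * u x = K * (\<bar>h x\<bar> * T n x)" for x by (simp add: u_def abs_sgn mult_ac)
      have "ennreal K * (\<integral>\<^sup>+x. ennreal (\<bar>h x\<bar> * T n x) \<partial>lebesgue) = (\<integral>\<^sup>+x. ennreal (h x * u x) \<partial>lebesgue)"
        unfolding hu_eq using K Tn(1) by (subst nn_integral_cmult[symmetric]) (auto simp: ennreal_mult)
      also have "\<dots> = ennreal (LINT x|lebesgue. h x * u x)"
        by (rule nn_integral_eq_integral[OF ihu[OF uU]]) (use K Tn(1) in \<open>simp add: hu_eq\<close>)
      also have "\<dots> \<le> ennreal \<rho>" by (rule ennreal_leI[OF hu[OF uU]])
      finally show ?thesis .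
    qed
    have "(\<integral>\<^sup>+x. ennreal (\<bar>h x\<bar> * norm (g x)) \<partial>lebesgue) = (\<integral>\<^sup>+x. (SUP n. ennreal (\<bar>h x\<bar> * T n x)) \<partial>lebesgue)"
    proof (intro nn_integral_cong)
      fix x
      obtain N :: nat where N: "norm (g x) \<le> real N" using real_arch_simple by blast
      have "(SUP n. ennreal (\<bar>h x\<bar> * T n x)) = ennreal (\<bar>h x\<bar> * norm (g x))"
      proof (rule antisym)
        show "(SUP n. ennreal (\<bar>h x\<bar> * T n x)) \<le> ennreal (\<bar>h x\<bar> * norm (g x))"
          by (intro SUP_least ennreal_leI mult_left_mono) (auto simp: T_def split: split_indicator)
        have "ennreal (\<bar>h x\<bar> * norm (g x)) = ennreal (\<bar>h x\<bar> * T N x)"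
          using N hB[of x] by (cases "x \<in> B") (auto simp: T_def)
        then show "ennreal (\<bar>h x\<bar> * norm (g x)) \<le> (SUP n. ennreal (\<bar>h x\<bar> * T n x))" by (metis SUP_upper UNIV_I)
      qed
      then show "ennreal (\<bar>h x\<bar> * norm (g x)) = (SUP n. ennreal (\<bar>h x\<bar> * T n x))" ..
    qed
    also have "\<dots> = (SUP n. \<integral>\<^sup>+x. ennreal (\<bar>h x\<bar> * T n x) \<partial>lebesgue)"
      by (rule nn_integral_monotone_convergence_SUP)
        (auto simp: incseq_def le_fun_def T_def intro!: ennreal_leI mult_left_mono mult_right_mono)
    finally show ?thesis
      using step by (simp add: SUP_mult_left_ennreal SUP_least)
  qed
  \<comment> \<open>Since \<rho> may vanish, \<epsilon> is added: then K/(\<rho> + \<epsilon>) times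
    |h| lies in the associate unit ball and may be inserted in \<open>dual\<close>.\<close>
  have GH: "(\<integral>\<^sup>+x. ennreal (G x * \<bar>h x\<bar>) \<partial>lebesgue) \<le> ennreal (\<rho> + \<epsilon>)" if \<epsilon>: "\<epsilon> > 0" for \<epsilon>
  proof -
    define c where "c = K / (\<rho> + \<epsilon>)"
    have c: "c > 0" using K \<rho>0 \<epsilon> by (simp add: c_def)
    have "assoc Z (\<lambda>x. complex_of_real (c * \<bar>h x\<bar>)) \<le> 1"
      unfolding assoc_def
    proof (rule SUP_least)
      fix g assume "g \<in> {g \<in> fspace Z. Z g = 1}"
      then have g: "g \<in> fspace Z" "Z g = 1" by auto
      then have gm [measurable]: "g \<in> borel_measurable lebesgue" by (simp add: fspace_def)
      have "(\<integral>\<^sup>+x. ennreal (norm (complex_of_real (c * \<bar>h x\<bar>) * g x)) \<partial>lebesgue) =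
          (\<integral>\<^sup>+x. ennreal (1 / (\<rho> + \<epsilon>)) * (ennreal K * ennreal (\<bar>h x\<bar> * norm (g x))) \<partial>lebesgue)"
      proof (intro nn_integral_cong)
        fix x
        have "norm (complex_of_real (c * \<bar>h x\<bar>) * g x) = c * (\<bar>h x\<bar> * norm (g x))"
          using c by (simp only: norm_mult norm_of_real abs_mult abs_abs abs_of_pos mult.assoc)
        also have "\<dots> = 1 / (\<rho> + \<epsilon>) * (K * (\<bar>h x\<bar> * norm (g x)))" by (simp add: c_def)
        finally show "ennreal (norm (complex_of_real (c * \<bar>h x\<bar>) * g x)) = ennreal (1 / (\<rho> + \<epsilon>)) * (ennreal K * ennreal (\<bar>h x\<bar> * norm (g x)))"
          using K \<rho>0 \<epsilon> by (simp only: ennreal_mult'[of "1 / (\<rho> + \<epsilon>)"] ennreal_mult'[of K] zero_le_divide_1_iff add_nonneg_nonneg less_imp_le)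
      qed
      also have "\<dots> = ennreal (1 / (\<rho> + \<epsilon>)) * (ennreal K * (\<integral>\<^sup>+x. ennreal (\<bar>h x\<bar> * norm (g x)) \<partial>lebesgue))"
        by (simp add: nn_integral_cmult)
      also have "\<dots> \<le> ennreal (1 / (\<rho> + \<epsilon>)) * ennreal \<rho>" by (intro mult_left_mono dualh g) auto
      also have "\<dots> = ennreal (\<rho> / (\<rho> + \<epsilon>))" using \<rho>0 \<epsilon> by (simp add: ennreal_mult[symmetric])
      also have "\<dots> \<le> 1" using \<rho>0 \<epsilon> by simp
      finally show "(\<integral>\<^sup>+x. ennreal (norm (complex_of_real (c * \<bar>h x\<bar>) * g x)) \<partial>lebesgue) \<le> 1" .
    qed
    then have "(\<integral>\<^sup>+x. ennreal (G x * (c * \<bar>h x\<bar>)) \<partial>lebesgue) \<le> ennreal K"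
      using c by (intro dual) auto
    also have "(\<integral>\<^sup>+x. ennreal (G x * (c * \<bar>h x\<bar>)) \<partial>lebesgue) = ennreal c * (\<integral>\<^sup>+x. ennreal (G x * \<bar>h x\<bar>) \<partial>lebesgue)"
      using c G0 Gm by (subst nn_integral_cmult[symmetric]) (auto simp: ennreal_mult[symmetric] mult_ac)
    finally have "ennreal (1 / c) * (ennreal c * (\<integral>\<^sup>+x. ennreal (G x * \<bar>h x\<bar>) \<partial>lebesgue)) \<le> ennreal (1 / c) * ennreal K"
      by (intro mult_left_mono) auto
    moreover have "ennreal (1 / c) * ennreal c = 1" using c by (simp add: ennreal_mult[symmetric])
    moreover have "ennreal (1 / c) * ennreal K = ennreal (\<rho> + \<epsilon>)"
      using c K \<rho>0 \<epsilon> by (simp add: ennreal_mult[symmetric] c_def)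
    ultimately show ?thesis by (simp add: mult.assoc[symmetric])
  qed
  have iGh: "integrable lebesgue (\<lambda>x. G x * h x)" by (rule integrable_mult_squares[OF Gm hm G2 h2])
  have "(LINT x|lebesgue. G x * h x) \<le> \<rho> + \<epsilon>" if \<epsilon>: "\<epsilon> > 0" for \<epsilon>
  proof -
    have "(LINT x|lebesgue. G x * h x) \<le> (LINT x|lebesgue. norm (G x * h x))"
      using iGh by (intro Bochner_Integration.integral_mono) auto
    also have "ennreal \<dots> = (\<integral>\<^sup>+x. ennreal (norm (G x * h x)) \<partial>lebesgue)"
      using iGh by (intro nn_integral_eq_integral[symmetric]) auto
    also have "\<dots> \<le> ennreal (\<rho> + \<epsilon>)" using GH[OF \<epsilon>] G0 by (simp add: abs_mult)
    finally have "ennreal (LINT x|lebesgue. G x * h x) \<le> ennreal (\<rho> + \<epsilon>)" by (simp add: ennreal_leI)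
    then show ?thesis by (subst (asm) ennreal_le_iff) (use \<rho>0 \<epsilon> in auto)
  qed
  then have "(LINT x|lebesgue. G x * h x) \<le> \<rho>" by (rule field_le_epsilon)
  \<comment> \<open>Together with the preceding upper bound \<rho>, this identity forces h = 0
    almost everywhere, so G agrees with the member \<open>u0\<close> of the ball.\<close>
  moreover have "(LINT x|lebesgue. G x * h x) = (LINT x|lebesgue. (h x)\<^sup>2) + \<rho>"
  proof -
    have "G x * h x = (h x)\<^sup>2 + h x * u0 x" for x by (simp add: h_def power2_eq_square algebra_simps)
    then show ?thesis using h2 ihu0 by (simp add: \<rho>_def)
  qed
  moreover have "0 \<le> (LINT x|lebesgue. (h x)\<^sup>2)" by (rule Bochner_Integration.integral_nonneg) simp
  ultimately have "(LINT x|lebesgue. (h x)\<^sup>2) = 0" by linarith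
  then have "AE x in lebesgue. (h x)\<^sup>2 = 0"
    using integral_nonneg_eq_0_iff_AE[OF h2] by simp
  then have "AE x in lebesgue. \<bar>G x\<bar> \<le> \<bar>u0 x\<bar>" by eventually_elim (simp add: h_def)
  then have "Z (\<lambda>x. complex_of_real (G x)) \<le> Z (\<lambda>x. complex_of_real (u0 x))"
    by (intro bqb_real_mono[OF X u0'(1) Gm])
  also have "\<dots> \<le> ennreal K" by (rule u0'(4))
  finally show ?thesis .
qed

text \<open>Truncation in height and support reduces to the bounded case, and
  \<open>bqb_liminf\<close> removes the truncation.\<close>

lemma lorentz_luxemburg:
  fixes Z :: "'n::finite fun_norm" and G :: "real^'n \<Rightarrow> real"
  assumes Z: "ball_banach Z" and K: "K > 0" and Gm: "G \<in> borel_measurable lebesgue"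
    and G0: "\<And>x. 0 \<le> G x"
    and dual: "\<And>h. h \<in> borel_measurable lebesgue \<Longrightarrow> (\<And>x. 0 \<le> h x) \<Longrightarrow>
      assoc Z (\<lambda>x. complex_of_real (h x)) \<le> 1 \<Longrightarrow> (\<integral>\<^sup>+x. ennreal (G x * h x) \<partial>lebesgue) \<le> ennreal K"
  shows "Z (\<lambda>x. complex_of_real (G x)) \<le> ennreal K"
proof (rule bqb_liminf[OF bb_bqb[OF Z]])
  define F where "F n x = min (G x) (real n) * indicator (ball 0 (real n)) x" for n x
  have bm: "ball (0 :: real^'n) (real n) \<in> sets lebesgue" for n using lmeasurable_ball[of 0 "real n"] by (auto simp: fmeasurable_def)
  show Fm: "F n \<in> borel_measurable lebesgue" for n unfolding F_def[abs_def] using Gm bm by measurable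
  show "G \<in> borel_measurable lebesgue" by fact
  have F0: "0 \<le> F n x" and FG: "F n x \<le> G x" for n x using G0[of x] by (auto simp: F_def split: split_indicator)
  show "Z (\<lambda>x. complex_of_real (F n x)) \<le> ennreal K" for n
  proof (rule lorentz_luxemburg_bounded[OF Z K Fm F0])
    show "F n x \<le> real n" for x using G0[of x] by (auto simp: F_def split: split_indicator)
    show "x \<notin> ball 0 (real n) \<Longrightarrow> F n x = 0" for x by (simp add: F_def)
    fix h :: "real^'n \<Rightarrow> real" assume h: "h \<in> borel_measurable lebesgue" "\<And>x. 0 \<le> h x" "assoc Z (\<lambda>x. complex_of_real (h x)) \<le> 1"
    have "(\<integral>\<^sup>+x. ennreal (F n x * h x) \<partial>lebesgue) \<le> (\<integral>\<^sup>+x. ennreal (G x * h x) \<partial>lebesgue)"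
      by (intro nn_integral_mono ennreal_leI mult_right_mono FG h(2))
    also have "\<dots> \<le> ennreal K" by (rule dual[OF h])
    finally show "(\<integral>\<^sup>+x. ennreal (F n x * h x) \<partial>lebesgue) \<le> ennreal K" .
  qed
  show "AE x in lebesgue. (\<lambda>n. F n x) \<longlonglongrightarrow> G x"
  proof (rule AE_I2)
    fix x
    obtain N :: nat where N: "max (G x) (norm x + 1) \<le> real N" using real_arch_simple by blast
    have "\<forall>\<^sub>F n in sequentially. F n x = G x"
      unfolding eventually_sequentially
    proof (intro exI allI impI)
      fix n assume "N \<le> n"
      then have "real N \<le> real n" by simp
      then have "G x \<le> real n" "norm x < real n" using N by linarith+
      then show "F n x = G x" by (simp add: F_def)
    qed
    then show "(\<lambda>n. F n x) \<longlonglongrightarrow> G x" by (rule tendsto_eventually)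
  qed
qed

section \<open>A dyadic weighted inequality\<close>

lemma nn_integral_int_point: "(\<integral>\<^sup>+i. f i * indicator {a} i \<partial>count_space (UNIV :: int set)) = (f a :: ennreal)"
proof -
  have "(\<integral>\<^sup>+i. f i * indicator {a} i \<partial>count_space (UNIV :: int set)) = (\<integral>\<^sup>+i. f a * indicator {a} i \<partial>count_space UNIV)"
    by (intro nn_integral_cong) (auto split: split_indicator)
  also have "\<dots> = f a" by (subst nn_integral_cmult_indicator) auto
  finally show ?thesis .
qed

text \<open>Sums over the integers are written as integrals for the counting measure, so that
  Tonelli's theorem exchanges them with integrals over space.\<close>

lemma int_le_sum: "f a \<le> (\<integral>\<^sup>+i. f i \<partial>count_space (UNIV :: int set))" for f :: "int \<Rightarrow> ennreal"
  unfolding nn_integral_int_point[of f a, symmetric]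
  by (intro nn_integral_mono) (auto split: split_indicator)

definition geo_sum :: "real \<Rightarrow> ennreal" where
  "geo_sum \<tau> = (\<integral>\<^sup>+i. ennreal (\<tau> ^ nat \<bar>i\<bar>) \<partial>count_space (UNIV :: int set))"

lemma geo_sum_finite:
  assumes "0 \<le> \<tau>" "\<tau> < 1" shows "geo_sum \<tau> < \<infinity>"
proof -
  have "geo_sum \<tau> \<le> (\<integral>\<^sup>+i. (\<Sum>n. ennreal (\<tau> ^ n) * indicator {int n, - int n} i) \<partial>count_space UNIV)"
    unfolding geo_sum_def
  proof (intro nn_integral_mono)
    fix i :: int
    have "i \<in> {int (nat \<bar>i\<bar>), - int (nat \<bar>i\<bar>)}" by (cases "0 \<le> i") auto
    then have "ennreal (\<tau> ^ nat \<bar>i\<bar>) = ennreal (\<tau> ^ nat \<bar>i\<bar>) * indicator {int (nat \<bar>i\<bar>), - int (nat \<bar>i\<bar>)} i"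
      by (simp only: indicator_simps mult_1_right)
    also have "\<dots> \<le> (\<Sum>n. ennreal (\<tau> ^ n) * indicator {int n, - int n} i)"
      by (rule ennreal_le_suminf[of "\<lambda>n. ennreal (\<tau> ^ n) * indicator {int n, - int n} i"])
    finally show "ennreal (\<tau> ^ nat \<bar>i\<bar>) \<le> (\<Sum>n. ennreal (\<tau> ^ n) * indicator {int n, - int n} i)" .
  qed
  also have "\<dots> = (\<Sum>n. \<integral>\<^sup>+i. ennreal (\<tau> ^ n) * indicator {int n, - int n} i \<partial>count_space UNIV)"
    by (intro nn_integral_suminf) auto
  also have "\<dots> \<le> (\<Sum>n. ennreal (2 * \<tau> ^ n))"
  proof (intro suminf_le)
    fix n
    have "(\<integral>\<^sup>+i. ennreal (\<tau> ^ n) * indicator {int n, - int n} i \<partial>count_space UNIV) = ennreal (\<tau> ^ n) * of_nat (card {int n, - int n})"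
      by (subst nn_integral_cmult_indicator) auto
    also have "\<dots> \<le> ennreal (\<tau> ^ n) * of_nat 2"
      by (intro mult_left_mono) (auto simp: card_insert_if)
    finally show "(\<integral>\<^sup>+i. ennreal (\<tau> ^ n) * indicator {int n, - int n} i \<partial>count_space UNIV) \<le> ennreal (2 * \<tau> ^ n)"
      using assms by (simp add: ennreal_mult' mult.commute)
  qed auto
  also have "\<dots> = ennreal (\<Sum>n. 2 * \<tau> ^ n)"
    using assms by (intro suminf_ennreal2 summable_mult summable_geometric) auto
  finally show ?thesis by (auto intro: le_less_trans)
qed

text \<open>An injective reindexing uses each exponent at most once.\<close>

lemma geo_sum_inj:
  assumes "inj \<phi>"
  shows "(\<integral>\<^sup>+j. ennreal (\<tau> ^ nat \<bar>\<phi> j\<bar>) \<partial>count_space (UNIV :: int set)) \<le> geo_sum \<tau>"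
proof -
  have "(\<integral>\<^sup>+j. ennreal (\<tau> ^ nat \<bar>\<phi> j\<bar>) \<partial>count_space (UNIV :: int set)) =
      (\<integral>\<^sup>+i. ennreal (\<tau> ^ nat \<bar>i\<bar>) \<partial>count_space (range \<phi>))"
    using nn_integral_bij_count_space[OF inj_on_imp_bij_betw[OF assms], of "\<lambda>i. ennreal (\<tau> ^ nat \<bar>i\<bar>)"] .
  also have "\<dots> = (\<integral>\<^sup>+i. ennreal (\<tau> ^ nat \<bar>i\<bar>) * indicator (range \<phi>) i \<partial>count_space UNIV)"
    by (simp add: nn_integral_count_space_indicator)
  also have "\<dots> \<le> geo_sum \<tau>"
    unfolding geo_sum_def by (intro nn_integral_mono) (auto split: split_indicator)
  finally show ?thesis .
qed

text \<open>A geometric series is comparable to its largest term, which is below v.\<close>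

lemma sum_powers_below:
  assumes "v \<ge> 0"
  shows "(\<integral>\<^sup>+k. ennreal (2 powi k) * indicator {k. 2 powi k < v} k \<partial>count_space (UNIV :: int set)) \<le> ennreal v * geo_sum (1/2)"
proof (cases "v = 0")
  case True
  then have "ennreal (2 powi k) * indicator {k. 2 powi k < v} k = 0" for k :: int
    using zero_le_power_int[of "2 :: real" k] by (auto simp: not_less split: split_indicator)
  then show ?thesis by simp
next
  case False
  with assms have v: "v > 0" by simp
  define L where "L = \<lfloor>log 2 v\<rfloor>"
  have "(\<integral>\<^sup>+k. ennreal (2 powi k) * indicator {k. 2 powi k < v} k \<partial>count_space (UNIV :: int set)) \<le>
      (\<integral>\<^sup>+k. ennreal v * ennreal ((1/2) ^ nat \<bar>L - k\<bar>) \<partial>count_space (UNIV :: int set))"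
  proof (intro nn_integral_mono)
    fix k :: int
    show "ennreal (2 powi k) * indicator {k. 2 powi k < v} k \<le> ennreal v * ennreal ((1/2) ^ nat \<bar>L - k\<bar>)"
    proof (cases "2 powi k < v")
      case True
      then have "2 powr real_of_int k < v" by (simp add: powr_real_of_int')
      then have "real_of_int k < log 2 v" using v by (simp add: less_log_iff)
      then have kL: "k \<le> L" unfolding L_def by linarith
      have "2 powi k = 2 powr real_of_int L * 2 powr - real_of_int (L - k)"
        by (simp add: powr_real_of_int'[symmetric] powr_add[symmetric])
      also have "\<dots> \<le> v * 2 powr - real_of_int (L - k)"
      proof (intro mult_right_mono)
        have "2 powr real_of_int L \<le> 2 powr log 2 v" by (intro powr_mono) (auto simp: L_def)
        then show "2 powr real_of_int L \<le> v" using v by simp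
      qed simp
      also have "2 powr - real_of_int (L - k) = (1/2) ^ nat \<bar>L - k\<bar>"
      proof -
        have "real_of_int (L - k) = real (nat \<bar>L - k\<bar>)" using kL by simp
        then show ?thesis by (simp only: powr_minus powr_realpow[of 2] zero_less_numeral power_one_over inverse_eq_divide)
      qed
      finally have "2 powi k \<le> v * (1/2) ^ nat \<bar>L - k\<bar>" .
      then show ?thesis using v by (auto simp: ennreal_mult'[symmetric] intro!: ennreal_leI split: split_indicator)
    qed simp
  qed
  also have "\<dots> = ennreal v * (\<integral>\<^sup>+k. ennreal ((1/2) ^ nat \<bar>L - k\<bar>) \<partial>count_space (UNIV :: int set))"
    by (intro nn_integral_cmult) simp
  also have "\<dots> \<le> ennreal v * geo_sum (1/2)"
    by (intro mult_left_mono geo_sum_inj[of "\<lambda>k. L - k"]) (auto simp: inj_def)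
  finally show ?thesis .
qed

text \<open>Since consecutive logarithms differ by at least one, their integer parts are distinct,
  which turns the two-sided sum into a geometric series.\<close>

lemma lacunary_sum:
  fixes W :: "int \<Rightarrow> real" and \<theta> a b m I :: real
  assumes W: "\<And>j. W j > 0" and dbl: "\<And>j. W j \<le> \<theta> * W (j + 1)" and \<theta>: "0 < \<theta>" "\<theta> < 1"
    and ab: "0 < a" "0 < b" and m: "0 < m" and I: "0 < I"
  defines "\<tau> \<equiv> \<theta> powr (min a b)"
  shows "(\<integral>\<^sup>+j. ennreal (min (m * W j powr a) (I * W j powr (- b))) \<partial>count_space UNIV)
    \<le> ennreal (1 / \<tau>) * geo_sum \<tau> * ennreal (m powr (b / (a + b)) * I powr (a / (a + b)))"
proof -
  \<comment> \<open>\<open>Ws\<close> is the value of W at which m W^a and I W^(-b) agree, and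
    \<open>V\<close> is their common value there.\<close>
  define V where "V = m powr (b / (a + b)) * I powr (a / (a + b))"
  define Ws where "Ws = (I / m) powr (1 / (a + b))"
  have Ws: "Ws > 0" using m I by (simp add: Ws_def)
  \<comment> \<open>The position of W j relative to the crossover, on the logarithmic scale with
    base 1/\<theta>. By \<open>dbl\<close> it grows by at least 1 from j to j + 1.\<close>
  define \<rho> where "\<rho> j = ln (W j / Ws) / ln (1 / \<theta>)" for j
  have l\<theta>: "ln (1 / \<theta>) > 0" using \<theta> by (simp add: ln_div)
  define c where "c = min a b"
  have c: "c > 0" using ab by (simp add: c_def)
  have \<tau>: "0 < \<tau>" "\<tau> < 1" using \<theta> powr_less_mono2[OF c, of \<theta> 1] by (auto simp: \<tau>_def c_def[symmetric])
  have inc: "\<rho> (j + 1) \<ge> \<rho> j + 1" for j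
  proof -
    have "(1 / \<theta>) * (W j / Ws) \<le> W (j + 1) / Ws"
      using dbl[of j] \<theta> Ws by (simp add: field_simps)
    then have "ln ((1 / \<theta>) * (W j / Ws)) \<le> ln (W (j + 1) / Ws)"
      using W \<theta> Ws by (intro ln_mono) (auto simp: zero_less_divide_iff)
    moreover have "ln ((1 / \<theta>) * (W j / Ws)) = ln (1 / \<theta>) + ln (W j / Ws)"
      using W \<theta> Ws by (intro ln_mult_pos) auto
    ultimately have "(ln (1 / \<theta>) + ln (W j / Ws)) / ln (1 / \<theta>) \<le> \<rho> (j + 1)"
      unfolding \<rho>_def using l\<theta> by (intro divide_right_mono) auto
    then show ?thesis using l\<theta> by (simp add: \<rho>_def add_divide_distrib)
  qed
  have incn: "\<rho> (j + int k) \<ge> \<rho> j + real k" for j k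
  proof (induction k)
    case (Suc k)
    then show ?case using inc[of "j + int k"] by (simp add: algebra_simps)
  qed simp
  have inj: "inj (\<lambda>j. \<lfloor>\<rho> j\<rfloor>)"
  proof (rule injI, rule ccontr)
    fix i j assume eq: "\<lfloor>\<rho> i\<rfloor> = \<lfloor>\<rho> j\<rfloor>" and "i \<noteq> j"
    have gen: "\<lfloor>\<rho> i\<rfloor> < \<lfloor>\<rho> j\<rfloor>" if "i < j" for i j
    proof -
      have "\<rho> i + real (nat (j - i)) \<le> \<rho> j" using incn[of i "nat (j - i)"] that by simp
      moreover have "real (nat (j - i)) \<ge> 1" using that by simp
      ultimately show ?thesis by linarith
    qed
    show False using gen[of i j] gen[of j i] eq \<open>i \<noteq> j\<close> by linarith
  qed
  have term_le: "min (m * W j powr a) (I * W j powr (- b)) \<le> (1 / \<tau>) * \<tau> ^ nat \<bar>\<lfloor>\<rho> j\<rfloor>\<bar> * V" for j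
  proof -
    define r where "r = W j / Ws"
    have r: "r > 0" using W Ws by (simp add: r_def)
    have Wj: "W j = Ws * r" using Ws by (simp add: r_def)
    have r\<rho>: "r = (1 / \<theta>) powr (\<rho> j)"
      using r l\<theta> \<theta> by (simp add: powr_def \<rho>_def r_def[symmetric])
    have V1: "m * Ws powr a = V"
    proof -
      have "m * Ws powr a = m powr 1 * (I powr (a / (a + b)) / m powr (a / (a + b)))"
        using m I by (simp add: Ws_def powr_powr powr_divide)
      also have "\<dots> = m powr (1 - a / (a + b)) * I powr (a / (a + b))"
        unfolding powr_diff by (simp only: times_divide_eq_right times_divide_eq_left)
      also have "1 - a / (a + b) = b / (a + b)" using ab by (simp add: field_simps)
      finally show ?thesis by (simp add: V_def)
    qed
    have V2: "I * Ws powr (- b) = V"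
    proof -
      have "I * Ws powr (- b) = I powr 1 * (I powr (- (b / (a + b))) / m powr (- (b / (a + b))))"
        using m I by (simp add: Ws_def powr_powr powr_divide)
      also have "\<dots> = I powr (1 - b / (a + b)) * m powr (b / (a + b))"
        unfolding powr_diff by (simp add: powr_minus field_simps)
      also have "1 - b / (a + b) = a / (a + b)" using ab by (simp add: field_simps)
      finally show ?thesis by (simp add: V_def mult.commute)
    qed
    have V0: "0 \<le> V" by (simp add: V_def)
    have min_eq: "m * W j powr a = V * r powr a" "I * W j powr (- b) = V * r powr (- b)"
      unfolding Wj using Ws r V1 V2 by (simp_all add: powr_mult mult.assoc[symmetric])
    have "min (r powr a) (r powr (- b)) \<le> \<theta> powr (c * \<bar>\<rho> j\<bar>)"
    proof (cases "\<rho> j \<ge> 0")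
      case True
      have "r powr (- b) = \<theta> powr (b * \<rho> j)"
        using \<theta> by (simp add: r\<rho> powr_powr powr_minus powr_divide mult.commute field_simps)
      also have "\<dots> \<le> \<theta> powr (c * \<bar>\<rho> j\<bar>)"
        using \<theta> True by (intro powr_mono') (auto simp: c_def intro!: mult_right_mono)
      finally show ?thesis by simp
    next
      case False
      have "r powr a = \<theta> powr (a * (- \<rho> j))"
        using \<theta> by (simp add: r\<rho> powr_powr powr_minus powr_divide mult.commute field_simps)
      also have "\<dots> \<le> \<theta> powr (c * \<bar>\<rho> j\<bar>)"
        using \<theta> False by (intro powr_mono') (auto simp: c_def intro!: mult_right_mono_neg)
      finally show ?thesis by simp
    qed
    \<comment> \<open>Passing to the integer part may lose 1 in the exponent; this is the origin of
      the factor 1/\<tau>.\<close>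
    also have "\<dots> \<le> \<theta> powr (c * (real (nat \<bar>\<lfloor>\<rho> j\<rfloor>\<bar>) - 1))"
    proof (intro powr_mono' mult_left_mono)
      show "real (nat \<bar>\<lfloor>\<rho> j\<rfloor>\<bar>) - 1 \<le> \<bar>\<rho> j\<bar>" by linarith
    qed (use \<theta> c in auto)
    also have "\<dots> = (1 / \<tau>) * \<tau> ^ nat \<bar>\<lfloor>\<rho> j\<rfloor>\<bar>"
    proof -
      have "\<theta> powr (c * (real (nat \<bar>\<lfloor>\<rho> j\<rfloor>\<bar>) - 1)) = \<tau> powr (real (nat \<bar>\<lfloor>\<rho> j\<rfloor>\<bar>) - 1)"
        by (simp add: \<tau>_def c_def powr_powr)
      also have "\<dots> = \<tau> powr real (nat \<bar>\<lfloor>\<rho> j\<rfloor>\<bar>) / \<tau>" using \<tau> by (simp only: powr_diff powr_one less_imp_le)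
      finally show ?thesis using \<tau>(1) by (simp only: powr_realpow) simp
    qed
    finally have "min (r powr a) (r powr (- b)) \<le> (1 / \<tau>) * \<tau> ^ nat \<bar>\<lfloor>\<rho> j\<rfloor>\<bar>" .
    from mult_left_mono[OF this V0] show ?thesis
      unfolding min_eq using V0 by (simp add: min_mult_distrib_left mult_ac)
  qed
  have "(\<integral>\<^sup>+j. ennreal (min (m * W j powr a) (I * W j powr (- b))) \<partial>count_space UNIV) \<le>
     (\<integral>\<^sup>+j. ennreal (1 / \<tau> * V) * ennreal (\<tau> ^ nat \<bar>\<lfloor>\<rho> j\<rfloor>\<bar>) \<partial>count_space UNIV)"
    using \<tau> term_le by (intro nn_integral_mono) (simp add: ennreal_mult'[symmetric] ennreal_leI V_def mult_ac)
  also have "\<dots> = ennreal (1 / \<tau> * V) * (\<integral>\<^sup>+j. ennreal (\<tau> ^ nat \<bar>\<lfloor>\<rho> j\<rfloor>\<bar>) \<partial>count_space UNIV)"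
    by (intro nn_integral_cmult) simp
  also have "\<dots> \<le> ennreal (1 / \<tau> * V) * geo_sum \<tau>" by (intro mult_left_mono geo_sum_inj inj) simp
  also have "\<dots> = ennreal (1 / \<tau>) * geo_sum \<tau> * ennreal V"
    using \<tau> by (subst ennreal_mult') (simp_all add: mult_ac)
  finally show ?thesis unfolding V_def .
qed

section \<open>Half-open dyadic cells\<close>

definition dyadic_index :: "int \<Rightarrow> (real^'n::finite) \<Rightarrow> int^'n" where
  "dyadic_index j x = (\<chi> i. \<lfloor>x $ i / 2 powi j\<rfloor>)"

definition dyadic_cell :: "int \<Rightarrow> (real^'n::finite) \<Rightarrow> (real^'n) set" where
  "dyadic_cell j x = {y. dyadic_index j y = dyadic_index j x}"

lemma dyadic_cell_self [simp]: "x \<in> dyadic_cell j x" by (simp add: dyadic_cell_def)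

lemma dyadic_cell_cong: "y \<in> dyadic_cell j x \<Longrightarrow> dyadic_cell j y = dyadic_cell j x" by (simp add: dyadic_cell_def)

lemma dyadic_cell_sym: "y \<in> dyadic_cell j x \<longleftrightarrow> x \<in> dyadic_cell j y" by (auto simp: dyadic_cell_def)

lemma dyadic_cell_mem_iff: "y \<in> dyadic_cell j x \<longleftrightarrow> (\<forall>i. \<lfloor>y $ i / 2 powi j\<rfloor> = \<lfloor>x $ i / 2 powi j\<rfloor>)"
  by (simp add: dyadic_cell_def dyadic_index_def vec_eq_iff)

text \<open>The closed companion of a cell: a partition of space needs half-open cells, while
  maximal operators and the A_1 condition refer to closed cubes.\<close>

definition dyadic_cube :: "int \<Rightarrow> (real^'n::finite) \<Rightarrow> (real^'n) set" where
  "dyadic_cube j x = cbox (\<chi> i. 2 powi j * \<lfloor>x $ i / 2 powi j\<rfloor>) ((\<chi> i. 2 powi j * \<lfloor>x $ i / 2 powi j\<rfloor>) + (\<chi> i. 2 powi j))"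

lemma pow2_pos: "(0::real) < 2 powi j" by (simp add: zero_less_power_int)

lemma dyadic_cell_mem_bounds:
  fixes x y :: "real^'n::finite"
  shows "y \<in> dyadic_cell j x \<longleftrightarrow> (\<forall>i. 2 powi j * \<lfloor>x $ i / 2 powi j\<rfloor> \<le> y $ i \<and> y $ i < 2 powi j * \<lfloor>x $ i / 2 powi j\<rfloor> + 2 powi j)"
proof -
  have "\<lfloor>a / c\<rfloor> = k \<longleftrightarrow> c * k \<le> a \<and> a < c * k + c" if "c > 0" for a c :: real and k :: int
    using that by (simp add: floor_eq_iff pos_le_divide_eq pos_divide_less_eq algebra_simps)
  from this[OF pow2_pos] show ?thesis unfolding dyadic_cell_mem_iff by simp
qed

lemma dyadic_cell_subset_cube: "dyadic_cell j x \<subseteq> dyadic_cube j x"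
  unfolding dyadic_cube_def by (rule subsetI) (simp add: dyadic_cell_mem_bounds mem_box_cart less_imp_le)

lemma cube_dyadic_cube: "cube (dyadic_cube j x)"
  unfolding cube_def dyadic_cube_def using pow2_pos by blast

lemma emeasure_dyadic_cube: "emeasure lebesgue (dyadic_cube j (x :: real^'n::finite)) = ennreal ((2 powi j) ^ CARD('n))"
  unfolding dyadic_cube_def using emeasure_cube[of "2 powi j"] pow2_pos[of j] by simp

lemma dyadic_index_measurable: "{x :: real^'n::finite. dyadic_index j x = k} \<in> sets borel"
proof -
  have "{x :: real^'n. dyadic_index j x = k} = (\<Inter>i\<in>UNIV. {x. \<lfloor>x $ i / 2 powi j\<rfloor> = k $ i})"
    by (auto simp: dyadic_index_def vec_eq_iff)
  also have "\<dots> \<in> sets borel"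
  proof (intro sets.finite_INT)
    fix i :: 'n
    have "{x \<in> space borel. \<lfloor>(x :: real^'n) $ i / 2 powi j\<rfloor> = k $ i} \<in> sets borel" by measurable
    then show "{x :: real^'n. \<lfloor>x $ i / 2 powi j\<rfloor> = k $ i} \<in> sets borel" by simp
  qed auto
  finally show ?thesis .
qed

lemma dyadic_cell_measurable: "dyadic_cell j x \<in> sets borel"
  unfolding dyadic_cell_def by (rule dyadic_index_measurable)

lemma dyadic_cell_lebesgue [measurable]: "dyadic_cell j x \<in> sets lebesgue"
  using dyadic_cell_measurable by (metis sets_completionI_sets sets_lborel)

lemma emeasure_dyadic_cell: "emeasure lebesgue (dyadic_cell j (x :: real^'n::finite)) = ennreal ((2 powi j) ^ CARD('n))"
proof (rule antisym)
  show "emeasure lebesgue (dyadic_cell j x) \<le> ennreal ((2 powi j) ^ CARD('n))"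
    unfolding emeasure_dyadic_cube[of j x, symmetric] by (intro emeasure_mono dyadic_cell_subset_cube) (auto simp: dyadic_cube_def)
  define a where "a = (\<chi> i. 2 powi j * real_of_int \<lfloor>x $ i / 2 powi j\<rfloor>)"
  define b where "b = a + (\<chi> i. 2 powi j)"
  have "box a b \<subseteq> dyadic_cell j x" by (auto simp: dyadic_cell_mem_bounds a_def b_def mem_box_cart less_imp_le)
  then have "emeasure lebesgue (box a b) \<le> emeasure lebesgue (dyadic_cell j x)" by (intro emeasure_mono) auto
  moreover have "emeasure lebesgue (box a b) = emeasure lborel (cbox a b)"
    by (simp add: emeasure_lborel_box_eq emeasure_lborel_cbox_eq)
  moreover have "emeasure lborel (cbox a b) = ennreal ((2 powi j) ^ CARD('n))"
    unfolding b_def using pow2_pos[of j] by (intro emeasure_cube) simp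
  ultimately show "ennreal ((2 powi j) ^ CARD('n)) \<le> emeasure lebesgue (dyadic_cell j x)" by simp
qed

text \<open>Doubling the side halves the quotient, and the integer part of a/2 is determined by that
  of a.\<close>

lemma dyadic_cell_mono_Suc: "dyadic_cell j x \<subseteq> dyadic_cell (j + 1) x"
proof -
  have "\<lfloor>a / 2 powi (j + 1)\<rfloor> = \<lfloor>a / 2 powi j\<rfloor> div 2" for a :: real
  proof -
    have "a / 2 powi (j + 1) = (a / 2 powi j) / real_of_int 2" by (simp add: power_int_add)
    then show ?thesis by (simp only: floor_divide_real_eq_div) 
  qed
  then show ?thesis by (auto simp: dyadic_cell_mem_iff)
qed

lemma dyadic_cell_mono: "i \<le> j \<Longrightarrow> dyadic_cell i x \<subseteq> dyadic_cell j x"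
proof (induction "nat (j - i)" arbitrary: j)
  case (Suc k)
  then have "i \<le> j - 1" "k = nat (j - 1 - i)" by auto
  then have "dyadic_cell i x \<subseteq> dyadic_cell (j - 1) x" using Suc by blast
  also have "\<dots> \<subseteq> dyadic_cell j x" using dyadic_cell_mono_Suc[of "j - 1" x] by simp
  finally show ?case .
qed auto

lemma countable_int_vec: "countable (UNIV :: (int^'n::finite) set)"
proof -
  have "UNIV = range (vec_lambda :: ('n \<Rightarrow> int) \<Rightarrow> int^'n)"
    by (metis surj_def vec_nth_inverse)
  then show ?thesis by (metis countableI_type countable_image)
qed

text \<open>A function that is constant on cells factors through the countable set of
  indices.\<close>

lemma dyadic_cell_const_measurable:
  fixes h :: "real^'n::finite \<Rightarrow> 'b"
  assumes "\<And>x y. dyadic_index j x = dyadic_index j y \<Longrightarrow> h x = h y" "range h \<subseteq> space N"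
  shows "h \<in> borel \<rightarrow>\<^sub>M N"
proof -
  define g where "g k = h (SOME x. dyadic_index j x = k)" for k
  have hg: "h x = g (dyadic_index j x)" for x
    unfolding g_def by (rule assms(1)) (metis (mono_tags) someI)
  have "h -` A \<in> sets borel" for A
  proof -
    have "h -` A = (\<Union>k\<in>{k. g k \<in> A}. {x. dyadic_index j x = k})" by (auto simp: hg)
    also have "\<dots> \<in> sets borel"
      by (intro sets.countable_UN'' dyadic_index_measurable countable_subset[OF subset_UNIV countable_int_vec])
    finally show ?thesis .
  qed
  then show ?thesis using assms(2) by (intro measurableI) auto
qed

lemma dyadic_cell_shrink_subset_ball:
  fixes x z :: "real^'n::finite"
  assumes "z \<in> dyadic_cell j x"
  shows "norm (z - x) \<le> real CARD('n) * 2 powi j"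
proof -
  have "norm (z - x) \<le> (\<Sum>i\<in>UNIV. \<bar>(z - x) $ i\<bar>)" by (rule norm_le_l1_cart)
  also have "\<dots> \<le> (\<Sum>i\<in>(UNIV :: 'n set). 2 powi j)"
  proof (rule sum_mono)
    fix i :: 'n
    let ?k = "2 powi j * real_of_int \<lfloor>x $ i / 2 powi j\<rfloor>"
    have "?k \<le> z $ i" "z $ i < ?k + 2 powi j" "?k \<le> x $ i" "x $ i < ?k + 2 powi j"
      using assms dyadic_cell_self[of x j] unfolding dyadic_cell_mem_bounds by blast+
    then show "\<bar>(z - x) $ i\<bar> \<le> 2 powi j" by (simp add: abs_le_iff)
  qed
  also have "\<dots> = real CARD('n) * 2 powi j" by simp
  finally show ?thesis .
qed

lemma ennreal_divide_cancel: "0 < c \<Longrightarrow> a / ennreal c * ennreal c = a"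
  by (cases a) (auto simp: divide_ennreal ennreal_mult[symmetric] ennreal_top_divide ennreal_top_mult)

text \<open>Cells have positive measure. This transfers bounds that hold almost everywhere to
  quantities that are constant on cells.\<close>

lemma dyadic_cell_AE_ex:
  fixes x :: "real^'n::finite"
  assumes "AE y in lebesgue. P y"
  shows "\<exists>y\<in>dyadic_cell j x. P y"
proof (rule ccontr)
  assume "\<not> (\<exists>y\<in>dyadic_cell j x. P y)"
  with assms have "AE y in lebesgue. y \<notin> dyadic_cell j x" by (auto elim!: eventually_mono)
  then have "emeasure lebesgue (dyadic_cell j x) = 0"
    by (subst (asm) AE_iff_measurable[of "dyadic_cell j x"]) auto
  then show False using emeasure_dyadic_cell[of j x] zero_less_power[OF pow2_pos[of j], of "CARD('n)"] by (simp add: ennreal_eq_0_iff)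
qed

text \<open>Tonelli's theorem over the countable partition into cells of one generation.\<close>

lemma nn_integral_dyadic_cell_cong:
  fixes h1 h2 :: "real^'n::finite \<Rightarrow> ennreal"
  assumes h: "h1 \<in> borel_measurable lebesgue" "h2 \<in> borel_measurable lebesgue"
    and eq: "\<And>x. (\<integral>\<^sup>+y\<in>dyadic_cell j x. h1 y \<partial>lebesgue) = (\<integral>\<^sup>+y\<in>dyadic_cell j x. h2 y \<partial>lebesgue)"
  shows "(\<integral>\<^sup>+y. h1 y \<partial>lebesgue) = (\<integral>\<^sup>+y. h2 y \<partial>lebesgue)"
proof -
  have dec: "(\<integral>\<^sup>+y. h y \<partial>lebesgue) = (\<integral>\<^sup>+k. (\<integral>\<^sup>+y. h y * indicator {y. dyadic_index j y = k} y \<partial>lebesgue) \<partial>count_space UNIV)"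
    if hm [measurable]: "h \<in> borel_measurable lebesgue" for h :: "real^'n \<Rightarrow> ennreal"
  proof -
    have [measurable]: "{y :: real^'n. dyadic_index j y = k} \<in> sets lebesgue" for k
      using dyadic_index_measurable by (metis sets_completionI_sets sets_lborel)
    have "(\<integral>\<^sup>+k. h y * indicator {y. dyadic_index j y = k} y \<partial>count_space UNIV) = h y" for y
    proof -
      have "(\<integral>\<^sup>+k. h y * indicator {y. dyadic_index j y = k} y \<partial>count_space UNIV) =
          (\<integral>\<^sup>+k. h y * indicator {dyadic_index j y} k \<partial>count_space UNIV)"
        by (intro nn_integral_cong) (auto split: split_indicator)
      also have "\<dots> = h y" by (subst nn_integral_cmult_indicator) auto
      finally show ?thesis .
    qed
    then have "(\<integral>\<^sup>+y. h y \<partial>lebesgue) = (\<integral>\<^sup>+y. (\<integral>\<^sup>+k. h y * indicator {y. dyadic_index j y = k} y \<partial>count_space UNIV) \<partial>lebesgue)"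
      by simp
    also have "\<dots> = (\<integral>\<^sup>+k. (\<integral>\<^sup>+y. h y * indicator {y. dyadic_index j y = k} y \<partial>lebesgue) \<partial>count_space UNIV)"
      by (rule nn_integral_count_space_nn_integral[OF countable_int_vec]) measurable
    finally show ?thesis .
  qed
  have "(\<integral>\<^sup>+y. h1 y * indicator {y. dyadic_index j y = k} y \<partial>lebesgue) = (\<integral>\<^sup>+y. h2 y * indicator {y. dyadic_index j y = k} y \<partial>lebesgue)" for k
  proof (cases "\<exists>x :: real^'n. dyadic_index j x = k")
    case True
    then obtain x :: "real^'n" where "dyadic_index j x = k" by blast
    then have "{y. dyadic_index j y = k} = dyadic_cell j x" by (auto simp: dyadic_cell_def)
    then show ?thesis using eq[of x] by simp
  next
    case False
    then have "{y :: real^'n. dyadic_index j y = k} = {}" by auto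
    then show ?thesis by simp
  qed
  then show ?thesis using dec h by simp
qed

text \<open>The A_1 condition with one exceptional null set for all cubes together, which is the
  form that the Rubio de Francia construction delivers.\<close>

locale A1_weight =
  fixes w :: "real^'n::finite \<Rightarrow> real" and A :: real
  assumes wm [measurable]: "w \<in> borel_measurable lebesgue"
    and w_pos: "AE x in lebesgue. 0 < w x"
    and A_ge: "1 \<le> A"
    and A1: "AE x in lebesgue. \<forall>Q. cube Q \<and> x \<in> Q \<longrightarrow>
      (\<integral>\<^sup>+y\<in>Q. ennreal (w y) \<partial>lebesgue) \<le> ennreal A * emeasure lebesgue Q * ennreal (w x)"
begin

section \<open>Masses of dyadic cells under an A_1 weight\<close>

definition V :: "int \<Rightarrow> real" where "V j = (2 powi j) ^ CARD('n)"

lemma V_pos: "0 < V j" unfolding V_def using pow2_pos by simp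

lemma V_Suc: "2 * V j \<le> V (j + 1)"
proof -
  have "V (j + 1) = 2 ^ CARD('n) * V j" by (simp add: V_def power_int_add power_mult_distrib mult.commute)
  moreover have "(2::real) ^ 1 \<le> 2 ^ CARD('n)" by (intro power_increasing) (auto simp: Suc_le_eq)
  ultimately show ?thesis using V_pos[of j] by simp
qed

definition dyadic_weight :: "int \<Rightarrow> (real^'n) \<Rightarrow> ennreal" where
  "dyadic_weight j x = (\<integral>\<^sup>+y\<in>dyadic_cell j x. ennreal (w y) \<partial>lebesgue)"

definition W :: "int \<Rightarrow> (real^'n) \<Rightarrow> real" where
  "W j x = enn2real (dyadic_weight j x)"

lemma dyadic_weight_cong: "y \<in> dyadic_cell j x \<Longrightarrow> dyadic_weight j y = dyadic_weight j x" by (simp add: dyadic_weight_def dyadic_cell_cong)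

lemma AE_dyadic_weight_le: "AE y in lebesgue. 0 < w y \<and> (\<forall>j. dyadic_weight j y \<le> ennreal (A * V j * w y))"
  using A1 w_pos
proof eventually_elim
  fix y assume a: "\<forall>Q. cube Q \<and> y \<in> Q \<longrightarrow>
      (\<integral>\<^sup>+y\<in>Q. ennreal (w y) \<partial>lebesgue) \<le> ennreal A * emeasure lebesgue Q * ennreal (w y)" and wy: "0 < w y"
  have "dyadic_weight j y \<le> ennreal (A * V j * w y)" for j
  proof -
    have "dyadic_weight j y \<le> (\<integral>\<^sup>+z\<in>dyadic_cube j y. ennreal (w z) \<partial>lebesgue)"
      unfolding dyadic_weight_def using dyadic_cell_subset_cube[of j y] by (intro nn_integral_mono) (auto split: split_indicator)
    also have "\<dots> \<le> ennreal A * emeasure lebesgue (dyadic_cube j y) * ennreal (w y)"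
      using a cube_dyadic_cube dyadic_cell_subset_cube[of j y] dyadic_cell_self[of y j] by blast
    also have "\<dots> = ennreal (A * V j * w y)"
      using A_ge V_pos[of j] wy by (simp add: emeasure_dyadic_cube V_def[symmetric] ennreal_mult)
    finally show ?thesis .
  qed
  with wy show "0 < w y \<and> (\<forall>j. dyadic_weight j y \<le> ennreal (A * V j * w y))" by blast
qed

lemma dyadic_weight_finite: "dyadic_weight j x < \<infinity>"
proof -
  obtain y where y: "y \<in> dyadic_cell j x" "dyadic_weight j y \<le> ennreal (A * V j * w y)" using dyadic_cell_AE_ex[OF AE_dyadic_weight_le, of j x] by blast
  then show ?thesis using dyadic_weight_cong[OF y(1)] by (auto intro: le_less_trans)
qed

lemma dyadic_weight_pos: "0 < dyadic_weight j x"
proof (rule ccontr)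
  assume "\<not> 0 < dyadic_weight j x"
  then have "dyadic_weight j x = 0" by simp
  then have "AE y in lebesgue. ennreal (w y) * indicator (dyadic_cell j x) y = 0"
    unfolding dyadic_weight_def by (subst (asm) nn_integral_0_iff_AE) auto
  with w_pos have "AE y in lebesgue. y \<notin> dyadic_cell j x"
    by eventually_elim (auto split: split_indicator_asm simp: ennreal_eq_0_iff)
  from dyadic_cell_AE_ex[OF this, of j x] show False by blast
qed

lemma dyadic_weight_eq: "dyadic_weight j x = ennreal (W j x)" using dyadic_weight_finite[of j x] by (simp add: W_def)

lemma W_pos: "0 < W j x" using dyadic_weight_pos[of j x] dyadic_weight_finite[of j x] by (simp add: W_def enn2real_positive_iff)

lemma W_cong: "y \<in> dyadic_cell j x \<Longrightarrow> W j y = W j x" by (simp add: W_def dyadic_weight_cong)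

text \<open>The A_1 condition read backwards: the weight is bounded below by its averages. Reverse
  doubling and \<open>lower_integral\<close> both use it in this form.\<close>

lemma AE_w_lower: "AE y in lebesgue. 0 < w y \<and> (\<forall>j. W j y / (A * V j) \<le> w y)"
  using AE_dyadic_weight_le
proof eventually_elim
  fix y assume *: "0 < w y \<and> (\<forall>j. dyadic_weight j y \<le> ennreal (A * V j * w y))"
  have "W j y / (A * V j) \<le> w y" for j
  proof -
    have p: "0 < A * V j" using A_ge V_pos[of j] by simp
    have "0 \<le> A * V j * w y" using * p by simp
    moreover have "ennreal (W j y) \<le> ennreal (A * V j * w y)" using * by (simp add: dyadic_weight_eq)
    ultimately have "W j y \<le> A * V j * w y" by (simp only: ennreal_le_iff)
    then show ?thesis using p by (simp add: pos_divide_le_eq mult.commute)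
  qed
  with * show "0 < w y \<and> (\<forall>j. W j y / (A * V j) \<le> w y)" by blast
qed

text \<open>Used twice: with exponents (s, e) against a weighted average, and with (p, p/q) against
  the integral over all of space.\<close>

lemma lower_integral:
  assumes Fm: "F \<in> borel_measurable lebesgue" and c: "0 \<le> c" and F: "AE y in lebesgue. y \<in> dyadic_cell j x \<longrightarrow> c \<le> F y"
    and a: "0 < a" and e: "0 \<le> e"
  shows "ennreal (c powr a * (W j x / (A * V j)) powr e * V j) \<le> (\<integral>\<^sup>+y\<in>dyadic_cell j x. ennreal (F y powr a * w y powr e) \<partial>lebesgue)"
proof -
  have "ennreal (c powr a * (W j x / (A * V j)) powr e * V j) =
      (\<integral>\<^sup>+y. ennreal (c powr a * (W j x / (A * V j)) powr e) * indicator (dyadic_cell j x) y \<partial>lebesgue)"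
    using V_pos[of j] by (subst nn_integral_cmult_indicator) (auto simp: emeasure_dyadic_cell V_def[symmetric] ennreal_mult'[symmetric] ennreal_mult''[symmetric])
  also have "\<dots> \<le> (\<integral>\<^sup>+y\<in>dyadic_cell j x. ennreal (F y powr a * w y powr e) \<partial>lebesgue)"
  proof (rule nn_integral_mono_AE)
    show "AE y in lebesgue. ennreal (c powr a * (W j x / (A * V j)) powr e) * indicator (dyadic_cell j x) y \<le> ennreal (F y powr a * w y powr e) * indicator (dyadic_cell j x) y"
      using F AE_w_lower
    proof eventually_elim
      fix y assume *: "y \<in> dyadic_cell j x \<longrightarrow> c \<le> F y" "0 < w y \<and> (\<forall>j. W j y / (A * V j) \<le> w y)"
      show "ennreal (c powr a * (W j x / (A * V j)) powr e) * indicator (dyadic_cell j x) y \<le> ennreal (F y powr a * w y powr e) * indicator (dyadic_cell j x) y"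
      proof (cases "y \<in> dyadic_cell j x")
        case True
        have "W j x / (A * V j) \<le> w y" using *(2) W_cong[OF True] by metis
        then have "c powr a * (W j x / (A * V j)) powr e \<le> F y powr a * w y powr e"
          using * True c a e W_cong[OF True] W_pos[of j x] V_pos[of j] A_ge
          by (intro mult_mono powr_mono2) (auto intro: less_imp_le)
        then show ?thesis using True by (simp add: ennreal_leI)
      qed simp
    qed
  qed
  finally show ?thesis .
qed

text \<open>Reverse doubling. The part of the parent cell outside the child has at least half of the
  parent's volume, and there w is at least the parent's average divided by A. So at least the
  fraction 1/(2A) of the mass lies outside the child.\<close>

lemma W_doubling: "W j x \<le> (1 - 1 / (2 * A)) * W (j + 1) x"
proof -
  define D where "D = dyadic_cell (j + 1) x - dyadic_cell j x"
  have Dm [measurable]: "D \<in> sets lebesgue" unfolding D_def by measurable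
  have split: "dyadic_weight (j + 1) x = dyadic_weight j x + (\<integral>\<^sup>+y\<in>D. ennreal (w y) \<partial>lebesgue)"
    unfolding dyadic_weight_def D_def using dyadic_cell_mono_Suc[of j x]
    by (subst nn_integral_add[symmetric]) (auto intro!: nn_integral_cong split: split_indicator)
  define c where "c = W (j + 1) x / (A * V (j + 1))"
  have c0: "0 \<le> c" using W_pos[of "j + 1" x] V_pos[of "j + 1"] A_ge by (simp add: c_def)
  have "ennreal (c * (V (j + 1) - V j)) = (\<integral>\<^sup>+y. ennreal c * indicator D y \<partial>lebesgue)"
  proof -
    have "emeasure lebesgue D = emeasure lebesgue (dyadic_cell (j + 1) x) - emeasure lebesgue (dyadic_cell j x)"
      unfolding D_def by (intro emeasure_Diff dyadic_cell_mono_Suc) (auto simp: emeasure_dyadic_cell)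
    also have "\<dots> = ennreal (V (j + 1) - V j)"
      using V_pos[of j] by (simp add: emeasure_dyadic_cell V_def[symmetric] ennreal_minus less_imp_le)
    finally show ?thesis using c0 by (subst nn_integral_cmult_indicator) (auto simp: ennreal_mult')
  qed
  also have "\<dots> \<le> (\<integral>\<^sup>+y\<in>D. ennreal (w y) \<partial>lebesgue)"
  proof (rule nn_integral_mono_AE)
    show "AE y in lebesgue. ennreal c * indicator D y \<le> ennreal (w y) * indicator D y"
      using AE_w_lower
    proof eventually_elim
      fix y assume *: "0 < w y \<and> (\<forall>j. W j y / (A * V j) \<le> w y)"
      show "ennreal c * indicator D y \<le> ennreal (w y) * indicator D y"
      proof (cases "y \<in> D")
        case True
        then have "W (j + 1) y = W (j + 1) x" by (intro W_cong) (auto simp: D_def)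
        with * have "c \<le> w y" unfolding c_def by metis
        then show ?thesis using True by (simp add: ennreal_leI)
      qed simp
    qed
  qed
  finally have D: "ennreal (c * (V (j + 1) - V j)) \<le> (\<integral>\<^sup>+y\<in>D. ennreal (w y) \<partial>lebesgue)" .
  have "ennreal (W j x + c * (V (j + 1) - V j)) = ennreal (W j x) + ennreal (c * (V (j + 1) - V j))"
    using W_pos[of j x] c0 V_Suc[of j] V_pos[of j] by (intro ennreal_plus) auto
  also have "\<dots> \<le> ennreal (W (j + 1) x)" using split D unfolding dyadic_weight_eq[symmetric] by (simp add: add_left_mono)
  finally have "W j x + c * (V (j + 1) - V j) \<le> W (j + 1) x"
    using W_pos[of "j + 1" x] by (simp add: ennreal_le_iff)
  moreover have "W (j + 1) x / (2 * A) \<le> c * (V (j + 1) - V j)"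
  proof -
    have "c * (V (j + 1) / 2) \<le> c * (V (j + 1) - V j)" using c0 V_Suc[of j] by (intro mult_left_mono) auto
    moreover have "c * (V (j + 1) / 2) = W (j + 1) x / (2 * A)" using V_pos[of "j + 1"] A_ge by (simp add: c_def)
    ultimately show ?thesis by simp
  qed
  ultimately show ?thesis by (simp add: algebra_simps)
qed

section \<open>The dyadic maximal operator relative to a weight\<close>

definition dyadic_avg :: "(real^'n \<Rightarrow> real) \<Rightarrow> int \<Rightarrow> (real^'n) \<Rightarrow> ennreal" where
  "dyadic_avg u j x = (\<integral>\<^sup>+y\<in>dyadic_cell j x. ennreal (u y * w y) \<partial>lebesgue) / dyadic_weight j x"

lemma dyadic_avg_cong: "y \<in> dyadic_cell j x \<Longrightarrow> dyadic_avg u j y = dyadic_avg u j x"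
  by (simp add: dyadic_avg_def dyadic_weight_cong dyadic_cell_cong)

lemma dyadic_avg_measurable [measurable]: "dyadic_avg u j \<in> borel_measurable lebesgue"
proof -
  have "dyadic_avg u j \<in> borel \<rightarrow>\<^sub>M borel"
    by (rule dyadic_cell_const_measurable[of j]) (auto intro: dyadic_avg_cong simp: dyadic_cell_def)
  then show ?thesis by (rule borel_imp_lebesgue)
qed

lemma dyadic_avg_times: "dyadic_avg u j x * dyadic_weight j x = (\<integral>\<^sup>+y\<in>dyadic_cell j x. ennreal (u y * w y) \<partial>lebesgue)"
  unfolding dyadic_avg_def dyadic_weight_eq by (rule ennreal_divide_cancel[OF W_pos])

text \<open>\<open>dyadic_avg\<close> is the conditional expectation for the measure w dx, and
  \<open>inv\<close> says that \<open>S\<close> is a union of cells of generation j.\<close>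

lemma dyadic_avg_integral:
  assumes um [measurable]: "u \<in> borel_measurable lebesgue" and Sm [measurable]: "S \<in> sets lebesgue"
    and inv: "\<And>x y. x \<in> S \<Longrightarrow> y \<in> dyadic_cell j x \<Longrightarrow> y \<in> S"
  shows "(\<integral>\<^sup>+x\<in>S. dyadic_avg u j x * ennreal (w x) \<partial>lebesgue) = (\<integral>\<^sup>+x\<in>S. ennreal (u x * w x) \<partial>lebesgue)"
proof (rule nn_integral_dyadic_cell_cong[of _ _ j])
  fix x
  have S: "indicator S y = (indicator S x :: ennreal)" if "y \<in> dyadic_cell j x" for y
    using inv[of x y] inv[of y x] that dyadic_cell_sym[of x j y] by (auto split: split_indicator)
  have "(\<integral>\<^sup>+y\<in>dyadic_cell j x. (dyadic_avg u j y * ennreal (w y) * indicator S y) \<partial>lebesgue) =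
      (\<integral>\<^sup>+y. (indicator S x * dyadic_avg u j x) * (ennreal (w y) * indicator (dyadic_cell j x) y) \<partial>lebesgue)"
  proof (intro nn_integral_cong)
    fix y
    show "dyadic_avg u j y * ennreal (w y) * indicator S y * indicator (dyadic_cell j x) y = indicator S x * dyadic_avg u j x * (ennreal (w y) * indicator (dyadic_cell j x) y)"
    proof (cases "y \<in> dyadic_cell j x")
      case True
      show ?thesis unfolding S[OF True] dyadic_avg_cong[OF True] by (simp only: mult_ac)
    qed simp
  qed
  also have "\<dots> = (indicator S x * dyadic_avg u j x) * dyadic_weight j x"
    unfolding dyadic_weight_def by (rule nn_integral_cmult) measurable
  also have "\<dots> = indicator S x * (\<integral>\<^sup>+y\<in>dyadic_cell j x. ennreal (u y * w y) \<partial>lebesgue)" by (simp only: mult.assoc dyadic_avg_times)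
  also have "\<dots> = (\<integral>\<^sup>+y. indicator S x * (ennreal (u y * w y) * indicator (dyadic_cell j x) y) \<partial>lebesgue)"
    by (rule nn_integral_cmult[symmetric]) measurable
  also have "\<dots> = (\<integral>\<^sup>+y\<in>dyadic_cell j x. (ennreal (u y * w y) * indicator S y) \<partial>lebesgue)"
  proof (intro nn_integral_cong)
    fix y
    show "indicator S x * (ennreal (u y * w y) * indicator (dyadic_cell j x) y) = ennreal (u y * w y) * indicator S y * indicator (dyadic_cell j x) y"
    proof (cases "y \<in> dyadic_cell j x")
      case True
      show ?thesis unfolding S[OF True] by (simp only: mult_ac)
    qed simp
  qed
  finally show "(\<integral>\<^sup>+y\<in>dyadic_cell j x. (dyadic_avg u j y * ennreal (w y) * indicator S y) \<partial>lebesgue) =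
    (\<integral>\<^sup>+y\<in>dyadic_cell j x. (ennreal (u y * w y) * indicator S y) \<partial>lebesgue)" .
qed measurable

definition dyadic_max :: "(real^'n \<Rightarrow> real) \<Rightarrow> (real^'n) \<Rightarrow> ennreal" where
  "dyadic_max u x = (SUP j. dyadic_avg u j x)"

lemma dyadic_max_measurable [measurable]: "dyadic_max u \<in> borel_measurable lebesgue"
  unfolding dyadic_max_def[abs_def] by (intro borel_measurable_SUP) auto

text \<open>A point of the level set belongs to exactly one \<open>B j\<close>, that of the largest
  generation in the range whose average exceeds l; the range is finite so that a largest one exists.
  Each \<open>B j\<close> is a union of cells of generation j, because membership depends only on
  averages over cells of generation at least j.\<close>

lemma weak_type_truncated:
  assumes um [measurable]: "u \<in> borel_measurable lebesgue"
  shows "l * (\<integral>\<^sup>+x. ennreal (w x) * indicator {x. \<exists>j\<in>{- int J..int J}. l < dyadic_avg u j x} x \<partial>lebesgue) \<le> (\<integral>\<^sup>+x. ennreal (u x * w x) \<partial>lebesgue)"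
proof -
  define I where "I = {- int J..int J}"
  define B where "B j = {x. l < dyadic_avg u j x \<and> (\<forall>i\<in>I. j < i \<longrightarrow> dyadic_avg u i x \<le> l)}" for j
  have Bm [measurable]: "B j \<in> sets lebesgue" for j
  proof -
    have "{x \<in> space lebesgue. l < dyadic_avg u j x \<and> (\<forall>i\<in>I. j < i \<longrightarrow> dyadic_avg u i x \<le> l)} \<in> sets lebesgue"
      unfolding I_def by measurable
    then show ?thesis by (simp add: B_def)
  qed
  have inv: "y \<in> B j" if "x \<in> B j" "y \<in> dyadic_cell j x" for x y j
  proof -
    have "dyadic_avg u i y = dyadic_avg u i x" if "j \<le> i" for i
      using dyadic_cell_mono[OF that, of x] \<open>y \<in> dyadic_cell j x\<close> by (intro dyadic_avg_cong) auto
    then show ?thesis using that(1) by (auto simp: B_def)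
  qed
  have disj: "i = j" if "x \<in> B i" "x \<in> B j" "i \<in> I" "j \<in> I" for x i j
    using that unfolding B_def by (metis (mono_tags, lifting) linorder_neqE mem_Collect_eq not_less)
  have ind: "indicator {x. \<exists>j\<in>I. l < dyadic_avg u j x} x = (\<Sum>j\<in>I. indicator (B j) x :: ennreal)" for x
  proof (cases "\<exists>j\<in>I. l < dyadic_avg u j x")
    case True
    define K where "K = {j\<in>I. l < dyadic_avg u j x}"
    have "finite I" by (simp add: I_def)
    then have K: "finite K" "K \<noteq> {}" using True by (auto simp: K_def)
    define k where "k = Max K"
    have kK: "k \<in> K" unfolding k_def by (rule Max_in[OF K])
    have "x \<in> B k" unfolding B_def
    proof (intro CollectI conjI ballI impI)
      show "l < dyadic_avg u k x" using kK by (simp add: K_def)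
      fix i assume i: "i \<in> I" "k < i"
      show "dyadic_avg u i x \<le> l"
      proof (rule ccontr)
        assume "\<not> dyadic_avg u i x \<le> l"
        then have "i \<in> K" using i by (simp add: K_def)
        then have "i \<le> k" unfolding k_def using K(1) by (intro Max_ge)
        with i show False by simp
      qed
    qed
    have "k \<in> I" using kK by (simp add: K_def)
    have "indicator (B j) x = (if j = k then 1 else 0 :: ennreal)" if "j \<in> I" for j
    proof (cases "j = k")
      case True
      then show ?thesis using \<open>x \<in> B k\<close> by simp
    next
      case False
      then have "x \<notin> B j" using disj[OF _ \<open>x \<in> B k\<close> that \<open>k \<in> I\<close>] by blast
      then show ?thesis using False by simp
    qed
    then have "(\<Sum>j\<in>I. indicator (B j) x :: ennreal) = (\<Sum>j\<in>I. if j = k then 1 else 0)" by (intro sum.cong) auto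
    also have "\<dots> = 1" using \<open>k \<in> I\<close> \<open>finite I\<close> by simp
    finally show ?thesis using True by simp
  next
    case False
    then have "indicator (B j) x = (0 :: ennreal)" if "j \<in> I" for j using that by (auto simp: B_def)
    then show ?thesis using False by simp
  qed
  have "l * (\<integral>\<^sup>+x. ennreal (w x) * indicator {x. \<exists>j\<in>I. l < dyadic_avg u j x} x \<partial>lebesgue) =
      (\<Sum>j\<in>I. \<integral>\<^sup>+x. (l * ennreal (w x)) * indicator (B j) x \<partial>lebesgue)"
    unfolding ind sum_distrib_left by (subst nn_integral_sum) (auto simp: nn_integral_cmult sum_distrib_left mult.assoc)
  also have "\<dots> \<le> (\<Sum>j\<in>I. \<integral>\<^sup>+x\<in>B j. dyadic_avg u j x * ennreal (w x) \<partial>lebesgue)"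
  proof (intro sum_mono nn_integral_mono)
    fix j x
    show "l * ennreal (w x) * indicator (B j) x \<le> dyadic_avg u j x * ennreal (w x) * indicator (B j) x"
      by (cases "x \<in> B j") (auto simp: B_def intro!: mult_right_mono intro: less_imp_le)
  qed
  also have "\<dots> = (\<Sum>j\<in>I. \<integral>\<^sup>+x\<in>B j. ennreal (u x * w x) \<partial>lebesgue)"
    using inv by (intro sum.cong refl dyadic_avg_integral) auto
  also have "\<dots> = (\<integral>\<^sup>+x. ennreal (u x * w x) * (\<Sum>j\<in>I. indicator (B j) x) \<partial>lebesgue)"
    unfolding sum_distrib_left by (subst nn_integral_sum) auto
  also have "\<dots> \<le> (\<integral>\<^sup>+x. ennreal (u x * w x) * 1 \<partial>lebesgue)"
    unfolding ind[symmetric] by (intro nn_integral_mono mult_left_mono) (auto split: split_indicator)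
  finally show ?thesis by (simp add: I_def)
qed

lemma weak_type:
  assumes um [measurable]: "u \<in> borel_measurable lebesgue"
  shows "l * (\<integral>\<^sup>+x. ennreal (w x) * indicator {x. l < dyadic_max u x} x \<partial>lebesgue) \<le> (\<integral>\<^sup>+x. ennreal (u x * w x) \<partial>lebesgue)"
proof -
  define S where "S J = {x. \<exists>j\<in>{- int J..int J}. l < dyadic_avg u j x}" for J :: nat
  have Sm [measurable]: "S J \<in> sets lebesgue" for J
  proof -
    have "{x \<in> space lebesgue. \<exists>j\<in>{- int J..int J}. l < dyadic_avg u j x} \<in> sets lebesgue" by measurable
    then show ?thesis by (simp add: S_def)
  qed
  have inc: "S J \<subseteq> S J'" if "J \<le> J'" for J J' using that unfolding S_def by force
  have "(\<integral>\<^sup>+x. ennreal (w x) * indicator {x. l < dyadic_max u x} x \<partial>lebesgue) = (\<integral>\<^sup>+x. (SUP J. ennreal (w x) * indicator (S J) x) \<partial>lebesgue)"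
  proof (intro nn_integral_cong)
    fix x
    show "ennreal (w x) * indicator {x. l < dyadic_max u x} x = (SUP J. ennreal (w x) * indicator (S J) x)"
    proof (cases "l < dyadic_max u x")
      case True
      then obtain j where "l < dyadic_avg u j x" unfolding dyadic_max_def less_SUP_iff by blast
      then have "x \<in> S (nat \<bar>j\<bar>)" unfolding S_def by (auto intro!: bexI[of _ j])
      then have "ennreal (w x) \<le> (SUP J. ennreal (w x) * indicator (S J) x)"
        by (intro SUP_upper2[of "nat \<bar>j\<bar>"]) auto
      moreover have "(SUP J. ennreal (w x) * indicator (S J) x) \<le> ennreal (w x)"
        by (intro SUP_least) (auto split: split_indicator)
      ultimately show ?thesis using True by auto
    next
      case False
      then have "x \<notin> S J" for J unfolding S_def dyadic_max_def less_SUP_iff by auto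
      then show ?thesis using False by simp
    qed
  qed
  also have "\<dots> = (SUP J. \<integral>\<^sup>+x. ennreal (w x) * indicator (S J) x \<partial>lebesgue)"
    using inc by (intro nn_integral_monotone_convergence_SUP)
      (auto simp: incseq_def le_fun_def intro!: mult_left_mono split: split_indicator, blast?)
  finally show ?thesis
    using weak_type_truncated[OF um, of l] unfolding S_def[symmetric]
    by (simp add: SUP_mult_left_ennreal SUP_least)
qed

end

lemma geo_sum_ge_one: "1 \<le> geo_sum \<tau>"
  using int_le_sum[of "\<lambda>i. ennreal (\<tau> ^ nat \<bar>i\<bar>)" 0] by (simp add: geo_sum_def)

text \<open>A layer-cake bound at powers of two. For finite m > 0 the index k = ceil(log2 m) - 2
  satisfies 2 * 2^k < m \<le> 4 * 2^k, so one term suffices; for the value infinity the sum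
  diverges. The factor 2 in the threshold prepares for \<open>dyadic_max_split\<close>.\<close>

lemma square_le_dyadic_sum:
  "epow M 2 \<le> (\<integral>\<^sup>+k. ennreal (16 * (2 powi k * 2 powi k)) * indicator {k. ennreal (2 * 2 powi k) < M} k \<partial>count_space (UNIV :: int set))"
    (is "_ \<le> ?R")
proof (cases M)
  case (real m)
  show ?thesis
  proof (cases "m = 0")
    case True
    then show ?thesis using real by simp
  next
    case False
    with real have m: "m > 0" by simp
    define k where "k = \<lceil>log 2 m\<rceil> - 2"
    have "2 powr real_of_int (k + 1) < 2 powr log 2 m" by (intro powr_less_mono) (simp_all add: k_def, linarith)
    then have k1: "2 * 2 powi k < m" using m by (simp add: powr_add powr_real_of_int')
    have "2 powr log 2 m \<le> 2 powr real_of_int (k + 2)" by (intro powr_mono) (simp_all add: k_def)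
    then have k2: "m \<le> 4 * 2 powi k" using m by (simp add: powr_add powr_real_of_int')
    have "m * m \<le> (4 * 2 powi k) * (4 * 2 powi k)" using k2 m by (intro mult_mono) auto
    then have "ennreal (m * m) \<le> ennreal (16 * (2 powi k * 2 powi k))" by (intro ennreal_leI) (simp add: mult_ac)
    also have "\<dots> = ennreal (16 * (2 powi k * 2 powi k)) * indicator {k. ennreal (2 * 2 powi k) < M} k"
      using k1 real m by (simp add: ennreal_less_iff)
    also have "\<dots> \<le> ?R" by (rule int_le_sum)
    finally show ?thesis using real m by (simp add: epow_ennreal power2_eq_square)
  qed
next
  case top
  have "?R = top"
  proof (rule ccontr)
    assume "?R \<noteq> top"
    then obtain r where r: "?R = ennreal r" "r \<ge> 0" by (cases ?R) auto
    obtain n :: nat where n: "r < real n" using reals_Archimedean2 by blast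
    have "ennreal (16 * (2 powi int n * 2 powi int n)) * indicator {k. ennreal (2 * 2 powi k) < M} (int n) \<le> ?R" by (rule int_le_sum)
    then have "ennreal (16 * (2 ^ n * 2 ^ n)) \<le> ennreal r" using top r(1) by simp
    then have "16 * (2 ^ n * 2 ^ n) \<le> r" using r(2) by (simp add: ennreal_le_iff)
    moreover have "real n * 1 \<le> 2 ^ n * 2 ^ n"
      using of_nat_less_two_power[of n, where 'a = real] by (intro mult_mono) auto
    ultimately show False using n by linarith
  qed
  then show ?thesis by simp
qed

context A1_weight
begin

text \<open>The part of u that is at most l adds at most l to any average.\<close>

lemma dyadic_max_split:
  assumes um [measurable]: "u \<in> borel_measurable lebesgue" and u0: "\<And>x. 0 \<le> u x" and l: "0 < l"
    and M: "ennreal (2 * l) < dyadic_max u x"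
  shows "ennreal l < dyadic_max (\<lambda>x. u x * indicator {x. l < u x} x) x"
proof -
  define u1 where "u1 x = u x * indicator {x. l < u x} x" for x
  from M obtain j where j: "ennreal (2 * l) < dyadic_avg u j x" unfolding dyadic_max_def less_SUP_iff by blast
  have u1m [measurable]: "u1 \<in> borel_measurable lebesgue" unfolding u1_def[abs_def] by measurable
  have "(\<integral>\<^sup>+y\<in>dyadic_cell j x. ennreal (u y * w y) \<partial>lebesgue) \<le>
      (\<integral>\<^sup>+y. ennreal (u1 y * w y) * indicator (dyadic_cell j x) y + ennreal l * (ennreal (w y) * indicator (dyadic_cell j x) y) \<partial>lebesgue)"
  proof (intro nn_integral_mono)
    fix y
    have "ennreal (u y * w y) \<le> ennreal (u1 y * w y) + ennreal l * ennreal (w y)"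
    proof (cases "l < u y")
      case False
      then have "ennreal (u y) * ennreal (w y) \<le> ennreal l * ennreal (w y)" by (intro mult_right_mono ennreal_leI) auto
      then show ?thesis using u0[of y] by (simp add: ennreal_mult' add_increasing)
    qed (simp add: u1_def)
    then show "ennreal (u y * w y) * indicator (dyadic_cell j x) y \<le>
        ennreal (u1 y * w y) * indicator (dyadic_cell j x) y + ennreal l * (ennreal (w y) * indicator (dyadic_cell j x) y)"
      by (auto split: split_indicator)
  qed
  also have "\<dots> = (\<integral>\<^sup>+y\<in>dyadic_cell j x. ennreal (u1 y * w y) \<partial>lebesgue) + ennreal l * dyadic_weight j x"
    unfolding dyadic_weight_def by (subst nn_integral_add) (auto simp: nn_integral_cmult)
  finally have "dyadic_avg u j x \<le> ((\<integral>\<^sup>+y\<in>dyadic_cell j x. ennreal (u1 y * w y) \<partial>lebesgue) + ennreal l * dyadic_weight j x) / dyadic_weight j x"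
    unfolding dyadic_avg_def by (rule divide_right_mono_ennreal)
  also have "\<dots> = dyadic_avg u1 j x + ennreal l"
    using W_pos[of j x] l unfolding dyadic_avg_def add_divide_distrib_ennreal dyadic_weight_eq
    by (simp add: ennreal_mult[symmetric] divide_ennreal)
  finally have le: "dyadic_avg u j x \<le> dyadic_avg u1 j x + ennreal l" .
  have "ennreal l < dyadic_avg u1 j x"
  proof (rule ccontr)
    assume "\<not> ennreal l < dyadic_avg u1 j x"
    then have "dyadic_avg u1 j x + ennreal l \<le> ennreal l + ennreal l" by (intro add_right_mono) simp
    also have "\<dots> = ennreal (2 * l)" using l by (simp add: ennreal_plus[symmetric] del: ennreal_plus)
    finally show False using le j by (meson leD order_trans)
  qed
  also have "\<dots> \<le> dyadic_max u1 x" unfolding dyadic_max_def by (rule SUP_upper) simp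
  finally show ?thesis unfolding u1_def .
qed

text \<open>Marcinkiewicz interpolation at exponent 2, between the weak type (1,1) bound and the
  trivial bound for bounded functions: at height 2 * 2^k only the part of u above 2^k counts. The
  constant does not depend on the weight.\<close>

lemma strong_type:
  assumes um [measurable]: "u \<in> borel_measurable lebesgue" and u0: "\<And>x. 0 \<le> u x"
  shows "(\<integral>\<^sup>+x. epow (dyadic_max u x) 2 * ennreal (w x) \<partial>lebesgue) \<le> 16 * geo_sum (1/2) * (\<integral>\<^sup>+x. ennreal ((u x)\<^sup>2 * w x) \<partial>lebesgue)"
proof -
  define u1 where "u1 k x = u x * indicator {x. 2 powi k < u x} x" for k :: int and x
  have u1m [measurable]: "u1 k \<in> borel_measurable lebesgue" for k unfolding u1_def[abs_def] by measurable
  define S where "S k = {x. ennreal (2 * 2 powi k) < dyadic_max u x}" for k :: int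
  have Sm [measurable]: "S k \<in> sets lebesgue" for k
  proof -
    have "{x \<in> space lebesgue. ennreal (2 * 2 powi k) < dyadic_max u x} \<in> sets lebesgue" by measurable
    then show ?thesis by (simp add: S_def)
  qed
  have "(\<integral>\<^sup>+x. epow (dyadic_max u x) 2 * ennreal (w x) \<partial>lebesgue) \<le>
      (\<integral>\<^sup>+x. (\<integral>\<^sup>+k. ennreal (16 * (2 powi k * 2 powi k)) * (ennreal (w x) * indicator (S k) x) \<partial>count_space (UNIV :: int set)) \<partial>lebesgue)"
  proof (intro nn_integral_mono)
    fix x
    have "epow (dyadic_max u x) 2 * ennreal (w x) \<le> (\<integral>\<^sup>+k. ennreal (16 * (2 powi k * 2 powi k)) * indicator {k. ennreal (2 * 2 powi k) < dyadic_max u x} k \<partial>count_space (UNIV :: int set)) * ennreal (w x)"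
      by (intro mult_right_mono square_le_dyadic_sum) simp
    also have "\<dots> = (\<integral>\<^sup>+k. ennreal (16 * (2 powi k * 2 powi k)) * (ennreal (w x) * indicator (S k) x) \<partial>count_space (UNIV :: int set))"
      by (subst nn_integral_multc[symmetric]) (auto simp: S_def mult_ac intro!: nn_integral_cong split: split_indicator)
    finally show "epow (dyadic_max u x) 2 * ennreal (w x) \<le> (\<integral>\<^sup>+k. ennreal (16 * (2 powi k * 2 powi k)) * (ennreal (w x) * indicator (S k) x) \<partial>count_space (UNIV :: int set))" .
  qed
  also have "\<dots> = (\<integral>\<^sup>+k. (\<integral>\<^sup>+x. ennreal (16 * (2 powi k * 2 powi k)) * (ennreal (w x) * indicator (S k) x) \<partial>lebesgue) \<partial>count_space (UNIV :: int set))"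
    by (rule nn_integral_count_space_nn_integral) auto
  also have "\<dots> \<le> (\<integral>\<^sup>+k. (\<integral>\<^sup>+x. ennreal (16 * 2 powi k) * ennreal (u1 k x * w x) \<partial>lebesgue) \<partial>count_space (UNIV :: int set))"
  proof (rule nn_integral_mono)
    fix k :: int
    have p: "(0::real) < 2 powi k" by (rule pow2_pos)
    have "(\<integral>\<^sup>+x. ennreal (16 * (2 powi k * 2 powi k)) * (ennreal (w x) * indicator (S k) x) \<partial>lebesgue) =
        ennreal (16 * 2 powi k) * (ennreal (2 powi k) * (\<integral>\<^sup>+x. ennreal (w x) * indicator (S k) x \<partial>lebesgue))"
      using p by (subst nn_integral_cmult) (auto simp: ennreal_mult'[symmetric] mult.assoc[symmetric])
    also have "\<dots> \<le> ennreal (16 * 2 powi k) * (\<integral>\<^sup>+x. ennreal (u1 k x * w x) \<partial>lebesgue)"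
    proof (intro mult_left_mono)
      have "ennreal (2 powi k) * (\<integral>\<^sup>+x. ennreal (w x) * indicator (S k) x \<partial>lebesgue) \<le>
          ennreal (2 powi k) * (\<integral>\<^sup>+x. ennreal (w x) * indicator {x. ennreal (2 powi k) < dyadic_max (u1 k) x} x \<partial>lebesgue)"
      proof (intro mult_left_mono nn_integral_mono)
        fix x show "indicator (S k) x \<le> (indicator {x. ennreal (2 powi k) < dyadic_max (u1 k) x} x :: ennreal)"
          using dyadic_max_split[OF um u0 p, of x] unfolding S_def u1_def[abs_def] by (auto split: split_indicator)
      qed auto
      also have "\<dots> \<le> (\<integral>\<^sup>+x. ennreal (u1 k x * w x) \<partial>lebesgue)" by (rule weak_type) measurable
      finally show "ennreal (2 powi k) * (\<integral>\<^sup>+x. ennreal (w x) * indicator (S k) x \<partial>lebesgue) \<le> (\<integral>\<^sup>+x. ennreal (u1 k x * w x) \<partial>lebesgue)" .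
    qed simp
    also have "\<dots> = (\<integral>\<^sup>+x. ennreal (16 * 2 powi k) * ennreal (u1 k x * w x) \<partial>lebesgue)"
      by (rule nn_integral_cmult[symmetric]) measurable
    finally show "(\<integral>\<^sup>+x. ennreal (16 * (2 powi k * 2 powi k)) * (ennreal (w x) * indicator (S k) x) \<partial>lebesgue) \<le>
      (\<integral>\<^sup>+x. ennreal (16 * 2 powi k) * ennreal (u1 k x * w x) \<partial>lebesgue)" .
  qed
  also have "\<dots> = (\<integral>\<^sup>+x. (\<integral>\<^sup>+k. ennreal (16 * 2 powi k) * ennreal (u1 k x * w x) \<partial>count_space (UNIV :: int set)) \<partial>lebesgue)"
    by (rule nn_integral_count_space_nn_integral[symmetric]) auto
  also have "\<dots> \<le> (\<integral>\<^sup>+x. (16 * geo_sum (1/2)) * ennreal ((u x)\<^sup>2 * w x) \<partial>lebesgue)"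
  proof (intro nn_integral_mono)
    fix x
    have "(\<integral>\<^sup>+k. ennreal (16 * 2 powi k) * ennreal (u1 k x * w x) \<partial>count_space (UNIV :: int set)) =
       (\<integral>\<^sup>+k. (16 * ennreal (u x * w x)) * (ennreal (2 powi k) * indicator {k. 2 powi k < u x} k) \<partial>count_space (UNIV :: int set))"
      by (intro nn_integral_cong) (auto simp: u1_def ennreal_mult' mult_ac split: split_indicator)
    also have "\<dots> = (16 * ennreal (u x * w x)) * (\<integral>\<^sup>+k. (ennreal (2 powi k) * indicator {k. 2 powi k < u x} k) \<partial>count_space (UNIV :: int set))"
      by (rule nn_integral_cmult) simp
    also have "\<dots> \<le> (16 * ennreal (u x * w x)) * (ennreal (u x) * geo_sum (1/2))"
      by (intro mult_left_mono sum_powers_below u0) simp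
    also have "\<dots> = (16 * geo_sum (1/2)) * ennreal ((u x)\<^sup>2 * w x)"
      using u0[of x] by (simp add: ennreal_mult' power2_eq_square mult_ac)
    finally show "(\<integral>\<^sup>+k. ennreal (16 * 2 powi k) * ennreal (u1 k x * w x) \<partial>count_space (UNIV :: int set)) \<le>
      (16 * geo_sum (1/2)) * ennreal ((u x)\<^sup>2 * w x)" .
  qed
  also have "\<dots> = 16 * geo_sum (1/2) * (\<integral>\<^sup>+x. ennreal ((u x)\<^sup>2 * w x) \<partial>lebesgue)"
    by (rule nn_integral_cmult) measurable
  finally show ?thesis .
qed

end

text \<open>\<open>\<tau>\<close> is the ratio in \<open>lacunary_sum\<close> for the factor 1 -
  1/(2A) of \<open>W_doubling\<close> and the exponents 1/p - 1/q and 1/q. The power of A dominates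
  the constants A^((1 + p/q)/p) and A^(1/q) of the two bounds that are combined.\<close>

definition hedberg_const :: "real \<Rightarrow> real \<Rightarrow> real \<Rightarrow> ennreal" where
  "hedberg_const p q A = (let \<tau> = (1 - 1 / (2 * A)) powr (min (1 / p - 1 / q) (1 / q)) in
     ennreal (A powr ((1 + p / q) / p + 1 / q)) * (ennreal (1 / \<tau>) * geo_sum \<tau>))"

lemma hedberg_const:
  assumes "0 < p" "p < q" "1 \<le> A"
  shows "hedberg_const p q A < \<infinity>" "0 < hedberg_const p q A"
proof -
  define c where "c = min (1 / p - 1 / q) (1 / q)"
  have c: "c > 0" using assms by (simp add: c_def field_simps)
  define \<theta> where "\<theta> = 1 - 1 / (2 * A)"
  have \<theta>: "0 < \<theta>" "\<theta> < 1" using assms(3) by (auto simp: \<theta>_def field_simps)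
  have t: "0 < \<theta> powr c" "\<theta> powr c < 1" using \<theta> powr_less_mono2[OF c, of \<theta> 1] by auto
  have w: "hedberg_const p q A = ennreal (A powr ((1 + p / q) / p + 1 / q)) * (ennreal (1 / \<theta> powr c) * geo_sum (\<theta> powr c))"
    by (simp add: hedberg_const_def Let_def c_def \<theta>_def)
  show "hedberg_const p q A < \<infinity>"
    unfolding w using geo_sum_finite[of "\<theta> powr c"] t by (simp add: ennreal_mult_less_top)
  have "0 < geo_sum (\<theta> powr c)" using geo_sum_ge_one[of "\<theta> powr c"] by (rule less_le_trans[rotated]) simp
  then show "0 < hedberg_const p q A"
    unfolding w using t \<theta> assms by (intro ennreal_zero_less_mult_iff[THEN iffD2] conjI) (auto simp: ennreal_zero_less_divide)
qed

text \<open>One computation for both bounds on a cell of volume v and average weight \<omega>: the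
  integral inequality \<open>le\<close> is solved for f. In both uses the remaining exponent (1 -
  e)/s - g of \<omega> is 0.\<close>

lemma hedberg_bound:
  fixes f \<omega> M s v a e g :: real
  assumes f: "0 \<le> f" and \<omega>: "0 < \<omega>" and M: "0 \<le> M" and s: "0 < s" and v: "0 < v" and a: "0 < a"
    and le: "f powr s * (\<omega> / a) powr e * v \<le> M * (\<omega> * v)"
  shows "v powr g * f \<le> a powr (e / s) * (M powr (1 / s) * ((\<omega> * v) powr g * (\<omega> powr ((1 - e) / s - g))))"
proof -
  have "f powr s * (\<omega> / a) powr e \<le> M * \<omega>"
    by (rule mult_right_le_imp_le[OF _ v]) (use le in \<open>simp only: mult.assoc\<close>)
  then have "f powr s * (\<omega> / a) powr e * (\<omega> / a) powr (- e) \<le> M * \<omega> * (\<omega> / a) powr (- e)"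
    by (intro mult_right_mono) auto
  moreover have "(\<omega> / a) powr e * (\<omega> / a) powr (- e) = 1" using \<omega> a by (simp add: powr_add[symmetric])
  ultimately have "f powr s \<le> M * \<omega> * (\<omega> / a) powr (- e)" by (simp add: mult.assoc)
  then have "(f powr s) powr (1 / s) \<le> (M * \<omega> * (\<omega> / a) powr (- e)) powr (1 / s)"
    using s by (intro powr_mono2) auto
  moreover have "(f powr s) powr (1 / s) = f" using f s by (simp add: powr_powr)
  moreover have "(M * \<omega> * (\<omega> / a) powr (- e)) powr (1 / s) = M powr (1 / s) * (\<omega> powr ((1 - e) / s) * a powr (e / s))"
  proof -
    have "(\<omega> / a) powr (- e) = \<omega> powr (- e) * a powr e" using \<omega> a by (simp add: powr_divide powr_minus field_simps)
    then have "M * \<omega> * (\<omega> / a) powr (- e) = M * ((\<omega> * \<omega> powr (- e)) * a powr e)" by (simp only: mult.assoc)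
    also have "\<omega> * \<omega> powr (- e) = \<omega> powr (1 - e)" using powr_add[of \<omega> 1 "- e"] \<omega> by simp
    finally have "(M * \<omega> * (\<omega> / a) powr (- e)) powr (1 / s) = (M * (\<omega> powr (1 - e) * a powr e)) powr (1 / s)"
      by (rule arg_cong)
    also have "\<dots> = M powr (1 / s) * (\<omega> powr ((1 - e) / s) * a powr (e / s))"
      using M \<omega> a by (simp add: powr_mult powr_powr)
    finally show ?thesis .
  qed
  ultimately have "f \<le> M powr (1 / s) * (\<omega> powr ((1 - e) / s) * a powr (e / s))" by simp
  then have "v powr g * f \<le> v powr g * (M powr (1 / s) * (\<omega> powr ((1 - e) / s) * a powr (e / s)))"
    by (intro mult_left_mono) auto
  also have "\<dots> = a powr (e / s) * (M powr (1 / s) * ((\<omega> * v) powr g * (\<omega> powr ((1 - e) / s - g))))"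
    using \<omega> v by (simp add: powr_mult powr_diff field_simps)
  finally show ?thesis .
qed

context A1_weight
begin

text \<open>Each summand is bounded both by a dyadic maximal function and by the integral of \<open>F\<^sup>p w\<^bsup>p / q\<^esup>\<close>, with
  opposite powers of the weights \<open>W j\<close>, which grow geometrically in \<open>j\<close>; summing the smaller of the two
  bounds gives Hedberg's inequality.\<close>

theorem weighted_dyadic_bound:
  fixes F :: "real^'n \<Rightarrow> real" and f :: "int \<Rightarrow> real^'n \<Rightarrow> real"
  assumes p: "0 < p" and pq: "p < q"
    and Fm [measurable]: "F \<in> borel_measurable lebesgue" and F0: "\<And>x. 0 \<le> F x"
    and f0: "\<And>j x. 0 \<le> f j x" and fF: "\<And>j x. AE y in lebesgue. y \<in> dyadic_cell j x \<longrightarrow> f j x \<le> F y"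
    and \<beta>: "\<beta> = real CARD('n) * (1 / p - 1 / q)"
  shows "(\<integral>\<^sup>+x. epow (\<integral>\<^sup>+j. ennreal (2 powr (real_of_int j * \<beta>) * f j x) \<partial>count_space UNIV) q * ennreal (w x) \<partial>lebesgue)
    \<le> epow (hedberg_const p q A) q * (16 * geo_sum (1/2)) * epow (\<integral>\<^sup>+x. ennreal (F x powr p * w x powr (p / q)) \<partial>lebesgue) (q / p)"
proof -
  have q: "0 < q" using p pq by simp
  define S where "S x = (\<integral>\<^sup>+j. ennreal (2 powr (real_of_int j * \<beta>) * f j x) \<partial>count_space UNIV)" for x
  define Ip where "Ip = (\<integral>\<^sup>+x. ennreal (F x powr p * w x powr (p / q)) \<partial>lebesgue)"
  define K where "K = hedberg_const p q A"
  have K: "K < \<infinity>" "0 < K" unfolding K_def using hedberg_const[OF p pq A_ge] by auto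
  then obtain Kr where Kr: "K = ennreal Kr" "0 < Kr" by (cases K) auto
  have gs: "1 \<le> geo_sum (1/2)" by (rule geo_sum_ge_one)
  show ?thesis
  proof (cases "Ip = top")
    case True
    have "epow K q * (16 * geo_sum (1/2)) \<noteq> 0"
      using Kr gs by (auto simp: epow_ennreal)
    then have "epow K q * (16 * geo_sum (1/2)) * epow Ip (q / p) = top"
      unfolding True by (simp add: ennreal_mult_top)
    then show ?thesis unfolding K_def Ip_def by simp
  next
    case False
    show ?thesis
    proof (cases "Ip = 0")
      case True
      then have "AE x in lebesgue. ennreal (F x powr p * w x powr (p / q)) = 0"
        unfolding Ip_def by (subst (asm) nn_integral_0_iff_AE) measurable
      then have "AE x in lebesgue. F x = 0"
        using w_pos
      proof eventually_elim
        fix x assume z: "ennreal (F x powr p * w x powr (p / q)) = 0" and "0 < w x"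
        then have pos: "0 < w x powr (p / q)" by simp
        have "F x powr p * w x powr (p / q) \<le> 0 * w x powr (p / q)" using z by (simp add: ennreal_eq_0_iff)
        then have "F x powr p \<le> 0" by (rule mult_right_le_imp_le) (rule pos)
        then show "F x = 0" by (metis dual_order.antisym powr_eq_0_iff powr_ge_zero)
      qed
      then have "f j x = 0" for j x
      proof -
        have "AE y in lebesgue. y \<in> dyadic_cell j x \<longrightarrow> f j x \<le> 0"
          using \<open>AE x in lebesgue. F x = 0\<close> fF[of j x] by eventually_elim auto
        from dyadic_cell_AE_ex[OF this, of j x] f0[of j x] show ?thesis by force
      qed
      then show ?thesis by simp
    next
      case nz: False
      define I where "I = enn2real Ip powr (1 / p)"
      have Ipos: "0 < enn2real Ip" using False nz by (simp add: enn2real_positive_iff less_top[symmetric] zero_less_iff_neq_zero)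
      have I: "0 < I" using Ipos by (simp add: I_def)
      have IpI: "Ip = ennreal (I powr p)"
        using False p Ipos by (simp add: I_def powr_powr less_top[symmetric])
      define g where "g = 1 / p - 1 / q"
      have g: "0 < g" using p pq by (simp add: g_def field_simps)
      \<comment> \<open>With s = p/2 the auxiliary function u satisfies u^2 w = F^p w^(p/q), so a
        maximal inequality in L^2(w) is what is required. The exponent e is then determined by u w =
        F^s w^e.\<close>
      define s where "s = p / 2"
      have s: "0 < s" using p by (simp add: s_def)
      define e where "e = (1 + p / q) / 2"
      have e: "0 \<le> e" using p q by (simp add: e_def)
      have ges: "(1 - e) / s = g" using p q by (simp add: e_def s_def g_def field_simps)
      have es: "e / s = (1 + p / q) / p" unfolding e_def s_def using p by (simp add: divide_simps)
      define u where "u x = F x powr s * w x powr (- (g * s))" for x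
      have um [measurable]: "u \<in> borel_measurable lebesgue" unfolding u_def[abs_def] by measurable
      have u0: "0 \<le> u x" for x by (simp add: u_def)
      define Q where "Q = A powr (e / s + 1 / q)"
      have Vb: "2 powr (real_of_int j * \<beta>) = V j powr g" for j
        by (simp add: V_def \<beta> g_def powr_real_of_int'[symmetric] powr_realpow[symmetric] powr_powr mult_ac)
      have uw: "AE y in lebesgue. ennreal (u y * w y) = ennreal (F y powr s * w y powr e)"
        using w_pos
      proof eventually_elim
        fix y assume wy: "0 < w y"
        have "w y powr (- (g * s)) * w y = w y powr (- (g * s) + 1)" using powr_add[of "w y" "- (g * s)" 1] wy by (simp only: powr_one less_imp_le)
        also have "- (g * s) + 1 = e" using ges s by (simp add: field_simps)
        finally show "ennreal (u y * w y) = ennreal (F y powr s * w y powr e)" by (simp add: u_def mult.assoc)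
      qed
      \<comment> \<open>The first bound comes from the weighted average of u over the cell and grows
        like W^g.\<close>
      have b1: "V j powr g * f j x \<le> Q * (m * W j x powr g)" if m: "dyadic_max u x = ennreal M" "0 \<le> M" "m = M powr (1 / s)" for j x M m
      proof -
        have "ennreal (f j x powr s * (W j x / (A * V j)) powr e * V j) \<le> (\<integral>\<^sup>+y\<in>dyadic_cell j x. ennreal (F y powr s * w y powr e) \<partial>lebesgue)"
          by (rule lower_integral[OF Fm f0 fF s e])
        also have "\<dots> = (\<integral>\<^sup>+y\<in>dyadic_cell j x. ennreal (u y * w y) \<partial>lebesgue)"
          by (rule nn_integral_cong_AE) (use uw in \<open>eventually_elim, simp\<close>)
        also have "\<dots> = dyadic_avg u j x * dyadic_weight j x" by (rule dyadic_avg_times[symmetric])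
        also have "\<dots> \<le> dyadic_max u x * dyadic_weight j x" unfolding dyadic_max_def by (intro mult_right_mono SUP_upper) auto
        also have "\<dots> = ennreal (M * W j x)" using m W_pos[of j x] by (simp add: dyadic_weight_eq ennreal_mult)
        finally have "f j x powr s * (W j x / (A * V j)) powr e * V j \<le> M * W j x"
          using m W_pos[of j x] by (simp add: ennreal_le_iff)
        then have "f j x powr s * ((W j x / V j) / A) powr e * V j \<le> M * ((W j x / V j) * V j)"
          using V_pos[of j] by (simp add: mult.commute)
        from hedberg_bound[OF f0 _ m(2) s V_pos _ this, of g]
        have "V j powr g * f j x \<le> A powr (e / s) * (m * W j x powr g)"
          using W_pos[of j x] V_pos[of j] A_ge unfolding ges m(3) by simp
        also have "\<dots> \<le> Q * (m * W j x powr g)"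
          unfolding Q_def using A_ge q m by (intro mult_right_mono powr_mono) auto
        finally show ?thesis .
      qed
      \<comment> \<open>The second bound comes from the whole integral and decays like
        W^(-1/q).\<close>
      have b2: "V j powr g * f j x \<le> Q * (I * W j x powr (- (1 / q)))" for j x
      proof -
        have "ennreal (f j x powr p * (W j x / (A * V j)) powr (p / q) * V j) \<le> (\<integral>\<^sup>+y\<in>dyadic_cell j x. ennreal (F y powr p * w y powr (p / q)) \<partial>lebesgue)"
          using p q by (intro lower_integral[OF Fm f0 fF]) auto
        also have "\<dots> \<le> Ip" unfolding Ip_def by (intro nn_integral_mono) (auto split: split_indicator)
        finally have "f j x powr p * (W j x / (A * V j)) powr (p / q) * V j \<le> I powr p"
          unfolding IpI by (simp add: ennreal_le_iff)
        then have "f j x powr p * ((W j x / V j) / A) powr (p / q) * V j \<le> (I powr p / W j x) * ((W j x / V j) * V j)"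
          using V_pos[of j] W_pos[of j x] by (simp add: mult.commute)
        from hedberg_bound[OF f0 _ _ p V_pos _ this, of g]
        have "V j powr g * f j x \<le> A powr (p / q / p) * ((I powr p / W j x) powr (1 / p) * (W j x powr g * (W j x / V j) powr ((1 - p / q) / p - g)))"
          using W_pos[of j x] V_pos[of j] A_ge by simp
        also have "(1 - p / q) / p - g = 0" using p q by (simp add: g_def field_simps)
        also have "(W j x / V j) powr 0 = 1" using W_pos[of j x] V_pos[of j] by simp
        also have "(I powr p / W j x) powr (1 / p) * (W j x powr g * 1) = I * W j x powr (- (1 / q))"
        proof -
          have "(I powr p / W j x) powr (1 / p) = I * W j x powr (- (1 / p))"
            using I p W_pos[of j x] by (simp add: powr_divide powr_powr powr_minus field_simps)
          then have "(I powr p / W j x) powr (1 / p) * (W j x powr g * 1) = I * (W j x powr (- (1 / p)) * W j x powr g)" by simp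
          also have "W j x powr (- (1 / p)) * W j x powr g = W j x powr (- (1 / q))" by (simp add: powr_add[symmetric] g_def)
          finally show ?thesis .
        qed
        also have "A powr (p / q / p) * (I * W j x powr (- (1 / q))) \<le> Q * (I * W j x powr (- (1 / q)))"
          unfolding Q_def using A_ge I p q e s by (intro mult_right_mono powr_mono) auto
        finally show ?thesis .
      qed
      \<comment> \<open>Hedberg's inequality: summing the smaller bound over j gives S \<le> K
        m^(p/q) I^((q-p)/q). Raised to the power q it contains m^p = M^2, again because s =
        p/2.\<close>
      have pw: "epow (S x) q \<le> epow K q * ennreal (I powr (q - p)) * epow (dyadic_max u x) 2" for x
      proof (cases "dyadic_max u x")
        case top
        have "epow K q * ennreal (I powr (q - p)) \<noteq> 0" using Kr I by (simp add: epow_ennreal ennreal_eq_0_iff not_le)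
        then show ?thesis unfolding top by (simp add: ennreal_mult_top)
      next
        case (real M)
        define m where "m = M powr (1 / s)"
        note b1 = b1[OF real(2,1) m_def]
        show ?thesis
        proof (cases "M = 0")
          case True
          then have "2 powr (real_of_int j * \<beta>) * f j x \<le> 0" for j unfolding Vb using b1[of j] by (simp add: m_def)
          then have "S x = 0" unfolding S_def by (simp add: ennreal_neg)
          then show ?thesis by simp
        next
          case False
          then have M: "0 < M" and m: "0 < m" using real by (auto simp: m_def)
          define \<tau> where "\<tau> = (1 - 1 / (2 * A)) powr (min g (1 / q))"
          have "S x \<le> (\<integral>\<^sup>+j. ennreal Q * ennreal (min (m * W j x powr g) (I * W j x powr (- (1 / q)))) \<partial>count_space UNIV)"
            unfolding S_def
          proof (intro nn_integral_mono)
            fix j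
            have Q0: "0 \<le> Q" by (simp add: Q_def)
            have "2 powr (real_of_int j * \<beta>) * f j x \<le> Q * min (m * W j x powr g) (I * W j x powr (- (1 / q)))"
              unfolding Vb min_mult_distrib_left using b1[of j] b2[of j x] Q0 by simp
            then show "ennreal (2 powr (real_of_int j * \<beta>) * f j x) \<le> ennreal Q * ennreal (min (m * W j x powr g) (I * W j x powr (- (1 / q))))"
              using Q0 by (simp add: ennreal_mult'[symmetric] ennreal_leI)
          qed
          also have "\<dots> = ennreal Q * (\<integral>\<^sup>+j. ennreal (min (m * W j x powr g) (I * W j x powr (- (1 / q)))) \<partial>count_space UNIV)"
            by (rule nn_integral_cmult) simp
          also have "\<dots> \<le> ennreal Q * (ennreal (1 / \<tau>) * geo_sum \<tau> * ennreal (m powr ((1 / q) / (g + 1 / q)) * I powr (g / (g + 1 / q))))"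
            unfolding \<tau>_def using A_ge q m I g
            by (intro mult_left_mono lacunary_sum W_pos W_doubling) (auto simp: field_simps)
          also have "\<dots> = K * ennreal (m powr ((1 / q) / (g + 1 / q)) * I powr (g / (g + 1 / q)))"
            unfolding K_def hedberg_const_def Let_def \<tau>_def Q_def g_def es by (simp only: mult.assoc)
          also have "(1 / q) / (g + 1 / q) = p / q" using p q by (simp add: g_def)
          also have "g / (g + 1 / q) = (q - p) / q" using p q by (simp add: g_def field_simps)
          finally have "S x \<le> K * ennreal (m powr (p / q) * I powr ((q - p) / q))" .
          then have "epow (S x) q \<le> epow (K * ennreal (m powr (p / q) * I powr ((q - p) / q))) q"
            using q by (intro epow_mono) auto
          also have "\<dots> = epow K q * ennreal ((m powr (p / q) * I powr ((q - p) / q)) powr q)"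
            using q by (simp add: epow_mult epow_ennreal)
          also have "(m powr (p / q) * I powr ((q - p) / q)) powr q = I powr (q - p) * M powr 2"
            using m I q p M by (simp add: powr_mult powr_powr m_def s_def)
          also have "epow K q * ennreal (I powr (q - p) * M powr 2) = epow K q * ennreal (I powr (q - p)) * epow (dyadic_max u x) 2"
            using real M by (simp add: ennreal_mult epow_ennreal mult.assoc)
          finally show ?thesis .
        qed
      qed
      have u2: "(\<integral>\<^sup>+x. ennreal ((u x)\<^sup>2 * w x) \<partial>lebesgue) = Ip"
        unfolding Ip_def
      proof (rule nn_integral_cong_AE)
        show "AE x in lebesgue. ennreal ((u x)\<^sup>2 * w x) = ennreal (F x powr p * w x powr (p / q))"
          using w_pos
        proof eventually_elim
          fix x assume wx: "0 < w x"
          have "(u x)\<^sup>2 = F x powr p * w x powr (- (g * p))"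
            unfolding u_def power2_eq_square s_def
            by (simp add: powr_add[symmetric] mult.assoc mult.left_commute[of "w x powr _"])
          then have "(u x)\<^sup>2 * w x = F x powr p * (w x powr (- (g * p)) * w x powr 1)" using wx by simp
          also have "w x powr (- (g * p)) * w x powr 1 = w x powr (p / q)"
            unfolding powr_add[symmetric] using p q by (simp add: g_def field_simps)
          finally show "ennreal ((u x)\<^sup>2 * w x) = ennreal (F x powr p * w x powr (p / q))" by simp
        qed
      qed
      have "(\<integral>\<^sup>+x. epow (S x) q * ennreal (w x) \<partial>lebesgue) \<le>
          (\<integral>\<^sup>+x. (epow K q * ennreal (I powr (q - p))) * (epow (dyadic_max u x) 2 * ennreal (w x)) \<partial>lebesgue)"
        by (intro nn_integral_mono) (simp only: mult.assoc[symmetric], intro mult_right_mono pw, simp)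
      also have "\<dots> = (epow K q * ennreal (I powr (q - p))) * (\<integral>\<^sup>+x. epow (dyadic_max u x) 2 * ennreal (w x) \<partial>lebesgue)"
        by (rule nn_integral_cmult) measurable
      also have "\<dots> \<le> (epow K q * ennreal (I powr (q - p))) * (16 * geo_sum (1/2) * Ip)"
        using strong_type[OF um u0] unfolding u2 by (intro mult_left_mono) auto
      also have "\<dots> = epow K q * (16 * geo_sum (1/2)) * (ennreal (I powr (q - p)) * Ip)" by (simp only: mult_ac)
      also have "ennreal (I powr (q - p)) * Ip = epow Ip (q / p)"
        unfolding IpI using I p by (simp add: ennreal_mult[symmetric] powr_add[symmetric] epow_ennreal powr_powr)
      finally show ?thesis unfolding S_def K_def Ip_def .
    qed
  qed
qed

end

section \<open>Extrapolation\<close>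

lemma ennreal_divide_self_cancel: "0 < c \<Longrightarrow> c < \<infinity> \<Longrightarrow> a / c * c = (a :: ennreal)"
  by (cases c) (auto intro: ennreal_divide_cancel)

lemma ennreal_suminf_Suc_le: "(\<Sum>i. f (Suc i)) \<le> suminf f" for f :: "nat \<Rightarrow> ennreal"
  using suminf_offset[of f 1] by (simp add: add_increasing2)

lemma cube_emeasure:
  assumes "cube (Q :: (real^'n::finite) set)"
  shows "0 < emeasure lebesgue Q" "emeasure lebesgue Q < \<infinity>" "Q \<in> sets lebesgue"
proof -
  obtain p l where pl: "0 < l" "Q = cbox p (p + (\<chi> i. l))" using assms by (auto simp: cube_def)
  have "emeasure lebesgue Q = ennreal (l ^ CARD('n))" using emeasure_cube[of l p] pl by simp
  then show "0 < emeasure lebesgue Q" "emeasure lebesgue Q < \<infinity>" using zero_less_power[OF pl(1), of "CARD('n)"] by auto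
  show "Q \<in> sets lebesgue" using pl(2) by simp
qed

lemma cube_integral_le:
  assumes "cube Q" "x \<in> Q"
  shows "(\<integral>\<^sup>+y\<in>Q. u y \<partial>lebesgue) \<le> emeasure lebesgue Q * cube_max u x"
proof -
  have "(\<integral>\<^sup>+y\<in>Q. u y \<partial>lebesgue) = (\<integral>\<^sup>+y\<in>Q. u y \<partial>lebesgue) / emeasure lebesgue Q * emeasure lebesgue Q"
    by (rule ennreal_divide_self_cancel[OF cube_emeasure(1,2)[OF assms(1)], symmetric])
  also have "\<dots> \<le> cube_max u x * emeasure lebesgue Q"
    by (intro mult_right_mono cube_max_ge assms) simp
  finally show ?thesis by (simp only: mult.commute)
qed

lemma real_ball_AE:
  assumes "\<And>r :: nat. AE x in lebesgue. x \<in> ball (0 :: 'a::euclidean_space) (real r) \<longrightarrow> P x"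
  shows "AE x in lebesgue. P x"
proof -
  have "AE x in lebesgue. \<forall>r :: nat. x \<in> ball (0 :: 'a) (real r) \<longrightarrow> P x"
    using assms by (subst AE_all_countable) auto
  then show ?thesis
  proof eventually_elim
    fix x assume *: "\<forall>r :: nat. x \<in> ball (0 :: 'a) (real r) \<longrightarrow> P x"
    obtain r :: nat where "norm x < real r" using reals_Archimedean2 by blast
    with * show "P x" by auto
  qed
qed

lemma ball_sets_lebesgue [measurable]: "ball c r \<in> sets lebesgue"
  using lmeasurable_ball[of c r] by (auto simp: fmeasurable_def)

lemma fspace_unit_indicator:
  fixes c :: "real^'n::finite"
  assumes X: "ball_quasi_banach X" and r: "0 < r"
  obtains a where "0 < a" "(\<lambda>x. complex_of_real (a * indicator (ball c r) x)) \<in> fspace X"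
    "X (\<lambda>x. complex_of_real (a * indicator (ball c r) x)) = 1"
proof -
  have f: "indicator (ball c r) \<in> fspace X" by (rule bqb_ball[OF X r])
  then have fm: "(indicator (ball c r) :: real^'n \<Rightarrow> complex) \<in> borel_measurable lebesgue" and fin: "X (indicator (ball c r)) < \<infinity>"
    by (auto simp: fspace_def)
  have nz: "X (indicator (ball c r)) \<noteq> 0"
  proof
    assume "X (indicator (ball c r)) = 0"
    from bqb_zero[OF X fm this] have "AE x in lebesgue. x \<notin> ball c r"
      by eventually_elim (auto split: split_indicator_asm)
    then have "emeasure lebesgue (ball c r) = 0"
      by (subst (asm) AE_iff_measurable[of "ball c r"]) auto
    then have "negligible (ball c r)" unfolding negligible_iff_null_sets by (intro null_setsI) auto
    moreover have "\<not> negligible (ball c r)" using r by (intro open_not_negligible) auto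
    ultimately show False by simp
  qed
  obtain v where v: "X (indicator (ball c r)) = ennreal v" "0 < v" using fin nz by (cases "X (indicator (ball c r))") auto
  define a where "a = 1 / v"
  have eq: "(\<lambda>x. complex_of_real (a * indicator (ball c r) x)) = (\<lambda>x. complex_of_real a * indicator (ball c r) x)"
    by (auto split: split_indicator)
  have one: "X (\<lambda>x. complex_of_real (a * indicator (ball c r) x)) = 1"
    unfolding eq bqb_cmult[OF X fm] v using v(2) by (simp add: a_def ennreal_mult[symmetric] norm_divide)
  show thesis
    by (rule that[of a]) (use v one fm in \<open>auto simp: a_def fspace_def eq\<close>)
qed

text \<open>A normalised indicator of any ball is an admissible test function, so u is integrable
  over every ball.\<close>

lemma assoc_finite_AE:
  fixes Z :: "'n::finite fun_norm"
  assumes Z: "ball_quasi_banach Z" and um [measurable]: "u \<in> borel_measurable lebesgue"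
    and N: "\<And>g. g \<in> fspace Z \<Longrightarrow> Z g = 1 \<Longrightarrow> (\<integral>\<^sup>+x. u x * ennreal (norm (g x)) \<partial>lebesgue) < \<infinity>"
  shows "AE x in lebesgue. u x < \<infinity>"
proof (rule real_ball_AE)
  fix r :: nat
  show "AE x in lebesgue. x \<in> ball 0 (real r) \<longrightarrow> u x < \<infinity>"
  proof (cases "r = 0")
    case False
    then have "0 < real r" by simp
    from fspace_unit_indicator[OF Z this, of 0] obtain a where a: "0 < a" "(\<lambda>x. complex_of_real (a * indicator (ball 0 (real r)) x)) \<in> fspace Z"
      "Z (\<lambda>x. complex_of_real (a * indicator (ball 0 (real r)) x)) = 1" by metis
    have "(\<integral>\<^sup>+x. u x * ennreal (norm (complex_of_real (a * indicator (ball 0 (real r)) x))) \<partial>lebesgue) \<noteq> \<infinity>"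
      using N[OF a(2,3)] by simp
    then have "AE x in lebesgue. u x * ennreal (norm (complex_of_real (a * indicator (ball 0 (real r)) x))) \<noteq> \<infinity>"
      by (intro nn_integral_PInf_AE) measurable
    then show ?thesis
    proof eventually_elim
      fix x assume *: "u x * ennreal (norm (complex_of_real (a * indicator (ball 0 (real r)) x))) \<noteq> \<infinity>"
      show "x \<in> ball 0 (real r) \<longrightarrow> u x < \<infinity>"
      proof
        assume "x \<in> ball 0 (real r)"
        with * a(1) have "u x * ennreal a \<noteq> \<infinity>" by simp
        then show "u x < \<infinity>" using a(1) by (cases "u x") (auto simp: ennreal_top_mult)
      qed
    qed
  qed simp
qed

lemma assoc_real:
  "assoc Z (\<lambda>x. complex_of_real (g x)) = (SUP f \<in> {f \<in> fspace Z. Z f = 1}. \<integral>\<^sup>+x. ennreal \<bar>g x\<bar> * ennreal (norm (f x)) \<partial>lebesgue)"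
  unfolding assoc_def by (intro SUP_cong refl nn_integral_cong) (simp add: norm_mult ennreal_mult)

lemma assoc_real_ge:
  assumes "f \<in> fspace Z" "Z f = 1"
  shows "(\<integral>\<^sup>+x. ennreal \<bar>g x\<bar> * ennreal (norm (f x)) \<partial>lebesgue) \<le> assoc Z (\<lambda>x. complex_of_real (g x))"
  unfolding assoc_real using assms by (intro SUP_upper) auto

text \<open>The weight is the series of the iterated maximal functions M^i g divided by (2C)^i,
  where C bounds the operator norm of M. Applying M shifts the series by one term, which costs the
  factor 2C; this is the A_1 condition. The term i = 0 is g, and the norms sum to at most 2.\<close>

theorem rubio_de_francia:
  fixes Z :: "'n::finite fun_norm"
  assumes Z: "ball_banach Z" and bdd: "hl_max_bounded_on (assoc Z)"
  obtains A where "1 \<le> A" "\<And>g. g \<in> borel_measurable lebesgue \<Longrightarrow> (\<And>x. 0 \<le> g x) \<Longrightarrow>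
    assoc Z (\<lambda>x. complex_of_real (g x)) \<le> 1 \<Longrightarrow> \<not> (AE x in lebesgue. g x = 0) \<Longrightarrow>
    \<exists>w. A1_weight w A \<and> (AE x in lebesgue. g x \<le> w x) \<and> assoc Z (\<lambda>x. complex_of_real (w x)) \<le> 2"
proof -
  note Zq = bb_bqb[OF Z]
  obtain C0 where C0: "C0 > 0" "\<And>f. f \<in> fspace (assoc Z) \<Longrightarrow> ext_norm (assoc Z) (hl_max f) \<le> ennreal C0 * assoc Z f"
    using bdd unfolding hl_max_bounded_on_def by blast
  define C where "C = max 1 C0"
  have C: "1 \<le> C" "\<And>f. f \<in> fspace (assoc Z) \<Longrightarrow> ext_norm (assoc Z) (hl_max f) \<le> ennreal C * assoc Z f"
    using C0 by (auto simp: C_def intro: order_trans[OF C0(2)] intro!: mult_right_mono ennreal_leI)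
  have "\<exists>w. A1_weight w (2 * C) \<and> (AE x in lebesgue. g x \<le> w x) \<and> assoc Z (\<lambda>x. complex_of_real (w x)) \<le> 2"
    if gm: "g \<in> borel_measurable lebesgue" and g0: "\<And>x. 0 \<le> g x"
      and gZ: "assoc Z (\<lambda>x. complex_of_real (g x)) \<le> 1" and gn: "\<not> (AE x in lebesgue. g x = 0)" for g
  proof -
    \<comment> \<open>\<open>enn2real\<close> makes the iterates real functions. Nothing is lost
      almost everywhere, since boundedness of M on the associate space makes them finite
      there.\<close>
    define G where "G = rec_nat g (\<lambda>_ h x. enn2real (hl_max (\<lambda>y. complex_of_real (h y)) x))"
    have G_0: "G 0 = g" and G_Suc: "G (Suc i) = (\<lambda>x. enn2real (hl_max (\<lambda>y. complex_of_real (G i y)) x))" for i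
      by (simp_all add: G_def)
    have G0: "0 \<le> G i x" for i x using g0 by (cases i) (simp_all add: G_0 G_Suc)
    have Gm [measurable]: "G i \<in> borel_measurable lebesgue" for i
    proof (cases i)
      case (Suc k)
      have [measurable]: "hl_max (\<lambda>y. complex_of_real (G k y)) \<in> borel_measurable lebesgue"
        by (rule borel_imp_lebesgue[OF hl_max_measurable])
      show ?thesis unfolding Suc G_Suc by measurable
    qed (use gm in \<open>simp add: G_0\<close>)
    have GZ: "assoc Z (\<lambda>x. complex_of_real (G i x)) \<le> ennreal (C ^ i)" for i
    proof (induction i)
      case 0 then show ?case using gZ by (simp add: G_0)
    next
      case (Suc i)
      have f: "(\<lambda>x. complex_of_real (G i x)) \<in> fspace (assoc Z)"
        using Suc by (auto simp: fspace_def intro: le_less_trans)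
      have le: "ext_norm (assoc Z) (hl_max (\<lambda>x. complex_of_real (G i x))) \<le> ennreal C * ennreal (C ^ i)"
        using C(2)[OF f] mult_left_mono[OF Suc, of "ennreal C"] by (auto intro: order_trans)
      then have "ext_norm (assoc Z) (hl_max (\<lambda>x. complex_of_real (G i x))) < \<infinity>"
        by (auto intro: le_less_trans simp: ennreal_mult_less_top)
      then have "assoc Z (\<lambda>x. complex_of_real (G (Suc i) x)) = ext_norm (assoc Z) (hl_max (\<lambda>x. complex_of_real (G i x)))"
        unfolding ext_norm_def G_Suc by (auto split: if_splits)
      then show ?case using le C(1) by (simp add: ennreal_mult)
    qed
    have Gfin: "AE x in lebesgue. hl_max (\<lambda>y. complex_of_real (G i y)) x < \<infinity>" for i
    proof -
      have f: "(\<lambda>x. complex_of_real (G i x)) \<in> fspace (assoc Z)"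
        using GZ[of i] by (auto simp: fspace_def intro: le_less_trans)
      have "ext_norm (assoc Z) (hl_max (\<lambda>x. complex_of_real (G i x))) \<le> ennreal C * ennreal (C ^ i)"
        using C(2)[OF f] mult_left_mono[OF GZ[of i], of "ennreal C"] by (auto intro: order_trans)
      also have "\<dots> < \<infinity>" by (simp add: ennreal_mult_less_top)
      finally show ?thesis unfolding ext_norm_def by (auto split: if_splits)
    qed
    \<comment> \<open>The series keeps its values in [0, infinity] until it is known to be finite
      almost everywhere.\<close>
    define w where "w x = (\<Sum>i. ennreal (1 / (2 * C) ^ i) * ennreal (G i x))" for x
    have wm [measurable]: "w \<in> borel_measurable lebesgue" unfolding w_def[abs_def] by measurable
    have gw: "ennreal (g x) \<le> w x" for x
      unfolding w_def using ennreal_le_suminf[of "\<lambda>i. ennreal (1 / (2 * C) ^ i) * ennreal (G i x)" 0] by (simp add: G_0)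
    have wZ: "(\<integral>\<^sup>+x. w x * ennreal (norm (f x)) \<partial>lebesgue) \<le> 2" if f: "f \<in> fspace Z" "Z f = 1" for f
    proof -
      have fm [measurable]: "f \<in> borel_measurable lebesgue" using f by (simp add: fspace_def)
      have "(\<integral>\<^sup>+x. w x * ennreal (norm (f x)) \<partial>lebesgue) = (\<integral>\<^sup>+x. (\<Sum>i. ennreal (1 / (2 * C) ^ i) * (ennreal (G i x) * ennreal (norm (f x)))) \<partial>lebesgue)"
        unfolding w_def by (simp add: ennreal_suminf_multc[symmetric] mult.assoc)
      also have "\<dots> = (\<Sum>i. \<integral>\<^sup>+x. ennreal (1 / (2 * C) ^ i) * (ennreal (G i x) * ennreal (norm (f x))) \<partial>lebesgue)"
        by (intro nn_integral_suminf) measurable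
      also have "\<dots> = (\<Sum>i. ennreal (1 / (2 * C) ^ i) * (\<integral>\<^sup>+x. ennreal (G i x) * ennreal (norm (f x)) \<partial>lebesgue))"
        by (intro suminf_cong nn_integral_cmult) measurable
      also have "\<dots> \<le> (\<Sum>i. ennreal ((1 / 2) ^ i))"
      proof (intro suminf_le)
        fix i
        have "(\<integral>\<^sup>+x. ennreal (G i x) * ennreal (norm (f x)) \<partial>lebesgue) \<le> assoc Z (\<lambda>x. complex_of_real (G i x))"
          using assoc_real_ge[OF f, of "G i"] G0[of i] by simp
        also have "\<dots> \<le> ennreal (C ^ i)" by (rule GZ)
        finally have "ennreal (1 / (2 * C) ^ i) * (\<integral>\<^sup>+x. ennreal (G i x) * ennreal (norm (f x)) \<partial>lebesgue) \<le> ennreal (1 / (2 * C) ^ i) * ennreal (C ^ i)"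
          by (intro mult_left_mono) auto
        also have "\<dots> = ennreal ((1 / 2) ^ i)" using C(1) by (simp add: ennreal_mult[symmetric] power_mult_distrib power_one_over)
        finally show "ennreal (1 / (2 * C) ^ i) * (\<integral>\<^sup>+x. ennreal (G i x) * ennreal (norm (f x)) \<partial>lebesgue) \<le> ennreal ((1 / 2) ^ i)" .
      qed auto
      also have "\<dots> = ennreal (\<Sum>i. (1 / 2) ^ i)" by (intro suminf_ennreal2 summable_geometric) auto
      also have "(\<Sum>i. (1 / 2 :: real) ^ i) = 2" by (subst suminf_geometric) auto
      finally show ?thesis by simp
    qed
    have wfin: "AE x in lebesgue. w x < \<infinity>"
      by (rule assoc_finite_AE[OF Zq wm]) (rule le_less_trans[OF wZ], simp_all)
    have wA1: "AE x in lebesgue. \<forall>Q. cube Q \<and> x \<in> Q \<longrightarrow> (\<integral>\<^sup>+y\<in>Q. w y \<partial>lebesgue) \<le> ennreal (2 * C) * emeasure lebesgue Q * w x"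
    proof -
      have "AE x in lebesgue. \<forall>i. hl_max (\<lambda>y. complex_of_real (G i y)) x < \<infinity>"
        using Gfin by (subst AE_all_countable) auto
      then show ?thesis
      proof eventually_elim
        fix x assume fin: "\<forall>i. hl_max (\<lambda>y. complex_of_real (G i y)) x < \<infinity>"
        show "\<forall>Q. cube Q \<and> x \<in> Q \<longrightarrow> (\<integral>\<^sup>+y\<in>Q. w y \<partial>lebesgue) \<le> ennreal (2 * C) * emeasure lebesgue Q * w x"
        proof (intro allI impI, elim conjE)
          fix Q :: "(real^'n) set" assume Q: "cube Q" "x \<in> Q"
          note [measurable] = cube_emeasure(3)[OF Q(1)]
          have "(\<integral>\<^sup>+y\<in>Q. w y \<partial>lebesgue) = (\<integral>\<^sup>+y. (\<Sum>i. ennreal (1 / (2 * C) ^ i) * (ennreal (G i y) * indicator Q y)) \<partial>lebesgue)"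
            unfolding w_def by (simp add: ennreal_suminf_multc[symmetric] mult.assoc)
          also have "\<dots> = (\<Sum>i. \<integral>\<^sup>+y. ennreal (1 / (2 * C) ^ i) * (ennreal (G i y) * indicator Q y) \<partial>lebesgue)"
            by (intro nn_integral_suminf) measurable
          also have "\<dots> = (\<Sum>i. ennreal (1 / (2 * C) ^ i) * (\<integral>\<^sup>+y\<in>Q. ennreal (G i y) \<partial>lebesgue))"
            by (intro suminf_cong nn_integral_cmult) measurable
          also have "\<dots> \<le> (\<Sum>i. (ennreal (2 * C) * emeasure lebesgue Q) * (ennreal (1 / (2 * C) ^ Suc i) * ennreal (G (Suc i) x)))"
          proof (intro suminf_le)
            fix i
            have cm: "(p * e) * (m * h) = (p * m) * (e * h)" for p e m h :: ennreal by (simp only: mult_ac)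
            have "(\<integral>\<^sup>+y\<in>Q. ennreal (G i y) \<partial>lebesgue) \<le> emeasure lebesgue Q * hl_max (\<lambda>y. complex_of_real (G i y)) x"
              using cube_integral_le[OF Q, of "\<lambda>y. ennreal (G i y)"] G0[of i] by (simp add: hl_max_eq_cube_max)
            also have "hl_max (\<lambda>y. complex_of_real (G i y)) x = ennreal (G (Suc i) x)" using fin by (simp add: G_Suc)
            finally have "ennreal (1 / (2 * C) ^ i) * (\<integral>\<^sup>+y\<in>Q. ennreal (G i y) \<partial>lebesgue) \<le> ennreal (1 / (2 * C) ^ i) * (emeasure lebesgue Q * ennreal (G (Suc i) x))"
              by (intro mult_left_mono) auto
            also have e1: "ennreal (1 / (2 * C) ^ i) = ennreal (2 * C) * ennreal (1 / (2 * C) ^ Suc i)"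
              using C(1) by (simp add: ennreal_mult'[symmetric] del: ennreal_mult' ennreal_mult)
            also have "(ennreal (2 * C) * ennreal (1 / (2 * C) ^ Suc i)) * (emeasure lebesgue Q * ennreal (G (Suc i) x)) =
                (ennreal (2 * C) * emeasure lebesgue Q) * (ennreal (1 / (2 * C) ^ Suc i) * ennreal (G (Suc i) x))" by (rule cm)
            finally show "ennreal (1 / (2 * C) ^ i) * (\<integral>\<^sup>+y\<in>Q. ennreal (G i y) \<partial>lebesgue) \<le>
              (ennreal (2 * C) * emeasure lebesgue Q) * (ennreal (1 / (2 * C) ^ Suc i) * ennreal (G (Suc i) x))"
              unfolding e1 .
          qed auto
          also have "\<dots> = (ennreal (2 * C) * emeasure lebesgue Q) * (\<Sum>i. ennreal (1 / (2 * C) ^ Suc i) * ennreal (G (Suc i) x))"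
            by (rule ennreal_suminf_cmult)
          also have "\<dots> \<le> (ennreal (2 * C) * emeasure lebesgue Q) * w x"
            unfolding w_def
            by (intro mult_left_mono ennreal_suminf_Suc_le[of "\<lambda>i. ennreal (1 / (2 * C) ^ i) * ennreal (G i x)"]) simp
          finally show "(\<integral>\<^sup>+y\<in>Q. w y \<partial>lebesgue) \<le> ennreal (2 * C) * emeasure lebesgue Q * w x" .
        qed
      qed
    qed
    \<comment> \<open>If w vanished at a point where the A_1 inequality holds, it would vanish
      almost everywhere on each cube containing that point. Then g would vanish almost everywhere
      too.\<close>
    have wpos: "AE x in lebesgue. 0 < w x"
    proof -
      have contra: "False" if bad: "w x0 = 0" "\<forall>Q. cube Q \<and> x0 \<in> Q \<longrightarrow> (\<integral>\<^sup>+y\<in>Q. w y \<partial>lebesgue) \<le> ennreal (2 * C) * emeasure lebesgue Q * w x0" for x0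
      proof -
        have "AE x in lebesgue. w x = 0"
        proof (rule real_ball_AE)
          fix r :: nat
          define L where "L = real r + norm x0 + 1"
          have L: "L > 0" by (simp add: L_def add_nonneg_pos)
          define Q where "Q = cbox (- (\<chi> i. L)) (- (\<chi> i. L) + (\<chi> i. 2 * L) :: real^'n)"
          have cQ: "cube Q" unfolding cube_def Q_def using L by (intro exI[of _ "- (\<chi> i. L)"] exI[of _ "2 * L"]) auto
          have mem: "x \<in> Q" if "norm x \<le> L" for x
          proof -
            have "\<bar>x $ i\<bar> \<le> L" for i using component_le_norm_cart[of x i] that by linarith
            then show ?thesis unfolding Q_def by (auto simp: mem_box_cart abs_le_iff minus_le_iff)
          qed
          have "x0 \<in> Q" by (rule mem) (simp add: L_def)
          then have "(\<integral>\<^sup>+y\<in>Q. w y \<partial>lebesgue) = 0" using bad cQ by fastforce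
          then have "AE y in lebesgue. w y * indicator Q y = 0"
            using cube_emeasure(3)[OF cQ] by (subst (asm) nn_integral_0_iff_AE) auto
          then show "AE x in lebesgue. x \<in> ball 0 (real r) \<longrightarrow> w x = 0"
          proof eventually_elim
            fix y assume "w y * indicator Q y = 0"
            moreover have "y \<in> Q" if "y \<in> ball 0 (real r)" 
            proof (rule mem)
              have "norm y < real r" using that by simp
              then show "norm y \<le> L" unfolding L_def using norm_ge_zero[of x0] by linarith
            qed
            ultimately show "y \<in> ball 0 (real r) \<longrightarrow> w y = 0" by auto
          qed
        qed
        then have "AE x in lebesgue. g x = 0"
        proof eventually_elim
          fix x assume "w x = 0"
          with gw[of x] have "ennreal (g x) \<le> 0" by simp
          then show "g x = 0" using g0[of x] by (simp add: ennreal_eq_0_iff)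
        qed
        with gn show False by blast
      qed
      show ?thesis
        using wA1
      proof eventually_elim
        fix x assume "\<forall>Q. cube Q \<and> x \<in> Q \<longrightarrow> (\<integral>\<^sup>+y\<in>Q. w y \<partial>lebesgue) \<le> ennreal (2 * C) * emeasure lebesgue Q * w x"
        with contra[of x] show "0 < w x" by (auto simp: zero_less_iff_neq_zero)
      qed
    qed
    define v where "v x = enn2real (w x)" for x
    have vw: "AE x in lebesgue. ennreal (v x) = w x" using wfin by eventually_elim (simp add: v_def)
    have "A1_weight v (2 * C)"
    proof
      show "v \<in> borel_measurable lebesgue" unfolding v_def[abs_def] by measurable
      show "AE x in lebesgue. 0 < v x" using wpos wfin by eventually_elim (simp add: v_def enn2real_positive_iff)
      show "1 \<le> 2 * C" using C(1) by simp
      have vQ: "(\<integral>\<^sup>+y\<in>Q. ennreal (v y) \<partial>lebesgue) = (\<integral>\<^sup>+y\<in>Q. w y \<partial>lebesgue)" for Q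
        using vw by (intro nn_integral_cong_AE) (auto elim!: eventually_mono)
      show "AE x in lebesgue. \<forall>Q. cube Q \<and> x \<in> Q \<longrightarrow>
        (\<integral>\<^sup>+y\<in>Q. ennreal (v y) \<partial>lebesgue) \<le> ennreal (2 * C) * emeasure lebesgue Q * ennreal (v x)"
        using wA1 vw by eventually_elim (simp add: vQ)
    qed
    moreover have "AE x in lebesgue. g x \<le> v x"
      using vw
    proof eventually_elim
      fix x assume "ennreal (v x) = w x"
      with gw[of x] have "ennreal (g x) \<le> ennreal (v x)" by simp
      then show "g x \<le> v x" by (subst (asm) ennreal_le_iff) (auto simp: v_def)
    qed
    moreover have "assoc Z (\<lambda>x. complex_of_real (v x)) \<le> 2"
      unfolding assoc_real
    proof (rule SUP_least)
      fix f assume f: "f \<in> {f \<in> fspace Z. Z f = 1}"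
      have "(\<integral>\<^sup>+x. ennreal \<bar>v x\<bar> * ennreal (norm (f x)) \<partial>lebesgue) = (\<integral>\<^sup>+x. w x * ennreal (norm (f x)) \<partial>lebesgue)"
        using vw by (intro nn_integral_cong_AE) (auto elim!: eventually_mono simp: v_def)
      then show "(\<integral>\<^sup>+x. ennreal \<bar>v x\<bar> * ennreal (norm (f x)) \<partial>lebesgue) \<le> 2" using wZ f by simp
    qed
    ultimately show ?thesis by blast
  qed
  then show thesis using C(1) by (intro that[of "2 * C"]) auto
qed

section \<open>From weighted inequalities to function spaces\<close>

lemma assoc_hoelder:
  assumes Z: "ball_quasi_banach Z" and fm: "f \<in> borel_measurable lebesgue" and f: "Z (\<lambda>x. complex_of_real (f x)) < \<infinity>"
    and gm: "g \<in> borel_measurable lebesgue"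
  shows "(\<integral>\<^sup>+x. ennreal \<bar>f x * g x\<bar> \<partial>lebesgue) \<le> Z (\<lambda>x. complex_of_real (f x)) * assoc Z (\<lambda>x. complex_of_real (g x))"
proof -
  have cm: "(\<lambda>x. complex_of_real (f x)) \<in> borel_measurable lebesgue" using fm by measurable
  show ?thesis
  proof (cases "Z (\<lambda>x. complex_of_real (f x)) = 0")
    case True
    from bqb_zero[OF Z cm True] have "AE x in lebesgue. ennreal \<bar>f x * g x\<bar> = 0" by eventually_elim simp
    then have "(\<integral>\<^sup>+x. ennreal \<bar>f x * g x\<bar> \<partial>lebesgue) = 0"
      using fm gm by (subst nn_integral_0_iff_AE) auto
    then show ?thesis by simp
  next
    case False
    with f obtain v where v: "Z (\<lambda>x. complex_of_real (f x)) = ennreal v" "0 < v"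
      by (cases "Z (\<lambda>x. complex_of_real (f x))") auto
    define h where "h x = complex_of_real (1 / v) * complex_of_real (f x)" for x
    have nv: "norm (complex_of_real (1 / v)) = 1 / v" using v(2) unfolding norm_of_real by simp
    have Zh: "Z h = 1" unfolding h_def bqb_cmult[OF Z cm] v nv using v(2) by (simp add: ennreal_mult[symmetric])
    have hf: "h \<in> fspace Z" using Zh cm by (simp add: fspace_def h_def[abs_def])
    have "(\<integral>\<^sup>+x. ennreal \<bar>f x * g x\<bar> \<partial>lebesgue) = (\<integral>\<^sup>+x. ennreal v * (ennreal \<bar>g x\<bar> * ennreal (norm (h x))) \<partial>lebesgue)"
      using v(2) by (intro nn_integral_cong) (simp add: h_def norm_mult norm_divide ennreal_mult[symmetric] abs_mult mult_ac)
    also have "\<dots> = ennreal v * (\<integral>\<^sup>+x. ennreal \<bar>g x\<bar> * ennreal (norm (h x)) \<partial>lebesgue)"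
      using gm hf by (intro nn_integral_cmult) (auto simp: fspace_def)
    also have "\<dots> \<le> ennreal v * assoc Z (\<lambda>x. complex_of_real (g x))"
      by (intro mult_left_mono assoc_real_ge[OF hf Zh]) simp
    finally show ?thesis unfolding v .
  qed
qed

lemma pow_space_real:
  assumes "\<And>x. 0 \<le> f x"
  shows "pow_space X r (\<lambda>x. complex_of_real (f x)) = epow (X (\<lambda>x. complex_of_real (f x powr r))) (1 / r)"
  using assms by (simp add: pow_space_def abs_pow_def)

lemma measurable_int_sum:
  fixes f :: "int \<Rightarrow> 'a \<Rightarrow> ennreal"
  assumes "\<And>j. f j \<in> borel_measurable M"
  shows "(\<lambda>x. \<integral>\<^sup>+j. f j x \<partial>count_space UNIV) \<in> borel_measurable M"
proof -
  have "(\<integral>\<^sup>+j. f j x \<partial>count_space UNIV) = (\<Sum>n. f (int_decode n) x)" for x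
    using nn_integral_bij_count_space[OF bij_int_decode, of "\<lambda>j. f j x"] by (simp add: nn_integral_count_space_nat)
  then show ?thesis using assms by simp
qed

definition dyadic_sum :: "real \<Rightarrow> (int \<Rightarrow> 'a \<Rightarrow> real) \<Rightarrow> 'a \<Rightarrow> ennreal" where
  "dyadic_sum \<beta> f x = (\<integral>\<^sup>+j. ennreal (2 powr (real_of_int j * \<beta>) * f j x) \<partial>count_space UNIV)"

lemma dyadic_sum_measurable:
  "(\<And>j. f j \<in> borel_measurable M) \<Longrightarrow> dyadic_sum \<beta> f \<in> borel_measurable M"
  unfolding dyadic_sum_def[abs_def] by (intro measurable_int_sum) measurable

text \<open>For a weight w of norm at most 2 in (Y^(1/q))', the identity of associate spaces
  controls w^(p/q) in (X^(1/p))'. Hoelder's inequality then bounds the integral of F^p w^(p/q) by a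
  multiple of the p-th power of the X-norm of F. So the weighted inequality controls the pairing of
  w with the q-th power of the dyadic sum, and Lorentz--Luxemburg duality in Y^(1/q) turns these
  pairings into a norm bound.\<close>

theorem dyadic_sum_bound:
  fixes X Y :: "'n::finite fun_norm"
  assumes X: "ball_quasi_banach X" and Y: "ball_quasi_banach Y" and p: "0 < p" and pq: "p < q"
    and W: "ball_banach (pow_space X (1 / p))" and Z: "ball_banach (pow_space Y (1 / q))"
    and same: "same_space (assoc (pow_space Y (1 / q))) (pow_space (assoc (pow_space X (1 / p))) (p / q))"
    and M: "hl_max_bounded_on (assoc (pow_space Y (1 / q)))"
    and \<beta>: "\<beta> = real CARD('n) * (1 / p - 1 / q)"
  obtains C where "C > 0" "\<And>F f. F \<in> borel_measurable lebesgue \<Longrightarrow> (\<And>x. 0 \<le> F x) \<Longrightarrow>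
     X (\<lambda>x. complex_of_real (F x)) < \<infinity> \<Longrightarrow> (\<And>j. f j \<in> borel_measurable lebesgue) \<Longrightarrow> (\<And>j x. 0 \<le> f j x) \<Longrightarrow>
     (\<And>j x. AE y in lebesgue. y \<in> dyadic_cell j x \<longrightarrow> f j x \<le> F y) \<Longrightarrow>
     (AE x in lebesgue. dyadic_sum \<beta> f x < \<infinity>) \<and>
     Y (\<lambda>x. complex_of_real (enn2real (dyadic_sum \<beta> f x))) \<le> ennreal C * X (\<lambda>x. complex_of_real (F x))"
proof -
  define Zs where "Zs = pow_space Y (1 / q)"
  define Ws where "Ws = pow_space X (1 / p)"
  have q: "0 < q" using p pq by simp
  note Zq = bb_bqb[OF Z, folded Zs_def] and Wq = bb_bqb[OF W, folded Ws_def]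
  obtain A where A: "1 \<le> A" "\<And>g. g \<in> borel_measurable lebesgue \<Longrightarrow> (\<And>x. 0 \<le> g x) \<Longrightarrow>
    assoc Zs (\<lambda>x. complex_of_real (g x)) \<le> 1 \<Longrightarrow> \<not> (AE x in lebesgue. g x = 0) \<Longrightarrow>
    \<exists>w. A1_weight w A \<and> (AE x in lebesgue. g x \<le> w x) \<and> assoc Zs (\<lambda>x. complex_of_real (w x)) \<le> 2"
    using rubio_de_francia[OF Z M] unfolding Zs_def by blast
  obtain C1 where C1: "C1 > 0" "\<And>f. f \<in> fspace (assoc Zs) \<Longrightarrow> pow_space (assoc Ws) (p / q) f \<le> ennreal C1 * assoc Zs f"
    using same unfolding same_space_def Zs_def Ws_def by blast
  define K where "K = epow (hedberg_const p q A) q * (16 * geo_sum (1/2)) * (ennreal C1 * 2)"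
  have "epow (hedberg_const p q A) q < \<infinity>" using hedberg_const(1)[OF p pq A(1)] by simp
  then have "K < \<infinity>"
    unfolding K_def using geo_sum_finite[of "1/2"] by (simp add: ennreal_mult_less_top)
  then obtain \<kappa>' where \<kappa>': "K = ennreal \<kappa>'" "0 \<le> \<kappa>'" by (cases K) auto
  define \<kappa> where "\<kappa> = \<kappa>' + 1"
  have \<kappa>: "0 < \<kappa>" "K \<le> ennreal \<kappa>" using \<kappa>' by (auto simp: \<kappa>_def intro: ennreal_leI)
  define C where "C = \<kappa> powr (1 / q)"
  have main: "(AE x in lebesgue. dyadic_sum \<beta> f x < \<infinity>) \<and>
     Y (\<lambda>x. complex_of_real (enn2real (dyadic_sum \<beta> f x))) \<le> ennreal C * X (\<lambda>x. complex_of_real (F x))"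
    if Fm [measurable]: "F \<in> borel_measurable lebesgue" and F0: "\<And>x. 0 \<le> F x" and FX: "X (\<lambda>x. complex_of_real (F x)) < \<infinity>"
      and fm: "\<And>j. f j \<in> borel_measurable lebesgue" and f0: "\<And>j x. 0 \<le> f j x"
      and fF: "\<And>j x. AE y in lebesgue. y \<in> dyadic_cell j x \<longrightarrow> f j x \<le> F y" for F f
  proof -
    define S where "S = dyadic_sum \<beta> f"
    have Sm [measurable]: "S \<in> borel_measurable lebesgue" unfolding S_def by (rule dyadic_sum_measurable[OF fm])
    define P where "P = X (\<lambda>x. complex_of_real (F x))"
    have est: "(\<integral>\<^sup>+x. epow (S x) q * ennreal (w x) \<partial>lebesgue) \<le> ennreal \<kappa> * epow P q"
      if w: "A1_weight w A" "assoc Zs (\<lambda>x. complex_of_real (w x)) \<le> 2" for w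
    proof -
      interpret A1_weight w A by fact
      have wp: "w x powr (p / q) = \<bar>w x\<bar> powr (p / q)" if "0 < w x" for x using that by simp
      have Wf: "Ws (\<lambda>x. complex_of_real (F x powr p)) = epow P p"
        unfolding Ws_def using F0 p by (simp add: pow_space_real powr_powr P_def)
      have Wfin: "Ws (\<lambda>x. complex_of_real (F x powr p)) < \<infinity>" unfolding Wf using FX by (simp add: P_def)
      have wsp: "(\<lambda>x. complex_of_real (w x)) \<in> fspace (assoc Zs)"
        using w(2) wm by (auto simp: fspace_def intro: le_less_trans)
      \<comment> \<open>\<open>pow_space\<close> takes powers of the modulus, and w is positive only
        almost everywhere, hence |w|.\<close>
      have "epow (assoc Ws (\<lambda>x. complex_of_real (\<bar>w x\<bar> powr (p / q)))) (q / p) = pow_space (assoc Ws) (p / q) (\<lambda>x. complex_of_real (w x))"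
        by (simp add: pow_space_def abs_pow_def)
      also have "\<dots> \<le> ennreal C1 * assoc Zs (\<lambda>x. complex_of_real (w x))" by (rule C1(2)[OF wsp])
      also have "\<dots> \<le> ennreal C1 * 2" by (intro mult_left_mono w(2)) simp
      finally have aw: "epow (assoc Ws (\<lambda>x. complex_of_real (\<bar>w x\<bar> powr (p / q)))) (q / p) \<le> ennreal C1 * 2" .
      have "(\<integral>\<^sup>+x. ennreal (F x powr p * w x powr (p / q)) \<partial>lebesgue) = (\<integral>\<^sup>+x. ennreal \<bar>F x powr p * \<bar>w x\<bar> powr (p / q)\<bar> \<partial>lebesgue)"
        using w_pos by (intro nn_integral_cong_AE) (auto elim!: eventually_mono)
      also have "\<dots> \<le> Ws (\<lambda>x. complex_of_real (F x powr p)) * assoc Ws (\<lambda>x. complex_of_real (\<bar>w x\<bar> powr (p / q)))"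
        by (rule assoc_hoelder[OF Wq _ Wfin]) measurable
      finally have "epow (\<integral>\<^sup>+x. ennreal (F x powr p * w x powr (p / q)) \<partial>lebesgue) (q / p) \<le>
          epow (epow P p * assoc Ws (\<lambda>x. complex_of_real (\<bar>w x\<bar> powr (p / q)))) (q / p)"
        unfolding Wf using p q by (intro epow_mono) auto
      also have "\<dots> = epow P q * epow (assoc Ws (\<lambda>x. complex_of_real (\<bar>w x\<bar> powr (p / q)))) (q / p)"
        using p q by (simp add: epow_mult epow_epow)
      also have "\<dots> \<le> epow P q * (ennreal C1 * 2)" by (intro mult_left_mono aw) simp
      finally have Fw: "epow (\<integral>\<^sup>+x. ennreal (F x powr p * w x powr (p / q)) \<partial>lebesgue) (q / p) \<le> epow P q * (ennreal C1 * 2)" .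
      have "(\<integral>\<^sup>+x. epow (S x) q * ennreal (w x) \<partial>lebesgue) \<le>
          epow (hedberg_const p q A) q * (16 * geo_sum (1/2)) * epow (\<integral>\<^sup>+x. ennreal (F x powr p * w x powr (p / q)) \<partial>lebesgue) (q / p)"
        unfolding S_def dyadic_sum_def by (rule weighted_dyadic_bound[OF p pq Fm F0 f0 fF \<beta>])
      also have "\<dots> \<le> epow (hedberg_const p q A) q * (16 * geo_sum (1/2)) * (epow P q * (ennreal C1 * 2))"
        by (intro mult_left_mono Fw) simp
      also have "\<dots> = K * epow P q" by (simp only: K_def mult_ac)
      also have "\<dots> \<le> ennreal \<kappa> * epow P q" by (intro mult_right_mono \<kappa>) simp
      finally show ?thesis .
    qed
    have RF: "ennreal \<kappa> * epow P q < \<infinity>" using FX by (simp add: P_def ennreal_mult_less_top)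
    \<comment> \<open>One weight is enough for finiteness. It is built from a multiple of the
      indicator of the unit ball, which lies in the associate unit ball by condition (vi) of a ball
      Banach function space.\<close>
    have fin: "AE x in lebesgue. S x < \<infinity>"
    proof -
      obtain c where c: "c > 0" "\<And>f. f \<in> fspace Zs \<Longrightarrow> (\<integral>\<^sup>+x\<in>ball 0 1. ennreal (norm (f x)) \<partial>lebesgue) \<le> ennreal c * Zs f"
        using bb_ball[OF Z, of 1 0] unfolding Zs_def by auto
      define g where "g x = (1 / c) * indicator (ball (0 :: real^'n) 1) x" for x
      have gm: "g \<in> borel_measurable lebesgue" unfolding g_def[abs_def] by measurable
      have "assoc Zs (\<lambda>x. complex_of_real (g x)) \<le> 1"
        unfolding assoc_real
      proof (rule SUP_least)
        fix f assume "f \<in> {f \<in> fspace Zs. Zs f = 1}"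
        then have f: "f \<in> fspace Zs" "Zs f = 1" by auto
        then have [measurable]: "f \<in> borel_measurable lebesgue" by (simp add: fspace_def)
        have "(\<integral>\<^sup>+x. ennreal \<bar>g x\<bar> * ennreal (norm (f x)) \<partial>lebesgue) = (\<integral>\<^sup>+x. ennreal (1 / c) * (ennreal (norm (f x)) * indicator (ball 0 1) x) \<partial>lebesgue)"
          using c(1) by (intro nn_integral_cong) (auto simp: g_def split: split_indicator)
        also have "\<dots> = ennreal (1 / c) * (\<integral>\<^sup>+x\<in>ball 0 1. ennreal (norm (f x)) \<partial>lebesgue)"
          by (rule nn_integral_cmult) measurable
        also have "\<dots> \<le> ennreal (1 / c) * (ennreal c * Zs f)" by (intro mult_left_mono c f) simp
        also have "\<dots> = 1" using c(1) f(2) by (simp add: ennreal_mult[symmetric])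
        finally show "(\<integral>\<^sup>+x. ennreal \<bar>g x\<bar> * ennreal (norm (f x)) \<partial>lebesgue) \<le> 1" .
      qed
      moreover have "\<not> (AE x in lebesgue. g x = 0)"
      proof
        assume "AE x in lebesgue. g x = 0"
        then have "AE x in lebesgue. x \<notin> ball (0 :: real^'n) 1" by eventually_elim (use c(1) in \<open>auto simp: g_def split: split_indicator_asm\<close>)
        then have "emeasure lebesgue (ball (0 :: real^'n) 1) = 0"
          by (subst (asm) AE_iff_measurable[of "ball 0 1"]) auto
        then have "negligible (ball (0 :: real^'n) 1)" unfolding negligible_iff_null_sets by (intro null_setsI) auto
        moreover have "\<not> negligible (ball (0 :: real^'n) 1)" by (intro open_not_negligible) auto
        ultimately show False by simp
      qed
      moreover have "0 \<le> g x" for x using c(1) by (simp add: g_def)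
      ultimately obtain w where w: "A1_weight w A" "assoc Zs (\<lambda>x. complex_of_real (w x)) \<le> 2"
        using A(2)[OF gm] by blast
      interpret A1_weight w A by fact
      have "(\<integral>\<^sup>+x. epow (S x) q * ennreal (w x) \<partial>lebesgue) \<noteq> \<infinity>" using est[OF w] RF by (auto simp: top_unique)
      then have "AE x in lebesgue. epow (S x) q * ennreal (w x) \<noteq> \<infinity>" by (intro nn_integral_PInf_AE) measurable
      then show ?thesis using w_pos
        by eventually_elim (auto simp: ennreal_mult_eq_top_iff ennreal_eq_0_iff less_top)
    qed
    define G where "G x = enn2real (S x) powr q" for x
    have Gm: "G \<in> borel_measurable lebesgue" unfolding G_def[abs_def] by measurable
    have G0: "0 \<le> G x" for x by (simp add: G_def)
    have GS: "AE x in lebesgue. ennreal (G x) = epow (S x) q"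
      using fin by eventually_elim (simp add: G_def epow_def)
    have pair: "(\<integral>\<^sup>+x. ennreal (G x * g x) \<partial>lebesgue) \<le> ennreal \<kappa> * epow P q"
      if g: "g \<in> borel_measurable lebesgue" "\<And>x. 0 \<le> g x" "assoc Zs (\<lambda>x. complex_of_real (g x)) \<le> 1" for g
    proof (cases "AE x in lebesgue. g x = 0")
      case True
      then have "AE x in lebesgue. ennreal (G x * g x) = 0" by eventually_elim simp
      then have "(\<integral>\<^sup>+x. ennreal (G x * g x) \<partial>lebesgue) = 0"
        using Gm g(1) by (subst nn_integral_0_iff_AE) auto
      then show ?thesis by simp
    next
      case False
      obtain w where w: "A1_weight w A" "AE x in lebesgue. g x \<le> w x" "assoc Zs (\<lambda>x. complex_of_real (w x)) \<le> 2"
        using A(2)[OF g False] by blast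
      have "(\<integral>\<^sup>+x. ennreal (G x * g x) \<partial>lebesgue) \<le> (\<integral>\<^sup>+x. epow (S x) q * ennreal (w x) \<partial>lebesgue)"
      proof (rule nn_integral_mono_AE)
        show "AE x in lebesgue. ennreal (G x * g x) \<le> epow (S x) q * ennreal (w x)"
          using GS w(2)
        proof eventually_elim
          fix x assume "ennreal (G x) = epow (S x) q" "g x \<le> w x"
          then show "ennreal (G x * g x) \<le> epow (S x) q * ennreal (w x)"
            using G0[of x] by (subst ennreal_mult') (auto intro!: mult_left_mono ennreal_leI)
        qed
      qed
      also have "\<dots> \<le> ennreal \<kappa> * epow P q" by (rule est[OF w(1,3)])
      finally show ?thesis .
    qed
    obtain B where B: "ennreal \<kappa> * epow P q = ennreal B" "0 \<le> B" using RF by (cases "ennreal \<kappa> * epow P q") auto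
    \<comment> \<open>\<open>lorentz_luxemburg\<close> asks for a positive bound, while B may be
      0.\<close>
    have "Zs (\<lambda>x. complex_of_real (G x)) \<le> ennreal B + ennreal \<epsilon>" if "\<epsilon> > 0" for \<epsilon>
    proof -
      have "Zs (\<lambda>x. complex_of_real (G x)) \<le> ennreal (B + \<epsilon>)"
      proof (rule lorentz_luxemburg[OF Z[folded Zs_def] _ Gm G0])
        show "0 < B + \<epsilon>" using B(2) that by simp
        fix h :: "real^'n \<Rightarrow> real" assume h: "h \<in> borel_measurable lebesgue" "\<And>x. 0 \<le> h x" "assoc Zs (\<lambda>x. complex_of_real (h x)) \<le> 1"
        have "(\<integral>\<^sup>+x. ennreal (G x * h x) \<partial>lebesgue) \<le> ennreal B" using pair[OF h] B by simp
        also have "\<dots> \<le> ennreal (B + \<epsilon>)" using that by (intro ennreal_leI) simp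
        finally show "(\<integral>\<^sup>+x. ennreal (G x * h x) \<partial>lebesgue) \<le> ennreal (B + \<epsilon>)" .
      qed
      then show ?thesis using B(2) that by simp
    qed
    then have "Zs (\<lambda>x. complex_of_real (G x)) \<le> ennreal B" by (rule ennreal_le_epsilon)
    moreover have "Zs (\<lambda>x. complex_of_real (G x)) = epow (Y (\<lambda>x. complex_of_real (enn2real (S x)))) q"
      unfolding Zs_def using q by (subst pow_space_real[OF G0]) (simp add: G_def powr_powr)
    ultimately have "epow (Y (\<lambda>x. complex_of_real (enn2real (S x)))) q \<le> ennreal \<kappa> * epow P q" using B by simp
    also have "\<dots> = epow (ennreal C * P) q"
      using q \<kappa> by (simp add: epow_mult epow_ennreal C_def powr_powr)
    finally have "Y (\<lambda>x. complex_of_real (enn2real (S x))) \<le> ennreal C * P" by (rule epow_le_cancel[OF q])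
    with fin show ?thesis by (simp add: S_def P_def)
  qed
  show thesis
    by (rule that[of C]) (use \<kappa> main in \<open>auto simp: C_def\<close>)
qed

section \<open>The Gaussian subordination formula\<close>

text \<open>Comparison on boxes identifies Lebesgue measure on (R^n)^m with an m-fold product
  measure, which gives access to product formulas for integrals.\<close>

lemma lborel_vec_PiM:
  "distr (Pi\<^sub>M (UNIV :: 'm::finite set) (\<lambda>_. lborel :: 'a::euclidean_space measure)) lborel (\<lambda>f. \<chi> k. f k) = (lborel :: ('a^'m) measure)"
proof (rule lborel_eqI[symmetric])
  interpret product_sigma_finite "\<lambda>_ :: 'm. lborel :: 'a measure" by standard
  let ?P = "Pi\<^sub>M (UNIV :: 'm set) (\<lambda>_. lborel :: 'a measure)"
  have m: "(\<lambda>f. \<chi> k. f k) \<in> ?P \<rightarrow>\<^sub>M (lborel :: ('a^'m) measure)"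
  proof -
    have "(\<lambda>f :: 'm \<Rightarrow> 'a. \<chi> k. f k) \<in> ?P \<rightarrow>\<^sub>M borel"
    proof (subst borel_measurable_euclidean_space, intro ballI)
      fix b :: "'a^'m" assume "b \<in> Basis"
      then obtain u i where b: "b = axis i u" "u \<in> Basis" by (auto simp: Basis_vec_def)
      have "(\<lambda>f :: 'm \<Rightarrow> 'a. f i \<bullet> u) \<in> borel_measurable ?P" by measurable
      then show "(\<lambda>f :: 'm \<Rightarrow> 'a. (\<chi> k. f k) \<bullet> b) \<in> borel_measurable ?P" by (simp add: b inner_axis)
    qed
    then show ?thesis by simp
  qed
  show "sets (distr ?P lborel (\<lambda>f. \<chi> k. f k)) = sets borel" by simp
  fix l u :: "'a^'m" assume lu: "\<And>b. b \<in> Basis \<Longrightarrow> l \<bullet> b \<le> u \<bullet> b"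
  have lu': "l $ i \<bullet> b \<le> u $ i \<bullet> b" if "b \<in> Basis" for i b
    using lu[of "axis i b"] that by (auto simp: Basis_vec_def inner_axis)
  have box: "(\<lambda>f. \<chi> k. f k) -` box l u \<inter> space ?P = (\<Pi>\<^sub>E i\<in>UNIV. box (l $ i) (u $ i))"
  proof -
    have "(\<chi> k. f k) \<in> box l u \<longleftrightarrow> (\<forall>i. f i \<in> box (l $ i) (u $ i))" for f
      unfolding mem_box by (auto simp: Basis_vec_def inner_axis)
    then show ?thesis by (auto simp: space_PiM PiE_UNIV_domain)
  qed
  have "emeasure (distr ?P lborel (\<lambda>f. \<chi> k. f k)) (box l u) = emeasure ?P ((\<lambda>f. \<chi> k. f k) -` box l u \<inter> space ?P)"
    by (rule emeasure_distr[OF m]) simp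
  also have "\<dots> = (\<Prod>i\<in>UNIV. emeasure lborel (box (l $ i) (u $ i)))"
    unfolding box by (rule emeasure_PiM) auto
  also have "\<dots> = (\<Prod>i\<in>UNIV. ennreal (\<Prod>b\<in>Basis. (u $ i - l $ i) \<bullet> b))"
    using lu' by (intro prod.cong refl emeasure_lborel_box) auto
  also have "\<dots> = ennreal (\<Prod>i\<in>UNIV. \<Prod>b\<in>Basis. (u $ i - l $ i) \<bullet> b)"
    using lu' by (intro prod_ennreal prod_nonneg) (auto simp: inner_diff_left)
  also have "(\<Prod>i\<in>UNIV. \<Prod>b\<in>Basis. (u $ i - l $ i) \<bullet> b) = (\<Prod>b\<in>Basis. (u - l) \<bullet> b)"
  proof -
    have "(\<Prod>i\<in>UNIV. \<Prod>b\<in>Basis. (u $ i - l $ i) \<bullet> b) = (\<Prod>(i, b)\<in>UNIV \<times> Basis. (u - l) \<bullet> axis i b)"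
      by (simp add: prod.cartesian_product inner_axis)
    also have "\<dots> = (\<Prod>b\<in>(\<lambda>(i, b). axis i b) ` (UNIV \<times> Basis). (u - l) \<bullet> b)"
      by (subst prod.reindex) (auto simp: inj_on_def axis_eq_axis nonzero_Basis split_beta)
    also have "(\<lambda>(i, b). axis i b) ` (UNIV \<times> Basis) = (Basis :: ('a^'m) set)"
      by (auto simp: Basis_vec_def)
    finally show ?thesis .
  qed
  finally show "emeasure (distr ?P lborel (\<lambda>f. \<chi> k. f k)) (box l u) = ennreal (\<Prod>b\<in>Basis. (u - l) \<bullet> b)" .
qed

lemma measurable_vec_lambda_PiM:
  "(\<lambda>f. \<chi> k. f k) \<in> Pi\<^sub>M (UNIV :: 'm::finite set) (\<lambda>_. lborel :: 'a::euclidean_space measure) \<rightarrow>\<^sub>M (lborel :: ('a^'m) measure)"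
proof -
  have "(\<lambda>f :: 'm \<Rightarrow> 'a. \<chi> k. f k) \<in> Pi\<^sub>M UNIV (\<lambda>_. lborel) \<rightarrow>\<^sub>M borel"
  proof (subst borel_measurable_euclidean_space, intro ballI)
    fix b :: "'a^'m" assume "b \<in> Basis"
    then obtain u i where b: "b = axis i u" "u \<in> Basis" by (auto simp: Basis_vec_def)
    have "(\<lambda>f :: 'm \<Rightarrow> 'a. f i \<bullet> u) \<in> borel_measurable (Pi\<^sub>M UNIV (\<lambda>_. lborel))" by measurable
    then show "(\<lambda>f :: 'm \<Rightarrow> 'a. (\<chi> k. f k) \<bullet> b) \<in> borel_measurable (Pi\<^sub>M UNIV (\<lambda>_. lborel))" by (simp add: b inner_axis)
  qed
  then show ?thesis by simp
qed

lemma nn_integral_vec_prod: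
  fixes h :: "'m::finite \<Rightarrow> 'a::euclidean_space \<Rightarrow> ennreal"
  assumes h: "\<And>k. h k \<in> borel_measurable borel"
  shows "(\<integral>\<^sup>+y. (\<Prod>k\<in>UNIV. h k (y $ k)) \<partial>(lborel :: ('a^'m) measure)) = (\<Prod>k\<in>UNIV. \<integral>\<^sup>+y. h k y \<partial>lborel)"
proof -
  interpret product_sigma_finite "\<lambda>_ :: 'm. lborel :: 'a measure" by standard
  have [measurable]: "(\<lambda>y :: 'a^'m. y $ k) \<in> borel_measurable borel" for k
    by (intro borel_measurable_continuous_onI continuous_intros)
  note [measurable] = h
  have "(\<integral>\<^sup>+y. (\<Prod>k\<in>UNIV. h k (y $ k)) \<partial>(lborel :: ('a^'m) measure)) =
     (\<integral>\<^sup>+y. (\<Prod>k\<in>UNIV. h k (y $ k)) \<partial>(distr (Pi\<^sub>M UNIV (\<lambda>_. lborel)) lborel (\<lambda>f. \<chi> k. f k)))"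
    by (simp only: lborel_vec_PiM)
  also have "\<dots> = (\<integral>\<^sup>+f. (\<Prod>k\<in>UNIV. h k (f k)) \<partial>(Pi\<^sub>M UNIV (\<lambda>_. lborel)))"
    by (subst nn_integral_distr[OF measurable_vec_lambda_PiM]) simp_all
  also have "\<dots> = (\<Prod>k\<in>UNIV. \<integral>\<^sup>+y. h k y \<partial>lborel)"
    using h by (intro product_nn_integral_prod) auto
  finally show ?thesis .
qed

lemma integral_vec_prod:
  fixes h :: "'m::finite \<Rightarrow> 'a::euclidean_space \<Rightarrow> complex"
  assumes h: "\<And>k. integrable lborel (h k)"
  shows "(LINT y|(lborel :: ('a^'m) measure). (\<Prod>k\<in>UNIV. h k (y $ k))) = (\<Prod>k\<in>UNIV. LINT y|lborel. h k y)"
proof -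
  interpret product_sigma_finite "\<lambda>_ :: 'm. lborel :: 'a measure" by standard
  have [measurable]: "(\<lambda>y :: 'a^'m. y $ k) \<in> borel_measurable borel" for k
    by (intro borel_measurable_continuous_onI continuous_intros)
  have [measurable]: "h k \<in> borel_measurable borel" for k using h[of k] by (simp add: borel_measurable_integrable)
  have "(LINT y|(lborel :: ('a^'m) measure). (\<Prod>k\<in>UNIV. h k (y $ k))) =
     (LINT y|(distr (Pi\<^sub>M UNIV (\<lambda>_. lborel)) lborel (\<lambda>f. \<chi> k. f k)). (\<Prod>k\<in>UNIV. h k (y $ k)))"
    by (simp only: lborel_vec_PiM)
  also have "\<dots> = (LINT f|(Pi\<^sub>M UNIV (\<lambda>_. lborel)). (\<Prod>k\<in>UNIV. h k (f k)))"
    by (subst integral_distr[OF measurable_vec_lambda_PiM]) simp_all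
  also have "\<dots> = (\<Prod>k\<in>UNIV. LINT y|lborel. h k y)"
    using h by (intro product_integral_prod) auto
  finally show ?thesis .
qed

text \<open>The preimage of a null set under a coordinate has measure 0 times the remaining factors.
  These may be infinite, but 0 times infinity is 0 in [0, infinity].\<close>

lemma AE_vec_component:
  assumes "AE x in (lborel :: 'a::euclidean_space measure). P x"
  shows "AE y in (lborel :: ('a^'m::finite) measure). P (y $ k)"
proof -
  from assms obtain N where N: "N \<in> null_sets lborel" "{x. \<not> P x} \<subseteq> N" by (auto elim!: AE_E simp: null_sets_def)
  have Nb: "N \<in> sets borel" using N by auto
  define h :: "'m \<Rightarrow> 'a \<Rightarrow> ennreal" where "h i = (if i = k then indicator N else (\<lambda>_. 1))" for i
  have m [measurable]: "(\<lambda>y :: 'a^'m. y $ k) \<in> borel_measurable borel" for k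
    by (intro borel_measurable_continuous_onI continuous_intros)
  have pm: "{y :: 'a^'m. y $ k \<in> N} \<in> sets lborel" using measurable_sets[OF m Nb, of k] by (simp add: vimage_def)
  have "(\<Prod>i\<in>UNIV. h i (y $ i)) = indicator {y. y $ k \<in> N} y" for y :: "'a^'m"
  proof -
    have "(\<Prod>i\<in>UNIV. h i (y $ i)) = h k (y $ k) * (\<Prod>i\<in>UNIV - {k}. h i (y $ i))" by (rule prod.remove) auto
    also have "(\<Prod>i\<in>UNIV - {k}. h i (y $ i)) = 1" by (intro prod.neutral) (auto simp: h_def)
    finally show ?thesis by (simp add: h_def indicator_def)
  qed
  then have "emeasure lborel {y :: 'a^'m. y $ k \<in> N} = (\<integral>\<^sup>+y. (\<Prod>i\<in>UNIV. h i (y $ i)) \<partial>(lborel :: ('a^'m) measure))"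
    using pm by simp
  also have "\<dots> = (\<Prod>i\<in>UNIV. \<integral>\<^sup>+y. h i y \<partial>lborel)"
    using Nb by (intro nn_integral_vec_prod) (auto simp: h_def)
  also have "\<dots> = 0"
    using N(1) Nb by (intro prod_zero) (auto intro!: bexI[of _ k] simp: h_def null_sets_def)
  finally have "{y :: 'a^'m. y $ k \<in> N} \<in> null_sets lborel" using pm by (simp add: null_sets_def)
  then show ?thesis using N(2) by (intro AE_I') auto
qed

text \<open>For a > 0 this is \<Gamma>(a/2)/2, by the substitution u = 1/t^2. It is the normalising
  constant of the subordination formula for |y|^(-a).\<close>

definition frac_const :: "real \<Rightarrow> ennreal" where
  "frac_const a = (\<integral>\<^sup>+t\<in>{0<..}. ennreal (t powr (- 1 - a) * exp (- (1 / t)\<^sup>2)) \<partial>lborel)"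

lemma frac_const_scale:
  assumes r: "0 < r"
  shows "(\<integral>\<^sup>+t\<in>{0<..}. ennreal (t powr (- 1 - a) * exp (- (r / t)\<^sup>2)) \<partial>lborel) = ennreal (1 / r powr a) * frac_const a"
proof -
  have "(\<integral>\<^sup>+t\<in>{0<..}. ennreal (t powr (- 1 - a) * exp (- (r / t)\<^sup>2)) \<partial>lborel) =
     ennreal r * (\<integral>\<^sup>+t. ennreal ((r * t) powr (- 1 - a) * exp (- (r / (r * t))\<^sup>2)) * indicator {0<..} (r * t) \<partial>lborel)"
    using nn_integral_real_affine[of "\<lambda>t. ennreal (t powr (- 1 - a) * exp (- (r / t)\<^sup>2)) * indicator {0<..} t" r 0] r by simp
  also have "\<dots> = ennreal r * (\<integral>\<^sup>+t. ennreal (r powr (- 1 - a)) * (ennreal (t powr (- 1 - a) * exp (- (1 / t)\<^sup>2)) * indicator {0<..} t) \<partial>lborel)"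
  proof (rule arg_cong[where f = "(*) (ennreal r)"], rule nn_integral_cong)
    fix t :: real
    show "ennreal ((r * t) powr (- 1 - a) * exp (- (r / (r * t))\<^sup>2)) * indicator {0<..} (r * t) =
      ennreal (r powr (- 1 - a)) * (ennreal (t powr (- 1 - a) * exp (- (1 / t)\<^sup>2)) * indicator {0<..} t)"
    proof (cases "0 < t")
      case True
      have "(r * t) powr (- 1 - a) * exp (- (r / (r * t))\<^sup>2) = r powr (- 1 - a) * (t powr (- 1 - a) * exp (- (1 / t)\<^sup>2))"
        using r True by (simp add: powr_mult)
      then have "ennreal ((r * t) powr (- 1 - a) * exp (- (r / (r * t))\<^sup>2)) =
          ennreal (r powr (- 1 - a)) * ennreal (t powr (- 1 - a) * exp (- (1 / t)\<^sup>2))"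
        by (simp only: ennreal_mult'[OF powr_ge_zero])
      then show ?thesis using r True by simp
    qed (use r in \<open>simp add: zero_less_mult_iff\<close>)
  qed
  also have "\<dots> = ennreal r * (ennreal (r powr (- 1 - a)) * frac_const a)"
    unfolding frac_const_def by (subst nn_integral_cmult) measurable
  also have "\<dots> = ennreal (r * r powr (- 1 - a)) * frac_const a" using r by (simp add: ennreal_mult mult.assoc)
  also have "r * r powr (- 1 - a) = 1 / r powr a"
  proof -
    have "r * r powr (- 1 - a) = r powr 1 * r powr (- 1 - a)" using r by simp
    also have "\<dots> = r powr (- a)" unfolding powr_add[symmetric] by simp
    finally show ?thesis by (simp add: powr_minus divide_inverse)
  qed
  finally show ?thesis .
qed

lemma frac_const_pos: "0 < frac_const a"
proof (rule ccontr)
  assume "\<not> 0 < frac_const a"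
  then have "frac_const a = 0" by simp
  then have "AE t in lborel. ennreal (t powr (- 1 - a) * exp (- (1 / t)\<^sup>2)) * indicator {0<..} t = 0"
    unfolding frac_const_def by (subst (asm) nn_integral_0_iff_AE) measurable
  then have "AE t in lborel. t \<notin> {0<..<1::real}" by eventually_elim (auto simp: ennreal_eq_0_iff mult_le_0_iff not_le split: split_indicator_asm)
  then have "emeasure lborel {0<..<1::real} = 0" by (subst (asm) AE_iff_measurable[of "{0<..<1}"]) auto
  then show False by simp
qed

text \<open>Near 0 the Gaussian factor beats the power, by v^n \<le> n^n exp(v) with v = 1/t^2. For
  t \<ge> 1 the power t^(-1-a) is integrable.\<close>

lemma frac_const_finite:
  assumes a: "0 < a" shows "frac_const a < \<infinity>"
proof -
  obtain n :: nat where n: "1 + a \<le> real n" using real_arch_simple by blast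
  have n1: "1 \<le> real n" using n a by simp
  define c where "c = real n ^ n"
  have c: "c \<ge> 1" using n1 by (simp add: c_def one_le_power)
  have small: "t powr (- 1 - a) * exp (- (1 / t)\<^sup>2) \<le> c" if t: "0 < t" "t \<le> 1" for t
  proof -
    define v where "v = (1 / t)\<^sup>2"
    have v: "v \<ge> 1 / t" "1 / t \<ge> 1" using t by (auto simp: v_def power2_eq_square field_simps)
    have "v ^ n = c * (v / real n) ^ n" using n1 by (simp add: c_def power_divide)
    also have "\<dots> \<le> c * exp (v / real n) ^ n"
    proof (intro mult_left_mono power_mono)
      show "v / real n \<le> exp (v / real n)" by (rule order_trans[OF _ exp_ge_add_one_self]) simp
    qed (use v c n1 in auto)
    also have "exp (v / real n) ^ n = exp v" using n1 by (simp add: exp_of_nat_mult[symmetric])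
    finally have e: "v ^ n \<le> c * exp v" .
    have "t powr (- 1 - a) = (1 / t) powr (1 + a)" using t powr_minus_divide[of t "1 + a"] by (simp add: powr_divide)
    also have "\<dots> \<le> (1 / t) powr real n" using v n by (intro powr_mono) auto
    also have "\<dots> = (1 / t) ^ n" using t by (simp add: powr_realpow)
    also have "\<dots> \<le> v ^ n" using v t by (intro power_mono) auto
    also have "\<dots> \<le> c * exp v" by (rule e)
    finally show ?thesis by (simp add: exp_minus v_def field_simps)
  qed
  have "frac_const a \<le> (\<integral>\<^sup>+t. ennreal c * indicator {0..1} t + ennreal (t powr (- 1 - a)) * indicator {1..} t \<partial>lborel)"
    unfolding frac_const_def
  proof (intro nn_integral_mono)
    fix t :: real
    show "ennreal (t powr (- 1 - a) * exp (- (1 / t)\<^sup>2)) * indicator {0<..} t \<le>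
        ennreal c * indicator {0..1} t + ennreal (t powr (- 1 - a)) * indicator {1..} t"
    proof (cases "0 < t")
      case True
      show ?thesis
      proof (cases "t \<le> 1")
        case True
        then show ?thesis using small[of t] \<open>0 < t\<close> by (auto intro!: add_increasing2 ennreal_leI)
      next
        case False
        have "t powr (- 1 - a) * exp (- (1 / t)\<^sup>2) \<le> t powr (- 1 - a) * 1" by (intro mult_left_mono) auto
        then show ?thesis using False by (auto intro!: ennreal_leI)
      qed
    qed simp
  qed
  also have "\<dots> = ennreal c + (\<integral>\<^sup>+t. ennreal (t powr (- 1 - a)) * indicator {1..} t \<partial>lborel)"
    using c by (subst nn_integral_add) (auto simp: nn_integral_cmult)
  also have "(\<integral>\<^sup>+t. ennreal (t powr (- 1 - a)) * indicator {1..} t \<partial>lborel) = ennreal (0 - (- 1 / a * 1 powr (- a)))"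
  proof (rule nn_integral_FTC_atLeast[where F = "\<lambda>t. - 1 / a * t powr (- a)"])
    show "((\<lambda>t. - 1 / a * t powr (- a)) has_real_derivative t powr (- 1 - a)) (at t)" if "1 \<le> t" for t
    proof -
      have eq: "- 1 - a = - a - 1" by simp
      show ?thesis unfolding eq using that a by (auto intro!: derivative_eq_intros)
    qed
    show "((\<lambda>t. - 1 / a * t powr (- a)) \<longlongrightarrow> 0) at_top"
      using a by (intro tendsto_mult_right_zero tendsto_neg_powr filterlim_ident) auto
  qed auto
  finally show ?thesis by (auto intro: le_less_trans)
qed

section \<open>The extended operator\<close>

definition top_kernel :: "real \<Rightarrow> ('m::finite \<Rightarrow> 'n::finite dist) \<Rightarrow> (real^'n) \<Rightarrow> real \<Rightarrow> complex" where
  "top_kernel \<alpha> f x t = indicator {0<..} t *\<^sub>R (complex_of_real (t powr (\<alpha> - 1)) * (\<Prod>k\<in>UNIV. conv_dist (dilate t gauss) (f k) x))"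

text \<open>A total function of arbitrary tuples: the Bochner integral is 0 where the integrand is
  not integrable. For tuples in the Hardy spaces the integrand is integrable wherever the dyadic
  sums converge, hence almost everywhere.\<close>

definition dist_frac_int :: "real \<Rightarrow> ('m::finite \<Rightarrow> 'n::finite dist) \<Rightarrow> (real^'n) \<Rightarrow> complex" where
  "dist_frac_int \<alpha> f x = complex_of_real (1 / enn2real (frac_const (real CARD('m) * real CARD('n) - \<alpha>))) *
     (LINT t|lborel. top_kernel \<alpha> f x t)"

lemma top_kernel_measurable_pair:
  fixes f :: "'m::finite \<Rightarrow> 'n::finite dist"
  assumes "\<And>k. f k \<in> tempered"
  shows "(\<lambda>(x, t). top_kernel \<alpha> f x t) \<in> borel_measurable borel"
proof -
  have c: "continuous_on (UNIV \<times> {0<..}) (\<lambda>p. (case (snd p, fst p) of (t, x) \<Rightarrow> conv_dist (dilate t gauss) (f k) x))" for k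
    by (rule continuous_on_compose2[OF conv_dist_continuous[OF assms gauss_schwartz]]) (auto intro!: continuous_intros)
  have op: "open (UNIV \<times> {0<..} :: ((real^'n) \<times> real) set)" by (intro open_Times) auto
  have m: "(\<lambda>p. indicator (UNIV \<times> {0<..}) p *\<^sub>R (complex_of_real (snd p powr (\<alpha> - 1)) * (\<Prod>k\<in>UNIV. (case (snd p, fst p) of (t, x) \<Rightarrow> conv_dist (dilate t gauss) (f k) x))))
      \<in> borel_measurable borel"
    by (rule borel_measurable_continuous_on_indicator[OF borel_open[OF op]]) (intro continuous_intros c, auto)
  then show ?thesis
    by (rule measurable_cong[THEN iffD1, rotated]) (auto simp: top_kernel_def indicator_def)
qed

lemma top_kernel_measurable:
  fixes f :: "'m::finite \<Rightarrow> 'n::finite dist"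
  assumes "\<And>k. f k \<in> tempered"
  shows "top_kernel \<alpha> f x \<in> borel_measurable borel"
  using measurable_compose[OF _ top_kernel_measurable_pair[OF assms, of \<alpha>], of "\<lambda>t. (x, t)" borel] by simp

lemma dist_frac_int_measurable:
  fixes f :: "'m::finite \<Rightarrow> 'n::finite dist"
  assumes "\<And>k. f k \<in> tempered"
  shows "dist_frac_int \<alpha> f \<in> borel_measurable lebesgue"
proof -
  have "(\<lambda>(x, t). top_kernel \<alpha> f x t) \<in> borel_measurable ((borel :: (real^'n) measure) \<Otimes>\<^sub>M lborel)"
    using top_kernel_measurable_pair[OF assms, of \<alpha>]
    by (subst measurable_cong_sets[OF sets_pair_measure_cong[OF refl sets_lborel] refl]) (simp add: borel_prod)
  then have "(\<lambda>x. LINT t|lborel. top_kernel \<alpha> f x t) \<in> borel_measurable (borel :: (real^'n) measure)"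
    by (rule lborel.borel_measurable_lebesgue_integral)
  then have "dist_frac_int \<alpha> f \<in> borel_measurable borel"
    unfolding dist_frac_int_def[abs_def] by measurable
  then show ?thesis by (rule borel_imp_lebesgue)
qed

section \<open>Pointwise control by dyadic sums\<close>

definition dyadic_inf :: "((real^'n::finite) \<Rightarrow> ennreal) \<Rightarrow> int \<Rightarrow> (real^'n) \<Rightarrow> real" where
  "dyadic_inf F j x = enn2real (INF y\<in>dyadic_cell j x. F y)"

lemma dyadic_inf_nonneg: "0 \<le> dyadic_inf F j x" by (simp add: dyadic_inf_def)

lemma dyadic_inf_measurable:
  fixes F :: "real^'n::finite \<Rightarrow> ennreal"
  shows "dyadic_inf F j \<in> borel_measurable lebesgue"
proof (rule borel_imp_lebesgue)
  have "dyadic_inf F j x = dyadic_inf F j y" if "dyadic_index j x = dyadic_index j y" for x y :: "real^'n"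
  proof -
    have "dyadic_cell j x = dyadic_cell j y" using that by (simp add: dyadic_cell_def)
    then show ?thesis by (simp only: dyadic_inf_def)
  qed
  then show "dyadic_inf F j \<in> borel_measurable borel"
    by (rule dyadic_cell_const_measurable[of j]) auto
qed

lemma dyadic_inf_le:
  assumes "F y < \<infinity>" "y \<in> dyadic_cell j x"
  shows "dyadic_inf F j x \<le> enn2real (F y)"
  unfolding dyadic_inf_def using assms by (intro enn2real_mono INF_lower) auto

text \<open>Some point of each cell has a finite value, so \<open>enn2real\<close> loses
  nothing.\<close>

lemma dyadic_inf_eq:
  assumes "AE y in lebesgue. F y < \<infinity>"
  shows "ennreal (dyadic_inf F j x) = (INF y\<in>dyadic_cell j x. F y)"
proof -
  obtain y where "y \<in> dyadic_cell j x" "F y < \<infinity>" using dyadic_cell_AE_ex[OF assms] by blast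
  then have "(INF y\<in>dyadic_cell j x. F y) < \<infinity>" by (auto intro: le_less_trans[OF INF_lower])
  then show ?thesis by (simp add: dyadic_inf_def)
qed

lemma ennreal_prod_mono: "(\<And>k. f k \<le> g k) \<Longrightarrow> (\<Prod>k\<in>A. f k) \<le> (\<Prod>k\<in>A. g k :: ennreal)"
  by (induction A rule: infinite_finite_induct) (auto intro: mult_mono)

text \<open>The left-hand side is the diagonal part of the expanded product of sums. This separates
  the m factors.\<close>

lemma sum_prod_le_prod_sum:
  fixes a :: "'k \<Rightarrow> int \<Rightarrow> ennreal"
  assumes "finite A" "A \<noteq> {}"
  shows "(\<integral>\<^sup>+j. (\<Prod>k\<in>A. a k j) \<partial>count_space UNIV) \<le> (\<Prod>k\<in>A. \<integral>\<^sup>+j. a k j \<partial>count_space UNIV)"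
proof -
  obtain k where k: "k \<in> A" using assms by blast
  have "(\<integral>\<^sup>+j. (\<Prod>k\<in>A. a k j) \<partial>count_space UNIV) \<le>
      (\<integral>\<^sup>+j. a k j * (\<Prod>i\<in>A - {k}. \<integral>\<^sup>+j. a i j \<partial>count_space UNIV) \<partial>count_space UNIV)"
  proof (rule nn_integral_mono)
    fix j
    have "(\<Prod>k\<in>A. a k j) = a k j * (\<Prod>i\<in>A - {k}. a i j)" using assms k by (intro prod.remove)
    also have "\<dots> \<le> a k j * (\<Prod>i\<in>A - {k}. \<integral>\<^sup>+j. a i j \<partial>count_space UNIV)"
      by (intro mult_left_mono ennreal_prod_mono int_le_sum) simp
    finally show "(\<Prod>k\<in>A. a k j) \<le> a k j * (\<Prod>i\<in>A - {k}. \<integral>\<^sup>+j. a i j \<partial>count_space UNIV)" .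
  qed
  also have "\<dots> = (\<integral>\<^sup>+j. a k j \<partial>count_space UNIV) * (\<Prod>i\<in>A - {k}. \<integral>\<^sup>+j. a i j \<partial>count_space UNIV)"
    by (rule nn_integral_multc) simp
  also have "\<dots> = (\<Prod>k\<in>A. \<integral>\<^sup>+j. a k j \<partial>count_space UNIV)" using assms k by (intro prod.remove[symmetric])
  finally show ?thesis .
qed

text \<open>The power increases or decreases according to the sign of \<alpha> - 1, so the cases use
  different ends of the interval.\<close>

lemma powr_dyadic_le:
  fixes T t \<alpha> :: real
  assumes T: "0 < T" "T \<le> t" "t < 2 * T" and \<alpha>: "0 < \<alpha>"
  shows "t powr (\<alpha> - 1) \<le> 2 powr \<alpha> * T powr (\<alpha> - 1)"
proof (cases "1 \<le> \<alpha>")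
  case True
  have "t powr (\<alpha> - 1) \<le> (2 * T) powr (\<alpha> - 1)" using T True by (intro powr_mono2) auto
  also have "\<dots> = 2 powr (\<alpha> - 1) * T powr (\<alpha> - 1)" using T by (simp add: powr_mult)
  also have "\<dots> \<le> 2 powr \<alpha> * T powr (\<alpha> - 1)" by (intro mult_right_mono powr_mono) auto
  finally show ?thesis .
next
  case False
  have "t powr (\<alpha> - 1) \<le> T powr (\<alpha> - 1)" using T False by (intro powr_mono2') auto
  also have "\<dots> \<le> 2 powr \<alpha> * T powr (\<alpha> - 1)"
    using \<alpha> ge_one_powr_ge_zero[of 2 \<alpha>] by (simp add: mult_le_cancel_right1)
  finally show ?thesis .
qed

text \<open>For n 2^j \<le> t < 2 n 2^j all points of the cell of side 2^j at x are within distance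
  t of x, so each convolution is bounded by the infimum of the grand maximal function over that
  cell. Integrating t^(\<alpha>-1) over this range of t leaves a multiple of 2^(j \<alpha>), which
  is shared evenly among the m factors.\<close>

lemma top_kernel_bound:
  assumes \<alpha>: "0 < \<alpha>"
  obtains D where "D > 0" "\<And>(f :: 'm::finite \<Rightarrow> 'n::finite dist) x. (\<And>k. f k \<in> tempered) \<Longrightarrow>
    (\<And>k. AE y in lebesgue. grand_max N (f k) y < \<infinity>) \<Longrightarrow>
    (\<integral>\<^sup>+t. ennreal (norm (top_kernel \<alpha> f x t)) \<partial>lborel) \<le>
      ennreal D * (\<Prod>k\<in>UNIV. dyadic_sum (\<alpha> / real CARD('m)) (dyadic_inf (grand_max N (f k))) x)"
proof -
  obtain C where C: "C > 0" "\<And>f t x z. f \<in> (tempered :: 'n dist set) \<Longrightarrow> t > 0 \<Longrightarrow> norm (z - x) \<le> t \<Longrightarrow>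
    ennreal (norm (conv_dist (dilate t gauss) f x)) \<le> ennreal C * grand_max N f z"
    using grand_max_translate_bound[OF gauss_schwartz, of N] by blast
  define n where "n = real CARD('n)"
  have n: "n \<ge> 1" by (simp add: n_def Suc_le_eq)
  define D where "D = (2 * n) powr \<alpha> * C ^ CARD('m)"
  have D: "D > 0" using C(1) n by (simp add: D_def)
  have "(\<integral>\<^sup>+t. ennreal (norm (top_kernel \<alpha> f x t)) \<partial>lborel) \<le>
      ennreal D * (\<Prod>k\<in>UNIV. dyadic_sum (\<alpha> / real CARD('m)) (dyadic_inf (grand_max N (f k))) x)"
    if f: "\<And>k. f k \<in> tempered" and fin: "\<And>k. AE y in lebesgue. grand_max N (f k) y < \<infinity>" for f :: "'m \<Rightarrow> 'n dist" and x
  proof -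
    define F where "F k = dyadic_inf (grand_max N (f k))" for k
    have F0: "0 \<le> F k j y" for k j y by (simp add: F_def dyadic_inf_nonneg)
    define I where "I j = {n * 2 powi j..<2 * (n * 2 powi j)}" for j :: int
    have cv: "norm (conv_dist (dilate t gauss) (f k) x) \<le> C * F k j x" if t: "n * 2 powi j \<le> t" for k j t
    proof -
      have "0 < n * 2 powi j" using n pow2_pos[of j] by (intro mult_pos_pos) auto
      then have tp: "0 < t" using t by linarith
      have "ennreal (norm (conv_dist (dilate t gauss) (f k) x)) \<le> ennreal C * ennreal (F k j x)"
        unfolding F_def dyadic_inf_eq[OF fin]
      proof -
        show "ennreal (norm (conv_dist (dilate t gauss) (f k) x)) \<le> ennreal C * (INF y\<in>dyadic_cell j x. grand_max N (f k) y)"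
        proof -
          have "ennreal (1 / C) * ennreal (norm (conv_dist (dilate t gauss) (f k) x)) \<le> (INF y\<in>dyadic_cell j x. grand_max N (f k) y)"
          proof (rule INF_greatest)
            fix z assume "z \<in> dyadic_cell j x"
            then have "norm (z - x) \<le> t" using dyadic_cell_shrink_subset_ball[of z j x] t by (simp add: n_def)
            then have "ennreal (1 / C) * ennreal (norm (conv_dist (dilate t gauss) (f k) x)) \<le> ennreal (1 / C) * (ennreal C * grand_max N (f k) z)"
              by (intro mult_left_mono C(2) f tp) simp_all
            also have "\<dots> = grand_max N (f k) z" using C(1) by (simp add: mult.assoc[symmetric] ennreal_mult[symmetric])
            finally show "ennreal (1 / C) * ennreal (norm (conv_dist (dilate t gauss) (f k) x)) \<le> grand_max N (f k) z" .
          qed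
          then have "ennreal C * (ennreal (1 / C) * ennreal (norm (conv_dist (dilate t gauss) (f k) x))) \<le> ennreal C * (INF y\<in>dyadic_cell j x. grand_max N (f k) y)"
            by (intro mult_left_mono) auto
          then show ?thesis using C(1) by (simp add: mult.assoc[symmetric] ennreal_mult[symmetric])
        qed
      qed
      then have "ennreal (norm (conv_dist (dilate t gauss) (f k) x)) \<le> ennreal (C * F k j x)"
        using C(1) F0 by (simp add: ennreal_mult)
      then show ?thesis using C(1) F0[of k j x] by (subst (asm) ennreal_le_iff) auto
    qed
    have "(\<integral>\<^sup>+t. ennreal (norm (top_kernel \<alpha> f x t)) \<partial>lborel) \<le>
        (\<integral>\<^sup>+t. (\<integral>\<^sup>+j. ennreal (2 powr \<alpha> * (n * 2 powi j) powr (\<alpha> - 1) * (\<Prod>k\<in>UNIV. C * F k j x)) * indicator (I j) t \<partial>count_space (UNIV :: int set)) \<partial>lborel)"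
    proof (rule nn_integral_mono)
      fix t :: real
      show "ennreal (norm (top_kernel \<alpha> f x t)) \<le>
        (\<integral>\<^sup>+j. ennreal (2 powr \<alpha> * (n * 2 powi j) powr (\<alpha> - 1) * (\<Prod>k\<in>UNIV. C * F k j x)) * indicator (I j) t \<partial>count_space (UNIV :: int set))"
      proof (cases "0 < t")
        case True
        define j where "j = \<lfloor>log 2 (t / n)\<rfloor>"
        have tn: "0 < t / n" using True n by simp
        have "2 powr real_of_int j \<le> 2 powr log 2 (t / n)" by (intro powr_mono) (auto simp: j_def)
        then have j1: "n * 2 powi j \<le> t" using tn n by (simp add: powr_real_of_int' field_simps)
        have "2 powr log 2 (t / n) < 2 powr real_of_int (j + 1)"
        proof (rule powr_less_mono)
          show "log 2 (t / n) < real_of_int (j + 1)" unfolding j_def by linarith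
        qed simp
        then have j2: "t < 2 * (n * 2 powi j)" using tn n by (simp add: powr_add powr_real_of_int' field_simps)
        have T: "0 < n * 2 powi j" using n pow2_pos[of j] by (intro mult_pos_pos) auto
        have "norm (top_kernel \<alpha> f x t) = t powr (\<alpha> - 1) * (\<Prod>k\<in>UNIV. norm (conv_dist (dilate t gauss) (f k) x))"
          using True by (simp add: top_kernel_def norm_mult prod_norm)
        also have "\<dots> \<le> (2 powr \<alpha> * (n * 2 powi j) powr (\<alpha> - 1)) * (\<Prod>k\<in>UNIV. C * F k j x)"
          using cv[OF j1] by (intro mult_mono powr_dyadic_le[OF T j1 j2 \<alpha>] prod_mono prod_nonneg) auto
        finally have "ennreal (norm (top_kernel \<alpha> f x t)) \<le> ennreal (2 powr \<alpha> * (n * 2 powi j) powr (\<alpha> - 1) * (\<Prod>k\<in>UNIV. C * F k j x)) * indicator (I j) t"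
          using j1 j2 by (simp add: I_def ennreal_leI)
        also have "\<dots> \<le> (\<integral>\<^sup>+j. ennreal (2 powr \<alpha> * (n * 2 powi j) powr (\<alpha> - 1) * (\<Prod>k\<in>UNIV. C * F k j x)) * indicator (I j) t \<partial>count_space (UNIV :: int set))"
          by (rule int_le_sum)
        finally show ?thesis .
      qed (simp add: top_kernel_def)
    qed
    also have "\<dots> = (\<integral>\<^sup>+j. (\<integral>\<^sup>+t. ennreal (2 powr \<alpha> * (n * 2 powi j) powr (\<alpha> - 1) * (\<Prod>k\<in>UNIV. C * F k j x)) * indicator (I j) t \<partial>lborel) \<partial>count_space (UNIV :: int set))"
      by (rule nn_integral_count_space_nn_integral) (auto simp: I_def)
    also have "\<dots> = (\<integral>\<^sup>+j. ennreal D * (\<Prod>k\<in>UNIV. ennreal (2 powr (real_of_int j * (\<alpha> / real CARD('m))) * F k j x)) \<partial>count_space (UNIV :: int set))"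
    proof (rule nn_integral_cong)
      fix j :: int
      define T where "T = n * 2 powi j"
      have T: "0 < T" using n pow2_pos[of j] by (auto simp: T_def)
      have PF: "0 \<le> (\<Prod>k\<in>UNIV. F k j x)" using F0 by (intro prod_nonneg) auto
      have "(\<integral>\<^sup>+t. ennreal (2 powr \<alpha> * T powr (\<alpha> - 1) * (\<Prod>k\<in>UNIV. C * F k j x)) * indicator (I j) t \<partial>lborel) =
         ennreal (2 powr \<alpha> * T powr (\<alpha> - 1) * (\<Prod>k\<in>UNIV. C * F k j x)) * ennreal T"
        using T by (subst nn_integral_cmult_indicator) (auto simp: I_def T_def)
      also have "\<dots> = ennreal (2 powr \<alpha> * T powr (\<alpha> - 1) * (\<Prod>k\<in>UNIV. C * F k j x) * T)"
        using T by (intro ennreal_mult''[symmetric]) auto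
      also have "2 powr \<alpha> * T powr (\<alpha> - 1) * (\<Prod>k\<in>UNIV. C * F k j x) * T = D * ((2 powi j) powr \<alpha> * (\<Prod>k\<in>UNIV. F k j x))"
      proof -
        have "T powr (\<alpha> - 1) * T = T powr \<alpha>" using T by (simp add: powr_diff)
        also have "\<dots> = n powr \<alpha> * (2 powi j) powr \<alpha>" using n pow2_pos[of j] by (simp add: T_def powr_mult)
        finally have 1: "T powr (\<alpha> - 1) * T = n powr \<alpha> * (2 powi j) powr \<alpha>" .
        have "2 powr \<alpha> * T powr (\<alpha> - 1) * (\<Prod>k\<in>UNIV. C * F k j x) * T = 2 powr \<alpha> * (T powr (\<alpha> - 1) * T) * (C ^ CARD('m) * (\<Prod>k\<in>UNIV. F k j x))"
          by (simp add: prod.distrib mult_ac)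
        then show ?thesis unfolding 1 D_def using n by (simp add: powr_mult mult_ac)
      qed
      also have "(2 powi j) powr \<alpha> * (\<Prod>k\<in>UNIV. F k j x) = (\<Prod>k\<in>(UNIV :: 'm set). 2 powr (real_of_int j * (\<alpha> / real CARD('m))) * F k j x)"
      proof -
        have "(2 powr (real_of_int j * (\<alpha> / real CARD('m)))) ^ CARD('m) = (2 powi j) powr \<alpha>"
          by (simp add: powr_realpow[symmetric] powr_powr powr_real_of_int'[symmetric])
        then show ?thesis by (simp add: prod.distrib)
      qed
      also have "ennreal (D * (\<Prod>k\<in>(UNIV :: 'm set). 2 powr (real_of_int j * (\<alpha> / real CARD('m))) * F k j x)) =
         ennreal D * (\<Prod>k\<in>UNIV. ennreal (2 powr (real_of_int j * (\<alpha> / real CARD('m))) * F k j x))"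
        using D F0 by (subst ennreal_mult') (auto simp: prod_ennreal)
      finally show "(\<integral>\<^sup>+t. ennreal (2 powr \<alpha> * (n * 2 powi j) powr (\<alpha> - 1) * (\<Prod>k\<in>UNIV. C * F k j x)) * indicator (I j) t \<partial>lborel) =
        ennreal D * (\<Prod>k\<in>UNIV. ennreal (2 powr (real_of_int j * (\<alpha> / real CARD('m))) * F k j x))" unfolding T_def .
    qed
    also have "\<dots> = ennreal D * (\<integral>\<^sup>+j. (\<Prod>k\<in>UNIV. ennreal (2 powr (real_of_int j * (\<alpha> / real CARD('m))) * F k j x)) \<partial>count_space (UNIV :: int set))"
      by (rule nn_integral_cmult) simp
    also have "\<dots> \<le> ennreal D * (\<Prod>k\<in>UNIV. dyadic_sum (\<alpha> / real CARD('m)) (F k) x)"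
      unfolding dyadic_sum_def by (intro mult_left_mono sum_prod_le_prod_sum) auto
    finally show ?thesis unfolding F_def .
  qed
  with D show thesis by (rule that)
qed

section \<open>Agreement with the fractional integral for bounded functions of compact
  support\<close>

lemma complex_lebesgue_borel_representative:
  fixes g :: "'a::euclidean_space \<Rightarrow> complex"
  assumes "g \<in> borel_measurable lebesgue"
  obtains g' where "g' \<in> borel_measurable borel" "AE x in lborel. g x = g' x"
proof -
  have "(\<lambda>x. Re (g x)) \<in> borel_measurable (completion lborel)" "(\<lambda>x. Im (g x)) \<in> borel_measurable (completion lborel)"
    using assms by measurable
  then obtain u v where uv: "u \<in> borel_measurable lborel" "AE x in lborel. Re (g x) = u x"
    "v \<in> borel_measurable lborel" "AE x in lborel. Im (g x) = v x"
    using completion_ex_borel_measurable_real by metis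
  have "(\<lambda>x. Complex (u x) (v x)) \<in> borel_measurable borel"
    using uv(1,3) unfolding Complex_eq by measurable
  moreover have "AE x in lborel. g x = Complex (u x) (v x)"
    using uv(2,4) by eventually_elim (simp add: complex_eq_iff)
  ultimately show thesis by (rule that)
qed

lemma distr_lborel_reflect: "distr lborel borel (\<lambda>y. x - y) = (lborel :: 'a::euclidean_space measure)"
  using lborel_affine[of "- 1" x] by (simp add: density_1)

lemma AE_lborel_reflect:
  fixes x :: "'a::euclidean_space"
  assumes "AE y in lborel. P y"
  shows "AE y in lborel. P (x - y)"
proof -
  have "AE y in distr lborel borel (\<lambda>y. x - y). P y" unfolding distr_lborel_reflect by (rule assms)
  then show ?thesis by (intro AE_distrD[of "\<lambda>y. x - y" lborel borel]) auto
qed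

lemma dilate_gauss:
  fixes z :: "real^'n::finite"
  assumes "t > 0"
  shows "dilate t gauss z = complex_of_real (t powr - real CARD('n) * exp (- (norm z / t)\<^sup>2))"
  using assms by (simp add: dilate_def gauss_def powr_minus powr_realpow divide_inverse mult.commute)

text \<open>The reason for choosing a Gaussian: |y|^2 is the sum of the |y_k|^2, so the product of
  the kernels depends on |y| alone.\<close>

lemma prod_dilate_gauss:
  fixes y :: "(real^'n::finite)^'m::finite"
  assumes t: "t > 0"
  shows "(\<Prod>k\<in>UNIV. dilate t gauss (y $ k)) =
    complex_of_real (t powr - (real CARD('m) * real CARD('n)) * exp (- (norm y / t)\<^sup>2))"
proof -
  have n: "(norm y)\<^sup>2 = (\<Sum>k\<in>UNIV. (norm (y $ k))\<^sup>2)"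
    by (simp add: power2_norm_eq_inner inner_vec_def)
  have "(\<Prod>k\<in>UNIV. dilate t gauss (y $ k)) = complex_of_real ((\<Prod>k\<in>(UNIV :: 'm set). t powr - real CARD('n)) * exp (\<Sum>k\<in>UNIV. - (norm (y $ k) / t)\<^sup>2))"
    using t by (simp add: dilate_gauss prod.distrib exp_sum del: of_real_mult flip: of_real_prod)
  also have "(\<Prod>k\<in>(UNIV :: 'm set). t powr - real CARD('n)) = t powr - (real CARD('m) * real CARD('n))"
    using t by (simp add: powr_powr mult.commute flip: powr_realpow)
  also have "(\<Sum>k\<in>UNIV. - (norm (y $ k) / t)\<^sup>2) = - (norm y / t)\<^sup>2"
    by (simp add: power_divide n sum_negf sum_divide_distrib)
  finally show ?thesis .
qed

lemma nn_integral_gauss_finite: "(\<integral>\<^sup>+u. ennreal (norm (gauss u :: complex)) \<partial>(lborel :: (real^'n::finite) measure)) < \<infinity>"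
proof -
  define N where "N = CARD('n) + 1"
  define B where "B = enn2real (schwartz_norm N (gauss :: real^'n \<Rightarrow> complex))"
  have "norm (gauss u) \<le> B * (1 / (1 + norm u) ^ N)" for u :: "real^'n"
  proof -
    have "(1 + norm u) ^ N > 0" by (simp add: add_pos_nonneg)
    then show ?thesis using schwartz_bound[OF gauss_schwartz, of "[]" N u] by (simp add: B_def field_simps)
  qed
  then have "(\<integral>\<^sup>+u. ennreal (norm (gauss u)) \<partial>(lborel :: (real^'n) measure)) \<le>
      (\<integral>\<^sup>+u. ennreal B * ennreal (1 / (1 + norm u) ^ N) \<partial>(lborel :: (real^'n) measure))"
    by (intro nn_integral_mono) (simp add: B_def ennreal_leI flip: ennreal_mult)
  also have "\<dots> = ennreal B * (\<integral>\<^sup>+u. ennreal (1 / (1 + norm u) ^ N) \<partial>(lborel :: (real^'n) measure))"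
    by (rule nn_integral_cmult) simp
  also have "\<dots> < \<infinity>" using nn_integral_decay_finite[where 'n = 'n, of N] by (simp add: N_def ennreal_mult_less_top)
  finally show ?thesis .
qed

text \<open>The condition 0 < a gives convergence at 0, and a < b at infinity. With a = \<alpha> and
  b = mn these are the two bounds on \<alpha>.\<close>

lemma nn_integral_powr_finite:
  fixes a b :: real
  assumes a: "0 < a" and b: "a < b"
  shows "(\<integral>\<^sup>+t\<in>{0<..}. ennreal (t powr (a - 1) * min 1 (t powr - b)) \<partial>lborel) < \<infinity>"
proof -
  have "((\<lambda>t. t powr (a - 1)) has_integral (1 powr (a - 1 + 1) / (a - 1 + 1))) {0..1}"
    using has_integral_powr_from_0[of "a - 1" 1] a by simp
  then have "(\<integral>\<^sup>+t. ennreal (t powr (a - 1)) * indicator {0..1} t \<partial>lborel) = ennreal (1 powr (a - 1 + 1) / (a - 1 + 1))"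
    by (intro nn_integral_has_integral_lebesgue') auto
  then have 1: "(\<integral>\<^sup>+t. ennreal (t powr (a - 1)) * indicator {0..1} t \<partial>lborel) < \<infinity>" by simp
  have 2: "(\<integral>\<^sup>+t. ennreal (t powr (a - 1 - b)) * indicator {1..} t \<partial>lborel) = ennreal (0 - 1 / (a - b) * 1 powr (a - b))"
  proof (rule nn_integral_FTC_atLeast[where F = "\<lambda>t. 1 / (a - b) * t powr (a - b)"])
    show "((\<lambda>t. 1 / (a - b) * t powr (a - b)) has_real_derivative t powr (a - 1 - b)) (at t)" if "1 \<le> t" for t
    proof -
      have eq: "a - 1 - b = a - b - 1" by simp
      show ?thesis unfolding eq using that b by (auto intro!: derivative_eq_intros)
    qed
    show "((\<lambda>t. 1 / (a - b) * t powr (a - b)) \<longlongrightarrow> 0) at_top"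
      using b by (intro tendsto_mult_right_zero tendsto_neg_powr filterlim_ident) auto
  qed auto
  have "(\<integral>\<^sup>+t\<in>{0<..}. ennreal (t powr (a - 1) * min 1 (t powr - b)) \<partial>lborel) \<le>
     (\<integral>\<^sup>+t. ennreal (t powr (a - 1)) * indicator {0..1} t + ennreal (t powr (a - 1 - b)) * indicator {1..} t \<partial>lborel)"
  proof (intro nn_integral_mono)
    fix t :: real
    have "t powr (a - 1) * min 1 (t powr - b) \<le> t powr (a - 1)" by (simp add: mult_left_le)
    moreover have "t powr (a - 1) * min 1 (t powr - b) \<le> t powr (a - 1 - b)"
    proof -
      have "t powr (a - 1) * min 1 (t powr - b) \<le> t powr (a - 1) * t powr - b" by (intro mult_left_mono) auto
      then show ?thesis by (simp flip: powr_add)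
    qed
    ultimately show "ennreal (t powr (a - 1) * min 1 (t powr - b)) * indicator {0<..} t \<le>
        ennreal (t powr (a - 1)) * indicator {0..1} t + ennreal (t powr (a - 1 - b)) * indicator {1..} t"
      by (cases "t \<le> 1") (auto split: split_indicator intro: ennreal_leI add_increasing2)
  qed
  also have "\<dots> < \<infinity>" using 1 2 by (subst nn_integral_add) auto
  finally show ?thesis .
qed


text \<open>\<open>frac_int\<close> is an integral for the completed measure, while Fubini's theorem
  is applied to Borel functions. Completeness makes f measurable.\<close>

lemma lborel_integral_cong_AE_lebesgue:
  fixes f :: "'a::euclidean_space \<Rightarrow> complex"
  assumes g: "g \<in> borel_measurable borel" and ae: "AE x in lborel. f x = g x"
  shows "(LINT x|lebesgue. f x) = (LINT x|lborel. g x)"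
proof -
  have g': "g \<in> borel_measurable lebesgue" using g by (rule borel_imp_lebesgue)
  have ae': "AE x in lebesgue. g x = f x" using ae by (auto intro!: AE_completion)
  have "f \<in> borel_measurable lebesgue"
  proof (rule measurableI)
    fix S :: "complex set" assume S: "S \<in> sets borel"
    have 1: "g -` S \<inter> space lebesgue \<in> sets lebesgue" using g' S by (rule measurable_sets)
    have 2: "AE x in lebesgue. x \<in> g -` S \<inter> space lebesgue \<longleftrightarrow> x \<in> f -` S \<inter> space lebesgue"
      using ae' by eventually_elim simp
    show "f -` S \<inter> space lebesgue \<in> sets lebesgue"
      by (rule completion.in_sets_AE[OF 2 1]) (rule Int_lower2)
  qed simp
  then have "(LINT x|lebesgue. f x) = (LINT x|lebesgue. g x)"
    using g' ae' by (intro integral_cong_AE) auto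
  also have "\<dots> = (LINT x|lborel. g x)" using g by (intro integral_completion) simp
  finally show ?thesis .
qed

text \<open>Two estimates of the convolution integral are combined: the bound of g times the L^1
  norm of the Gaussian, and the L^1 norm of g times the maximum t^(-n) of the dilated Gaussian. The
  minimum makes the later integral over t converge at both ends.\<close>

lemma (in bounded_cpt) borel_representative:
  obtains g' B where "g' \<in> borel_measurable borel" "AE x in lborel. g x = g' x" "0 \<le> B"
    "\<And>t x. t > 0 \<Longrightarrow> (\<integral>\<^sup>+y. ennreal (norm (g' (x - y) * dilate t gauss y)) \<partial>lborel) \<le> ennreal (B * min 1 (t powr - real CARD('n)))"
proof -
  obtain g' where g': "g' \<in> borel_measurable borel" "AE x in lborel. g x = g' x"
    using complex_lebesgue_borel_representative[OF g_meas] by blast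
  define \<Gamma> where "\<Gamma> = enn2real (\<integral>\<^sup>+u. ennreal (norm (gauss u :: complex)) \<partial>(lborel :: (real^'n) measure))"
  have \<Gamma>: "(\<integral>\<^sup>+u. ennreal (norm (gauss u :: complex)) \<partial>(lborel :: (real^'n) measure)) = ennreal \<Gamma>"
    using nn_integral_gauss_finite[where 'n = 'n] by (simp add: \<Gamma>_def)
  have \<Gamma>0: "0 \<le> \<Gamma>" by (simp add: \<Gamma>_def)
  have gm: "(gauss :: real^'n \<Rightarrow> complex) \<in> borel_measurable borel"
    by (rule smooth_measurable[OF schwartz_smooth[OF gauss_schwartz]])
  have ball: "emeasure lborel (cball 0 R :: (real^'n) set) = ennreal V"
    unfolding V_def using emeasure_lborel_cball_finite[of "0 :: real^'n" R]
    by (subst emeasure_eq_ennreal_measure) auto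
  have A: "AE y in lborel. norm (g' y) \<le> A * indicator (cball 0 R) y"
    using g'(2) AE_completion_iff[THEN iffD1, OF gA]
    by eventually_elim (use gR in \<open>force split: split_indicator\<close>)
  have AS: "AE y in lborel. norm (g' (x - y)) \<le> A * indicator (cball 0 R) (x - y)" for x
    by (rule AE_lborel_reflect[OF A])
  show thesis
  proof (rule that[OF g', of "A * \<Gamma> + A * V"])
    show "0 \<le> A * \<Gamma> + A * V" using A0 V0 \<Gamma>0 by simp
    fix t :: real and x :: "real^'n" assume t: "t > 0"
    have dm: "dilate t (gauss :: real^'n \<Rightarrow> complex) \<in> borel_measurable borel"
      unfolding dilate_def using gm by measurable
    let ?I = "\<integral>\<^sup>+y. ennreal (norm (g' (x - y) * dilate t gauss y)) \<partial>lborel"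
    have "?I \<le> (\<integral>\<^sup>+y. ennreal A * ennreal (norm (dilate t gauss (y :: real^'n))) \<partial>lborel)"
    proof (rule nn_integral_mono_AE)
      show "AE y in lborel. ennreal (norm (g' (x - y) * dilate t gauss y)) \<le> ennreal A * ennreal (norm (dilate t gauss y))"
        using AS[of x]
      proof eventually_elim
        case (elim y)
        have "norm (g' (x - y) * dilate t gauss y) \<le> A * norm (dilate t gauss y)"
          unfolding norm_mult using elim A0 by (intro mult_right_mono) (auto split: split_indicator_asm)
        then show ?case using A0 by (simp add: ennreal_leI flip: ennreal_mult)
      qed
    qed
    also have "\<dots> = ennreal A * (\<integral>\<^sup>+y. ennreal (norm (dilate t gauss (y :: real^'n))) \<partial>lborel)"
      using dm by (intro nn_integral_cmult) measurable
    also have "(\<integral>\<^sup>+y. ennreal (norm (dilate t gauss (y :: real^'n))) \<partial>lborel) = (\<integral>\<^sup>+y. ennreal (norm (dilate t gauss (0 - y :: real^'n))) \<partial>lborel)"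
      by (simp add: dilate_def gauss_def)
    also have "\<dots> = ennreal \<Gamma>" using nn_integral_dilate[OF gm t, of 0] by (simp only: \<Gamma>)
    finally have 1: "?I \<le> ennreal (A * \<Gamma>)" using A0 \<Gamma>0 by (simp add: ennreal_mult)
    have dl: "norm (dilate t gauss (y :: real^'n)) \<le> t powr - real CARD('n)" for y
      using t by (simp add: dilate_gauss norm_mult mult_left_le)
    have "?I \<le> (\<integral>\<^sup>+y. ennreal (A * t powr - real CARD('n)) * indicator (cball 0 R) (x - y) \<partial>lborel)"
    proof (rule nn_integral_mono_AE)
      show "AE y in lborel. ennreal (norm (g' (x - y) * dilate t gauss y)) \<le> ennreal (A * t powr - real CARD('n)) * indicator (cball 0 R) (x - y)"
        using AS[of x]
      proof eventually_elim
        case (elim y)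
        have "norm (g' (x - y) * dilate t gauss y) \<le> (A * indicator (cball 0 R) (x - y)) * t powr - real CARD('n)"
          unfolding norm_mult using elim dl A0 by (intro mult_mono) auto
        then show ?case by (auto split: split_indicator intro: ennreal_leI)
      qed
    qed
    also have "\<dots> = (\<integral>\<^sup>+y. ennreal (A * t powr - real CARD('n)) * indicator (cball 0 R) y \<partial>(distr lborel borel (\<lambda>y. x - y)))"
    proof (rule nn_integral_distr[symmetric])
      show "(\<lambda>y. x - y) \<in> lborel \<rightarrow>\<^sub>M borel" by simp
      show "(\<lambda>y. ennreal (A * t powr - real CARD('n)) * indicator (cball 0 R) y) \<in> borel_measurable (distr lborel borel (\<lambda>y. x - y))"
        unfolding measurable_distr_eq1 by (intro borel_measurable_times_ennreal borel_measurable_const borel_measurable_indicator) simp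
    qed
    also have "\<dots> = ennreal (A * t powr - real CARD('n)) * emeasure lborel (cball 0 R :: (real^'n) set)"
      unfolding distr_lborel_reflect by (rule nn_integral_cmult_indicator) simp
    also have "\<dots> = ennreal (A * V * t powr - real CARD('n))"
      using A0 V0 by (simp add: ball ennreal_mult mult_ac)
    finally have 2: "?I \<le> ennreal (A * V * t powr - real CARD('n))" .
    have "A * \<Gamma> \<le> A * \<Gamma> + A * V" "A * V * t powr - real CARD('n) \<le> (A * \<Gamma> + A * V) * t powr - real CARD('n)"
      using A0 V0 \<Gamma>0 by (auto simp: mult_right_mono)
    then have "?I \<le> ennreal (A * \<Gamma> + A * V)" "?I \<le> ennreal ((A * \<Gamma> + A * V) * t powr - real CARD('n))"
      using 1 2 by (meson ennreal_leI order_trans)+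
    then show "?I \<le> ennreal ((A * \<Gamma> + A * V) * min 1 (t powr - real CARD('n)))"
      by (simp add: min_def)
  qed
qed


text \<open>Fubini's theorem in (t, y). For fixed t the integral over y factors into the m
  convolutions; for fixed y \<noteq> 0 the integral over t is the subordination integral with r =
  |y|.\<close>

lemma dist_frac_int_dist_of:
  fixes g :: "'m::finite \<Rightarrow> real^'n::finite \<Rightarrow> complex"
  assumes g: "\<And>k. bounded_cpt (g k) (A k) (R k)" and \<alpha>: "0 < \<alpha>" "\<alpha> < real CARD('m) * real CARD('n)"
  shows "dist_frac_int \<alpha> (\<lambda>k. dist_of (g k)) x = frac_int \<alpha> g x"
proof -
  define M where "M = real CARD('m) * real CARD('n)"
  \<comment> \<open>The properties of a Borel representative are packed into one predicate, so that
    representatives and constants can be chosen for all k at once.\<close>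
  define Q where "Q k = (\<lambda>(g', B). g' \<in> borel_measurable borel \<and> (AE x in lborel. g k x = g' x) \<and> 0 \<le> B \<and>
    (\<forall>t x. t > 0 \<longrightarrow> (\<integral>\<^sup>+y. ennreal (norm (g' (x - y) * dilate t gauss y)) \<partial>lborel) \<le> ennreal (B * min 1 (t powr - real CARD('n)))))" for k
  have "\<exists>gB. Q k gB" for k
  proof (rule bounded_cpt.borel_representative[OF g[of k]])
    fix g' :: "real^'n \<Rightarrow> complex" and B :: real
    assume "g' \<in> borel_measurable borel" "AE x in lborel. g k x = g' x" "0 \<le> B"
      "\<And>t x. t > 0 \<Longrightarrow> (\<integral>\<^sup>+y. ennreal (norm (g' (x - y) * dilate t gauss y)) \<partial>lborel) \<le> ennreal (B * min 1 (t powr - real CARD('n)))"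
    then have "Q k (g', B)" by (simp add: Q_def)
    then show ?thesis ..
  qed
  then obtain gB where gB: "\<And>k. Q k (gB k)" by metis
  define g' where "g' k = fst (gB k)" for k
  define B where "B k = snd (gB k)" for k
  have Q: "Q k (g' k, B k)" for k using gB[of k] by (simp add: g'_def B_def)
  have g': "\<And>k. g' k \<in> borel_measurable borel" "\<And>k. AE x in lborel. g k x = g' k x" "\<And>k. 0 \<le> B k"
    "\<And>k t x. t > 0 \<Longrightarrow> (\<integral>\<^sup>+y. ennreal (norm (g' k (x - y) * dilate t gauss y)) \<partial>lborel) \<le> ennreal (B k * min 1 (t powr - real CARD('n)))"
    using Q unfolding Q_def by blast+
  note [measurable] = g'(1)
  have [measurable]: "(\<lambda>y :: (real^'n)^'m. y $ k) \<in> borel_measurable borel" for k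
    by (intro borel_measurable_continuous_onI continuous_intros)
  have dm [measurable]: "dilate t (gauss :: real^'n \<Rightarrow> complex) \<in> borel_measurable borel" for t
    unfolding dilate_def using smooth_measurable[OF schwartz_smooth[OF gauss_schwartz]] by measurable
  define W where "W y = (\<Prod>k\<in>UNIV. g' k (x - y $ k))" for y :: "(real^'n)^'m"
  \<comment> \<open>The Gaussian kernel on (R^n)^m at scale t, multiplied by t^(\<alpha>-1) and
    extended by 0 to t \<le> 0.\<close>
  define \<Phi> where "\<Phi> t y = indicator {0<..} t * (t powr (\<alpha> - 1 - M) * exp (- (norm y / t)\<^sup>2))" for t and y :: "(real^'n)^'m"
  have W [measurable]: "W \<in> borel_measurable borel" unfolding W_def by measurable
  have \<Phi>0: "0 \<le> \<Phi> t y" for t y by (simp add: \<Phi>_def)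
  have factor: "complex_of_real (\<Phi> t y) * W y = complex_of_real (t powr (\<alpha> - 1)) * (\<Prod>k\<in>UNIV. g' k (x - y $ k) * dilate t gauss (y $ k))"
    if t: "t > 0" for t y
  proof -
    have "t powr (\<alpha> - 1 - M) = t powr (\<alpha> - 1) * t powr - M" by (simp flip: powr_add)
    then show ?thesis
      using t by (simp add: \<Phi>_def W_def prod.distrib prod_dilate_gauss M_def mult_ac)
  qed
  have int: "integrable lborel (\<lambda>y. g' k (x - y) * dilate t gauss y)" if t: "t > 0" for k t
  proof (rule integrableI_bounded)
    show "(\<integral>\<^sup>+y. ennreal (norm (g' k (x - y) * dilate t gauss y)) \<partial>lborel) < \<infinity>"
      using g'(4)[OF t, of k x] by (rule le_less_trans) simp
  qed measurable
  have kernel: "top_kernel \<alpha> (\<lambda>k. dist_of (g k)) x t = (LINT y|lborel. complex_of_real (\<Phi> t y) * W y)" for t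
  proof (cases "t > 0")
    case t: True
    have "conv_dist (dilate t gauss) (dist_of (g k)) x = (LINT y|lborel. g' k (x - y) * dilate t gauss y)" for k
    proof -
      have "conv_dist (dilate t gauss) (dist_of (g k)) x = (LINT y|lebesgue. g k y * dilate t gauss (x - y))"
        by (rule bounded_cpt.conv_dist_of(1)[OF g gauss_schwartz t])
      also have "\<dots> = (LINT y|lborel. g' k y * dilate t gauss (x - y))"
        by (rule lborel_integral_cong_AE_lebesgue, measurable) (use g'(2)[of k] in \<open>eventually_elim, simp\<close>)
      also have "\<dots> = (LINT y|distr lborel borel (\<lambda>y. x - y). g' k y * dilate t gauss (x - y))"
        by (simp only: distr_lborel_reflect)
      also have "\<dots> = (LINT y|lborel. g' k (x - y) * dilate t gauss y)"
        by (subst integral_distr) simp_all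
      finally show ?thesis .
    qed
    then have "top_kernel \<alpha> (\<lambda>k. dist_of (g k)) x t = complex_of_real (t powr (\<alpha> - 1)) * (\<Prod>k\<in>UNIV. LINT y|lborel. g' k (x - y) * dilate t gauss y)"
      using t by (simp add: top_kernel_def)
    also have "\<dots> = complex_of_real (t powr (\<alpha> - 1)) * (LINT y|(lborel :: ((real^'n)^'m) measure). (\<Prod>k\<in>UNIV. g' k (x - y $ k) * dilate t gauss (y $ k)))"
      by (subst integral_vec_prod[OF int[OF t]]) simp
    also have "\<dots> = (LINT y|lborel. complex_of_real (\<Phi> t y) * W y)"
      by (simp only: factor[OF t] integral_mult_right_zero)
    finally show ?thesis .
  qed (simp add: top_kernel_def \<Phi>_def)
  have mp: "(\<lambda>(t, y). complex_of_real (\<Phi> t y) * W y) \<in> borel_measurable (lborel \<Otimes>\<^sub>M lborel)"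
    unfolding \<Phi>_def by measurable
  have ip: "integrable (lborel \<Otimes>\<^sub>M lborel) (\<lambda>(t, y). complex_of_real (\<Phi> t y) * W y)"
  proof (rule integrableI_bounded[OF mp])
    define P where "P = (\<Prod>k\<in>(UNIV :: 'm set). B k)"
    have P: "0 \<le> P" using g'(3) by (simp add: P_def prod_nonneg)
    have "(\<integral>\<^sup>+z. ennreal (norm (case z of (t, y) \<Rightarrow> complex_of_real (\<Phi> t y) * W y)) \<partial>(lborel \<Otimes>\<^sub>M lborel)) =
      (\<integral>\<^sup>+t. \<integral>\<^sup>+y. ennreal (norm (complex_of_real (\<Phi> t y) * W y)) \<partial>lborel \<partial>lborel)"
      using mp by (subst lborel.nn_integral_fst[symmetric]) (simp_all add: case_prod_beta')
    also have "\<dots> \<le> (\<integral>\<^sup>+t. ennreal P * (ennreal (t powr (\<alpha> - 1) * min 1 (t powr - M)) * indicator {0<..} t) \<partial>lborel)"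
    proof (rule nn_integral_mono)
      fix t :: real
      show "(\<integral>\<^sup>+y. ennreal (norm (complex_of_real (\<Phi> t y) * W y)) \<partial>lborel) \<le> ennreal P * (ennreal (t powr (\<alpha> - 1) * min 1 (t powr - M)) * indicator {0<..} t)"
      proof (cases "t > 0")
        case t: True
        have "ennreal (norm (complex_of_real (\<Phi> t y) * W y)) =
          ennreal (t powr (\<alpha> - 1)) * (\<Prod>k\<in>UNIV. ennreal (norm (g' k (x - y $ k) * dilate t gauss (y $ k))))" for y
        proof -
          have "norm (complex_of_real (\<Phi> t y) * W y) = t powr (\<alpha> - 1) * (\<Prod>k\<in>UNIV. norm (g' k (x - y $ k) * dilate t gauss (y $ k)))"
            unfolding factor[OF t] by (subst norm_mult) (simp only: prod_norm norm_of_real abs_of_nonneg powr_ge_zero)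
          then show ?thesis by (simp only: ennreal_mult' powr_ge_zero prod_ennreal norm_ge_zero)
        qed
        then have "(\<integral>\<^sup>+y. ennreal (norm (complex_of_real (\<Phi> t y) * W y)) \<partial>lborel) =
          (\<integral>\<^sup>+y. ennreal (t powr (\<alpha> - 1)) * (\<Prod>k\<in>UNIV. ennreal (norm (g' k (x - y $ k) * dilate t gauss (y $ k)))) \<partial>(lborel :: ((real^'n)^'m) measure))"
          by (simp only:)
        also have "\<dots> = ennreal (t powr (\<alpha> - 1)) * (\<integral>\<^sup>+y. (\<Prod>k\<in>UNIV. ennreal (norm (g' k (x - y $ k) * dilate t gauss (y $ k)))) \<partial>(lborel :: ((real^'n)^'m) measure))"
          by (rule nn_integral_cmult) measurable
        also have "\<dots> = ennreal (t powr (\<alpha> - 1)) * (\<Prod>k\<in>UNIV. \<integral>\<^sup>+y. ennreal (norm (g' k (x - y) * dilate t gauss y)) \<partial>lborel)"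
          by (subst nn_integral_vec_prod) simp_all
        also have "\<dots> \<le> ennreal (t powr (\<alpha> - 1)) * (\<Prod>k\<in>UNIV. ennreal (B k * min 1 (t powr - real CARD('n))))"
          by (intro mult_left_mono ennreal_prod_mono g'(4)[OF t]) simp
        also have "\<dots> = ennreal (t powr (\<alpha> - 1) * (\<Prod>k\<in>UNIV. B k * min 1 (t powr - real CARD('n))))"
          using g'(3) by (simp add: prod_ennreal prod_nonneg flip: ennreal_mult)
        also have "(\<Prod>k\<in>UNIV. B k * min 1 (t powr - real CARD('n))) = P * min 1 (t powr - real CARD('n)) ^ CARD('m)"
          by (simp add: P_def prod.distrib)
        also have "min 1 (t powr - real CARD('n)) ^ CARD('m) = min 1 (t powr - M)"
        proof -
          have e: "(t powr - real CARD('n)) ^ CARD('m) = t powr - M"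
            using t by (simp add: powr_powr M_def mult.commute flip: powr_realpow)
          show ?thesis
          proof (cases "t powr - real CARD('n) \<le> 1")
            case True
            then show ?thesis using power_le_one[of "t powr - real CARD('n)" "CARD('m)"] by (simp add: e[symmetric] min_def)
          next
            case False
            then show ?thesis using one_le_power[of "t powr - real CARD('n)" "CARD('m)"] by (simp add: e[symmetric] min_def)
          qed
        qed
        finally show ?thesis using t P by (simp add: mult_ac flip: ennreal_mult)
      qed (simp add: \<Phi>_def)
    qed
    also have "\<dots> = ennreal P * (\<integral>\<^sup>+t\<in>{0<..}. ennreal (t powr (\<alpha> - 1) * min 1 (t powr - M)) \<partial>lborel)"
      by (rule nn_integral_cmult) measurable
    also have "\<dots> < \<infinity>" using nn_integral_powr_finite[of \<alpha> M] \<alpha> by (simp add: M_def ennreal_mult_less_top)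
    finally show "(\<integral>\<^sup>+z. ennreal (norm (case z of (t, y) \<Rightarrow> complex_of_real (\<Phi> t y) * W y)) \<partial>(lborel \<Otimes>\<^sub>M lborel)) < \<infinity>" .
  qed
  define c where "c = enn2real (frac_const (M - \<alpha>))"
  have c: "frac_const (M - \<alpha>) = ennreal c" "c > 0"
    using frac_const_finite[of "M - \<alpha>"] frac_const_pos[of "M - \<alpha>"] \<alpha> by (auto simp: c_def M_def enn2real_positive_iff)
  have inner: "(LINT t|lborel. complex_of_real (\<Phi> t y) * W y) = complex_of_real c * (complex_of_real (1 / norm y powr (M - \<alpha>)) * W y)"
    if y: "y \<noteq> 0" for y
  proof -
    have "(LINT t|lborel. \<Phi> t y) = enn2real (\<integral>\<^sup>+t. ennreal (\<Phi> t y) \<partial>lborel)"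
      by (rule integral_eq_nn_integral) (auto simp: \<Phi>_def)
    also have "(\<integral>\<^sup>+t. ennreal (\<Phi> t y) \<partial>lborel) = (\<integral>\<^sup>+t\<in>{0<..}. ennreal (t powr (- 1 - (M - \<alpha>)) * exp (- (norm y / t)\<^sup>2)) \<partial>lborel)"
    proof (rule nn_integral_cong)
      fix t :: real
      have "\<alpha> - 1 - M = - 1 - (M - \<alpha>)" by simp
      then show "ennreal (\<Phi> t y) = ennreal (t powr (- 1 - (M - \<alpha>)) * exp (- (norm y / t)\<^sup>2)) * indicator {0<..} t"
        unfolding \<Phi>_def by (simp only: split: split_indicator) simp
    qed
    also have "\<dots> = ennreal (1 / norm y powr (M - \<alpha>) * c)"
      using y c(2) unfolding frac_const_scale[OF y[folded zero_less_norm_iff]] c(1) by (intro ennreal_mult[symmetric]) auto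
    also have "enn2real \<dots> = 1 / norm y powr (M - \<alpha>) * c" using c by simp
    finally have "(LINT t|lborel. \<Phi> t y) = 1 / norm y powr (M - \<alpha>) * c" .
    then show ?thesis by (simp add: mult_ac)
  qed
  have "(LINT t|lborel. top_kernel \<alpha> (\<lambda>k. dist_of (g k)) x t) = (LINT t|lborel. LINT y|lborel. complex_of_real (\<Phi> t y) * W y)"
    by (simp only: kernel)
  also have "\<dots> = (LINT y|lborel. LINT t|lborel. complex_of_real (\<Phi> t y) * W y)"
    by (rule lborel_pair.Fubini_integral[OF ip, symmetric])
  also have "\<dots> = (LINT y|lborel. complex_of_real c * (complex_of_real (1 / norm y powr (M - \<alpha>)) * W y))"
  proof (rule integral_cong_AE)
    show "(\<lambda>y. LINT t|lborel. complex_of_real (\<Phi> t y) * W y) \<in> borel_measurable lborel"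
      using borel_measurable_integrable[OF lborel_pair.integrable_snd[OF ip]] by simp
    \<comment> \<open>The origin, where the integral over t diverges, is a null set.\<close>
    show "AE y in lborel. (LINT t|lborel. complex_of_real (\<Phi> t y) * W y) = complex_of_real c * (complex_of_real (1 / norm y powr (M - \<alpha>)) * W y)"
      using AE_lborel_singleton[of 0] by eventually_elim (rule inner)
  qed measurable
  also have "\<dots> = complex_of_real c * (LINT y|lborel. complex_of_real (1 / norm y powr (M - \<alpha>)) * W y)"
    by (rule integral_mult_right_zero)
  also have "(LINT y|lborel. complex_of_real (1 / norm y powr (M - \<alpha>)) * W y) = frac_int \<alpha> g x"
    unfolding frac_int_def
  proof (rule lborel_integral_cong_AE_lebesgue[symmetric])
    have "AE y in lborel. \<forall>k\<in>UNIV. g k (x - y $ k) = g' k (x - y $ k)"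
      by (intro AE_finite_allI finite_class.finite_UNIV AE_vec_component AE_lborel_reflect[where P = "\<lambda>u. g _ u = g' _ u"] g'(2))
    then show "AE y in lborel. complex_of_real (1 / norm y powr (real CARD('m) * real CARD('n) - \<alpha>)) * (\<Prod>k\<in>UNIV. g k (x - y $ k)) =
        complex_of_real (1 / norm y powr (M - \<alpha>)) * W y"
      by eventually_elim (simp add: W_def M_def)
  qed measurable
  finally show ?thesis
    using c by (simp add: dist_frac_int_def M_def c_def)
qed

section \<open>Linearity and boundedness of the extension\<close>

lemma dist_frac_int_linear:
  fixes f :: "'m::finite \<Rightarrow> 'n::finite dist"
  assumes "integrable lborel (top_kernel \<alpha> (f(k := g)) x)" "integrable lborel (top_kernel \<alpha> (f(k := h)) x)"
  shows "dist_frac_int \<alpha> (f(k := (\<lambda>\<phi>. a * g \<phi> + b * h \<phi>))) x =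
    a * dist_frac_int \<alpha> (f(k := g)) x + b * dist_frac_int \<alpha> (f(k := h)) x"
proof -
  have split: "(\<Prod>j\<in>UNIV. conv_dist \<psi> ((f(k := u)) j) x) = conv_dist \<psi> u x * (\<Prod>j\<in>UNIV - {k}. conv_dist \<psi> (f j) x)" for \<psi> u
  proof -
    have "(\<Prod>j\<in>UNIV - {k}. conv_dist \<psi> ((f(k := u)) j) x) = (\<Prod>j\<in>UNIV - {k}. conv_dist \<psi> (f j) x)"
      by (intro prod.cong) auto
    then show ?thesis by (subst prod.remove[of _ k]) simp_all
  qed
  have "top_kernel \<alpha> (f(k := (\<lambda>\<phi>. a * g \<phi> + b * h \<phi>))) x t =
      a * top_kernel \<alpha> (f(k := g)) x t + b * top_kernel \<alpha> (f(k := h)) x t" for t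
    unfolding top_kernel_def split by (simp add: conv_dist_def algebra_simps scaleR_conv_of_real)
  then have "(LINT t|lborel. top_kernel \<alpha> (f(k := (\<lambda>\<phi>. a * g \<phi> + b * h \<phi>))) x t) =
      a * (LINT t|lborel. top_kernel \<alpha> (f(k := g)) x t) + b * (LINT t|lborel. top_kernel \<alpha> (f(k := h)) x t)"
    using assms by simp
  then show ?thesis by (simp add: dist_frac_int_def algebra_simps)
qed

lemma hardyD:
  assumes "f \<in> hardy N X"
  shows "f \<in> tempered" "AE x in lebesgue. grand_max N f x < \<infinity>"
    "X (\<lambda>x. complex_of_real (enn2real (grand_max N f x))) = hardy_norm N X f" "hardy_norm N X f < \<infinity>"
  using assms by (auto simp: hardy_def hardy_norm_def ext_norm_def split: if_splits)

text \<open>\<open>dyadic_sum_bound\<close> is applied with F the grand maximal function and with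
  its infima over cells as the functions on the separate scales. The constant does not depend on
  N.\<close>

lemma hardy_dyadic_sum_bound:
  fixes X Y :: "'n::finite fun_norm"
  assumes "ball_quasi_banach X" "ball_quasi_banach Y" "0 < p" "p < q"
    and "ball_banach (pow_space X (1 / p))" "ball_banach (pow_space Y (1 / q))"
    and "same_space (assoc (pow_space Y (1 / q))) (pow_space (assoc (pow_space X (1 / p))) (p / q))"
    and "hl_max_bounded_on (assoc (pow_space Y (1 / q)))"
    and "\<beta> = real CARD('n) * (1 / p - 1 / q)"
  shows "\<exists>C>0. \<forall>N. \<forall>f\<in>hardy N X. (AE x in lebesgue. dyadic_sum \<beta> (dyadic_inf (grand_max N f)) x < \<infinity>) \<and>
    Y (\<lambda>x. complex_of_real (enn2real (dyadic_sum \<beta> (dyadic_inf (grand_max N f)) x))) \<le> ennreal C * hardy_norm N X f"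
proof (rule dyadic_sum_bound[OF assms])
  fix C assume C: "C > 0" "\<And>F f. F \<in> borel_measurable lebesgue \<Longrightarrow> (\<And>x. 0 \<le> F x) \<Longrightarrow>
     X (\<lambda>x. complex_of_real (F x)) < \<infinity> \<Longrightarrow> (\<And>j. f j \<in> borel_measurable lebesgue) \<Longrightarrow> (\<And>j x. 0 \<le> f j x) \<Longrightarrow>
     (\<And>j x. AE y in lebesgue. y \<in> dyadic_cell j x \<longrightarrow> f j x \<le> F y) \<Longrightarrow>
     (AE x in lebesgue. dyadic_sum \<beta> f x < \<infinity>) \<and>
     Y (\<lambda>x. complex_of_real (enn2real (dyadic_sum \<beta> f x))) \<le> ennreal C * X (\<lambda>x. complex_of_real (F x))"
  have "(AE x in lebesgue. dyadic_sum \<beta> (dyadic_inf (grand_max N f)) x < \<infinity>) \<and>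
    Y (\<lambda>x. complex_of_real (enn2real (dyadic_sum \<beta> (dyadic_inf (grand_max N f)) x))) \<le> ennreal C * hardy_norm N X f"
    if f: "f \<in> hardy N X" for N f
    unfolding hardyD(3)[OF f, symmetric]
  proof (rule C(2))
    have "(\<lambda>x. enn2real (grand_max N f x)) \<in> borel_measurable borel"
      using grand_max_measurable[OF hardyD(1)[OF f], of N] by measurable
    then show "(\<lambda>x. enn2real (grand_max N f x)) \<in> borel_measurable lebesgue" by (rule borel_imp_lebesgue)
    show "X (\<lambda>x. complex_of_real (enn2real (grand_max N f x))) < \<infinity>" using hardyD(3,4)[OF f] by simp
    show "AE y in lebesgue. y \<in> dyadic_cell j x \<longrightarrow> dyadic_inf (grand_max N f) j x \<le> enn2real (grand_max N f y)" for j x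
      using hardyD(2)[OF f] by eventually_elim (blast intro: dyadic_inf_le)
  qed (simp_all add: dyadic_inf_measurable dyadic_inf_nonneg)
  with C(1) show ?thesis by blast
qed

text \<open>Stated at a single point x, so that the exceptional null sets of the final argument are
  those where some dyadic sum diverges.\<close>

lemma dist_frac_int_bound:
  assumes \<alpha>: "0 < \<alpha>" and \<alpha>2: "\<alpha> < real CARD('m) * real CARD('n)"
  obtains D where "D > 0" "\<And>(f :: 'm::finite \<Rightarrow> 'n::finite dist) x. (\<And>k. f k \<in> tempered) \<Longrightarrow>
    (\<And>k. AE y in lebesgue. grand_max N (f k) y < \<infinity>) \<Longrightarrow>
    (\<And>k. dyadic_sum (\<alpha> / real CARD('m)) (dyadic_inf (grand_max N (f k))) x < \<infinity>) \<Longrightarrow>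
    integrable lborel (top_kernel \<alpha> f x) \<and>
    norm (dist_frac_int \<alpha> f x) \<le> D * (\<Prod>k\<in>UNIV. enn2real (dyadic_sum (\<alpha> / real CARD('m)) (dyadic_inf (grand_max N (f k))) x))"
proof -
  define c where "c = enn2real (frac_const (real CARD('m) * real CARD('n) - \<alpha>))"
  have c: "c > 0"
    using frac_const_finite[of "real CARD('m) * real CARD('n) - \<alpha>"] frac_const_pos[of "real CARD('m) * real CARD('n) - \<alpha>"] \<alpha>2
    by (auto simp: c_def enn2real_positive_iff)
  obtain D where D: "D > 0" "\<And>(f :: 'm::finite \<Rightarrow> 'n::finite dist) x. (\<And>k. f k \<in> tempered) \<Longrightarrow>
    (\<And>k. AE y in lebesgue. grand_max N (f k) y < \<infinity>) \<Longrightarrow>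
    (\<integral>\<^sup>+t. ennreal (norm (top_kernel \<alpha> f x t)) \<partial>lborel) \<le>
      ennreal D * (\<Prod>k\<in>UNIV. dyadic_sum (\<alpha> / real CARD('m)) (dyadic_inf (grand_max N (f k))) x)"
    by (rule top_kernel_bound[OF \<alpha>]) blast
  show thesis
  proof (rule that[of "D / c"])
    show "D / c > 0" using D(1) c by simp
    fix f :: "'m \<Rightarrow> 'n dist" and x
    assume f: "\<And>k. f k \<in> tempered" "\<And>k. AE y in lebesgue. grand_max N (f k) y < \<infinity>"
      and fin: "\<And>k. dyadic_sum (\<alpha> / real CARD('m)) (dyadic_inf (grand_max N (f k))) x < \<infinity>"
    define s where "s k = enn2real (dyadic_sum (\<alpha> / real CARD('m)) (dyadic_inf (grand_max N (f k))) x)" for k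
    have s: "dyadic_sum (\<alpha> / real CARD('m)) (dyadic_inf (grand_max N (f k))) x = ennreal (s k)" "0 \<le> s k" for k
      using fin[of k] by (simp_all add: s_def)
    have le: "(\<integral>\<^sup>+t. ennreal (norm (top_kernel \<alpha> f x t)) \<partial>lborel) \<le> ennreal (D * (\<Prod>k\<in>UNIV. s k))"
    proof -
      have "(\<integral>\<^sup>+t. ennreal (norm (top_kernel \<alpha> f x t)) \<partial>lborel) \<le> ennreal D * (\<Prod>k\<in>UNIV. ennreal (s k))"
        unfolding s(1)[symmetric] by (rule D(2)) (rule f)+
      then show ?thesis using s(2) D(1) by (simp add: prod_ennreal prod_nonneg ennreal_mult)
    qed
    have int: "integrable lborel (top_kernel \<alpha> f x)"
    proof (rule integrableI_bounded)
      have "top_kernel \<alpha> f x \<in> borel_measurable borel" by (rule top_kernel_measurable) (rule f)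
      then show "top_kernel \<alpha> f x \<in> borel_measurable lborel" by simp
      show "(\<integral>\<^sup>+t. ennreal (norm (top_kernel \<alpha> f x t)) \<partial>lborel) < \<infinity>" using le by (rule le_less_trans) simp
    qed
    have "ennreal (norm (LINT t|lborel. top_kernel \<alpha> f x t)) \<le> ennreal (D * (\<Prod>k\<in>UNIV. s k))"
      using integral_norm_bound_ennreal[OF int] le by (rule order_trans)
    then have "norm (LINT t|lborel. top_kernel \<alpha> f x t) \<le> D * (\<Prod>k\<in>UNIV. s k)"
      using s(2) D(1) by (simp add: prod_nonneg)
    then have "norm (dist_frac_int \<alpha> f x) \<le> D / c * (\<Prod>k\<in>UNIV. s k)"
      using c by (simp add: dist_frac_int_def c_def[symmetric] norm_mult norm_divide divide_right_mono)
    with int show "integrable lborel (top_kernel \<alpha> f x) \<and>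
      norm (dist_frac_int \<alpha> f x) \<le> D / c * (\<Prod>k\<in>UNIV. enn2real (dyadic_sum (\<alpha> / real CARD('m)) (dyadic_inf (grand_max N (f k))) x))"
      by (simp add: s_def)
  qed
qed

theorem theorem1p1:
  fixes X Yk :: "'m::finite \<Rightarrow> 'n::finite fun_norm"
    and Y :: "'n fun_norm"
    and p q \<alpha> :: real
    and pk qk :: "'m \<Rightarrow> real"
  assumes "\<And>k. ball_quasi_banach (X k)"
    and "\<And>k. ball_quasi_banach (Yk k)"
    and "ball_quasi_banach Y"
    and "\<And>k. abs_cont_norm (X k)"
    and "\<And>k. assumption_A (X k)"
    and "\<And>k. assumption_B (X k)"
    and "assumption_B Y"
    and "0 < p" and "0 < q" and "\<And>k. 0 < pk k" and "\<And>k. 0 < qk k"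
    and "0 < \<alpha>" and "\<alpha> < real CARD('m) * real CARD('n)"
    and "1 / q = (\<Sum>k\<in>UNIV. 1 / qk k)"
    and "1 / p = (\<Sum>k\<in>UNIV. 1 / pk k)"
    and "\<And>k. 1 / pk k - 1 / qk k = \<alpha> / (real CARD('m) * real CARD('n))"
    and "\<exists>C>0. \<forall>f. (\<forall>k. f k \<in> fspace (Yk k)) \<longrightarrow>
           Y (\<lambda>x. \<Prod>k\<in>UNIV. f k x) \<le> ennreal C * (\<Prod>k\<in>UNIV. Yk k (f k))"
    and "\<And>k. ball_banach (pow_space (X k) (1 / pk k))"
    and "\<And>k. ball_banach (pow_space (Yk k) (1 / qk k))"
    and "\<And>k. same_space (assoc (pow_space (Yk k) (1 / qk k)))
                         (pow_space (assoc (pow_space (X k) (1 / pk k))) (pk k / qk k))"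
    and "\<And>k. hl_max_bounded_on (assoc (pow_space (Yk k) (1 / qk k)))"
  shows "\<exists>N0. \<forall>N\<ge>N0. extends_bounded N \<alpha> X Y"
proof -
  note X = assms(1) and Yk = assms(2) and Y = assms(3) and A = assms(5) and pk = assms(10) and qk = assms(11)
    and \<alpha> = assms(12,13) and pq = assms(16) and hoelder = assms(17)
  have "\<exists>K0. \<forall>K. K0 \<le> real K \<longrightarrow> X k (\<lambda>x. complex_of_real (1 / (1 + norm x) ^ K)) < \<infinity>" for k
    by (rule assumption_A_decay[OF X A, of k]) blast
  then obtain K0 where K0: "\<And>k K. K0 k \<le> real K \<Longrightarrow> X k (\<lambda>x. complex_of_real (1 / (1 + norm x) ^ K)) < \<infinity>"
    by metis
  \<comment> \<open>One d for all k, at least as large as every decay exponent \<open>K0 k\<close>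
    obtained from Assumption (A).\<close>
  define d where "d = nat \<lceil>\<Sum>k\<in>UNIV. \<bar>K0 k\<bar>\<rceil>"
  have decay: "X k (\<lambda>x. complex_of_real (1 / (1 + norm x) ^ (CARD('n) + Suc d))) < \<infinity>" for k
  proof (rule K0)
    have "K0 k \<le> \<bar>K0 k\<bar>" by simp
    also have "\<dots> \<le> (\<Sum>k\<in>UNIV. \<bar>K0 k\<bar>)" by (intro member_le_sum) auto
    also have "\<dots> \<le> real d" unfolding d_def by (rule real_nat_ceiling_ge)
    finally show "K0 k \<le> real (CARD('n) + Suc d)" by simp
  qed
  have lt: "pk k < qk k" for k
  proof -
    have "1 / pk k - 1 / qk k > 0" using \<alpha> unfolding pq by simp
    then show ?thesis using pk[of k] qk[of k] by (simp add: field_simps)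
  qed
  \<comment> \<open>The exponent of the dyadic sums is the same for all k, as required for splitting
    t^\<alpha> evenly.\<close>
  have \<beta>: "\<alpha> / real CARD('m) = real CARD('n) * (1 / pk k - 1 / qk k)" for k unfolding pq by simp
  define S where "S N u = dyadic_sum (\<alpha> / real CARD('m)) (dyadic_inf (grand_max N u))" for N and u :: "'n dist"
  have "\<exists>C>0. \<forall>N. \<forall>u\<in>hardy N (X k). (AE x in lebesgue. S N u x < \<infinity>) \<and>
      Yk k (\<lambda>x. complex_of_real (enn2real (S N u x))) \<le> ennreal C * hardy_norm N (X k) u" for k
    unfolding S_def by (rule hardy_dyadic_sum_bound[OF X Yk pk lt assms(18) assms(19) assms(20) assms(21) \<beta>])
  then obtain C where C: "\<And>k :: 'm. 0 < C k" "\<And>k N u. u \<in> hardy N (X k) \<Longrightarrow> AE x in lebesgue. S N u x < \<infinity>"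
      "\<And>k N u. u \<in> hardy N (X k) \<Longrightarrow> Yk k (\<lambda>x. complex_of_real (enn2real (S N u x))) \<le> ennreal (C k) * hardy_norm N (X k) u"
    by metis
  obtain H where H: "H > 0" "\<And>f. (\<forall>k. f k \<in> fspace (Yk k)) \<Longrightarrow>
      Y (\<lambda>x. \<Prod>k\<in>UNIV. f k x) \<le> ennreal H * (\<Prod>k\<in>UNIV. Yk k (f k))"
    using hoelder by blast
  \<comment> \<open>The Taylor argument for atoms uses derivatives of order d + 1 with decay n + d +
    1, all controlled by the seminorm of index N.\<close>
  have "extends_bounded N \<alpha> X Y" if N: "CARD('n) + Suc d \<le> N" for N
  proof -
    obtain D where D: "D > 0" "\<And>(f :: 'm \<Rightarrow> 'n dist) x. (\<And>k. f k \<in> tempered) \<Longrightarrow>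
        (\<And>k. AE y in lebesgue. grand_max N (f k) y < \<infinity>) \<Longrightarrow> (\<And>k. S N (f k) x < \<infinity>) \<Longrightarrow>
        integrable lborel (top_kernel \<alpha> f x) \<and> norm (dist_frac_int \<alpha> f x) \<le> D * (\<Prod>k\<in>UNIV. enn2real (S N (f k) x))"
      unfolding S_def by (rule dist_frac_int_bound[OF \<alpha>]) blast
    have Sm: "S N u \<in> borel_measurable lebesgue" for u
      unfolding S_def by (intro dyadic_sum_measurable dyadic_inf_measurable)
    have AE_all: "AE x in lebesgue. \<forall>k. S N (f k) x < \<infinity>" if "\<forall>k. f k \<in> hardy N (X k)" for f
      using that C(2) by (subst AE_all_countable) blast
    have good: "AE x in lebesgue. integrable lborel (top_kernel \<alpha> f x) \<and>
        norm (dist_frac_int \<alpha> f x) \<le> D * (\<Prod>k\<in>UNIV. enn2real (S N (f k) x))" if f: "\<forall>k. f k \<in> hardy N (X k)" for f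
      using AE_all[OF f] by eventually_elim (intro D(2) hardyD(1,2)[OF f[rule_format]], blast)
    have bounded: "dist_frac_int \<alpha> f \<in> fspace Y \<and>
        Y (dist_frac_int \<alpha> f) \<le> ennreal (D * H * (\<Prod>k\<in>UNIV. C k)) * (\<Prod>k\<in>UNIV. hardy_norm N (X k) (f k))"
      if f: "\<forall>k. f k \<in> hardy N (X k)" for f
    proof -
      define s where "s k x = complex_of_real (enn2real (S N (f k) x))" for k x
      have sm: "s k \<in> borel_measurable lebesgue" for k unfolding s_def[abs_def] using Sm[of "f k"] by measurable
      have Ts: "dist_frac_int \<alpha> f \<in> borel_measurable lebesgue"
        using f by (intro dist_frac_int_measurable hardyD(1)) blast
      have sY: "Yk k (s k) \<le> ennreal (C k) * hardy_norm N (X k) (f k)" for k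
        using C(3) f unfolding s_def[abs_def] by blast
      have sp: "s k \<in> fspace (Yk k)" for k
      proof -
        have "ennreal (C k) * hardy_norm N (X k) (f k) < \<infinity>" using hardyD(4)[OF f[rule_format]] by (simp add: ennreal_mult_less_top)
        then show ?thesis using sY[of k] sm[of k] by (auto simp: fspace_def intro: le_less_trans)
      qed
      have pm: "(\<lambda>x. \<Prod>k\<in>UNIV. s k x) \<in> borel_measurable lebesgue" using sm by (intro borel_measurable_prod)
      have "Y (dist_frac_int \<alpha> f) \<le> Y (\<lambda>x. complex_of_real D * (\<Prod>k\<in>UNIV. s k x))"
      proof (rule bqb_mono[OF Y _ Ts])
        show "(\<lambda>x. complex_of_real D * (\<Prod>k\<in>UNIV. s k x)) \<in> borel_measurable lebesgue" using pm by measurable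
        show "AE x in lebesgue. norm (dist_frac_int \<alpha> f x) \<le> norm (complex_of_real D * (\<Prod>k\<in>UNIV. s k x))"
          using good[OF f] by eventually_elim (use D(1) in \<open>simp add: s_def norm_mult abs_of_nonneg prod_nonneg flip: of_real_prod\<close>)
      qed
      also have "\<dots> = ennreal D * Y (\<lambda>x. \<Prod>k\<in>UNIV. s k x)" using D(1) by (subst bqb_cmult[OF Y pm]) simp
      also have "\<dots> \<le> ennreal D * (ennreal H * (\<Prod>k\<in>UNIV. Yk k (s k)))"
        using H(2)[of s] sp by (intro mult_left_mono) auto
      also have "\<dots> \<le> ennreal D * (ennreal H * (\<Prod>k\<in>UNIV. ennreal (C k) * hardy_norm N (X k) (f k)))"
        by (intro mult_left_mono ennreal_prod_mono sY) auto
      also have "\<dots> = ennreal (D * H * (\<Prod>k\<in>UNIV. C k)) * (\<Prod>k\<in>UNIV. hardy_norm N (X k) (f k))"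
      proof -
        have "ennreal (\<Prod>k\<in>UNIV. C k) = (\<Prod>k\<in>UNIV. ennreal (C k))" using C(1) by (intro prod_ennreal[symmetric]) (simp add: less_imp_le)
        then show ?thesis using D(1) H(1) C(1) by (simp add: ennreal_mult prod_nonneg less_imp_le prod.distrib mult.assoc)
      qed
      finally have le: "Y (dist_frac_int \<alpha> f) \<le> ennreal (D * H * (\<Prod>k\<in>UNIV. C k)) * (\<Prod>k\<in>UNIV. hardy_norm N (X k) (f k))" .
      have "(\<Prod>k\<in>UNIV. hardy_norm N (X k) (f k)) \<noteq> \<infinity>"
        using hardyD(4)[OF f[rule_format]] by (simp add: ennreal_prod_eq_top less_top)
      then have "ennreal (D * H * (\<Prod>k\<in>UNIV. C k)) * (\<Prod>k\<in>UNIV. hardy_norm N (X k) (f k)) < \<infinity>"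
        by (simp add: ennreal_mult_less_top less_top)
      with le Ts show ?thesis by (auto simp: fspace_def intro: le_less_trans)
    qed
    have linear: "AE x in lebesgue. dist_frac_int \<alpha> (f(k := (\<lambda>\<phi>. a * g \<phi> + b * h \<phi>))) x =
        a * dist_frac_int \<alpha> (f(k := g)) x + b * dist_frac_int \<alpha> (f(k := h)) x"
      if "(\<forall>j. f j \<in> hardy N (X j)) \<and> g \<in> hardy N (X k) \<and> h \<in> hardy N (X k)" for f k g h a b
    proof -
      have "\<forall>j. (f(k := g)) j \<in> hardy N (X j)" "\<forall>j. (f(k := h)) j \<in> hardy N (X j)" using that by auto
      from good[OF this(1)] good[OF this(2)] show ?thesis
        by eventually_elim (blast intro: dist_frac_int_linear)
    qed
    have "(\<forall>k. dist_of (g k) \<in> hardy N (X k)) \<and> (AE x in lebesgue. dist_frac_int \<alpha> (\<lambda>k. dist_of (g k)) x = frac_int \<alpha> g x)"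
      if g: "\<forall>k. g k \<in> atom_span (X k) d" for g
    proof
      show "\<forall>k. dist_of (g k) \<in> hardy N (X k)"
        using g by (intro allI atom_span_hardy[OF X _ decay N]) blast
      have "\<exists>A R. bounded_cpt (g k) A R" for k
        by (rule atom_span_bounded_cpt[OF X g[rule_format, of k]]) blast
      then obtain A R where "\<And>k. bounded_cpt (g k) (A k) (R k)" by metis
      then show "AE x in lebesgue. dist_frac_int \<alpha> (\<lambda>k. dist_of (g k)) x = frac_int \<alpha> g x"
        by (intro AE_I2 dist_frac_int_dist_of \<alpha>)
    qed
    moreover have "D * H * (\<Prod>k\<in>UNIV. C k) > 0" using D(1) H(1) C(1) by (simp add: prod_pos)
    ultimately show ?thesis
      unfolding extends_bounded_def using bounded linear
      by (intro exI[of _ "D * H * (\<Prod>k\<in>UNIV. C k)"] conjI exI[of _ d] exI[of _ "dist_frac_int \<alpha>"] allI impI) blast+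
  qed
  then show ?thesis by blast
qed

end
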